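(* Let $G$ be a finite connected simple graph. The connected subgraph arrangement $\mathcal{A}_G$ (over $\mathbb{Q}$) is free if and only if $G$ is isomorphic to one of the following: a path graph $P_n$ ($n\ge 1$), a cycle graph $C_n$ ($n\ge 3$), an almost path graph $A_{n,k}$ for some $1<k<n$, or a path-with-triangle graph $\Delta_{n,k}$ for some $1\le k<n$.
   Context: For a finite simple graph $G=(N,E)$ with $N=\{1,\dots,n\}$ and $I\subseteq N$, $G[I]$ denotes the induced subgraph on $I$, and $H_I=\ker\big(\sum_{i\in I}x_i\big)\subseteq\mathbb{Q}^n$, where $x_1,\dots,x_n$ are the coordinate functions. The connected subgraph arrangement of $G$ is $\mathcal{A}_G=\{H_I:\emptyset\neq I\subseteq N,\ G[I]\text{ connected}\}$, a hyperplane arrangement in $\mathbb{Q}^n$. Graph families: the path $P_n$ has vertices $1,\dots,n$ and edges $\{i,i+1\}$, $1\le i<n$. The cycle $C_n$ ($n\ge 3$) is $P_n$ plus the edge $\{1,n\}$. The almost path $A_{n,k}$ ($1<k<n$) has vertices $1,\dots,n+1$ and edges $\{i,i+1\}$ ($1\le i<n$) and $\{k,n+1\}$. The path-with-triangle graph $\Delta_{n,k}$ ($1\le k<n$) has vertices $1,\dots,n+1$ and edges $\{i,i+1\}$ ($1\le i<n$), $\{k,n+1\}$ and $\{k+1,n+1\}$. Freeness: for an arrangement $\mathcal{A}$ in $V=\mathbb{Q}^\ell$ let $S=\mathbb{Q}[x_1,\dots,x_\ell]$ and for each $H\in\mathcal{A}$ fix a linear form $\alpha_H$ with $H=\ker\alpha_H$.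 The module of $\mathcal{A}$-derivations is $D(\mathcal{A})=\{\theta\in\mathrm{Der}_{\mathbb{Q}}(S):\theta(\alpha_H)\in\alpha_H S\ \text{for all } H\in\mathcal{A}\}$; $\mathcal{A}$ is free if $D(\mathcal{A})$ is a free $S$-module, and then its exponents are the multiset of degrees of a homogeneous basis. *)

theory Defs
  imports Complex_Main "HOL-Library.Poly_Mapping"
begin

section \<open>Graphs on vertex set {1..n}\<close>

text \<open>A finite simple graph with vertex set {1..n}: edges are 2-element subsets of {1..n}.\<close>
definition simple_graph :: "nat \<Rightarrow> nat set set \<Rightarrow> bool" where
  "simple_graph n E \<longleftrightarrow> (\<forall>e\<in>E. e \<subseteq> {1..n} \<and> card e = 2)"

text \<open>The induced subgraph G[I] is connected (nonempty, any two vertices joined by a path inside I).\<close>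
definition induced_connected :: "nat set set \<Rightarrow> nat set \<Rightarrow> bool" where
  "induced_connected E I \<longleftrightarrow> I \<noteq> {} \<and>
     (\<forall>u\<in>I. \<forall>v\<in>I. (u, v) \<in> ({(a, b). a \<in> I \<and> b \<in> I \<and> {a, b} \<in> E})\<^sup>*)"

definition graph_iso :: "nat \<Rightarrow> nat set set \<Rightarrow> nat \<Rightarrow> nat set set \<Rightarrow> bool" where
  "graph_iso n E m F \<longleftrightarrow> (\<exists>f. bij_betw f {1..n} {1..m} \<and>
     (\<forall>u\<in>{1..n}. \<forall>v\<in>{1..n}. {u, v} \<in> E \<longleftrightarrow> {f u, f v} \<in> F))"

text \<open>Path P_n on {1..n}.\<close>
definition path_edges :: "nat \<Rightarrow> nat set set" where
  "path_edges n = {{i, i + 1} | i. 1 \<le> i \<and> i < n}"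

text \<open>Cycle C_n on {1..n}.\<close>
definition cycle_edges :: "nat \<Rightarrow> nat set set" where
  "cycle_edges n = path_edges n \<union> {{1, n}}"

text \<open>Almost path A_{n,k} on {1..n+1}.\<close>
definition almost_path_edges :: "nat \<Rightarrow> nat \<Rightarrow> nat set set" where
  "almost_path_edges n k = path_edges n \<union> {{k, n + 1}}"

text \<open>Path with triangle Delta_{n,k} on {1..n+1}.\<close>
definition path_triangle_edges :: "nat \<Rightarrow> nat \<Rightarrow> nat set set" where
  "path_triangle_edges n k = path_edges n \<union> {{k, n + 1}, {k + 1, n + 1}}"

section \<open>Polynomial ring Q[x_1,...,x_n] and derivations\<close>

type_synonym qpoly = "(nat \<Rightarrow>\<^sub>0 nat) \<Rightarrow>\<^sub>0 rat"

text \<open>Polynomials in the variables x_1..x_n only: S = Q[x_1,..,x_n].\<close>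
definition polys_in :: "nat \<Rightarrow> qpoly set" where
  "polys_in n = {p. \<forall>m\<in>Poly_Mapping.keys p. Poly_Mapping.keys m \<subseteq> {1..n}}"

definition var :: "nat \<Rightarrow> qpoly" where
  "var i = Poly_Mapping.single (Poly_Mapping.single i 1) 1"

definition const :: "rat \<Rightarrow> qpoly" where
  "const c = Poly_Mapping.single 0 c"

text \<open>Linear form with coefficient vector a: sum a_i x_i.\<close>
definition lin_form :: "nat \<Rightarrow> (nat \<Rightarrow> rat) \<Rightarrow> qpoly" where
  "lin_form n a = (\<Sum>i\<in>{1..n}. const (a i) * var i)"

text \<open>A Q-derivation theta of S is determined by the n-tuple (theta(x_1),...,theta(x_n)) in S^n
  (Der(S) is free with basis d/dx_i); we represent it by that tuple, with theta i = 0 for i outside {1..n}.\<close>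
definition derivations :: "nat \<Rightarrow> (nat \<Rightarrow> qpoly) set" where
  "derivations n = {\<theta>. (\<forall>i\<in>{1..n}. \<theta> i \<in> polys_in n) \<and> (\<forall>i. i \<notin> {1..n} \<longrightarrow> \<theta> i = 0)}"

text \<open>theta applied to a linear form sum a_i x_i.\<close>
definition apply_der :: "nat \<Rightarrow> (nat \<Rightarrow> qpoly) \<Rightarrow> (nat \<Rightarrow> rat) \<Rightarrow> qpoly" where
  "apply_der n \<theta> a = (\<Sum>i\<in>{1..n}. const (a i) * \<theta> i)"

text \<open>Arrangement given by the set of defining linear forms (coefficient vectors) alpha_H.
  D(A) = derivations theta with theta(alpha_H) in alpha_H S for every H.\<close>
definition Dmod :: "nat \<Rightarrow> (nat \<Rightarrow> rat) set \<Rightarrow> (nat \<Rightarrow> qpoly) set" where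
  "Dmod n A = {\<theta> \<in> derivations n. \<forall>a\<in>A. \<exists>q\<in>polys_in n. apply_der n \<theta> a = lin_form n a * q}"

text \<open>A subset M of S^n (an S-submodule) is a free S-module: it has a basis B.\<close>
definition free_module :: "nat \<Rightarrow> (nat \<Rightarrow> qpoly) set \<Rightarrow> bool" where
  "free_module n M \<longleftrightarrow> (\<exists>B\<subseteq>M.
     (\<forall>\<theta>\<in>M. \<exists>F c. finite F \<and> F \<subseteq> B \<and> (\<forall>b\<in>F. c b \<in> polys_in n) \<and>
                    \<theta> = (\<lambda>i. \<Sum>b\<in>F. c b * b i)) \<and>
     (\<forall>F c. finite F \<and> F \<subseteq> B \<and> (\<forall>b\<in>F. c b \<in> polys_in n) \<and>
            (\<lambda>i. \<Sum>b\<in>F. c b * b i) = (\<lambda>i. 0) \<longrightarrow> (\<forall>b\<in>F. c b = 0)))"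

definition free_arrangement :: "nat \<Rightarrow> (nat \<Rightarrow> rat) set \<Rightarrow> bool" where
  "free_arrangement n A \<longleftrightarrow> free_module n (Dmod n A)"

text \<open>Connected subgraph arrangement: H_I = ker(sum_{i in I} x_i), coefficient vector = indicator of I.\<close>
definition conn_subgraph_arr :: "nat \<Rightarrow> nat set set \<Rightarrow> (nat \<Rightarrow> rat) set" where
  "conn_subgraph_arr n E =
     {(\<lambda>i. if i \<in> I then 1 else 0) | I. I \<noteq> {} \<and> I \<subseteq> {1..n} \<and> induced_connected E I}"

end

theory Submission
  imports Defs "Jordan_Normal_Form.Determinant"
begin

text \<open>
  If \<open>\<A>\<^sub>G\<close> is free, then so is its localization at every flat, and a homogeneous basis of the
  localization has degrees adding up to at most its number of hyperplanes. A rank \<open>r\<close> arrangement whose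
  logarithmic derivations of degree at most \<open>d\<close> are all multiples of the Euler derivation needs \<open>r - 1\<close>
  basis elements of degree above \<open>d\<close>, hence more than \<open>(r - 1)(d + 1)\<close> hyperplanes. Flats violating this
  bound exist as soon as \<open>G\<close> contracts, after deleting vertices, to one of eight small graphs: \<open>K\<^sub>4\<close>, the
  diamond, the square with a pendant edge, \<open>K\<^sub>1\<^sub>,\<^sub>4\<close>, the cricket, the butterfly, the net and the spider
  with three legs of length two. A connected graph without these induced minors, built up one vertex at a
  time, always stays in the four families.

  Conversely, in partial sum coordinates \<open>y\<^sub>0 = 0, \<dots>, y\<^sub>m\<close> along the path, and with \<open>z\<close> for the additional
  vertex (for a cycle: minus the sum of all vertices), the arrangement of a member of the families becomes a deformation of the braid arrangement by
  \<open>y\<^sub>j - y\<^sub>i + z\<close>. A basis is given by the Euler derivation and by \<open>y\<^sub>i \<mapsto> F(y\<^sub>i)\<close>, \<open>z \<mapsto> 0\<close> for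
  indefinite sums \<open>F\<close> of suitable products of linear polynomials; independence is checked at the single
  point \<open>y\<^sub>i = 2i\<close>, \<open>z = 1\<close>, and Saito's criterion follows by adding up degrees.
\<close>

section \<open>Substitution into polynomials\<close>

text \<open>\<open>free_module\<close> is ungraded: its basis is a bare set of derivations of
  unknown size, not assumed homogeneous, so no exponents are available at the start. Determinants
  replace them. The determinant of a basis divides that of any \<open>n\<close> logarithmic
  derivations, which forces it to divide the product of the forms. This divisibility survives
  translation to a point of a flat, and expanding the rows there into homogeneous components gives
  \<open>n\<close> independent homogeneous derivations whose degrees add up to at most the number of
  hyperplanes through the point. Independence is all that the degree count uses. The eight graphs
  are tuned to the bound (r - 1)(d + 1). Six of them have a flat with r + 1 forms in general
  position, where d = 1 works as soon as r + 1 <= 2(r - 1), that is r >= 3. The diamond has 6 = 2 *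
  3 forms with d = 2, and K4 has 15 = 3 * 5 with d = 4. In the other direction the step 2 between
  the values of the \<open>y i\<close>, against z = 1, separates even roots from odd ones by parity,
  so that the products in the independence argument do not vanish.\<close>

definition mono_val :: "(nat \<Rightarrow> 'a::comm_ring_1) \<Rightarrow> (nat \<Rightarrow>\<^sub>0 nat) \<Rightarrow> 'a" where
  "mono_val h m = (\<Prod>i\<in>Poly_Mapping.keys m. h i ^ Poly_Mapping.lookup m i)"

text \<open>The coefficient map \<open>c\<close> is a parameter so that evaluation at a rational
  point, substitution of polynomials and the grading map are instances of one construction, with the
  homomorphism laws proved once.\<close>

definition ins :: "(rat \<Rightarrow> 'a::comm_ring_1) \<Rightarrow> (nat \<Rightarrow> 'a) \<Rightarrow> qpoly \<Rightarrow> 'a" where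
  "ins c h p = (\<Sum>m\<in>Poly_Mapping.keys p. c (Poly_Mapping.lookup p m) * mono_val h m)"

lemma mono_val_superset:
  assumes "finite S" "Poly_Mapping.keys m \<subseteq> S"
  shows "mono_val h m = (\<Prod>i\<in>S. h i ^ Poly_Mapping.lookup m i)"
  unfolding mono_val_def
  by (rule prod.mono_neutral_left) (use assms in \<open>auto simp: in_keys_iff\<close>)

lemma mono_val_0 [simp]: "mono_val h 0 = 1"
  by (simp add: mono_val_def)

lemma mono_val_add: "mono_val h (m + m') = mono_val h m * mono_val h m'"
proof -
  let ?S = "Poly_Mapping.keys m \<union> Poly_Mapping.keys m'"
  have "mono_val h (m + m') = (\<Prod>i\<in>?S. h i ^ Poly_Mapping.lookup (m + m') i)"
    by (rule mono_val_superset) (use keys_add[of m m'] in auto)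
  also have "\<dots> = (\<Prod>i\<in>?S. h i ^ Poly_Mapping.lookup m i) * (\<Prod>i\<in>?S. h i ^ Poly_Mapping.lookup m' i)"
    by (simp add: lookup_add power_add prod.distrib)
  also have "\<dots> = mono_val h m * mono_val h m'"
    by (subst (1 2) mono_val_superset[of ?S]) auto
  finally show ?thesis .
qed

lemma mono_val_single [simp]: "mono_val h (Poly_Mapping.single i k) = h i ^ k"
  by (simp add: mono_val_def)

lemma sum_singles: "p = (\<Sum>m\<in>Poly_Mapping.keys p. Poly_Mapping.single m (Poly_Mapping.lookup p m))"
proof (rule poly_mapping_eqI)
  fix k
  have "(\<Sum>m\<in>Poly_Mapping.keys p. Poly_Mapping.lookup (Poly_Mapping.single m (Poly_Mapping.lookup p m)) k)
      = (\<Sum>m\<in>Poly_Mapping.keys p. if m = k then Poly_Mapping.lookup p k else 0)"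
    by (rule sum.cong) (auto simp: lookup_single when_def)
  also have "\<dots> = Poly_Mapping.lookup p k"
    by (simp add: sum.delta in_keys_iff)
  finally show "Poly_Mapping.lookup p k =
      Poly_Mapping.lookup (\<Sum>m\<in>Poly_Mapping.keys p. Poly_Mapping.single m (Poly_Mapping.lookup p m)) k"
    by (simp add: lookup_sum)
qed

lemma prod_single_exp:
  assumes "finite S"
  shows "(\<Prod>i\<in>S. Poly_Mapping.single (f i) (1::rat)) = Poly_Mapping.single (\<Sum>i\<in>S. f i) (1::rat)"
  using assms by (induction S rule: finite_induct) (simp_all add: mult_single)

lemma var_power: "var i ^ k = Poly_Mapping.single (Poly_Mapping.single i k) (1::rat)"
  by (induction k) (simp_all add: var_def mult_single single_add[symmetric])

lemma single_eq_mono_val: "Poly_Mapping.single m c = const c * mono_val var m"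
proof -
  have "mono_val var m = Poly_Mapping.single
      (\<Sum>i\<in>Poly_Mapping.keys m. Poly_Mapping.single i (Poly_Mapping.lookup m i)) (1::rat)"
    unfolding mono_val_def var_power by (rule prod_single_exp) simp
  also have "\<dots> = Poly_Mapping.single m 1"
    by (simp add: sum_singles[symmetric])
  finally show ?thesis by (simp add: const_def mult_single)
qed

lemma const_0 [simp]: "const 0 = 0" and const_1 [simp]: "const 1 = 1"
  by (simp_all add: const_def)

lemma const_add: "const (a + b) = const a + const b"
  and const_mult: "const (a * b) = const a * const b"
  and const_uminus: "const (- a) = - const a"
  and const_diff: "const (a - b) = const a - const b"
  by (simp_all add: const_def single_add mult_single single_uminus single_diff)

lemma const_sum: "const (sum f S) = (\<Sum>i\<in>S. const (f i))"
  by (induction S rule: infinite_finite_induct) (simp_all add: const_add)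

lemma const_eq_0_iff [simp]: "const c = 0 \<longleftrightarrow> c = 0"
  unfolding const_def by (metis lookup_single_eq lookup_zero single_zero)

text \<open>Arbitrary sets of variables instead of \<open>{1..n}\<close>: \<open>UNIV\<close> gives
  the whole type, which has infinitely many variables, and small sets allow variables to be
  eliminated one at a time.\<close>

definition polys_over :: "nat set \<Rightarrow> qpoly set" where
  "polys_over V = {p. \<forall>m\<in>Poly_Mapping.keys p. Poly_Mapping.keys m \<subseteq> V}"

lemma polys_in_over: "polys_in n = polys_over {1..n}"
  by (simp add: polys_in_def polys_over_def)

lemma polys_over_const [simp]: "const c \<in> polys_over V"
  by (simp add: polys_over_def const_def)

lemma polys_over_0 [simp]: "0 \<in> polys_over V" and polys_over_1 [simp]: "1 \<in> polys_over V"
  by (simp_all add: polys_over_def)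

lemma polys_over_var: "i \<in> V \<Longrightarrow> var i \<in> polys_over V"
  by (simp add: polys_over_def var_def)

lemma polys_over_add: "p \<in> polys_over V \<Longrightarrow> q \<in> polys_over V \<Longrightarrow> p + q \<in> polys_over V"
  using keys_add[of p q] unfolding polys_over_def by blast

lemma polys_over_mult:
  assumes "p \<in> polys_over V" "q \<in> polys_over V" shows "p * q \<in> polys_over V"
  unfolding polys_over_def
proof safe
  fix m i assume "m \<in> Poly_Mapping.keys (p * q)" "i \<in> Poly_Mapping.keys m"
  then obtain a b where "m = a + b" "a \<in> Poly_Mapping.keys p" "b \<in> Poly_Mapping.keys q"
    using keys_mult[of p q] by blast
  then show "i \<in> V"
    using assms keys_add[of a b] \<open>i \<in> Poly_Mapping.keys m\<close> unfolding polys_over_def by blast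
qed

lemma polys_over_uminus: "p \<in> polys_over V \<Longrightarrow> - p \<in> polys_over V"
  using polys_over_mult[OF polys_over_const[of "-1" V], of p] by (simp add: const_uminus)

lemma polys_over_diff: "p \<in> polys_over V \<Longrightarrow> q \<in> polys_over V \<Longrightarrow> p - q \<in> polys_over V"
  using polys_over_add[of p V "- q"] polys_over_uminus[of q V] by simp

lemma polys_over_sum: "(\<And>i. i \<in> S \<Longrightarrow> f i \<in> polys_over V) \<Longrightarrow> sum f S \<in> polys_over V"
  by (induction S rule: infinite_finite_induct) (auto intro: polys_over_add)

lemma polys_over_prod: "(\<And>i. i \<in> S \<Longrightarrow> f i \<in> polys_over V) \<Longrightarrow> prod f S \<in> polys_over V"
  by (induction S rule: infinite_finite_induct) (auto intro: polys_over_mult)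

lemma polys_over_power: "p \<in> polys_over V \<Longrightarrow> p ^ k \<in> polys_over V"
  by (induction k) (auto intro: polys_over_mult)

lemma polys_over_UNIV [simp]: "p \<in> polys_over UNIV"
  by (simp add: polys_over_def)

lemma polys_over_induct [consumes 1, case_names const var add mult]:
  assumes p: "p \<in> polys_over V"
    and C: "\<And>c. P (const c)" and V: "\<And>i. i \<in> V \<Longrightarrow> P (var i)"
    and A: "\<And>p q. p \<in> polys_over V \<Longrightarrow> q \<in> polys_over V \<Longrightarrow> P p \<Longrightarrow> P q \<Longrightarrow> P (p + q)"
    and M: "\<And>p q. p \<in> polys_over V \<Longrightarrow> q \<in> polys_over V \<Longrightarrow> P p \<Longrightarrow> P q \<Longrightarrow> P (p * q)"
  shows "P p"
proof -
  let ?Q = "\<lambda>p. p \<in> polys_over V \<and> P p"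
  have pw: "?Q (p ^ k)" if "?Q p" for p k
    using that by (induction k) (use C[of 1] M in \<open>auto intro: polys_over_mult\<close>)
  have pr: "?Q (prod f S)" if "\<And>i. i \<in> S \<Longrightarrow> ?Q (f i)" for f :: "nat \<Rightarrow> qpoly" and S
    using that by (induction S rule: infinite_finite_induct)
      (use C[of 1] M in \<open>auto intro: polys_over_mult\<close>)
  have sm: "?Q (sum f S)" if "\<And>i. i \<in> S \<Longrightarrow> ?Q (f i)" for f :: "(nat \<Rightarrow>\<^sub>0 nat) \<Rightarrow> qpoly" and S
    using that by (induction S rule: infinite_finite_induct)
      (use C[of 0] A in \<open>auto intro: polys_over_add\<close>)
  have "?Q (\<Sum>m\<in>Poly_Mapping.keys p. Poly_Mapping.single m (Poly_Mapping.lookup p m))"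
  proof (rule sm)
    fix m assume m: "m \<in> Poly_Mapping.keys p"
    then have "Poly_Mapping.keys m \<subseteq> V" using p by (auto simp: polys_over_def)
    then have "?Q (mono_val var m)" unfolding mono_val_def
      by (intro pr pw) (auto intro: V polys_over_var)
    then show "?Q (Poly_Mapping.single m (Poly_Mapping.lookup p m))"
      unfolding single_eq_mono_val using C M by (auto intro: polys_over_mult)
  qed
  then show ?thesis using sum_singles[of p] by simp
qed

lemma qpoly_induct [case_names const var add mult]:
  fixes p :: qpoly
  assumes "\<And>c. P (const c)" "\<And>i. P (var i)"
    "\<And>p q. P p \<Longrightarrow> P q \<Longrightarrow> P (p + q)" "\<And>p q. P p \<Longrightarrow> P q \<Longrightarrow> P (p * q)"
  shows "P p"
  using polys_over_UNIV[of p] by (induction rule: polys_over_induct) (use assms in auto)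

section \<open>Substitution as a ring homomorphism\<close>

locale coeff_hom =
  fixes c :: "rat \<Rightarrow> 'a::comm_ring_1"
  assumes c_add: "c (a + b) = c a + c b" and c_mult: "c (a * b) = c a * c b"
    and c_0: "c 0 = 0" and c_1: "c 1 = 1"
begin

lemma ins_add: "ins c h (p + q) = ins c h p + ins c h q"
  unfolding ins_def
  by (rule setsum_keys_plus_distrib) (simp_all add: c_0 c_add ring_distribs)

lemma ins_single: "ins c h (Poly_Mapping.single m x) = c x * mono_val h m"
  by (simp add: ins_def c_0)

lemma ins_0 [simp]: "ins c h 0 = 0"
  by (simp add: ins_def)

lemma ins_sum: "ins c h (sum f S) = (\<Sum>i\<in>S. ins c h (f i))"
  by (induction S rule: infinite_finite_induct) (simp_all add: ins_add)

lemma ins_mult: "ins c h (p * q) = ins c h p * ins c h q"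
proof -
  have s: "ins c h (Poly_Mapping.single m x * q) = ins c h (Poly_Mapping.single m x) * ins c h q" for m x
  proof -
    have "ins c h (Poly_Mapping.single m x * q)
        = (\<Sum>k\<in>Poly_Mapping.keys q. ins c h (Poly_Mapping.single m x * Poly_Mapping.single k (Poly_Mapping.lookup q k)))"
      by (subst (1) sum_singles[of q]) (simp add: sum_distrib_left ins_sum)
    also have "\<dots> = ins c h (Poly_Mapping.single m x) * (\<Sum>k\<in>Poly_Mapping.keys q. c (Poly_Mapping.lookup q k) * mono_val h k)"
      by (simp add: mult_single ins_single c_mult mono_val_add sum_distrib_left mult_ac)
    finally show ?thesis by (simp add: ins_def)
  qed
  have "ins c h (p * q) = (\<Sum>m\<in>Poly_Mapping.keys p. ins c h (Poly_Mapping.single m (Poly_Mapping.lookup p m) * q))"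
    by (subst (1) sum_singles[of p]) (simp add: sum_distrib_right ins_sum)
  also have "\<dots> = (\<Sum>m\<in>Poly_Mapping.keys p. c (Poly_Mapping.lookup p m) * mono_val h m) * ins c h q"
    by (simp add: s ins_single sum_distrib_right)
  finally show ?thesis by (simp add: ins_def)
qed

lemma ins_const [simp]: "ins c h (const x) = c x"
  by (simp add: const_def ins_single)

lemma ins_var [simp]: "ins c h (var i) = h i"
  by (simp add: var_def ins_single c_1)

lemma ins_hom: "comm_ring_hom (ins c h)"
proof
  show "ins c h 1 = 1" using ins_const[of h 1] by (simp add: c_1)
qed (simp_all add: ins_add ins_mult)

sublocale hom: comm_ring_hom "ins c h" for h
  by (rule ins_hom)

lemma ins_cong:
  assumes "p \<in> polys_over V" "\<And>i. i \<in> V \<Longrightarrow> h i = h' i"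
  shows "ins c h p = ins c h' p"
  using assms(1) by (induction rule: polys_over_induct) (simp_all add: assms(2) hom.hom_add hom.hom_mult)

end

definition ev :: "(nat \<Rightarrow> rat) \<Rightarrow> qpoly \<Rightarrow> rat" where "ev v = ins (\<lambda>c. c) v"
definition psub :: "(nat \<Rightarrow> qpoly) \<Rightarrow> qpoly \<Rightarrow> qpoly" where "psub h = ins const h"
text \<open>Every variable is multiplied by a formal parameter, whose \<open>d\<close>-th power then
  carries the homogeneous component of degree \<open>d\<close>. Questions about the grading become
  questions about univariate polynomials.\<close>

definition Hm :: "qpoly \<Rightarrow> qpoly poly" where "Hm = ins (\<lambda>c. [:const c:]) (\<lambda>i. [:0, var i:])"

interpretation ev_h: coeff_hom "\<lambda>c::rat. c" by unfold_locales auto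
interpretation psub_h: coeff_hom const by unfold_locales (auto simp: const_add const_mult)
interpretation Hm_h: coeff_hom "\<lambda>c. [:const c:]"
  by unfold_locales (auto simp: const_add const_mult one_pCons)

interpretation ev: comm_ring_hom "ev v" for v unfolding ev_def by (rule ev_h.ins_hom)
interpretation psub: comm_ring_hom "psub h" for h unfolding psub_def by (rule psub_h.ins_hom)
interpretation Hm: comm_ring_hom Hm unfolding Hm_def by (rule Hm_h.ins_hom)

lemma ev_const [simp]: "ev v (const c) = c" and ev_var [simp]: "ev v (var i) = v i"
  by (simp_all add: ev_def)
lemma psub_const [simp]: "psub h (const c) = const c" and psub_var [simp]: "psub h (var i) = h i"
  by (simp_all add: psub_def)
lemma Hm_const [simp]: "Hm (const c) = [:const c:]" and Hm_var [simp]: "Hm (var i) = [:0, var i:]"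
  by (simp_all add: Hm_def)

lemma psub_id: "psub var p = p"
  by (induction p rule: qpoly_induct) (simp_all add: psub.hom_add psub.hom_mult)

lemma psub_cong: "p \<in> polys_over V \<Longrightarrow> (\<And>i. i \<in> V \<Longrightarrow> h i = h' i) \<Longrightarrow> psub h p = psub h' p"
  unfolding psub_def by (rule psub_h.ins_cong)

lemma psub_id_on: "p \<in> polys_over V \<Longrightarrow> (\<And>i. i \<in> V \<Longrightarrow> h i = var i) \<Longrightarrow> psub h p = p"
  using psub_cong[of p V h var] psub_id by simp

lemma ev_psub: "ev v (psub h p) = ev (\<lambda>i. ev v (h i)) p"
  by (induction p rule: qpoly_induct) (simp_all add: psub.hom_add psub.hom_mult ev.hom_add ev.hom_mult)

lemma psub_polys_over:
  assumes "p \<in> polys_over W" "\<And>i. i \<in> W \<Longrightarrow> h i \<in> polys_over V"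
  shows "psub h p \<in> polys_over V"
  using assms(1) by (induction rule: polys_over_induct)
    (auto simp: psub.hom_add psub.hom_mult assms(2) intro: polys_over_add polys_over_mult)

text \<open>The source of all factor theorems below: comparing the identity with a substitution that
  eliminates a variable exhibits the eliminated form as a divisor.\<close>

lemma psub_cong_dvd:
  assumes "\<And>i. d dvd h i - h' i"
  shows "d dvd psub h p - psub h' p"
proof (induction p rule: qpoly_induct)
  case (add p q)
  have "psub h (p + q) - psub h' (p + q) = (psub h p - psub h' p) + (psub h q - psub h' q)"
    by (simp add: psub.hom_add)
  then show ?case using add dvd_add by metis
next
  case (mult p q)
  have "psub h (p * q) - psub h' (p * q) = (psub h p - psub h' p) * psub h q + psub h' p * (psub h q - psub h' q)"
    by (simp add: psub.hom_mult algebra_simps)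
  then show ?case using mult by (metis dvd_add dvd_mult dvd_mult2)
qed (simp_all add: assms)

subsection \<open>Polynomials are determined by their values\<close>

text \<open>Uniqueness of digits in base \<open>M\<close>, by which an exponent vector can be
  recovered from a single exponent.\<close>

lemma digits_inj:
  fixes a b :: "nat \<Rightarrow> nat"
  assumes "\<And>i. i < N \<Longrightarrow> a i < M" "\<And>i. i < N \<Longrightarrow> b i < M"
    and "(\<Sum>i<N. a i * M ^ i) = (\<Sum>i<N. b i * M ^ i)" and "i < N"
  shows "a i = b i"
  using assms
proof (induction N arbitrary: a b i)
  case (Suc N)
  have sh: "(\<Sum>i<Suc N. f i * M ^ i) = f 0 + M * (\<Sum>i<N. f (Suc i) * M ^ i)" for f :: "nat \<Rightarrow> nat"
    by (subst sum.lessThan_Suc_shift) (simp add: sum_distrib_left mult_ac)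
  have eq: "a 0 + M * (\<Sum>i<N. a (Suc i) * M ^ i) = b 0 + M * (\<Sum>i<N. b (Suc i) * M ^ i)"
    using Suc.prems(3) by (simp only: sh)
  have lt: "a 0 < M" "b 0 < M" using Suc.prems by auto
  have "a 0 = b 0" using arg_cong[OF eq, of "\<lambda>x. x mod M"] lt by simp
  with eq lt have "(\<Sum>i<N. a (Suc i) * M ^ i) = (\<Sum>i<N. b (Suc i) * M ^ i)" by auto
  then have "a (Suc j) = b (Suc j)" if "j < N" for j
    using Suc.IH[of "\<lambda>i. a (Suc i)" "\<lambda>i. b (Suc i)" j] Suc.prems(1,2) that by auto
  with \<open>a 0 = b 0\<close> Suc.prems(4) show ?case by (cases i) auto
qed simp

text \<open>Kronecker substitution: \<open>x\<^sub>i \<mapsto> X ^ (M ^ i)\<close> is injective on monomials with exponents below \<open>M\<close>.\<close>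

lemma exists_nonzero_value:
  assumes "p \<noteq> (0::qpoly)"
  shows "\<exists>v. ev v p \<noteq> 0"
proof -
  let ?K = "Poly_Mapping.keys p"
  let ?U = "\<Union>m\<in>?K. Poly_Mapping.keys m"
  have fU: "finite ?U" by simp
  define N where "N = Suc (Max (insert 0 ?U))"
  have N: "i < N" if "m \<in> ?K" "i \<in> Poly_Mapping.keys m" for m i
    unfolding N_def using that fU by (intro le_imp_less_Suc Max_ge) auto
  let ?E = "\<Union>m\<in>?K. Poly_Mapping.lookup m ` Poly_Mapping.keys m"
  define M where "M = Suc (Max (insert 0 ?E))"
  have M: "Poly_Mapping.lookup m i < M" if "m \<in> ?K" for m i
  proof (cases "i \<in> Poly_Mapping.keys m")
    case True
    then show ?thesis unfolding M_def using that by (intro le_imp_less_Suc Max_ge) auto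
  next
    case False
    then show ?thesis by (simp add: M_def in_keys_iff)
  qed
  define \<Phi> where "\<Phi> m = (\<Sum>i<N. Poly_Mapping.lookup m i * M ^ i)" for m :: "nat \<Rightarrow>\<^sub>0 nat"
  have inj: "m = m'" if "m \<in> ?K" "m' \<in> ?K" "\<Phi> m = \<Phi> m'" for m m'
  proof (rule poly_mapping_eqI)
    fix i
    show "Poly_Mapping.lookup m i = Poly_Mapping.lookup m' i"
    proof (cases "i < N")
      case True
      then show ?thesis
        using digits_inj[of N "Poly_Mapping.lookup m" M "Poly_Mapping.lookup m'"] M that
        by (auto simp: \<Phi>_def)
    next
      case False
      then show ?thesis using N[OF that(1), of i] N[OF that(2), of i] by (metis in_keys_iff)
    qed
  qed
  have mv: "mono_val (\<lambda>i. t ^ (M ^ i)) m = t ^ \<Phi> m" if "m \<in> ?K" for t :: rat and m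
    using N[OF that] unfolding \<Phi>_def
    by (subst mono_val_superset[of "{..<N}"]) (auto simp: power_sum power_mult[symmetric] mult.commute)
  define q where "q = (\<Sum>m\<in>?K. monom (Poly_Mapping.lookup p m) (\<Phi> m))"
  have ev_q: "ev (\<lambda>i. t ^ (M ^ i)) p = poly q t" for t
    unfolding ev_def ins_def q_def by (simp add: poly_sum poly_monom mv)
  obtain m0 where m0: "m0 \<in> ?K" using assms by fastforce
  have "coeff q (\<Phi> m0) = (\<Sum>m\<in>?K. if m = m0 then Poly_Mapping.lookup p m else 0)"
    unfolding q_def coeff_sum by (rule sum.cong) (use inj m0 in auto)
  also have "\<dots> = Poly_Mapping.lookup p m0" using m0 by simp
  finally have "coeff q (\<Phi> m0) \<noteq> 0" using m0 by (simp add: in_keys_iff)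
  then have "q \<noteq> 0" by auto
  then obtain t where "poly q t \<noteq> 0" using poly_all_0_iff_0 by blast
  with ev_q show ?thesis by metis
qed

subsection \<open>Homogeneous components\<close>

definition hc :: "nat \<Rightarrow> qpoly \<Rightarrow> qpoly" where "hc d p = coeff (Hm p) d"
text \<open>Zero is homogeneous of every degree in this sense, so sums and quotients need no case
  distinction.\<close>

definition homog :: "nat \<Rightarrow> qpoly \<Rightarrow> bool" where "homog d p \<longleftrightarrow> Hm p = monom p d"
definition tdeg :: "qpoly \<Rightarrow> nat" where "tdeg p = degree (Hm p)"

lemma hc_0 [simp]: "hc d 0 = 0" by (simp add: hc_def Hm.hom_zero)
lemma hc_add: "hc d (p + q) = hc d p + hc d q" by (simp add: hc_def Hm.hom_add)
lemma hc_sum: "hc d (sum f S) = (\<Sum>i\<in>S. hc d (f i))"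
  by (induction S rule: infinite_finite_induct) (simp_all add: hc_add)
lemma hc_mult: "hc d (p * q) = (\<Sum>i\<le>d. hc i p * hc (d - i) q)"
  by (simp add: hc_def Hm.hom_mult coeff_mult)
lemma hc_const: "hc d (const c) = (if d = 0 then const c else 0)"
  by (simp add: hc_def coeff_pCons split: nat.split)
lemma hc_var: "hc d (var i) = (if d = 1 then var i else 0)"
  by (simp add: hc_def coeff_pCons split: nat.split)
lemma hc_const_mult: "hc d (const c * p) = const c * hc d p"
  by (simp add: hc_def Hm.hom_mult)

lemma Hm_eval: "poly (Hm p) 1 = p"
  by (induction p rule: qpoly_induct) (simp_all add: Hm.hom_add Hm.hom_mult)

lemma sum_hc: assumes "tdeg p \<le> D" shows "(\<Sum>d\<le>D. hc d p) = p"
proof -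
  have "p = poly (Hm p) 1" by (simp add: Hm_eval)
  also have "\<dots> = (\<Sum>d\<le>degree (Hm p). coeff (Hm p) d)" by (simp add: poly_altdef)
  also have "\<dots> = (\<Sum>d\<le>D. coeff (Hm p) d)"
    by (rule sum.mono_neutral_left) (use assms in \<open>auto simp: tdeg_def coeff_eq_0\<close>)
  finally show ?thesis by (simp add: hc_def)
qed

lemma homog_hc_iff: "homog d p \<longleftrightarrow> (\<forall>e. hc e p = (if e = d then p else 0))"
  unfolding homog_def hc_def poly_eq_iff by (auto simp: when_def)

lemma homog_0 [simp]: "homog d 0" by (simp add: homog_hc_iff)
lemma homog_const: "homog 0 (const c)" by (simp add: homog_hc_iff hc_const)
lemma homog_var: "homog 1 (var i)" by (simp add: homog_hc_iff hc_var)
lemma homog_add: "homog d p \<Longrightarrow> homog d q \<Longrightarrow> homog d (p + q)"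
  by (simp add: homog_def Hm.hom_add add_monom)
lemma homog_mult: "homog d p \<Longrightarrow> homog e q \<Longrightarrow> homog (d + e) (p * q)"
  by (simp add: homog_def Hm.hom_mult mult_monom)
lemma homog_uminus: "homog d p \<Longrightarrow> homog d (- p)"
  by (simp add: homog_def Hm.hom_uminus minus_monom)
lemma homog_diff: "homog d p \<Longrightarrow> homog d q \<Longrightarrow> homog d (p - q)"
  using homog_add[of d p "- q"] homog_uminus by simp
lemma homog_sum: "(\<And>i. i \<in> S \<Longrightarrow> homog d (f i)) \<Longrightarrow> homog d (sum f S)"
  by (induction S rule: infinite_finite_induct) (auto intro: homog_add)
lemma homog_prod: "(\<And>i. i \<in> S \<Longrightarrow> homog (d i) (f i)) \<Longrightarrow> homog (sum d S) (prod f S)"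
proof (induction S rule: infinite_finite_induct)
  case (insert x F)
  then show ?case by (auto intro: homog_mult)
qed (use homog_const[of 1] in auto)
lemma homog_const_mult: "homog d p \<Longrightarrow> homog d (const c * p)"
  using homog_mult[OF homog_const[of c], of d p] by simp

lemma homog_hc: "homog d (hc d p)"
proof (induction p arbitrary: d rule: qpoly_induct)
  case (const c)
  then show ?case using homog_const by (auto simp: hc_const)
next
  case (var i)
  then show ?case using homog_var by (auto simp: hc_var)
next
  case (add p q)
  then show ?case by (simp add: hc_add homog_add)
next
  case (mult p q)
  show ?case unfolding hc_mult
  proof (rule homog_sum)
    fix i assume "i \<in> {..d}"
    then show "homog d (hc i p * hc (d - i) q)"
      using homog_mult[OF mult(1)[of i] mult(2)[of "d - i"]] by simp
  qed
qed

lemma homog_unique: "homog d p \<Longrightarrow> homog e p \<Longrightarrow> p \<noteq> 0 \<Longrightarrow> d = e"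
  by (metis homog_hc_iff)

lemma hc_homog_mult:
  assumes "homog k a" shows "hc (k + d) (a * p) = a * hc d p"
proof -
  have "hc (k + d) (a * p) = (\<Sum>i\<le>k+d. if i = k then a * hc d p else 0)"
    unfolding hc_mult by (rule sum.cong) (use assms in \<open>auto simp: homog_hc_iff\<close>)
  then show ?thesis by simp
qed

lemma hc_homog_mult_less:
  assumes "homog k a" "d < k" shows "hc d (a * p) = 0"
  unfolding hc_mult by (rule sum.neutral) (use assms in \<open>auto simp: homog_hc_iff\<close>)

lemma homog_cancel:
  assumes "homog k a" "homog (k + d) (a * p)" "a \<noteq> 0" shows "homog d p"
  unfolding homog_hc_iff
proof
  fix e
  have "a * hc e p = hc (k + e) (a * p)" using hc_homog_mult[OF assms(1)] by simp
  also have "\<dots> = (if e = d then a * p else 0)" using assms(2) by (simp add: homog_hc_iff)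
  finally show "hc e p = (if e = d then p else 0)" using assms(3) by (auto split: if_splits)
qed

lemma hc_polys_over: "p \<in> polys_over V \<Longrightarrow> hc d p \<in> polys_over V"
proof (induction arbitrary: d rule: polys_over_induct)
  case (mult p q)
  then show ?case unfolding hc_mult by (auto intro!: polys_over_sum polys_over_mult)
qed (auto simp: hc_const hc_var hc_add intro: polys_over_var polys_over_add)

section \<open>Total degree\<close>

lemma tdeg_mult: "p \<noteq> 0 \<Longrightarrow> q \<noteq> 0 \<Longrightarrow> tdeg (p * q) = tdeg p + tdeg q"
  unfolding tdeg_def Hm.hom_mult by (rule degree_mult_eq) (metis Hm_eval poly_0)+

lemma tdeg_mult_le: "tdeg (p * q) \<le> tdeg p + tdeg q"
  by (simp add: tdeg_def Hm.hom_mult degree_mult_le)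
lemma tdeg_add_le: "tdeg p \<le> d \<Longrightarrow> tdeg q \<le> d \<Longrightarrow> tdeg (p + q) \<le> d"
  by (simp add: tdeg_def Hm.hom_add degree_add_le)
lemma tdeg_uminus [simp]: "tdeg (- p) = tdeg p"
  by (simp add: tdeg_def Hm.hom_uminus)
lemma tdeg_diff_le: "tdeg p \<le> d \<Longrightarrow> tdeg q \<le> d \<Longrightarrow> tdeg (p - q) \<le> d"
  using tdeg_add_le[of p d "- q"] by simp
lemma tdeg_0 [simp]: "tdeg 0 = 0" by (simp add: tdeg_def Hm.hom_zero)
lemma tdeg_const [simp]: "tdeg (const c) = 0" by (simp add: tdeg_def)
lemma tdeg_1 [simp]: "tdeg 1 = 0" using tdeg_const[of 1] by simp
lemma tdeg_var: "tdeg (var i) \<le> 1" by (simp add: tdeg_def)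
lemma tdeg_sum_le: "(\<And>i. i \<in> S \<Longrightarrow> tdeg (f i) \<le> d) \<Longrightarrow> tdeg (sum f S) \<le> d"
  by (induction S rule: infinite_finite_induct) (auto intro: tdeg_add_le)
lemma tdeg_prod_le: "(\<And>i. i \<in> S \<Longrightarrow> tdeg (f i) \<le> d i) \<Longrightarrow> tdeg (prod f S) \<le> sum d S"
proof (induction S rule: infinite_finite_induct)
  case (insert x F)
  have "tdeg (f x * prod f F) \<le> tdeg (f x) + tdeg (prod f F)" by (rule tdeg_mult_le)
  with insert show ?case by (auto intro: add_mono order_trans)
qed auto
lemma tdeg_power_le: "tdeg p \<le> d \<Longrightarrow> tdeg (p ^ k) \<le> k * d"
proof (induction k)
  case (Suc k)
  have "tdeg (p * p ^ k) \<le> tdeg p + tdeg (p ^ k)" by (rule tdeg_mult_le)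
  with Suc show ?case by auto
qed simp
lemma tdeg_const_mult_le: "tdeg p \<le> d \<Longrightarrow> tdeg (const c * p) \<le> d"
  using tdeg_mult_le[of "const c" p] by simp

lemma homog_tdeg: "homog d p \<Longrightarrow> tdeg p \<le> d"
  by (simp add: homog_def tdeg_def degree_monom_le)

lemma homog_tdeg_eq: "homog d p \<Longrightarrow> p \<noteq> 0 \<Longrightarrow> tdeg p = d"
  by (simp add: homog_def tdeg_def degree_monom_eq)

lemma tdeg_0_const: assumes "tdeg p = 0" shows "\<exists>c. p = const c"
proof -
  have "hc 0 p = const (ev (\<lambda>_. 0) p)" for p
    by (induction p rule: qpoly_induct)
      (simp_all add: hc_const hc_var hc_add hc_mult ev.hom_add ev.hom_mult const_add const_mult)
  then have "p = const (ev (\<lambda>_. 0) p)" using sum_hc[of p 0] assms by simp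
  then show ?thesis by blast
qed

lemma homog_0_const: "homog 0 p \<Longrightarrow> \<exists>c. p = const c"
  using homog_tdeg[of 0 p] tdeg_0_const by simp

text \<open>Induction on \<open>p\<close> itself breaks down at sums, where cancellation can lower
  \<open>tdeg p\<close>. The bound is proved for each homogeneous component, where it is stable
  under sums and products, and the components are added up at the end.\<close>

lemma tdeg_psub_le:
  assumes h: "\<And>i. tdeg (h i) \<le> 1" shows "tdeg (psub h p) \<le> tdeg p"
proof -
  have hom: "tdeg (psub h (hc d q)) \<le> d" for d q
  proof (induction q arbitrary: d rule: qpoly_induct)
    case (mult p q)
    show ?case unfolding hc_mult psub.hom_sum psub.hom_mult
    proof (rule tdeg_sum_le)
      fix i assume "i \<in> {..d}"
      then show "tdeg (psub h (hc i p) * psub h (hc (d - i) q)) \<le> d"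
        using tdeg_mult_le[of "psub h (hc i p)" "psub h (hc (d - i) q)"] mult(1)[of i] mult(2)[of "d - i"]
        by auto
    qed
  qed (auto simp: hc_const hc_var hc_add psub.hom_add psub.hom_zero h[simplified] intro: tdeg_add_le)
  have "psub h p = (\<Sum>d\<le>tdeg p. psub h (hc d p))"
    by (subst (1) sum_hc[of p "tdeg p", symmetric]) (simp_all add: psub.hom_sum)
  also have "tdeg \<dots> \<le> tdeg p"
    using hom by (intro tdeg_sum_le) (auto intro: order_trans)
  finally show ?thesis .
qed

section \<open>Determinants\<close>

text \<open>Matrices as plain functions on indices below \<open>n\<close> keep carrier conditions
  out of the statements.\<close>

definition fdet :: "nat \<Rightarrow> (nat \<Rightarrow> nat \<Rightarrow> 'a::comm_ring_1) \<Rightarrow> 'a" where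
  "fdet n M = det (mat n n (\<lambda>(i, j). M i j))"

lemma fdet_leibniz:
  "fdet n M = (\<Sum>p | p permutes {0..<n}. signof p * (\<Prod>i = 0..<n. M i (p i)))"
proof -
  have "(\<Prod>i = 0..<n. mat n n (\<lambda>(i, j). M i j) $$ (i, p i)) = (\<Prod>i = 0..<n. M i (p i))"
    if "p permutes {0..<n}" for p
    using permutes_in_image[OF that] by (intro prod.cong) auto
  then show ?thesis
    unfolding fdet_def by (subst det_def'[of _ n]) (auto intro!: sum.cong)
qed

lemma fdet_cong: "(\<And>i j. i < n \<Longrightarrow> j < n \<Longrightarrow> M i j = N i j) \<Longrightarrow> fdet n M = fdet n N"
  unfolding fdet_def by (intro arg_cong[of _ _ det] cong_mat) auto

lemma fdet_hom: "comm_ring_hom h \<Longrightarrow> h (fdet n M) = fdet n (\<lambda>i j. h (M i j))"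
  unfolding fdet_def
  by (subst comm_ring_hom.hom_det[symmetric]) (auto intro!: arg_cong[of _ _ det])

lemma fdet_mult:
  "fdet n (\<lambda>i j. \<Sum>k<n. C i k * M k j) = fdet n C * fdet n M"
  unfolding fdet_def
  by (subst det_mult[symmetric, of _ n])
    (auto intro!: arg_cong[of _ _ det] sum.cong simp: scalar_prod_def lessThan_atLeast0)

lemma fdet_transpose: "fdet n (\<lambda>i j. M j i) = fdet n M"
  unfolding fdet_def
  by (subst det_transpose[symmetric, of _ n]) (auto intro!: arg_cong[of _ _ det])

lemma fdet_0_right:
  fixes M :: "nat \<Rightarrow> nat \<Rightarrow> 'a::idom"
  shows "fdet n M = 0 \<longleftrightarrow> (\<exists>c. (\<exists>j<n. c j \<noteq> 0) \<and> (\<forall>i<n. (\<Sum>j<n. M i j * c j) = 0))"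
proof -
  let ?A = "mat n n (\<lambda>(i, j). M i j)"
  have "fdet n M = 0 \<longleftrightarrow> (\<exists>v. v \<in> carrier_vec n \<and> v \<noteq> 0\<^sub>v n \<and> ?A *\<^sub>v v = 0\<^sub>v n)"
    unfolding fdet_def by (rule det_0_iff_vec_prod_zero) simp
  also have "\<dots> \<longleftrightarrow> (\<exists>c. (\<exists>j<n. c j \<noteq> 0) \<and> (\<forall>i<n. (\<Sum>j<n. M i j * c j) = 0))"
  proof safe
    fix v :: "'a vec" assume v: "v \<in> carrier_vec n" "v \<noteq> 0\<^sub>v n" "?A *\<^sub>v v = 0\<^sub>v n"
    have nz: "\<exists>j<n. v $ j \<noteq> 0" using v(1,2) by (metis carrier_vecD eq_vecI index_zero_vec)
    have z: "(\<Sum>j<n. M i j * v $ j) = 0" if "i < n" for i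
    proof -
      have "(?A *\<^sub>v v) $ i = (\<Sum>j<n. M i j * v $ j)"
        using that v(1) by (auto simp: scalar_prod_def lessThan_atLeast0)
      then show ?thesis using v(3) that by simp
    qed
    show "\<exists>c. (\<exists>j<n. c j \<noteq> 0) \<and> (\<forall>i<n. (\<Sum>j<n. M i j * c j) = 0)"
      by (rule exI[of _ "\<lambda>j. v $ j"]) (use nz z in blast)
  next
    fix c :: "nat \<Rightarrow> 'a" and j assume c: "\<forall>i<n. (\<Sum>j<n. M i j * c j) = 0" "j < n" "c j \<noteq> 0"
    have "vec n c \<noteq> 0\<^sub>v n" using c(2,3) by (metis index_vec index_zero_vec(1))
    moreover have "?A *\<^sub>v vec n c = 0\<^sub>v n"
      by (rule eq_vecI) (use c(1) in \<open>auto simp: scalar_prod_def lessThan_atLeast0\<close>)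
    ultimately show "\<exists>v. v \<in> carrier_vec n \<and> v \<noteq> 0\<^sub>v n \<and> ?A *\<^sub>v v = 0\<^sub>v n"
      by (intro exI[of _ "vec n c"]) auto
  qed
  finally show ?thesis .
qed

lemma fdet_0_left:
  fixes M :: "nat \<Rightarrow> nat \<Rightarrow> 'a::idom"
  shows "fdet n M = 0 \<longleftrightarrow> (\<exists>c. (\<exists>i<n. c i \<noteq> 0) \<and> (\<forall>j<n. (\<Sum>i<n. c i * M i j) = 0))"
  unfolding fdet_transpose[of n M, symmetric] fdet_0_right by (simp add: mult.commute)

text \<open>Zero rows make the matrix square and singular, so a kernel vector exists over the domain
  itself, without passing to a field of fractions.\<close>

lemma homogeneous_system:
  fixes M :: "nat \<Rightarrow> nat \<Rightarrow> 'a::idom"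
  assumes "m < k"
  shows "\<exists>c. (\<exists>j<k. c j \<noteq> 0) \<and> (\<forall>i<m. (\<Sum>j<k. M i j * c j) = 0)"
proof -
  let ?N = "\<lambda>i j. if i < m then M i j else 0"
  have "fdet k ?N = 0" unfolding fdet_0_left
    by (rule exI[of _ "\<lambda>i. if i < m then 0 else 1"]) (use assms in \<open>auto intro!: sum.neutral\<close>)
  then obtain c where "\<exists>j<k. c j \<noteq> 0" "\<forall>i<k. (\<Sum>j<k. ?N i j * c j) = 0"
    unfolding fdet_0_right by blast
  moreover have "(\<Sum>j<k. M i j * c j) = 0" if "i < m" for i
    using calculation(2)[rule_format, of i] that assms by simp
  ultimately show ?thesis by blast
qed

lemma fdet_row_sum:
  assumes "k < n"
  shows "fdet n (\<lambda>i j. if i = k then (\<Sum>l\<in>S. x l * R l j) else M i j)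
       = (\<Sum>l\<in>S. x l * fdet n (\<lambda>i j. if i = k then R l j else M i j))"
proof -
  have split: "(\<Prod>i = 0..<n. if i = k then r (p i) else M i (p i))
      = r (p k) * (\<Prod>i\<in>{0..<n} - {k}. M i (p i))" for r p
    using assms by (subst prod.remove[of _ k]) (auto intro!: prod.cong)
  have "fdet n (\<lambda>i j. if i = k then (\<Sum>l\<in>S. x l * R l j) else M i j)
      = (\<Sum>p | p permutes {0..<n}. \<Sum>l\<in>S. x l * (signof p * (R l (p k) * (\<Prod>i\<in>{0..<n} - {k}. M i (p i)))))"
    unfolding fdet_leibniz split[of "\<lambda>j. \<Sum>l\<in>S. x l * R l j"]
    by (simp add: sum_distrib_left sum_distrib_right mult_ac)
  also have "\<dots> = (\<Sum>l\<in>S. x l * fdet n (\<lambda>i j. if i = k then R l j else M i j))"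
    by (subst sum.swap) (simp add: fdet_leibniz split[of "R _"] sum_distrib_left)
  finally show ?thesis .
qed

lemma fdet_identical_rows:
  assumes "i < n" "j < n" "i \<noteq> j" "\<And>l. l < n \<Longrightarrow> M i l = M j l"
  shows "fdet n M = 0"
  unfolding fdet_def
  by (rule det_identical_rows[OF _ assms(3,1,2)]) (use assms in \<open>auto intro!: eq_vecI\<close>)

text \<open>Cramer's rule without division. The adjugate supplies coefficients \<open>c k\<close>;
  inserting the resulting combination into row \<open>k\<close> identifies them, by multilinearity,
  as determinants with one row replaced. That form is what Saito's criterion needs, because such
  determinants are divisible by the product of the forms.\<close>

lemma cramer_rows:
  fixes M :: "nat \<Rightarrow> nat \<Rightarrow> 'a::idom"
  assumes nz: "fdet n M \<noteq> 0" and j: "j < n"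
  shows "fdet n M * r j = (\<Sum>k<n. fdet n (\<lambda>i j. if i = k then r j else M i j) * M k j)"
proof -
  let ?A = "mat n n (\<lambda>(i, j). M i j)"
  have A: "?A \<in> carrier_mat n n" by simp
  define c where "c k = (\<Sum>i<n. r i * adj_mat ?A $$ (i, k))" for k
  have adj: "(\<Sum>k<n. adj_mat ?A $$ (i, k) * M k j) = (if i = j then fdet n M else 0)" if "i < n" "j < n" for i j
  proof -
    have "(adj_mat ?A * ?A) $$ (i, j) = (\<Sum>k<n. adj_mat ?A $$ (i, k) * M k j)"
      using that adj_mat(1)[OF A] by (auto simp: scalar_prod_def lessThan_atLeast0)
    then show ?thesis using adj_mat(3)[OF A] that by (cases "i = j") (simp_all add: fdet_def)
  qed
  have comb: "fdet n M * r j = (\<Sum>k<n. c k * M k j)" if "j < n" for j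
  proof -
    have "(\<Sum>k<n. c k * M k j) = (\<Sum>i<n. r i * (\<Sum>k<n. adj_mat ?A $$ (i, k) * M k j))"
      unfolding c_def sum_distrib_right sum_distrib_left by (subst sum.swap) (simp add: mult_ac)
    also have "\<dots> = (\<Sum>i<n. if i = j then r j * fdet n M else 0)"
      by (rule sum.cong) (use that adj in auto)
    finally show ?thesis using that by (simp add: mult.commute)
  qed
  have "c k = fdet n (\<lambda>i j. if i = k then r j else M i j)" if k: "k < n" for k
  proof -
    \<comment> \<open>The sum over a single index is scalar multiplication of row \<open>k\<close>,
      put into the format of \<open>fdet_row_sum\<close>.\<close>
    have "fdet n M * fdet n (\<lambda>i j. if i = k then r j else M i j)
        = fdet n (\<lambda>i j. if i = k then (\<Sum>l\<in>{0::nat}. fdet n M * r j) else M i j)"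
      using fdet_row_sum[OF k, where S = "{0::nat}" and x = "\<lambda>_. fdet n M" and R = "\<lambda>_. r" and M = M] by simp
    also have "\<dots> = fdet n (\<lambda>i j. if i = k then (\<Sum>l<n. c l * M l j) else M i j)"
      by (rule fdet_cong) (simp add: comb)
    also have "\<dots> = (\<Sum>l<n. c l * fdet n (\<lambda>i j. if i = k then M l j else M i j))"
      by (rule fdet_row_sum[OF k])
    also have "\<dots> = (\<Sum>l<n. if l = k then c k * fdet n M else 0)"
    proof (rule sum.cong[OF refl])
      fix l assume l: "l \<in> {..<n}"
      show "c l * fdet n (\<lambda>i j. if i = k then M l j else M i j) = (if l = k then c k * fdet n M else 0)"
      proof (cases "l = k")
        case True
        then show ?thesis by (auto intro!: arg_cong[of _ _ "(*) (c k)"] fdet_cong)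
      next
        case False
        then have "fdet n (\<lambda>i j. if i = k then M l j else M i j) = 0"
          using l k by (intro fdet_identical_rows[of k n l]) auto
        with False show ?thesis by simp
      qed
    qed
    also have "\<dots> = fdet n M * c k" using k by (simp add: mult.commute)
    finally show ?thesis using nz by simp
  qed
  with comb[OF j] show ?thesis by simp
qed

section \<open>Arrangements and Saito's criterion\<close>

definition dot :: "nat \<Rightarrow> (nat \<Rightarrow> rat) \<Rightarrow> (nat \<Rightarrow> rat) \<Rightarrow> rat" where
  "dot n a v = (\<Sum>i\<in>{1..n}. a i * v i)"

lemma ev_lin_form [simp]: "ev v (lin_form n a) = dot n a v"
  by (simp add: lin_form_def dot_def ev.hom_sum ev.hom_mult)

lemma lin_form_polys_over [simp]: "lin_form n a \<in> polys_over {1..n}"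
  unfolding lin_form_def by (auto intro!: polys_over_sum polys_over_mult polys_over_var)

lemma homog_lin_form: "homog 1 (lin_form n a)"
  unfolding lin_form_def by (intro homog_sum homog_const_mult homog_var)

lemma lin_form_nonzero:
  assumes "p \<in> {1..n}" "a p \<noteq> 0" shows "lin_form n a \<noteq> 0"
proof
  assume "lin_form n a = 0"
  then have "dot n a (\<lambda>i. if i = p then 1 else 0) = 0"
    using ev_lin_form[of "\<lambda>i. if i = p then 1 else 0" n a] by (simp add: ev.hom_zero)
  moreover have "dot n a (\<lambda>i. if i = p then 1 else 0) = (\<Sum>i\<in>{1..n}. if i = p then a p else 0)"
    unfolding dot_def by (rule sum.cong) auto
  ultimately show False using assms by simp
qed

text \<open>Solves the equation of the hyperplane for the variable with index \<open>p\<close>, that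
  is, restricts to the hyperplane. For \<open>a p \<noteq> 0\<close> the kernel of this substitution
  is the ideal of the form, which turns divisibility into an equation.\<close>

definition elim :: "nat \<Rightarrow> (nat \<Rightarrow> rat) \<Rightarrow> nat \<Rightarrow> nat \<Rightarrow> qpoly" where
  "elim n a p i = (if i = p then var p - const (inverse (a p)) * lin_form n a else var i)"

lemma psub_elim_lin_form:
  assumes "p \<in> {1..n}" "a p \<noteq> 0" shows "psub (elim n a p) (lin_form n a) = 0"
proof -
  let ?L = "lin_form n a"
  have "psub (elim n a p) ?L = (\<Sum>i\<in>{1..n}. const (a i) * elim n a p i)"
    by (simp add: lin_form_def psub.hom_sum psub.hom_mult)
  also have "\<dots> = (\<Sum>i\<in>{1..n}. const (a i) * var i - (if i = p then const (a p) * const (inverse (a p)) * ?L else 0))"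
    by (rule sum.cong) (auto simp: elim_def algebra_simps)
  also have "\<dots> = ?L - const (a p) * const (inverse (a p)) * ?L"
    using assms by (simp add: sum_subtractf lin_form_def)
  also have "\<dots> = 0"
    using assms by (simp add: const_mult[symmetric])
  finally show ?thesis .
qed

lemma lin_form_dvd_iff:
  assumes "p \<in> {1..n}" "a p \<noteq> 0"
  shows "lin_form n a dvd f \<longleftrightarrow> psub (elim n a p) f = 0"
proof
  assume "lin_form n a dvd f"
  then show "psub (elim n a p) f = 0"
    using psub_elim_lin_form[of p n a, OF assms] by (auto simp: dvd_def psub.hom_mult)
next
  assume 0: "psub (elim n a p) f = 0"
  have "lin_form n a dvd psub var f - psub (elim n a p) f"
    by (rule psub_cong_dvd) (auto simp: elim_def)
  then show "lin_form n a dvd f" using 0 by (simp add: psub_id)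
qed

text \<open>The multiples of the form are the kernel of a homomorphism into a domain. This takes the
  place of unique factorization throughout.\<close>

lemma lin_form_prime:
  assumes "p \<in> {1..n}" "a p \<noteq> 0" "lin_form n a dvd f * g"
  shows "lin_form n a dvd f \<or> lin_form n a dvd g"
  using assms(3) unfolding lin_form_dvd_iff[of p n a, OF assms(1,2)] by (simp add: psub.hom_mult)

text \<open>The definition of \<open>Dmod\<close> wants the quotient in the ring of the given
  variables. Setting all foreign variables to zero fixes \<open>d\<close> and \<open>f\<close> and
  moves the quotient there.\<close>

lemma dvd_in_polys:
  assumes "d \<in> polys_over V" "f \<in> polys_over V" "d dvd f"
  shows "\<exists>q\<in>polys_over V. f = d * q"
proof -
  obtain q where q: "f = d * q" using assms(3) by (auto simp: dvd_def)
  let ?r = "psub (\<lambda>i. if i \<in> V then var i else 0)"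
  have "f = ?r f" using assms(2) by (simp add: psub_id_on)
  also have "\<dots> = ?r d * ?r q" by (simp add: q psub.hom_mult)
  also have "?r d = d" using assms(1) by (simp add: psub_id_on)
  finally have "f = d * ?r q" .
  moreover have "?r q \<in> polys_over V"
    by (rule psub_polys_over[of _ UNIV]) (auto intro: polys_over_var)
  ultimately show ?thesis by blast
qed

lemma apply_der_polys_over: "\<theta> \<in> derivations n \<Longrightarrow> apply_der n \<theta> a \<in> polys_over {1..n}"
  unfolding apply_der_def derivations_def polys_in_over
  by (auto intro!: polys_over_sum polys_over_mult)

lemma Dmod_iff:
  "\<theta> \<in> Dmod n A \<longleftrightarrow> \<theta> \<in> derivations n \<and> (\<forall>a\<in>A. lin_form n a dvd apply_der n \<theta> a)"
  unfolding Dmod_def polys_in_over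
  using dvd_in_polys[OF lin_form_polys_over apply_der_polys_over] by (auto simp: dvd_def)

text \<open>Between nonzero linear forms divisibility means proportionality, so the last clause says
  that different coefficient vectors give different hyperplanes.\<close>

definition arr :: "nat \<Rightarrow> (nat \<Rightarrow> rat) set \<Rightarrow> bool" where
  "arr n A \<longleftrightarrow> finite A \<and> (\<forall>a\<in>A. \<exists>p\<in>{1..n}. a p \<noteq> 0) \<and>
    (\<forall>a\<in>A. \<forall>b\<in>A. a \<noteq> b \<longrightarrow> \<not> lin_form n a dvd lin_form n b)"

definition Qpoly :: "nat \<Rightarrow> (nat \<Rightarrow> rat) set \<Rightarrow> qpoly" where
  "Qpoly n A = (\<Prod>a\<in>A. lin_form n a)"

lemma arr_prime:
  "arr n A \<Longrightarrow> a \<in> A \<Longrightarrow> lin_form n a dvd f * g \<Longrightarrow> lin_form n a dvd f \<or> lin_form n a dvd g"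
  unfolding arr_def using lin_form_prime by blast

lemma arr_nonzero: "arr n A \<Longrightarrow> a \<in> A \<Longrightarrow> lin_form n a \<noteq> 0"
  unfolding arr_def using lin_form_nonzero by blast

lemma arr_subset: "arr n A \<Longrightarrow> B \<subseteq> A \<Longrightarrow> arr n B"
  unfolding arr_def by (auto intro: finite_subset)

lemma arr_not_unit: "arr n A \<Longrightarrow> a \<in> A \<Longrightarrow> \<not> lin_form n a dvd 1"
proof
  assume a: "arr n A" "a \<in> A" "lin_form n a dvd 1"
  then obtain p where "p \<in> {1..n}" "a p \<noteq> 0" unfolding arr_def by blast
  then show False using a(3) lin_form_dvd_iff[of p n a 1] by simp
qed

lemma Qpoly_nonzero: "arr n A \<Longrightarrow> Qpoly n A \<noteq> 0"
  unfolding Qpoly_def using arr_nonzero by (auto simp: arr_def)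

lemma homog_Qpoly: "homog (card A) (Qpoly n A)"
  unfolding Qpoly_def using homog_prod[of A "\<lambda>_. 1" "lin_form n"] homog_lin_form by simp

lemma arr_not_dvd_Qpoly:
  assumes "arr n (insert a B)" "a \<notin> B"
  shows "\<not> lin_form n a dvd Qpoly n B"
proof -
  have "finite B" using assms(1) by (simp add: arr_def)
  then show ?thesis using assms
  proof (induction B rule: finite_induct)
    case empty
    then show ?case using arr_not_unit[of n "{a}" a] by (simp add: Qpoly_def)
  next
    case (insert b B)
    have "arr n (insert a B)" using insert.prems(1) by (rule arr_subset) auto
    then have "\<not> lin_form n a dvd Qpoly n B" using insert by auto
    moreover have "\<not> lin_form n a dvd lin_form n b"
      using insert.prems unfolding arr_def by auto
    ultimately show ?case
      using arr_prime[OF insert.prems(1), of a] insert.hyps by (auto simp: Qpoly_def)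
  qed
qed

lemma Qpoly_dvd:
  assumes "arr n A" "\<And>a. a \<in> A \<Longrightarrow> lin_form n a dvd x"
  shows "Qpoly n A dvd x"
proof -
  have "finite A" using assms(1) by (simp add: arr_def)
  then show ?thesis using assms
  proof (induction A rule: finite_induct)
    case (insert a A)
    then have "Qpoly n A dvd x" using arr_subset[OF insert.prems(1)] by blast
    then obtain y where y: "x = Qpoly n A * y" by (auto simp: dvd_def)
    moreover have "lin_form n a dvd x" using insert.prems(2) by auto
    ultimately have "lin_form n a dvd y"
      using arr_prime[OF insert.prems(1), of a "Qpoly n A" y] arr_not_dvd_Qpoly[OF insert.prems(1)] insert.hyps
      by auto
    then show ?case using y insert.hyps by (auto simp: Qpoly_def dvd_def mult_ac)
  qed (simp add: Qpoly_def)
qed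

text \<open>Saito's determinant. Rows are derivations; the \<open>Suc\<close> reconciles variables
  counted from 1 with columns counted from 0.\<close>

definition der_det :: "nat \<Rightarrow> (nat \<Rightarrow> nat \<Rightarrow> qpoly) \<Rightarrow> qpoly" where
  "der_det n \<Theta> = fdet n (\<lambda>k j. \<Theta> k (Suc j))"

lemma sum_1_n: "(\<Sum>i = Suc 0..n. f i) = (\<Sum>j<n. f (Suc j))"
  by (simp add: lessThan_atLeast0 sum.shift_bounds_Suc_ivl[symmetric] atLeastLessThanSuc_atLeastAtMost)

text \<open>On the hyperplane of \<open>a\<close> every row is orthogonal to the constant vector
  \<open>a\<close>, so the restricted matrix is singular.\<close>

lemma lin_form_dvd_der_det:
  assumes "arr n A" "a \<in> A" "\<And>k. k < n \<Longrightarrow> \<Theta> k \<in> Dmod n A"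
  shows "lin_form n a dvd der_det n \<Theta>"
proof -
  obtain p where p: "p \<in> {1..n}" "a p \<noteq> 0" using assms(1,2) unfolding arr_def by blast
  let ?s = "psub (elim n a p)"
  have "?s (der_det n \<Theta>) = fdet n (\<lambda>k j. ?s (\<Theta> k (Suc j)))"
    unfolding der_det_def by (rule fdet_hom) unfold_locales
  also have "\<dots> = 0" unfolding fdet_0_right
  proof (intro exI[of _ "\<lambda>j. const (a (Suc j))"] conjI allI impI)
    show "\<exists>j<n. const (a (Suc j)) \<noteq> 0"
      by (rule exI[of _ "p - 1"]) (use p in auto)
    fix k assume "k < n"
    then have "?s (apply_der n (\<Theta> k) a) = 0"
      using assms(2,3) lin_form_dvd_iff[of p n a, OF p] by (auto simp: Dmod_iff)
    then show "(\<Sum>j<n. ?s (\<Theta> k (Suc j)) * const (a (Suc j))) = 0"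
      by (simp add: apply_der_def sum_1_n psub.hom_sum psub.hom_mult mult.commute)
  qed
  finally show ?thesis by (simp add: lin_form_dvd_iff[of p n a, OF p])
qed

lemma Qpoly_dvd_der_det:
  "arr n A \<Longrightarrow> (\<And>k. k < n \<Longrightarrow> \<Theta> k \<in> Dmod n A) \<Longrightarrow> Qpoly n A dvd der_det n \<Theta>"
  by (rule Qpoly_dvd) (auto intro: lin_form_dvd_der_det)

lemma der_det_polys_over:
  assumes "\<And>k. k < n \<Longrightarrow> \<Theta> k \<in> derivations n"
  shows "der_det n \<Theta> \<in> polys_over {1..n}"
  unfolding der_det_def fdet_leibniz
proof (rule polys_over_sum)
  fix p assume "p \<in> {p. p permutes {0..<n}}"
  then have p: "p i < n" if "i < n" for i using permutes_in_image[of p "{0..<n}" i] that by auto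
  have "(\<Prod>i = 0..<n. \<Theta> i (Suc (p i))) \<in> polys_over {1..n}"
    using p assms by (intro polys_over_prod) (auto simp: derivations_def polys_in_over Suc_le_eq)
  then show "signof p * (\<Prod>i = 0..<n. \<Theta> i (Suc (p i))) \<in> polys_over {1..n}"
    by (cases "sign p = 1") (auto simp: sign_def intro: polys_over_uminus split: if_splits)
qed

text \<open>The product of the forms divides the determinant, and the degree bound leaves only a
  constant cofactor. Cramer's rule then writes every logarithmic derivation in terms of the rows
  with polynomial coefficients.\<close>

theorem saito_free:
  assumes arr: "arr n A" and D: "\<And>k. k < n \<Longrightarrow> \<Theta> k \<in> Dmod n A"
    and nz: "der_det n \<Theta> \<noteq> 0" and deg: "tdeg (der_det n \<Theta>) \<le> card A"
  shows "free_arrangement n A"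
proof -
  let ?\<delta> = "der_det n \<Theta>" and ?Q = "Qpoly n A"
  obtain g where g: "?\<delta> = ?Q * g" using Qpoly_dvd_der_det[of n A \<Theta>, OF arr D] by (auto elim: dvdE)
  have g0: "g \<noteq> 0" and Q0: "?Q \<noteq> 0" using g nz by auto
  have "tdeg ?\<delta> = card A + tdeg g"
    using tdeg_mult[OF Q0 g0] homog_tdeg_eq[OF homog_Qpoly Q0] g by simp
  with deg have "tdeg g = 0" by simp
  then obtain c where c: "g = const c" using tdeg_0_const by blast
  with g0 have c0: "c \<noteq> 0" by auto
  have der: "\<Theta> k \<in> derivations n" if "k < n" for k using D that by (simp add: Dmod_iff)
  have inj: "inj_on \<Theta> {..<n}"
  proof (rule inj_onI, rule ccontr)
    fix i j assume "i \<in> {..<n}" "j \<in> {..<n}" "\<Theta> i = \<Theta> j" "i \<noteq> j"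
    then have "?\<delta> = 0" unfolding der_det_def by (intro fdet_identical_rows[of i n j]) auto
    with nz show False by simp
  qed
  have span: "\<exists>F c. finite F \<and> F \<subseteq> \<Theta> ` {..<n} \<and> (\<forall>b\<in>F. c b \<in> polys_in n) \<and> \<theta> = (\<lambda>i. \<Sum>b\<in>F. c b * b i)"
    if \<theta>: "\<theta> \<in> Dmod n A" for \<theta>
  proof -
    have d: "\<theta> \<in> derivations n" using \<theta> by (simp add: Dmod_iff)
    \<comment> \<open>Each Cramer numerator is again the determinant of \<open>n\<close> logarithmic
      derivations, hence a multiple of \<open>?Q\<close>, and \<open>?Q\<close> is the denominator
      up to the constant \<open>c\<close>.\<close>
    let ?R = "\<lambda>k i. if i = k then \<theta> else \<Theta> i"
    have rep: "der_det n (?R k) = fdet n (\<lambda>i j. if i = k then \<theta> (Suc j) else \<Theta> i (Suc j))" for k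
      unfolding der_det_def by (rule fdet_cong) auto
    have "\<exists>q\<in>polys_over {1..n}. der_det n (?R k) = ?Q * q" if "k < n" for k
    proof (rule dvd_in_polys)
      show "?Q \<in> polys_over {1..n}" unfolding Qpoly_def by (intro polys_over_prod lin_form_polys_over)
      show "der_det n (?R k) \<in> polys_over {1..n}" using der d by (intro der_det_polys_over) auto
      show "?Q dvd der_det n (?R k)" using D \<theta> by (intro Qpoly_dvd_der_det[OF arr]) auto
    qed
    then have "\<forall>k\<in>{..<n}. \<exists>q. q \<in> polys_over {1..n} \<and> der_det n (?R k) = ?Q * q" by blast
    from bchoice[OF this] obtain q
      where q: "\<forall>k\<in>{..<n}. q k \<in> polys_over {1..n} \<and> der_det n (?R k) = ?Q * q k" by (elim exE)
    have q1: "q k \<in> polys_over {1..n}" and q2: "der_det n (?R k) = ?Q * q k" if "k < n" for k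
      using q that by auto
    define x where "x k = const (inverse c) * q k" for k
    have comb: "\<theta> i = (\<Sum>k<n. x k * \<Theta> k i)" for i
    proof (cases "i \<in> {1..n}")
      case True
      then obtain j where j: "i = Suc j" "j < n" by (cases i) auto
      have "?\<delta> * \<theta> (Suc j) = (\<Sum>k<n. der_det n (?R k) * \<Theta> k (Suc j))"
        unfolding rep using cramer_rows[of n "\<lambda>k j. \<Theta> k (Suc j)" j "\<lambda>j. \<theta> (Suc j)"] nz j
        by (simp add: der_det_def)
      also have "\<dots> = ?Q * (\<Sum>k<n. q k * \<Theta> k (Suc j))"
        by (simp add: q2 sum_distrib_left mult_ac)
      finally have "?Q * (const c * \<theta> (Suc j)) = ?Q * (\<Sum>k<n. q k * \<Theta> k (Suc j))"
        by (simp add: g c mult_ac)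
      then have e: "const c * \<theta> (Suc j) = (\<Sum>k<n. q k * \<Theta> k (Suc j))" using Q0 by simp
      have "\<theta> (Suc j) = const (inverse c) * (const c * \<theta> (Suc j))"
        using c0 by (simp add: mult.assoc[symmetric] const_mult[symmetric])
      also have "\<dots> = (\<Sum>k<n. x k * \<Theta> k (Suc j))"
        unfolding e by (simp add: x_def sum_distrib_left mult_ac)
      finally show ?thesis using j by simp
    next
      case False
      then show ?thesis using d der by (auto simp: derivations_def intro!: sum.neutral[symmetric])
    qed
    \<comment> \<open>\<open>free_module\<close> speaks of a set of derivations, so coefficients are
      carried from indices to elements along the injection \<open>\<Theta>\<close>.\<close>
    define y where "y b = x (the_inv_into {..<n} \<Theta> b)" for b
    have "\<theta> = (\<lambda>i. \<Sum>b\<in>\<Theta> ` {..<n}. y b * b i)"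
      by (rule ext) (simp add: comb sum.reindex[OF inj] y_def the_inv_into_f_f[OF inj])
    moreover have "\<forall>b\<in>\<Theta> ` {..<n}. y b \<in> polys_in n"
      using q1 by (auto simp: y_def the_inv_into_f_f[OF inj] x_def polys_in_over intro!: polys_over_mult)
    ultimately show ?thesis by (intro exI[of _ "\<Theta> ` {..<n}"] exI[of _ y]) auto
  qed
  have indep: "\<forall>b\<in>F. c b = 0"
    if F: "F \<subseteq> \<Theta> ` {..<n}" and eq: "(\<lambda>i. \<Sum>b\<in>F. c b * b i) = (\<lambda>i. 0)" for F c
  proof (rule ccontr)
    assume "\<not> (\<forall>b\<in>F. c b = 0)"
    then obtain k where k: "k < n" "\<Theta> k \<in> F" "c (\<Theta> k) \<noteq> 0" using F by auto
    define x where "x k = (if \<Theta> k \<in> F then c (\<Theta> k) else 0)" for k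
    have "(\<Sum>k<n. x k * \<Theta> k i) = (\<Sum>b\<in>F. c b * b i)" for i
    proof -
      have "(\<Sum>k<n. x k * \<Theta> k i) = (\<Sum>b\<in>\<Theta> ` {..<n}. (if b \<in> F then c b else 0) * b i)"
        by (simp add: sum.reindex[OF inj] x_def)
      also have "\<dots> = (\<Sum>b\<in>F. c b * b i)"
        by (rule sum.mono_neutral_cong_right) (use F in auto)
      finally show ?thesis .
    qed
    then have "(\<Sum>k<n. x k * \<Theta> k i) = 0" for i using fun_cong[OF eq, of i] by simp
    moreover have "x k \<noteq> 0" using k by (simp add: x_def)
    ultimately have "?\<delta> = 0" unfolding der_det_def fdet_0_left using k(1) by blast
    with nz show False by simp
  qed
  show ?thesis unfolding free_arrangement_def free_module_def
    using D span indep by (intro exI[of _ "\<Theta> ` {..<n}"]) blast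
qed

section \<open>Consequences of freeness\<close>

lemma Dmod_zero [simp]: "(\<lambda>i. 0) \<in> Dmod n A"
  by (simp add: Dmod_iff derivations_def apply_der_def polys_in_over)

lemma fdet_diag: "fdet n (\<lambda>i j. if i = j then s i else 0) = (\<Prod>i<n. s i)"
proof -
  let ?A = "mat n n (\<lambda>(i, j). if i = j then s i else 0)"
  have "det ?A = prod_list (diag_mat ?A)"
    by (rule det_upper_triangular) (auto simp: upper_triangular_def)
  also have "\<dots> = (\<Prod>i<n. s i)" 
    unfolding prod_list_diag_prod by (auto simp: lessThan_atLeast0 intro!: prod.cong)
  finally show ?thesis by (simp add: fdet_def)
qed

text \<open>More than \<open>n\<close> vectors of length \<open>n\<close> over a domain are
  dependent, so a basis has at most \<open>n\<close> elements and can be listed as \<open>n\<close>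
  rows. Any other \<open>n\<close> derivations arise from these rows by a coefficient matrix, whose
  determinant is the cofactor.\<close>

lemma free_basis:
  assumes free: "free_arrangement n A"
  obtains \<Theta> where "\<And>k. k < n \<Longrightarrow> \<Theta> k \<in> Dmod n A"
    and "\<And>H. (\<And>k. k < n \<Longrightarrow> H k \<in> Dmod n A) \<Longrightarrow> der_det n \<Theta> dvd der_det n H"
proof -
  obtain B where B: "B \<subseteq> Dmod n A"
    and span: "\<forall>\<theta>\<in>Dmod n A. \<exists>F c. finite F \<and> F \<subseteq> B \<and> (\<forall>b\<in>F. c b \<in> polys_in n) \<and> \<theta> = (\<lambda>i. \<Sum>b\<in>F. c b * b i)"
    and indep: "\<forall>F c. finite F \<and> F \<subseteq> B \<and> (\<forall>b\<in>F. c b \<in> polys_in n) \<and>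
            (\<lambda>i. \<Sum>b\<in>F. c b * b i) = (\<lambda>i. 0) \<longrightarrow> (\<forall>b\<in>F. c b = 0)"
    using free unfolding free_arrangement_def free_module_def by (elim exE conjE) (rule that)
  have small: "card F \<le> n" if F: "finite F" "F \<subseteq> B" for F
  proof (rule ccontr)
    assume "\<not> card F \<le> n"
    then have nF: "n < card F" by simp
    obtain f where f: "bij_betw f {..<card F} F"
      using ex_bij_betw_nat_finite[OF F(1)] by (auto simp: lessThan_atLeast0)
    obtain c j0 where j0: "j0 < card F" "c j0 \<noteq> 0"
      and c: "\<forall>i<n. (\<Sum>j<card F. f j (Suc i) * c j) = 0"
      using homogeneous_system[OF nF, of "\<lambda>i j. f j (Suc i)"] by blast
    obtain v where v: "ev v (c j0) \<noteq> 0" using exists_nonzero_value[OF j0(2)] by blast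
    \<comment> \<open>the coefficients must be moved into \<open>\<rat>[x\<^sub>1,\<dots>,x\<^sub>n]\<close> without killing \<open>c j0\<close>\<close>
    let ?h = "\<lambda>i. if i \<in> {1..n} then var i else const (v i)"
    define c' where "c' j = psub ?h (c j)" for j
    have c'P: "c' j \<in> polys_over {1..n}" for j
      unfolding c'_def by (rule psub_polys_over[of _ UNIV]) (auto intro: polys_over_var)
    have "(\<lambda>i. ev v (?h i)) = v" by auto
    then have c'0: "c' j0 \<noteq> 0" using v ev_psub[of v ?h "c j0"] unfolding c'_def by (metis ev.hom_zero)
    have der: "f j \<in> derivations n" if "j < card F" for j
    proof -
      have "f j \<in> F" using f that by (auto simp: bij_betw_def)
      then show ?thesis using F(2) B by (auto simp: Dmod_iff)
    qed
    have rel: "(\<Sum>j<card F. c' j * f j i) = 0" for i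
    proof (cases "i \<in> {1..n}")
      case True
      then obtain i' where i': "i = Suc i'" "i' < n" by (cases i) auto
      have "psub ?h (\<Sum>j<card F. f j (Suc i') * c j) = 0" using c i' by (simp add: psub.hom_zero)
      moreover have "psub ?h (f j (Suc i')) = f j (Suc i')" if "j < card F" for j
        using der[OF that] i' by (intro psub_id_on[of _ "{1..n}"]) (auto simp: derivations_def polys_in_over)
      ultimately show ?thesis
        using i' by (simp add: psub.hom_sum psub.hom_mult c'_def mult.commute)
    next
      case False
      then show ?thesis using der by (auto simp: derivations_def intro!: sum.neutral)
    qed
    let ?g = "the_inv_into {..<card F} f"
    have inj: "inj_on f {..<card F}" and im: "F = f ` {..<card F}" using f by (auto simp: bij_betw_def)
    have "(\<lambda>i. \<Sum>b\<in>F. c' (?g b) * b i) = (\<lambda>i. 0)"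
    proof
      fix i
      have "(\<Sum>b\<in>F. c' (?g b) * b i) = (\<Sum>j<card F. c' (?g (f j)) * f j i)"
        by (subst im, subst sum.reindex[OF inj]) simp
      also have "\<dots> = (\<Sum>j<card F. c' j * f j i)"
        by (rule sum.cong) (auto simp: the_inv_into_f_f[OF inj])
      finally show "(\<Sum>b\<in>F. c' (?g b) * b i) = 0" using rel by simp
    qed
    then have "\<forall>b\<in>F. c' (?g b) = 0"
      using indep[rule_format, of F "\<lambda>b. c' (?g b)"] F c'P unfolding polys_in_over by blast
    moreover have "f j0 \<in> F" using im j0 by auto
    ultimately have "c' j0 = 0" using j0 the_inv_into_f_f[OF inj, of j0] by auto
    with c'0 show False by simp
  qed
  have fB: "finite B"
  proof (rule ccontr)
    assume "infinite B"
    then obtain F where "F \<subseteq> B" "finite F" "card F = Suc n"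
      using infinite_arbitrarily_large by blast
    with small[of F] show False by simp
  qed
  then have cB: "card B \<le> n" using small by blast
  obtain f where f: "bij_betw f {..<card B} B"
    using ex_bij_betw_nat_finite[OF fB] by (auto simp: lessThan_atLeast0)
  have inj: "inj_on f {..<card B}" and im: "B = f ` {..<card B}" using f by (auto simp: bij_betw_def)
  \<comment> \<open>A basis with fewer than \<open>n\<close> elements is padded with zero rows. Its
    determinant would then be zero; this case is excluded later, when the determinant is shown to
    divide the nonzero product of the forms.\<close>
  define \<Theta> where "\<Theta> k = (if k < card B then f k else (\<lambda>i. 0))" for k
  have D: "\<Theta> k \<in> Dmod n A" for k
  proof (cases "k < card B")
    case True
    then have "f k \<in> B" using im by blast
    with True B show ?thesis by (auto simp: \<Theta>_def)
  qed (simp add: \<Theta>_def)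
  have comb: "\<exists>x. \<forall>i. \<theta> i = (\<Sum>k<n. x k * \<Theta> k i)" if \<theta>: "\<theta> \<in> Dmod n A" for \<theta>
  proof -
    obtain F c where F: "finite F" "F \<subseteq> B" "\<theta> = (\<lambda>i. \<Sum>b\<in>F. c b * b i)"
      using bspec[OF span \<theta>] by (elim exE conjE) (rule that)
    define x where "x k = (if f k \<in> F then c (f k) else 0)" for k
    have "\<theta> i = (\<Sum>k<n. x k * \<Theta> k i)" for i
    proof -
      have "\<theta> i = (\<Sum>b\<in>B. (if b \<in> F then c b else 0) * b i)"
        unfolding F(3) by (rule sum.mono_neutral_cong_left) (use F fB in auto)
      also have "\<dots> = (\<Sum>k<card B. x k * f k i)"
        by (subst im, subst sum.reindex[OF inj]) (simp add: x_def)
      also have "\<dots> = (\<Sum>k<n. x k * \<Theta> k i)"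
        by (rule sum.mono_neutral_cong_left) (use cB in \<open>auto simp: \<Theta>_def\<close>)
      finally show ?thesis .
    qed
    then show ?thesis by blast
  qed
  have "der_det n \<Theta> dvd der_det n H" if H: "\<And>k. k < n \<Longrightarrow> H k \<in> Dmod n A" for H
  proof -
    have "\<forall>k\<in>{..<n}. \<exists>x. \<forall>i. H k i = (\<Sum>l<n. x l * \<Theta> l i)" using comb H by blast
    from bchoice[OF this] obtain C where C: "\<forall>k\<in>{..<n}. \<forall>i. H k i = (\<Sum>l<n. C k l * \<Theta> l i)" ..
    have "der_det n H = fdet n (\<lambda>k j. \<Sum>l<n. C k l * \<Theta> l (Suc j))"
      unfolding der_det_def by (rule fdet_cong) (use C in auto)
    also have "\<dots> = fdet n C * der_det n \<Theta>"
      unfolding der_det_def by (rule fdet_mult)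
    finally show ?thesis by simp
  qed
  with D show ?thesis using that by blast
qed

section \<open>Cancelling prime factors in a domain\<close>

lemma prime_cancel:
  fixes \<delta> \<alpha> m :: "'a::idom"
  assumes pr: "\<And>f g. \<alpha> dvd f * g \<Longrightarrow> \<alpha> dvd f \<or> \<alpha> dvd g" and a0: "\<alpha> \<noteq> 0"
    and "\<not> \<alpha> dvd \<delta>" "\<delta> dvd \<alpha> ^ N * m"
  shows "\<delta> dvd m"
  using assms(4)
proof (induction N)
  case (Suc N)
  then obtain e where e: "\<alpha> * (\<alpha> ^ N * m) = \<delta> * e" by (auto simp: dvd_def mult_ac)
  then have "\<alpha> dvd \<delta> * e" by (metis dvd_triv_left)
  then obtain e' where "e = \<alpha> * e'" using pr assms(3) by blast
  with e a0 have "\<alpha> ^ N * m = \<delta> * e'" by (simp add: mult_ac)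
  then show ?case using Suc.IH by (metis dvd_triv_left)
qed simp

text \<open>After removing the at most one factor \<open>\<alpha>\<close> of
  \<open>\<delta>\<close>, the previous lemma discards the whole power, and one copy of
  \<open>\<alpha>\<close> is put back.\<close>

lemma prime_cancel_square:
  fixes \<delta> \<alpha> m :: "'a::idom"
  assumes pr: "\<And>f g. \<alpha> dvd f * g \<Longrightarrow> \<alpha> dvd f \<or> \<alpha> dvd g" and a0: "\<alpha> \<noteq> 0"
    and sq: "\<not> \<alpha> * \<alpha> dvd \<delta>" and d: "\<delta> dvd \<alpha> ^ N * m"
  shows "\<delta> dvd \<alpha> * m"
proof (cases "\<alpha> dvd \<delta>")
  case False
  then show ?thesis using prime_cancel[OF pr a0 False d] by (simp add: dvd_mult)
next
  case True
  then obtain \<delta>' where \<delta>': "\<delta> = \<alpha> * \<delta>'" by (auto simp: dvd_def)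
  then have n: "\<not> \<alpha> dvd \<delta>'" using sq by auto
  have "\<delta>' dvd \<alpha> ^ N * m" using d \<delta>' by (metis dvd_mult_right)
  then have "\<delta>' dvd m" using prime_cancel[OF pr a0 n] by blast
  then show ?thesis using \<delta>' by auto
qed

lemma prime_dvd_power:
  fixes \<alpha> :: "'a::idom"
  assumes "\<And>f g. \<alpha> dvd f * g \<Longrightarrow> \<alpha> dvd f \<or> \<alpha> dvd g" "\<alpha> dvd x ^ N" "\<not> \<alpha> dvd 1"
  shows "\<alpha> dvd x"
  using assms(2) by (induction N) (use assms(1,3) in auto)

lemma Q_derivation:
  assumes "i \<in> {1..n}" "finite A" shows "(\<lambda>j. if j = i then Qpoly n A else 0) \<in> Dmod n A"
proof -
  have "Qpoly n A \<in> polys_over {1..n}"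
    unfolding Qpoly_def by (intro polys_over_prod lin_form_polys_over)
  moreover have "apply_der n (\<lambda>j. if j = i then Qpoly n A else 0) a = const (a i) * Qpoly n A" for a
  proof -
    have "apply_der n (\<lambda>j. if j = i then Qpoly n A else 0) a
        = (\<Sum>j\<in>{1..n}. if j = i then const (a i) * Qpoly n A else 0)"
      unfolding apply_der_def by (rule sum.cong) auto
    then show ?thesis using assms by simp
  qed
  moreover have "lin_form n a dvd Qpoly n A" if "a \<in> A" for a
    unfolding Qpoly_def using \<open>finite A\<close> that by (rule dvd_prodI)
  ultimately show ?thesis
    using assms(1) by (auto simp: Dmod_iff derivations_def polys_in_over intro: dvd_mult)
qed

text \<open>The derivations \<open>(Q/\<alpha>) (\<partial>\<^sub>k - (a\<^sub>k/a\<^sub>p) \<partial>\<^sub>p)\<close>, tangent to the hyperplane \<open>\<alpha> = 0\<close>,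
  together with \<open>Q \<partial>\<^sub>p\<close> show that \<open>\<alpha>\<close> divides the determinant of a basis at most once.\<close>

lemma basis_det_dvd:
  assumes arr: "arr n A" and a: "a \<in> A"
    and dvd: "\<And>H. (\<And>k. k < n \<Longrightarrow> H k \<in> Dmod n A) \<Longrightarrow> \<delta> dvd der_det n H"
  shows "\<delta> dvd lin_form n a * Qpoly n (A - {a}) ^ n"
proof -
  obtain p where p: "p \<in> {1..n}" "a p \<noteq> 0" using arr a unfolding arr_def by blast
  have fA: "finite A" using arr by (simp add: arr_def)
  let ?R = "Qpoly n (A - {a})" and ?L = "lin_form n a"
  have Q: "Qpoly n A = ?L * ?R" unfolding Qpoly_def using fA a by (simp add: prod.remove)
  have RP: "?R \<in> polys_over {1..n}" unfolding Qpoly_def by (intro polys_over_prod lin_form_polys_over)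
  define w where "w k = (if k = p then 0 else const (a k / a p))" for k
  define H where "H k j = (if k = p then (if j = p then Qpoly n A else 0)
      else if j = k then ?R else if j = p then - w k * ?R else 0)" for k j
  have HD: "H k \<in> Dmod n A" if k: "k \<in> {1..n}" for k
  proof (cases "k = p")
    case True
    then have "H k = (\<lambda>j. if j = p then Qpoly n A else 0)" by (auto simp: H_def)
    then show ?thesis using Q_derivation[OF p(1) fA] by simp
  next
    case False
    have der: "H k \<in> derivations n"
      using RP k p False unfolding derivations_def polys_in_over H_def w_def
      by (auto intro!: polys_over_mult polys_over_uminus)
    have app: "apply_der n (H k) b = (const (b k) - const (b p) * w k) * ?R" for b
    proof -
      have "apply_der n (H k) b = (\<Sum>j\<in>{1..n}. (if j = k then const (b k) * ?R else 0) +
          (if j = p then const (b p) * (- w k * ?R) else 0))"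
        unfolding apply_der_def H_def using False by (intro sum.cong) auto
      then show ?thesis using k p(1) by (simp add: sum.distrib algebra_simps)
    qed
    have "lin_form n b dvd apply_der n (H k) b" if "b \<in> A" for b
    proof (cases "b = a")
      case True
      have "const (a k) - const (a p) * w k = 0"
        using False p(2) by (simp add: w_def const_mult[symmetric] const_diff[symmetric])
      then show ?thesis unfolding app True by simp
    next
      case False
      then have "lin_form n b dvd ?R" unfolding Qpoly_def using fA that by (intro dvd_prodI) auto
      then show ?thesis unfolding app by simp
    qed
    then show ?thesis using der by (auto simp: Dmod_iff)
  qed
  \<comment> \<open>Up to the diagonal factors \<open>s\<close>, the matrix of \<open>H\<close> is
    the identity with one column altered. Changing the sign of \<open>\<epsilon>\<close> inverts it,
    so its determinant is a unit and drops out.\<close>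
  define U where "U \<epsilon> i j = (if i = j then 1 else if Suc j = p then \<epsilon> * w (Suc i) else 0)" for \<epsilon> i j
  define s where "s i = (if Suc i = p then Qpoly n A else ?R)" for i
  have dU: "fdet n (U (-1)) * fdet n (U 1) = 1"
  proof -
    have "(\<Sum>k<n. U (-1) i k * U 1 k j) = (if i = j then 1 else 0)" if ij: "i < n" "j < n" for i j
    proof -
      have "(\<Sum>k<n. U (-1) i k * U 1 k j) = (\<Sum>k<n. (if k = i then U 1 i j else 0) +
          (if Suc k = p \<and> i \<noteq> k then - w (Suc i) * U 1 k j else 0))"
        by (rule sum.cong) (auto simp: U_def)
      also have "\<dots> = U 1 i j + (\<Sum>k<n. if k = p - 1 then (if i \<noteq> k then - w (Suc i) * U 1 k j else 0) else 0)"
        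
        using ij(1) p(1) unfolding sum.distrib by (intro arg_cong2[of _ _ _ _ "(+)"] sum.cong) auto
      also have "\<dots> = U 1 i j + (if i \<noteq> p - 1 then - w (Suc i) * U 1 (p - 1) j else 0)"
        using p(1) by auto
      also have "\<dots> = (if i = j then 1 else 0)"
        using p(1) by (auto simp: U_def w_def)
      finally show ?thesis .
    qed
    then have "fdet n (\<lambda>i j. \<Sum>k<n. U (-1) i k * U 1 k j) = fdet n (\<lambda>i j. if i = j then 1 else 0)"
      by (intro fdet_cong)
    then show ?thesis unfolding fdet_mult fdet_diag by simp
  qed
  have "der_det n (\<lambda>k. H (Suc k)) = fdet n (\<lambda>i j. \<Sum>k<n. (if i = k then s i else 0) * U (-1) k j)"
    unfolding der_det_def
  proof (rule fdet_cong)
    fix i j assume "i < n" "j < n"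
    have "(\<Sum>k<n. (if i = k then s i else 0) * U (-1) k j) = (\<Sum>k<n. if k = i then s i * U (-1) i j else 0)"
      by (rule sum.cong) auto
    also have "\<dots> = s i * U (-1) i j" using \<open>i < n\<close> by simp
    finally show "H (Suc i) (Suc j) = (\<Sum>k<n. (if i = k then s i else 0) * U (-1) k j)"
      by (auto simp: H_def U_def s_def w_def)
  qed
  also have "\<dots> = (\<Prod>i<n. s i) * fdet n (U (-1))"
    unfolding fdet_mult fdet_diag ..
  finally have "\<delta> dvd (\<Prod>i<n. s i) * fdet n (U (-1))"
    using dvd[of "\<lambda>k. H (Suc k)"] HD by auto
  then have "\<delta> dvd (\<Prod>i<n. s i) * fdet n (U (-1)) * fdet n (U 1)" by (rule dvd_mult2)
  then have "\<delta> dvd (\<Prod>i<n. s i)" using dU by (simp add: mult.assoc)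
  also have "(\<Prod>i<n. s i) = s (p - 1) * (\<Prod>i\<in>{..<n} - {p - 1}. s i)"
    using p(1) by (intro prod.remove) auto
  also have "(\<Prod>i\<in>{..<n} - {p - 1}. s i) = (\<Prod>i\<in>{..<n} - {p - 1}. ?R)"
    using p(1) by (intro prod.cong) (auto simp: s_def)
  also have "\<dots> = ?R ^ (n - 1)" 
  proof -
    have "card ({..<n} - {p - 1}) = n - 1"
      using p(1) by (subst card_Diff_singleton) auto
    then show ?thesis by simp
  qed
  also have "s (p - 1) * ?R ^ (n - 1) = ?L * ?R ^ n"
    using p(1) by (simp add: s_def Q power_eq_if)
  finally show ?thesis .
qed

text \<open>The derivations with a single entry \<open>Qpoly n A\<close> show that the determinant
  divides a power of the product. No form divides it twice, by \<open>basis_det_dvd\<close>, so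
  every exponent can be lowered to one.\<close>

lemma free_det_dvd_Q:
  assumes arr: "arr n A" and free: "free_arrangement n A"
  obtains \<Theta> where "\<And>k. k < n \<Longrightarrow> \<Theta> k \<in> Dmod n A" "der_det n \<Theta> dvd Qpoly n A"
proof -
  obtain \<Theta> where D: "\<And>k. k < n \<Longrightarrow> \<Theta> k \<in> Dmod n A"
    and dvd: "\<And>H. (\<And>k. k < n \<Longrightarrow> H k \<in> Dmod n A) \<Longrightarrow> der_det n \<Theta> dvd der_det n H"
    using free_basis[OF free] by blast
  let ?\<delta> = "der_det n \<Theta>"
  have fA: "finite A" using arr by (simp add: arr_def)
  have "?\<delta> dvd der_det n (\<lambda>k j. if j = Suc k then Qpoly n A else 0)"
    by (rule dvd) (use Q_derivation[OF _ fA] in auto)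
  also have "der_det n (\<lambda>k j. if j = Suc k then Qpoly n A else 0) = Qpoly n A ^ n"
  proof -
    have "der_det n (\<lambda>k j. if j = Suc k then Qpoly n A else 0) = fdet n (\<lambda>i j. if i = j then Qpoly n A else 0)"
      unfolding der_det_def by (rule fdet_cong) auto
    then show ?thesis by (simp add: fdet_diag)
  qed
  finally have dQn: "?\<delta> dvd Qpoly n A ^ n" .
  have sq: "\<not> lin_form n a * lin_form n a dvd ?\<delta>" if a: "a \<in> A" for a
  proof
    assume "lin_form n a * lin_form n a dvd ?\<delta>"
    also have "?\<delta> dvd lin_form n a * Qpoly n (A - {a}) ^ n"
      by (rule basis_det_dvd[OF arr a dvd])
    finally have "lin_form n a dvd Qpoly n (A - {a}) ^ n"
      using arr_nonzero[OF arr a] by simp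
    then have "lin_form n a dvd Qpoly n (A - {a})"
      using prime_dvd_power[OF arr_prime[OF arr a]] arr_not_unit[OF arr a] by blast
    then show False using arr_not_dvd_Qpoly[of n a "A - {a}"] arr a by (simp add: insert_absorb)
  qed
  \<comment> \<open>\<open>B\<close> collects the forms whose exponent has already been lowered from
    \<open>n\<close> to 1; the induction adds one form at a time.\<close>
  have "?\<delta> dvd (\<Prod>a\<in>A - B. lin_form n a ^ n) * Qpoly n B" if "B \<subseteq> A" for B
  proof -
    have "finite B" using that fA finite_subset by blast
    then show ?thesis using that
    proof (induction B rule: finite_induct)
      case empty
      then show ?case using dQn by (simp add: Qpoly_def prod_power_distrib)
    next
      case (insert b B)
      have "(\<Prod>a\<in>A - B. lin_form n a ^ n) = lin_form n b ^ n * (\<Prod>a\<in>A - insert b B. lin_form n a ^ n)"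
        using insert fA by (subst prod.remove[of _ b]) (auto simp: Diff_insert2[symmetric] Diff_insert[symmetric])
      then have "?\<delta> dvd lin_form n b ^ n * ((\<Prod>a\<in>A - insert b B. lin_form n a ^ n) * Qpoly n B)"
        using insert by (simp add: mult.assoc)
      then have "?\<delta> dvd lin_form n b * ((\<Prod>a\<in>A - insert b B. lin_form n a ^ n) * Qpoly n B)"
        using insert.prems by (intro prime_cancel_square[OF arr_prime[OF arr] arr_nonzero[OF arr] sq]) auto
      then show ?case using insert.hyps by (simp add: Qpoly_def mult_ac)
    qed
  qed
  from this[of A] have "?\<delta> dvd Qpoly n A" by simp
  with D show ?thesis using that by blast
qed

subsection \<open>Localization\<close>

text \<open>Moves the point \<open>v\<close> to the origin: forms vanishing at \<open>v\<close> stay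
  as they are, all others acquire a nonzero constant term.\<close>

definition shift :: "(nat \<Rightarrow> rat) \<Rightarrow> qpoly \<Rightarrow> qpoly" where
  "shift v = psub (\<lambda>i. var i + const (v i))"

definition local_arr :: "nat \<Rightarrow> (nat \<Rightarrow> rat) set \<Rightarrow> (nat \<Rightarrow> rat) \<Rightarrow> (nat \<Rightarrow> rat) set" where
  "local_arr n A v = {a \<in> A. dot n a v = 0}"

interpretation shift: comm_ring_hom "shift v" for v
  unfolding shift_def by (rule psub.comm_ring_hom_axioms)

lemma shift_lin_form: "shift v (lin_form n a) = lin_form n a + const (dot n a v)"
  by (simp add: shift_def lin_form_def dot_def psub.hom_sum psub.hom_mult sum.distrib distrib_left
      const_sum const_mult)

lemma shift_const [simp]: "shift v (const c) = const c"
  by (simp add: shift_def)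

lemma shift_Dmod:
  assumes "\<theta> \<in> Dmod n A" shows "(\<lambda>i. shift v (\<theta> i)) \<in> Dmod n (local_arr n A v)"
proof -
  have "shift v p \<in> polys_over {1..n}" if "p \<in> polys_over {1..n}" for p
    unfolding shift_def using that
    by (rule psub_polys_over) (intro polys_over_add polys_over_var polys_over_const)
  then have "(\<lambda>i. shift v (\<theta> i)) \<in> derivations n"
    using assms by (auto simp: Dmod_iff derivations_def polys_in_over)
  moreover have "apply_der n (\<lambda>i. shift v (\<theta> i)) a = shift v (apply_der n \<theta> a)" for a
    by (simp add: apply_der_def shift.hom_sum shift.hom_mult)
  moreover have "lin_form n a dvd shift v (apply_der n \<theta> a)" if "a \<in> local_arr n A v" for a
  proof -
    have "lin_form n a dvd apply_der n \<theta> a" using assms that by (auto simp: Dmod_iff local_arr_def)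
    then obtain q where "apply_der n \<theta> a = lin_form n a * q" by (elim dvdE)
    then show ?thesis using that by (simp add: shift.hom_mult shift_lin_form local_arr_def)
  qed
  ultimately show ?thesis by (simp add: Dmod_iff)
qed

lemma hc_0_ev: "hc 0 p = const (ev (\<lambda>_. 0) p)"
  by (induction p rule: qpoly_induct)
    (simp_all add: hc_const hc_var hc_add hc_mult ev.hom_add ev.hom_mult const_add const_mult)

lemma hc_Dmod:
  assumes "\<theta> \<in> Dmod n A" shows "(\<lambda>i. hc d (\<theta> i)) \<in> Dmod n A"
proof -
  have "(\<lambda>i. hc d (\<theta> i)) \<in> derivations n"
    using assms by (auto simp: Dmod_iff derivations_def polys_in_over intro: hc_polys_over)
  moreover have "apply_der n (\<lambda>i. hc d (\<theta> i)) a = hc d (apply_der n \<theta> a)" for a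
    by (simp add: apply_der_def hc_sum hc_const_mult)
  moreover have "lin_form n a dvd hc d (apply_der n \<theta> a)" if "a \<in> A" for a
  proof -
    have "lin_form n a dvd apply_der n \<theta> a" using assms that by (auto simp: Dmod_iff)
    then obtain q where q: "apply_der n \<theta> a = lin_form n a * q" by (elim dvdE)
    show ?thesis
    proof (cases d)
      case 0
      then show ?thesis unfolding q using hc_homog_mult_less[OF homog_lin_form] by simp
    next
      case (Suc e)
      then show ?thesis unfolding q using hc_homog_mult[OF homog_lin_form, of e n a q] by simp
    qed
  qed
  ultimately show ?thesis by (simp add: Dmod_iff)
qed

lemma homog_der_det:
  assumes "\<And>k i. k < n \<Longrightarrow> homog (d k) (\<Theta> k i)"
  shows "homog (\<Sum>k<n. d k) (der_det n \<Theta>)"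
  unfolding der_det_def fdet_leibniz
proof (rule homog_sum)
  fix p
  have "homog (\<Sum>k = 0..<n. d k) (\<Prod>i = 0..<n. \<Theta> i (Suc (p i)))"
    using assms by (intro homog_prod) auto
  then show "homog (\<Sum>k<n. d k) (signof p * (\<Prod>i = 0..<n. \<Theta> i (Suc (p i))))"
    by (cases "sign p = 1") (auto simp: sign_def lessThan_atLeast0 intro: homog_uminus split: if_splits)
qed

text \<open>The determinant is linear in row \<open>m\<close>, so after expanding this row into
  homogeneous components at least one summand still has a nonzero component of degree
  \<open>N\<close>. Rows are treated one after another.\<close>

lemma homogeneous_rows:
  assumes D: "\<And>k. k < n \<Longrightarrow> \<Theta> k \<in> Dmod n A" and N: "hc N (der_det n \<Theta>) \<noteq> 0" and "m \<le> n"
  shows "\<exists>\<Theta>' d. (\<forall>k<n. \<Theta>' k \<in> Dmod n A) \<and> (\<forall>k<m. \<forall>i. homog (d k) (\<Theta>' k i)) \<and> hc N (der_det n \<Theta>') \<noteq> 0"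
  using assms(3)
proof (induction m)
  case 0
  then show ?case using D N by blast
next
  case (Suc m)
  then obtain \<Theta>' d where \<Theta>': "\<forall>k<n. \<Theta>' k \<in> Dmod n A" "\<forall>k<m. \<forall>i. homog (d k) (\<Theta>' k i)"
    "hc N (der_det n \<Theta>') \<noteq> 0" by auto
  define D where "D = Max (insert 0 ((\<lambda>i. tdeg (\<Theta>' m i)) ` {1..n}))"
  have sum: "\<Theta>' m (Suc j) = (\<Sum>e\<le>D. hc e (\<Theta>' m (Suc j)))" if "j < n" for j
    by (rule sum_hc[symmetric]) (use that in \<open>auto simp: D_def intro!: Max_ge\<close>)
  let ?R = "\<lambda>e k. if k = m then (\<lambda>i. hc e (\<Theta>' m i)) else \<Theta>' k"
  have rep: "der_det n (?R e) = fdet n (\<lambda>k j. if k = m then hc e (\<Theta>' m (Suc j)) else \<Theta>' k (Suc j))" for e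
    unfolding der_det_def by (rule fdet_cong) auto
  have "der_det n \<Theta>' = fdet n (\<lambda>k j. if k = m then (\<Sum>e\<le>D. 1 * hc e (\<Theta>' m (Suc j))) else \<Theta>' k (Suc j))"
    unfolding der_det_def by (rule fdet_cong) (auto simp: sum)
  also have "\<dots> = (\<Sum>e\<le>D. 1 * der_det n (?R e))"
    unfolding rep by (rule fdet_row_sum) (use Suc.prems in auto)
  finally have "hc N (\<Sum>e\<le>D. der_det n (?R e)) \<noteq> 0" using \<Theta>'(3) by simp
  then obtain e where e: "hc N (der_det n (?R e)) \<noteq> 0"
    unfolding hc_sum by (meson sum.neutral)
  have "\<forall>k<n. ?R e k \<in> Dmod n A" using \<Theta>'(1) hc_Dmod by auto
  moreover have "\<forall>k<Suc m. \<forall>i. homog ((d(m := e)) k) (?R e k i)"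
    using \<Theta>'(2) homog_hc by (auto simp: less_Suc_eq)
  ultimately show ?case using e by (intro exI[of _ "?R e"] exI[of _ "d(m := e)"] conjI)
qed

text \<open>After translation to \<open>v\<close> the product of the forms is
  \<open>Qpoly n ?L\<close> times a polynomial that does not vanish at the origin. The translated
  determinant divides it and so has a nonzero component in degree at most \<open>card ?L\<close>;
  making the rows homogeneous turns that degree into a sum of row degrees.\<close>

theorem free_localization:
  assumes arr: "arr n A" and free: "free_arrangement n A"
  obtains \<Theta> d where "\<And>k. k < n \<Longrightarrow> \<Theta> k \<in> Dmod n (local_arr n A v)"
    "\<And>k i. k < n \<Longrightarrow> homog (d k) (\<Theta> k i)" "der_det n \<Theta> \<noteq> 0"
    "(\<Sum>k<n. d k) \<le> card (local_arr n A v)"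
proof -
  let ?L = "local_arr n A v"
  obtain \<Theta> where D: "\<And>k. k < n \<Longrightarrow> \<Theta> k \<in> Dmod n A" and dvd: "der_det n \<Theta> dvd Qpoly n A"
    using free_det_dvd_Q[OF arr free] by blast
  obtain g where g: "Qpoly n A = der_det n \<Theta> * g" using dvd by (auto simp: dvd_def)
  define P where "P = (\<Prod>a\<in>A - ?L. lin_form n a + const (dot n a v))"
  have fA: "finite A" using arr by (simp add: arr_def)
  have LA: "?L \<subseteq> A" by (auto simp: local_arr_def)
  have "shift v (Qpoly n A) = (\<Prod>a\<in>A. lin_form n a + const (dot n a v))"
    by (simp add: Qpoly_def shift.hom_prod shift_lin_form)
  also have "\<dots> = P * (\<Prod>a\<in>?L. lin_form n a + const (dot n a v))"
    unfolding P_def using fA LA by (rule prod.subset_diff[rotated])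
  also have "(\<Prod>a\<in>?L. lin_form n a + const (dot n a v)) = Qpoly n ?L"
    unfolding Qpoly_def by (rule prod.cong) (auto simp: local_arr_def)
  finally have sQ: "shift v (Qpoly n A) = Qpoly n ?L * P" by (simp add: mult.commute)
  \<comment> \<open>\<open>P\<close> collects the forms not vanishing at \<open>v\<close>. Its
    nonzero constant term makes the component of degree \<open>card ?L\<close> a nonzero multiple of
    \<open>Qpoly n ?L\<close>.\<close>
  have "ev (\<lambda>_. 0) P \<noteq> 0"
    using fA by (auto simp: P_def ev.hom_prod ev.hom_add local_arr_def dot_def)
  then have "hc (card ?L + 0) (shift v (Qpoly n A)) \<noteq> 0"
    unfolding sQ hc_homog_mult[OF homog_Qpoly] hc_0_ev
    using Qpoly_nonzero[OF arr_subset[OF arr LA]] by simp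
  moreover have "der_det n (\<lambda>k i. shift v (\<Theta> k i)) = shift v (der_det n \<Theta>)"
    unfolding der_det_def by (rule fdet_hom[symmetric]) unfold_locales
  ultimately have "hc (card ?L) (der_det n (\<lambda>k i. shift v (\<Theta> k i)) * shift v g) \<noteq> 0"
    by (simp add: g shift.hom_mult)
  \<comment> \<open>Components of a product are convolutions, so a nonzero component of the product
    in degree \<open>card ?L\<close> needs one of the first factor in the same or a lower
    degree.\<close>
  then obtain N where N: "N \<le> card ?L" "hc N (der_det n (\<lambda>k i. shift v (\<Theta> k i))) \<noteq> 0"
    unfolding hc_mult by (metis (no_types, lifting) atMost_iff mult_zero_left sum.neutral)
  obtain \<Theta>' d where \<Theta>': "\<forall>k<n. \<Theta>' k \<in> Dmod n ?L" "\<forall>k<n. \<forall>i. homog (d k) (\<Theta>' k i)"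
    "hc N (der_det n \<Theta>') \<noteq> 0"
    using homogeneous_rows[of n "\<lambda>k i. shift v (\<Theta> k i)" ?L N n] shift_Dmod D N(2) by blast
  have h: "homog (\<Sum>k<n. d k) (der_det n \<Theta>')" using \<Theta>'(2) by (intro homog_der_det) auto
  have nz: "der_det n \<Theta>' \<noteq> 0" using \<Theta>'(3) by auto
  have "N = (\<Sum>k<n. d k)" using h \<Theta>'(3) unfolding homog_hc_iff by metis
  then show ?thesis using that[of \<Theta>' d] \<Theta>' nz N(1) by auto
qed

section \<open>An obstruction to freeness\<close>

text \<open>A rank bound: the rows in \<open>K\<close> are independent and lie in the common kernel
  of \<open>s\<close> independent functionals, with \<open>\<tau>\<close> as dual system. If there
  were too many, some combination of the functionals would also kill the remaining rows, hence
  vanish.\<close>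

lemma independent_functionals:
  fixes W :: "nat \<Rightarrow> nat \<Rightarrow> rat"
  assumes W: "fdet n W \<noteq> 0" and K: "K \<subseteq> {..<n}"
    and van: "\<And>k j. k \<in> K \<Longrightarrow> j < s \<Longrightarrow> (\<Sum>i<n. W k i * \<phi> j i) = 0"
    and dual: "\<And>j l. j < s \<Longrightarrow> l < s \<Longrightarrow> (\<Sum>i<n. \<phi> j i * \<tau> l i) = (if j = l then 1 else 0)"
  shows "card K + s \<le> n"
proof (rule ccontr)
  assume "\<not> card K + s \<le> n"
  let ?N = "{..<n} - K"
  have fK: "finite K" using K finite_subset by blast
  have "card ?N = n - card K" using K fK by (simp add: card_Diff_subset)
  moreover have "card K \<le> n" using K card_mono[of "{..<n}" K] by simp
  ultimately have lt: "card ?N < s" using \<open>\<not> card K + s \<le> n\<close> by linarith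
  obtain e where e: "bij_betw e {..<card ?N} ?N"
    using ex_bij_betw_nat_finite[of ?N] by (auto simp: lessThan_atLeast0)
  obtain c l where l: "l < s" "c l \<noteq> 0"
    and c: "\<forall>i<card ?N. (\<Sum>j<s. (\<Sum>i'<n. W (e i) i' * \<phi> j i') * c j) = 0"
    using homogeneous_system[OF lt, of "\<lambda>i j. \<Sum>i'<n. W (e i) i' * \<phi> j i'"] by blast
  define f where "f i = (\<Sum>j<s. \<phi> j i * c j)" for i
  have swap: "(\<Sum>i<n. W k i * f i) = (\<Sum>j<s. (\<Sum>i<n. W k i * \<phi> j i) * c j)" for k
    unfolding f_def sum_distrib_left sum_distrib_right by (subst sum.swap) (simp add: mult_ac)
  have "(\<Sum>i<n. W k i * f i) = 0" if "k < n" for k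
  proof (cases "k \<in> K")
    case True
    then show ?thesis unfolding swap using van by (auto intro!: sum.neutral)
  next
    case False
    then have "k \<in> e ` {..<card ?N}" using e that by (auto simp: bij_betw_def)
    then obtain i where "i < card ?N" "k = e i" by auto
    then show ?thesis unfolding swap using c by auto
  qed
  then have f0: "f i = 0" if "i < n" for i using W that unfolding fdet_0_right by blast
  have "c l = (\<Sum>j<s. (if j = l then 1 else 0) * c j)"
  proof -
    have "(\<Sum>j<s. (if j = l then 1 else 0) * c j) = (\<Sum>j<s. if j = l then c l else 0)"
      by (rule sum.cong) auto
    then show ?thesis using l by simp
  qed
  also have "\<dots> = (\<Sum>j<s. (\<Sum>i<n. \<phi> j i * \<tau> l i) * c j)"
    using dual l(1) by (intro sum.cong) auto
  also have "\<dots> = (\<Sum>i<n. f i * \<tau> l i)"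
    unfolding f_def sum_distrib_left sum_distrib_right by (subst sum.swap) (simp add: mult_ac)
  also have "\<dots> = 0" using f0 by (intro sum.neutral) auto
  finally show False using l by simp
qed

text \<open>For each form, all but finitely many points of the line through \<open>v\<close> in
  direction \<open>w\<close> stay off its hyperplane, unless the form is constant on the line, in
  which case it already has the right value.\<close>

lemma generic_vector:
  assumes "finite A" and sub: "\<And>u w t. u \<in> X \<Longrightarrow> w \<in> X \<Longrightarrow> (\<lambda>i. u i + t * w i) \<in> X" and "X \<noteq> {}"
    and "\<And>a. a \<in> A \<Longrightarrow> \<exists>w\<in>X. dot n a w \<noteq> 0"
  shows "\<exists>v\<in>X. \<forall>a\<in>A. dot n a v \<noteq> 0"
  using assms(1,4)
proof (induction A rule: finite_induct)
  case (insert a A)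
  then obtain v where v: "v \<in> X" "\<forall>b\<in>A. dot n b v \<noteq> 0" by auto
  obtain w where w: "w \<in> X" "dot n a w \<noteq> 0" using insert by auto
  have lin: "dot n b (\<lambda>i. v i + t * w i) = dot n b v + t * dot n b w" for b t
    by (simp add: dot_def sum.distrib sum_distrib_left algebra_simps)
  let ?bad = "(\<lambda>b. - dot n b v / dot n b w) ` insert a A"
  obtain t where t: "t \<notin> ?bad" using ex_new_if_finite[of ?bad] insert.hyps infinite_UNIV_char_0 by blast
  have "dot n b (\<lambda>i. v i + t * w i) \<noteq> 0" if "b \<in> insert a A" for b
  proof (cases "dot n b w = 0")
    case True
    then show ?thesis unfolding lin using that v w by auto
  next
    case False
    have "t \<noteq> - dot n b v / dot n b w" using t that by blast
    then show ?thesis unfolding lin using False by (auto simp: field_simps eq_neg_iff_add_eq_0)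
  qed
  then show ?case using sub[OF v(1) w(1)] by blast
qed (use \<open>X \<noteq> {}\<close> in auto)

text \<open>Multiples of the Euler derivation are described by vanishing 2 by 2 minors, so that no
  multiplier has to be named and the condition can be evaluated at a point.\<close>

definition rigid :: "nat \<Rightarrow> (nat \<Rightarrow> rat) set \<Rightarrow> nat \<Rightarrow> bool" where
  "rigid r B d \<longleftrightarrow> (\<forall>\<theta> k. k \<le> d \<longrightarrow> \<theta> \<in> Dmod r B \<longrightarrow> (\<forall>i. homog k (\<theta> i)) \<longrightarrow>
     (\<forall>i\<in>{1..r}. \<forall>j\<in>{1..r}. var i * \<theta> j = var j * \<theta> i))"

lemma rigid_tdeg:
  assumes "rigid r B d" "\<theta> \<in> Dmod r B" "\<And>i. tdeg (\<theta> i) \<le> d" "i \<in> {1..r}" "j \<in> {1..r}"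
  shows "var i * \<theta> j = var j * \<theta> i"
proof -
  have "var i * hc k (\<theta> j) = var j * hc k (\<theta> i)" if "k \<le> d" for k
    using assms(1)[unfolded rigid_def, rule_format, OF that hc_Dmod[OF assms(2)] homog_hc assms(4,5)] .
  then have "(\<Sum>k\<le>d. var i * hc k (\<theta> j)) = (\<Sum>k\<le>d. var j * hc k (\<theta> i))"
    by (intro sum.cong) auto
  then show ?thesis unfolding sum_distrib_left[symmetric] sum_hc[OF assms(3)] .
qed

lemma dot_1_n: "dot n a v = (\<Sum>j<n. a (Suc j) * v (Suc j))"
  by (simp add: dot_def sum_1_n)

text \<open>The localization lives in \<open>n\<close> variables but depends only on the forms
  \<open>\<psi> j\<close>. Restricting to the affine slice through \<open>q\<close> spanned by the
  \<open>\<sigma> l\<close>, and projecting by the \<open>\<psi> j\<close>, gives a derivation of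
  the arrangement \<open>B\<close> in \<open>r\<close> variables.\<close>

lemma restricted_derivation:
  fixes \<psi> \<sigma> :: "nat \<Rightarrow> nat \<Rightarrow> rat" and q :: "nat \<Rightarrow> rat" and r :: nat
  defines "h \<equiv> \<lambda>i. const (q i) + (\<Sum>l\<in>{1..r}. const (\<sigma> l i) * var l)"
  assumes dual: "\<And>j l. j \<in> {1..r} \<Longrightarrow> l \<in> {1..r} \<Longrightarrow> dot n (\<psi> j) (\<sigma> l) = (if j = l then 1 else 0)"
    and q: "\<And>j. j \<in> {1..r} \<Longrightarrow> dot n (\<psi> j) q = 0"
    and \<theta>: "\<theta> \<in> Dmod n A"
    and pull: "\<And>\<beta>. \<beta> \<in> B \<Longrightarrow> \<exists>a\<in>A. \<forall>i\<in>{1..n}. a i = (\<Sum>j\<in>{1..r}. \<beta> j * \<psi> j i)"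
  shows "(\<lambda>j. if j \<in> {1..r} then \<Sum>i\<in>{1..n}. const (\<psi> j i) * psub h (\<theta> i) else 0) \<in> Dmod r B"
    (is "?\<eta> \<in> _")
proof -
  have hP: "h i \<in> polys_over {1..r}" for i
    unfolding h_def by (intro polys_over_add polys_over_const polys_over_sum polys_over_mult polys_over_var)
  have "?\<eta> \<in> derivations r"
    unfolding derivations_def polys_in_over
    by (auto intro!: polys_over_sum polys_over_mult psub_polys_over[of _ UNIV] hP[simplified])
  moreover have "lin_form r \<beta> dvd apply_der r ?\<eta> \<beta>" if \<beta>: "\<beta> \<in> B" for \<beta>
  proof -
    obtain a where a: "a \<in> A" "\<And>i. i \<in> {1..n} \<Longrightarrow> a i = (\<Sum>j\<in>{1..r}. \<beta> j * \<psi> j i)"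
      using pull[OF \<beta>] by blast
    have "apply_der r ?\<eta> \<beta> = (\<Sum>j\<in>{1..r}. \<Sum>i\<in>{1..n}. const (\<beta> j * \<psi> j i) * psub h (\<theta> i))"
      unfolding apply_der_def by (intro sum.cong refl) (simp add: sum_distrib_left const_mult mult.assoc)
    also have "\<dots> = (\<Sum>i\<in>{1..n}. const (a i) * psub h (\<theta> i))"
      by (subst sum.swap) (intro sum.cong refl, simp add: a(2) const_sum sum_distrib_right)
    also have "\<dots> = psub h (apply_der n \<theta> a)"
      by (simp add: apply_der_def psub.hom_sum psub.hom_mult)
    finally have ap: "apply_der r ?\<eta> \<beta> = psub h (apply_der n \<theta> a)" .
    have da: "dot n a v = (\<Sum>j\<in>{1..r}. \<beta> j * dot n (\<psi> j) v)" for v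
    proof -
      have "dot n a v = (\<Sum>i\<in>{1..n}. \<Sum>j\<in>{1..r}. \<beta> j * \<psi> j i * v i)"
        unfolding dot_def by (intro sum.cong refl) (simp add: a(2) sum_distrib_right)
      then show ?thesis unfolding dot_def sum_distrib_left by (subst sum.swap) (simp add: mult_ac)
    qed
    have dq: "dot n a q = 0" unfolding da using q by (intro sum.neutral) auto
    have ds: "dot n a (\<sigma> l) = \<beta> l" if l: "l \<in> {1..r}" for l
    proof -
      have "dot n a (\<sigma> l) = (\<Sum>j\<in>{1..r}. if j = l then \<beta> l else 0)"
        unfolding da by (rule sum.cong) (use dual l in auto)
      then show ?thesis using l by simp
    qed
    have "psub h (lin_form n a) = (\<Sum>i\<in>{1..n}. const (a i * q i)) + (\<Sum>i\<in>{1..n}. \<Sum>l\<in>{1..r}. const (a i * \<sigma> l i) * var l)"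
      by (simp add: lin_form_def psub.hom_sum psub.hom_mult h_def distrib_left sum.distrib sum_distrib_left
          const_mult mult.assoc)
    also have "(\<Sum>i\<in>{1..n}. const (a i * q i)) = 0" using dq by (simp add: dot_def const_sum[symmetric])
    also have "(\<Sum>i\<in>{1..n}. \<Sum>l\<in>{1..r}. const (a i * \<sigma> l i) * var l) = (\<Sum>l\<in>{1..r}. const (dot n a (\<sigma> l)) * var l)"
      by (subst sum.swap) (simp add: dot_def const_sum sum_distrib_right)
    also have "\<dots> = lin_form r \<beta>"
      unfolding lin_form_def by (intro sum.cong refl) (simp add: ds)
    finally have pl: "psub h (lin_form n a) = lin_form r \<beta>" by simp
    have "lin_form n a dvd apply_der n \<theta> a" using \<theta> a(1) by (auto simp: Dmod_iff)
    then have "psub h (lin_form n a) dvd psub h (apply_der n \<theta> a)" by (auto simp: dvd_def psub.hom_mult)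
    then show ?thesis unfolding ap pl .
  qed
  ultimately show ?thesis by (simp add: Dmod_iff)
qed

text \<open>\<open>pull\<close> and \<open>flat\<close> say that \<open>B\<close> is the
  localization at the flat \<open>X\<close> in the coordinates \<open>\<psi>\<close>. At a point
  where the determinant does not vanish, rows of degree at most \<open>d\<close> point in the Euler
  direction modulo the flat, so at least \<open>r - 1\<close> rows have larger degree, and at least
  \<open>r\<close> rows are nonconstant. The degrees then add up to at least (r - 1) d + r, one more
  than (r - 1)(d + 1).\<close>

theorem obstruction:
  fixes \<psi> \<sigma> :: "nat \<Rightarrow> nat \<Rightarrow> rat"
  assumes arr: "arr n A" and free: "free_arrangement n A" and r: "2 \<le> r"
    and dual: "\<And>j l. j \<in> {1..r} \<Longrightarrow> l \<in> {1..r} \<Longrightarrow> dot n (\<psi> j) (\<sigma> l) = (if j = l then 1 else 0)"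
    and fB: "finite B"
    and pull: "\<And>\<beta>. \<beta> \<in> B \<Longrightarrow> \<exists>a\<in>A. \<forall>i\<in>{1..n}. a i = (\<Sum>j\<in>{1..r}. \<beta> j * \<psi> j i)"
    and flat: "\<And>a. a \<in> A \<Longrightarrow> \<forall>i\<in>{1..n}. a i = (\<Sum>j\<in>{1..r}. dot n a (\<sigma> j) * \<psi> j i) \<Longrightarrow>
      \<exists>\<beta>\<in>B. \<forall>i\<in>{1..n}. a i = (\<Sum>j\<in>{1..r}. \<beta> j * \<psi> j i)"
    and rigid: "rigid r B d" and card: "card B \<le> (r - 1) * (d + 1)"
  shows False
proof -
  have fA: "finite A" using arr by (simp add: arr_def)
  define X where "X = {v. \<forall>j\<in>{1..r}. dot n (\<psi> j) v = 0}"
  define A' where "A' = {a \<in> A. \<not> (\<forall>i\<in>{1..n}. a i = (\<Sum>j\<in>{1..r}. dot n a (\<sigma> j) * \<psi> j i))}"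
  have "\<exists>v\<in>X. \<forall>a\<in>A'. dot n a v \<noteq> 0"
  proof (rule generic_vector)
    show "finite A'" using fA by (simp add: A'_def)
    show "(\<lambda>i. u i + t * w i) \<in> X" if "u \<in> X" "w \<in> X" for u w t
    proof -
      have "dot n b (\<lambda>i. u i + t * w i) = dot n b u + t * dot n b w" for b
        by (simp add: dot_def sum.distrib sum_distrib_left algebra_simps)
      then show ?thesis using that by (auto simp: X_def)
    qed
    have "(\<lambda>_. 0) \<in> X" by (simp add: X_def dot_def)
    then show "X \<noteq> {}" by blast
    fix a assume "a \<in> A'"
    then obtain i where i: "i \<in> {1..n}" "a i \<noteq> (\<Sum>j\<in>{1..r}. dot n a (\<sigma> j) * \<psi> j i)"
      by (auto simp: A'_def)
    \<comment> \<open>The \<open>i\<close>-th unit vector projected into \<open>X\<close> along the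
      \<open>\<sigma> j\<close>. Pairing with it measures by how much \<open>a\<close> leaves the
      span of the \<open>\<psi> j\<close> in coordinate \<open>i\<close>.\<close>
    define w where "w m = (if m = i then 1 else 0) - (\<Sum>j\<in>{1..r}. \<psi> j i * \<sigma> j m)" for m
    have dw: "dot n b w = b i - (\<Sum>j\<in>{1..r}. dot n b (\<sigma> j) * \<psi> j i)" for b
    proof -
      have "dot n b w = (\<Sum>m\<in>{1..n}. (if m = i then b i else 0) - (\<Sum>j\<in>{1..r}. b m * \<sigma> j m * \<psi> j i))"
        unfolding dot_def w_def by (rule sum.cong) (auto simp: algebra_simps sum_distrib_left)
      also have "\<dots> = b i - (\<Sum>m\<in>{1..n}. \<Sum>j\<in>{1..r}. b m * \<sigma> j m * \<psi> j i)"
        using i(1) by (simp add: sum_subtractf)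
      also have "(\<Sum>m\<in>{1..n}. \<Sum>j\<in>{1..r}. b m * \<sigma> j m * \<psi> j i) = (\<Sum>j\<in>{1..r}. dot n b (\<sigma> j) * \<psi> j i)"
        by (subst sum.swap) (simp add: dot_def sum_distrib_right)
      finally show ?thesis .
    qed
    have "w \<in> X" unfolding X_def
    proof safe
      fix l assume l: "l \<in> {1..r}"
      have "(\<Sum>j\<in>{1..r}. dot n (\<psi> l) (\<sigma> j) * \<psi> j i) = (\<Sum>j\<in>{1..r}. if j = l then \<psi> l i else 0)"
        by (rule sum.cong) (use dual l in auto)
      then show "dot n (\<psi> l) w = 0" unfolding dw using l by simp
    qed
    moreover have "dot n a w \<noteq> 0" unfolding dw using i(2) by simp
    ultimately show "\<exists>w\<in>X. dot n a w \<noteq> 0" by blast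
  qed
  then obtain v where v: "v \<in> X" "\<forall>a\<in>A'. dot n a v \<noteq> 0" by blast
  let ?L = "local_arr n A v"
  have pullL: "\<exists>a\<in>?L. \<forall>i\<in>{1..n}. a i = (\<Sum>j\<in>{1..r}. \<beta> j * \<psi> j i)" if \<beta>: "\<beta> \<in> B" for \<beta>
  proof -
    obtain a where a: "a \<in> A" "\<And>i. i \<in> {1..n} \<Longrightarrow> a i = (\<Sum>j\<in>{1..r}. \<beta> j * \<psi> j i)"
      using pull[OF \<beta>] by blast
    have "dot n a v = (\<Sum>i\<in>{1..n}. \<Sum>j\<in>{1..r}. \<beta> j * \<psi> j i * v i)"
      unfolding dot_def by (intro sum.cong refl) (simp add: a(2) sum_distrib_right)
    also have "\<dots> = (\<Sum>j\<in>{1..r}. \<beta> j * dot n (\<psi> j) v)"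
      unfolding dot_def sum_distrib_left by (subst sum.swap) (simp add: mult_ac)
    also have "\<dots> = 0" using v(1) by (intro sum.neutral) (auto simp: X_def)
    finally show ?thesis using a by (auto simp: local_arr_def)
  qed
  have "card ?L \<le> card B"
  proof -
    have "\<exists>\<beta>. \<beta> \<in> B \<and> (\<forall>i\<in>{1..n}. a i = (\<Sum>j\<in>{1..r}. \<beta> j * \<psi> j i))" if "a \<in> ?L" for a
    proof -
      have "a \<in> A" "a \<notin> A'" using that v(2) by (auto simp: local_arr_def)
      then show ?thesis using flat[of a] by (auto simp: A'_def)
    qed
    then have "\<forall>a\<in>?L. \<exists>\<beta>. \<beta> \<in> B \<and> (\<forall>i\<in>{1..n}. a i = (\<Sum>j\<in>{1..r}. \<beta> j * \<psi> j i))" by blast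
    from bchoice[OF this] obtain b
      where b: "\<forall>a\<in>?L. b a \<in> B \<and> (\<forall>i\<in>{1..n}. a i = (\<Sum>j\<in>{1..r}. b a j * \<psi> j i))" ..
    have "inj_on b ?L"
    proof (rule inj_onI, rule ccontr)
      fix a a' assume aa: "a \<in> ?L" "a' \<in> ?L" "b a = b a'" "a \<noteq> a'"
      then have "a i = a' i" if "i \<in> {1..n}" for i using b that by metis
      then have "lin_form n a = lin_form n a'" unfolding lin_form_def by (intro sum.cong) auto
      then have "lin_form n a dvd lin_form n a'" by simp
      then show False using arr aa unfolding arr_def local_arr_def by blast
    qed
    then show ?thesis using b fB by (intro card_inj_on_le[of b]) auto
  qed
  obtain \<Theta> e where D: "\<And>k. k < n \<Longrightarrow> \<Theta> k \<in> Dmod n ?L"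
    and hom: "\<And>k i. k < n \<Longrightarrow> homog (e k) (\<Theta> k i)" and nz: "der_det n \<Theta> \<noteq> 0"
    and deg: "(\<Sum>k<n. e k) \<le> card ?L"
    using free_localization[OF arr free] by blast
  have r1: "1 \<in> {1..r}" using r by simp
  have "ev (\<sigma> 1) (lin_form n (\<psi> 1)) \<noteq> 0" using dual[OF r1 r1] by simp
  then have "lin_form n (\<psi> 1) \<noteq> 0" by (metis ev.hom_zero)
  \<comment> \<open>The determinant must not vanish at \<open>p\<close>, to keep the rows
    independent; \<open>\<psi> 1\<close> must not either, because \<open>y 1\<close> becomes a
    denominator.\<close>
  then obtain p where p: "ev p (der_det n \<Theta> * lin_form n (\<psi> 1)) \<noteq> 0"
    using exists_nonzero_value[of "der_det n \<Theta> * lin_form n (\<psi> 1)"] nz by auto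
  then have p1: "dot n (\<psi> 1) p \<noteq> 0" and pd: "ev p (der_det n \<Theta>) \<noteq> 0"
    by (auto simp: ev.hom_mult)
  \<comment> \<open>\<open>q\<close> is the part of \<open>p\<close> on which all
    \<open>\<psi> j\<close> vanish; the slice \<open>h\<close> passes through \<open>p\<close> at
    parameter \<open>y\<close>.\<close>
  define y where "y j = dot n (\<psi> j) p" for j
  define q where "q i = p i - (\<Sum>l\<in>{1..r}. y l * \<sigma> l i)" for i
  have q0: "dot n (\<psi> j) q = 0" if j: "j \<in> {1..r}" for j
  proof -
    have "dot n (\<psi> j) q = dot n (\<psi> j) p - (\<Sum>i\<in>{1..n}. \<Sum>l\<in>{1..r}. y l * (\<psi> j i * \<sigma> l i))"
      unfolding dot_def q_def sum_subtractf[symmetric]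
      by (intro sum.cong refl) (simp add: algebra_simps sum_distrib_left)
    also have "(\<Sum>i\<in>{1..n}. \<Sum>l\<in>{1..r}. y l * (\<psi> j i * \<sigma> l i)) = (\<Sum>l\<in>{1..r}. y l * dot n (\<psi> j) (\<sigma> l))"
      by (subst sum.swap) (simp add: dot_def sum_distrib_left)
    also have "\<dots> = (\<Sum>l\<in>{1..r}. if l = j then y j else 0)"
      by (rule sum.cong) (use dual j in auto)
    finally show ?thesis using j by (simp add: y_def)
  qed
  define h where "h i = const (q i) + (\<Sum>l\<in>{1..r}. const (\<sigma> l i) * var l)" for i
  define \<eta> where "\<eta> k = (\<lambda>j. if j \<in> {1..r} then \<Sum>i\<in>{1..n}. const (\<psi> j i) * psub h (\<Theta> k i) else 0)" for k
  have \<eta>D: "\<eta> k \<in> Dmod r B" if "k < n" for k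
    unfolding \<eta>_def h_def by (rule restricted_derivation[OF dual q0 D[OF that] pullL])
  have ht: "tdeg (h i) \<le> 1" for i
    unfolding h_def by (intro tdeg_add_le tdeg_sum_le tdeg_const_mult_le tdeg_var) auto
  have \<eta>t: "tdeg (\<eta> k j) \<le> e k" if "k < n" for k j
    unfolding \<eta>_def using order_trans[OF tdeg_psub_le[of h, OF ht] homog_tdeg[OF hom[OF that]]]
    by (auto intro!: tdeg_sum_le tdeg_const_mult_le)
  have "ev y (h i) = p i" for i
    by (simp add: h_def q_def ev.hom_add ev.hom_sum ev.hom_mult mult.commute)
  then have evh: "(\<lambda>i. ev y (h i)) = p" by auto
  have ev\<eta>: "ev y (\<eta> k j) = dot n (\<psi> j) (\<lambda>i. ev p (\<Theta> k i))" if "j \<in> {1..r}" for k j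
    using that by (simp add: \<eta>_def ev.hom_sum ev.hom_mult ev_psub evh dot_def)
  define W where "W k i = ev p (\<Theta> k (Suc i))" for k i
  have W: "fdet n W \<noteq> 0"
  proof -
    have "ev p (der_det n \<Theta>) = fdet n W" unfolding der_det_def W_def by (rule fdet_hom) unfold_locales
    with pd show ?thesis by simp
  qed
  have dW: "dot n (\<psi> j) (\<lambda>i. ev p (\<Theta> k i)) = (\<Sum>i<n. W k i * \<psi> j (Suc i))" for j k
    by (simp add: dot_1_n W_def mult.commute)
  define K where "K = {k. k < n \<and> e k \<le> d}"
  define K0 where "K0 = {k. k < n \<and> e k = 0}"
  have prp: "y i * ev y (\<eta> k j) = y j * ev y (\<eta> k i)" if "k \<in> K" "i \<in> {1..r}" "j \<in> {1..r}" for k i j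
  proof -
    have k: "k < n" "e k \<le> d" using that by (auto simp: K_def)
    have "var i * \<eta> k j = var j * \<eta> k i"
      using order_trans[OF \<eta>t[OF k(1)] k(2)] that(2,3) by (rule rigid_tdeg[OF rigid \<eta>D[OF k(1)]])
    then have "ev y (var i * \<eta> k j) = ev y (var j * \<eta> k i)" by simp
    then show ?thesis by (simp add: ev.hom_mult)
  qed
  \<comment> \<open>A constant derivation proportional to the Euler derivation is zero, so rows of
    degree 0 vanish on all \<open>r\<close> functionals, one more than in the general case.\<close>
  have zero: "ev y (\<eta> k j) = 0" if "k \<in> K0" "j \<in> {1..r}" for k j
  proof -
    have k: "k < n" "e k = 0" using that by (auto simp: K0_def)
    obtain i where i: "i \<in> {1..r}" "i \<noteq> j"
      using r by (metis atLeastAtMost_iff one_le_numeral order_refl numeral_eq_one_iff semiring_norm(85) le_trans)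
    have "tdeg (\<eta> k l) = 0" for l using \<eta>t[OF k(1), of l] k(2) by simp
    then have "\<exists>c. \<eta> k l = const c" for l using tdeg_0_const by blast
    then obtain ci cj where c: "\<eta> k i = const ci" "\<eta> k j = const cj" by blast
    have "var i * \<eta> k j = var j * \<eta> k i"
      using \<eta>t[OF k(1)] k(2) i(1) that(2) by (intro rigid_tdeg[OF rigid \<eta>D[OF k(1)]]) (auto intro: order_trans)
    then have "ev (\<lambda>l. if l = i then 1 else 0) (var i * \<eta> k j) = ev (\<lambda>l. if l = i then 1 else 0) (var j * \<eta> k i)"
      by simp
    then have "cj = 0" using i(2) by (simp add: c ev.hom_mult)
    then show ?thesis using c by simp
  qed
  \<comment> \<open>Values proportional to \<open>y\<close> are annihilated by the
    \<open>r - 1\<close> combinations of \<open>\<psi> (j + 2)\<close> and \<open>\<psi> 1\<close>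
    chosen to vanish at \<open>y\<close>; the shift by 2 makes \<open>j + 2\<close> run from 2 to
    \<open>r\<close>.\<close>
  have K1: "card K + (r - 1) \<le> n"
  proof (rule independent_functionals[OF W, where
        \<phi> = "\<lambda>j i. \<psi> (j + 2) (Suc i) - y (j + 2) / y 1 * \<psi> 1 (Suc i)" and \<tau> = "\<lambda>l i. \<sigma> (l + 2) (Suc i)"])
    show "K \<subseteq> {..<n}" by (auto simp: K_def)
    have y1: "y 1 \<noteq> 0" using p1 by (simp add: y_def)
    fix k j assume k: "k \<in> K" and j: "j < r - 1"
    then have j2: "j + 2 \<in> {1..r}" by auto
    have "(\<Sum>i<n. W k i * (\<psi> (j + 2) (Suc i) - y (j + 2) / y 1 * \<psi> 1 (Suc i)))
        = (\<Sum>i<n. W k i * \<psi> (j + 2) (Suc i)) - y (j + 2) / y 1 * (\<Sum>i<n. W k i * \<psi> 1 (Suc i))"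
      by (simp add: sum_subtractf sum_distrib_left algebra_simps)
    also have "\<dots> = ev y (\<eta> k (j + 2)) - y (j + 2) / y 1 * ev y (\<eta> k 1)"
      unfolding ev\<eta>[OF j2] ev\<eta>[OF r1] dW ..
    also have "\<dots> = 0" using prp[OF k r1 j2] y1 by (simp add: field_simps)
    finally show "(\<Sum>i<n. W k i * (\<psi> (j + 2) (Suc i) - y (j + 2) / y 1 * \<psi> 1 (Suc i))) = 0" .
  next
    fix j l assume j: "j < r - 1" and l: "l < r - 1"
    then have j2: "j + 2 \<in> {1..r}" and l2: "l + 2 \<in> {1..r}" by auto
    have "(\<Sum>i<n. (\<psi> (j + 2) (Suc i) - y (j + 2) / y 1 * \<psi> 1 (Suc i)) * \<sigma> (l + 2) (Suc i))
        = dot n (\<psi> (j + 2)) (\<sigma> (l + 2)) - y (j + 2) / y 1 * dot n (\<psi> 1) (\<sigma> (l + 2))"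
      by (simp add: dot_1_n sum_subtractf sum_distrib_left algebra_simps)
    then show "(\<Sum>i<n. (\<psi> (j + 2) (Suc i) - y (j + 2) / y 1 * \<psi> 1 (Suc i)) * \<sigma> (l + 2) (Suc i))
        = (if j = l then 1 else 0)"
      unfolding dual[OF j2 l2] dual[OF r1 l2] by simp
  qed
  have K2: "card K0 + r \<le> n"
  proof (rule independent_functionals[OF W, where
        \<phi> = "\<lambda>j i. \<psi> (Suc j) (Suc i)" and \<tau> = "\<lambda>l i. \<sigma> (Suc l) (Suc i)"])
    show "K0 \<subseteq> {..<n}" by (auto simp: K0_def)
    show "(\<Sum>i<n. W k i * \<psi> (Suc j) (Suc i)) = 0" if "k \<in> K0" "j < r" for k j
      using zero[OF that(1), of "Suc j"] ev\<eta>[of "Suc j" k] that(2) dW by auto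
    show "(\<Sum>i<n. \<psi> (Suc j) (Suc i) * \<sigma> (Suc l) (Suc i)) = (if j = l then 1 else 0)"
      if "j < r" "l < r" for j l
      using dual[of "Suc j" "Suc l"] that by (simp add: dot_1_n)
  qed
  have sub: "K0 \<subseteq> K" "K \<subseteq> {..<n}" "finite K" by (auto simp: K0_def K_def)
  \<comment> \<open>A row outside \<open>K\<close> has degree at least \<open>d + 1\<close> and is
    also outside \<open>K0\<close>; a row of \<open>K\<close> outside \<open>K0\<close> has degree
    at least 1.\<close>
  have "(\<Sum>k<n. e k) \<ge> (\<Sum>k<n. (if k \<notin> K then d else 0) + (if k \<notin> K0 then 1 else 0))"
    by (rule sum_mono) (auto simp: K_def K0_def)
  also have "(\<Sum>k<n. (if k \<notin> K then d else 0) + (if k \<notin> K0 then 1 else 0))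
      = card ({..<n} - K) * d + card ({..<n} - K0)"
    by (simp add: sum.distrib sum.If_cases Diff_eq Collect_neg_eq)
  finally have "(n - card K) * d + (n - card K0) \<le> (\<Sum>k<n. e k)"
    using sub by (simp add: card_Diff_subset finite_subset)
  moreover have "(r - 1) * d \<le> (n - card K) * d" using K1 by (intro mult_right_mono) auto
  moreover have "r \<le> n - card K0" using K2 by linarith
  ultimately have "(r - 1) * d + r \<le> card B" using deg \<open>card ?L \<le> card B\<close> by linarith
  moreover have "(r - 1) * (d + 1) = (r - 1) * d + (r - 1)" by (simp add: add_mult_distrib2)
  ultimately show False using card r by linarith
qed

section \<open>Rigid arrangements\<close>

definition ind :: "nat set \<Rightarrow> nat \<Rightarrow> rat" where
  "ind I = (\<lambda>i. if i \<in> I then 1 else 0)"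

definition vs :: "nat set \<Rightarrow> qpoly" where "vs I = (\<Sum>i\<in>I. var i)"

lemma var_nonzero [simp]: "var i \<noteq> 0"
proof
  assume "var i = 0"
  then have "ev (\<lambda>_. 1) (var i) = 0" by (simp only: ev.hom_zero)
  then show False by simp
qed

lemma sum_ind:
  fixes f :: "nat \<Rightarrow> 'a::comm_ring_1"
  assumes "I \<subseteq> {1..n}" "\<And>i. i \<in> {1..n} \<Longrightarrow> g i = (if i \<in> I then f i else 0)"
  shows "(\<Sum>i\<in>{1..n}. g i) = (\<Sum>i\<in>I. f i)"
  by (rule sum.mono_neutral_cong_right) (use assms in auto)

lemma lin_form_ind: "I \<subseteq> {1..n} \<Longrightarrow> lin_form n (ind I) = vs I"
  unfolding lin_form_def vs_def by (rule sum_ind) (auto simp: ind_def)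

lemma apply_der_ind: "I \<subseteq> {1..n} \<Longrightarrow> apply_der n \<theta> (ind I) = (\<Sum>i\<in>I. \<theta> i)"
  unfolding apply_der_def by (rule sum_ind) (auto simp: ind_def)

lemma ev_vs [simp]: "ev v (vs I) = (\<Sum>i\<in>I. v i)"
  by (simp add: vs_def ev.hom_sum)

lemma homog_vs: "homog 1 (vs I)"
  unfolding vs_def by (intro homog_sum homog_var)

lemma vs_polys_over: "I \<subseteq> V \<Longrightarrow> vs I \<in> polys_over V"
  unfolding vs_def by (auto intro!: polys_over_sum polys_over_var)

lemma vs_prime:
  assumes "I \<subseteq> {1..n}" "I \<noteq> {}" "vs I dvd f * g"
  shows "vs I dvd f \<or> vs I dvd g"
proof -
  obtain p where p: "p \<in> I" using assms(2) by blast
  have "lin_form n (ind I) dvd f \<or> lin_form n (ind I) dvd g"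
  proof (rule lin_form_prime)
    show "p \<in> {1..n}" "ind I p \<noteq> 0" using p assms(1) by (auto simp: ind_def)
    show "lin_form n (ind I) dvd f * g" using assms(3) by (simp add: lin_form_ind[OF assms(1)])
  qed
  then show ?thesis by (simp add: lin_form_ind[OF assms(1)])
qed

lemma vs_nonzero: "finite I \<Longrightarrow> I \<noteq> {} \<Longrightarrow> vs I \<noteq> 0"
proof
  assume "finite I" "I \<noteq> {}" "vs I = 0"
  then have "ev (\<lambda>_. 1) (vs I) = 0" by (metis ev.hom_zero)
  with \<open>finite I\<close> \<open>I \<noteq> {}\<close> show False by simp
qed

lemma vs_not_dvd:
  assumes "finite I" "finite J" "I \<noteq> {}" "J \<noteq> {}" "vs I dvd vs J"
  shows "I = J"
proof -
  obtain q where q: "vs J = vs I * q" using assms(5) by (auto simp: dvd_def)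
  have "homog (1 + 0) (vs I * q)" using q homog_vs[of J] by simp
  then have "homog 0 q" by (rule homog_cancel[OF homog_vs]) (rule vs_nonzero[OF assms(1,3)])
  then obtain c where c: "q = const c" using homog_0_const by blast
  have e: "ind J i = ind I i * c" for i
  proof -
    have "ev (\<lambda>l. if l = i then 1 else 0) (vs J) = ev (\<lambda>l. if l = i then 1 else 0) (vs I) * c"
      unfolding q c by (simp add: ev.hom_mult)
    then show ?thesis using assms(1,2) by (simp add: ind_def)
  qed
  obtain j where "j \<in> J" using assms(4) by blast
  with e[of j] have "c \<noteq> 0" by (auto simp: ind_def)
  have "i \<in> J \<longleftrightarrow> i \<in> I" for i using e[of i] \<open>c \<noteq> 0\<close> by (auto simp: ind_def split: if_splits)
  then show ?thesis by blast
qed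

lemma Dmod_mult: "\<theta> \<in> Dmod n A \<Longrightarrow> p \<in> polys_over {1..n} \<Longrightarrow> (\<lambda>i. p * \<theta> i) \<in> Dmod n A"
proof -
  assume a: "\<theta> \<in> Dmod n A" "p \<in> polys_over {1..n}"
  have "apply_der n (\<lambda>i. p * \<theta> i) b = p * apply_der n \<theta> b" for b
    by (simp add: apply_der_def sum_distrib_left mult_ac)
  then show ?thesis
    using a by (auto simp: Dmod_iff derivations_def polys_in_over intro: polys_over_mult)
qed

text \<open>Multiplication by a power of \<open>var 1\<close> lifts any smaller degree to
  \<open>d\<close> and does not affect proportionality, so only the top degree has to be
  examined.\<close>

lemma rigid_exactI:
  assumes r: "1 \<le> r"
    and ex: "\<And>\<theta> i j. \<theta> \<in> Dmod r B \<Longrightarrow> (\<And>i. homog d (\<theta> i)) \<Longrightarrow> i \<in> {1..r} \<Longrightarrow> j \<in> {1..r} \<Longrightarrow>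
      var i * \<theta> j = var j * \<theta> i"
  shows "rigid r B d"
  unfolding rigid_def
proof (intro allI impI ballI)
  fix \<theta> k i j assume k: "k \<le> d" and \<theta>: "\<theta> \<in> Dmod r B" "\<forall>i. homog k (\<theta> i)" and ij: "i \<in> {1..r}" "j \<in> {1..r}"
  let ?m = "var 1 ^ (d - k)"
  have hm: "homog (d - k) ?m"
    using homog_prod[of "{..<d-k}" "\<lambda>_. 1" "\<lambda>_. var 1"] homog_var by simp
  have "homog d (?m * \<theta> i)" for i
    using homog_mult[OF hm, of k "\<theta> i"] \<theta>(2) k by simp
  moreover have "(\<lambda>i. ?m * \<theta> i) \<in> Dmod r B"
    using r by (intro Dmod_mult \<theta> polys_over_power polys_over_var) auto
  ultimately have "var i * (?m * \<theta> j) = var j * (?m * \<theta> i)" using ij by (intro ex)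
  then have "?m * (var i * \<theta> j) = ?m * (var j * \<theta> i)" by (simp add: mult_ac)
  then show "var i * \<theta> j = var j * \<theta> i" by simp
qed

lemma homog_quotient:
  assumes "homog (Suc d) f" "f = a * q" "homog 1 a" "a \<noteq> 0" shows "homog d q"
  using homog_cancel[of 1 a d q] assms by simp

lemma coordinate_quotients:
  assumes "\<theta> \<in> Dmod r B" "\<And>i. homog (Suc d) (\<theta> i)" "\<And>i. i \<in> {1..r} \<Longrightarrow> ind {i} \<in> B"
  obtains g where "\<And>i. i \<in> {1..r} \<Longrightarrow> \<theta> i = var i * g i" "\<And>i. i \<in> {1..r} \<Longrightarrow> homog d (g i)"
proof -
  have "\<exists>g. \<theta> i = var i * g \<and> homog d g" if i: "i \<in> {1..r}" for i
  proof -
    have "lin_form r (ind {i}) dvd apply_der r \<theta> (ind {i})"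
      using assms(1) assms(3)[OF i] by (auto simp: Dmod_iff)
    then have "var i dvd \<theta> i"
      using i by (simp add: lin_form_ind apply_der_ind vs_def)
    then obtain g where "\<theta> i = var i * g" by (elim dvdE)
    then show ?thesis using homog_quotient[OF assms(2) _ homog_var] by auto
  qed
  then show ?thesis using that by metis
qed

text \<open>Coordinate hyperplanes plus one in general position: a derivation of degree one is
  diagonal because of the former, and having \<open>\<gamma>\<close> as an eigenvector with all
  entries nonzero makes the diagonal constant.\<close>

lemma rigid_circuit:
  assumes r: "2 \<le> r" and \<gamma>: "\<And>j. j \<in> {1..r} \<Longrightarrow> \<gamma> j \<noteq> 0"
    and B: "\<And>j. j \<in> {1..r} \<Longrightarrow> ind {j} \<in> B" "\<gamma> \<in> B"
  shows "rigid r B 1"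
proof (rule rigid_exactI)
  fix \<theta> i j assume \<theta>: "\<theta> \<in> Dmod r B" "\<And>i. homog 1 (\<theta> i)" and ij: "i \<in> {1..r}" "j \<in> {1..r}"
  obtain g where g: "\<And>i. i \<in> {1..r} \<Longrightarrow> \<theta> i = var i * g i" "\<And>i. i \<in> {1..r} \<Longrightarrow> homog 0 (g i)"
    using coordinate_quotients[OF \<theta>(1) _ B(1), of 0] \<theta>(2) by auto
  have r1: "1 \<in> {1..r}" using r by simp
  have L0: "lin_form r \<gamma> \<noteq> 0" by (rule lin_form_nonzero[where a = \<gamma>, OF r1 \<gamma>[OF r1]])
  obtain q where q: "apply_der r \<theta> \<gamma> = lin_form r \<gamma> * q"
    using \<theta>(1) B(2) by (auto simp: Dmod_iff dvd_def)
  have "homog 1 (apply_der r \<theta> \<gamma>)"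
    unfolding apply_der_def by (intro homog_sum homog_const_mult \<theta>)
  then have "homog 0 q" using homog_quotient[OF _ q homog_lin_form L0, of 0] by simp
  then obtain m where m: "q = const m" using homog_0_const by blast
  have "g l = const m" if l: "l \<in> {1..r}" for l
  proof -
    obtain c where c: "g l = const c" using homog_0_const g(2)[OF l] by blast
    let ?v = "\<lambda>i. if i = l then 1 else 0 :: rat"
    have "ev ?v (apply_der r \<theta> \<gamma>) = (\<Sum>i\<in>{1..r}. if i = l then \<gamma> l * c else 0)"
      unfolding apply_der_def ev.hom_sum by (rule sum.cong) (auto simp: g(1) c ev.hom_mult ev.hom_zero)
    moreover have "dot r \<gamma> ?v = (\<Sum>i\<in>{1..r}. if i = l then \<gamma> l else 0)"
      unfolding dot_def by (rule sum.cong) auto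
    ultimately have "\<gamma> l * c = \<gamma> l * m" using l by (auto simp: q m ev.hom_mult)
    then show ?thesis using c \<gamma>[OF l] by simp
  qed
  then show "var i * \<theta> j = var j * \<theta> i" using g(1) ij by (simp add: mult_ac)
qed (use r in simp)

text \<open>Coordinates 1 and 2 stand for the two vertices of degree three of the diamond,
  coordinate 3 for the sum over all four vertices. The form 3 minus 1 minus 2 is absent, since the
  other two vertices are not adjacent.\<close>

definition diamond_forms :: "(nat \<Rightarrow> rat) set" where
  "diamond_forms = {ind {1}, ind {2}, ind {3}, ind {1, 2},
     (\<lambda>i. ind {3} i - ind {1} i), (\<lambda>i. ind {3} i - ind {2} i)}"

lemma set_1_3: "{1..3::nat} = {1, 2, 3}" and set_1_4: "{1..4::nat} = {1, 2, 3, 4}"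
  by auto

text \<open>Each form supported on two coordinates makes the difference of two quotients
  \<open>g\<close> a constant multiple of that form. The three differences add up around a triangle,
  and comparing coefficients kills all three constants.\<close>

lemma rigid_diamond: "rigid 3 diamond_forms 2"
proof (rule rigid_exactI)
  fix \<theta> i j assume \<theta>: "\<theta> \<in> Dmod 3 diamond_forms" "\<And>i. homog 2 (\<theta> i)" and ij: "i \<in> {1..3::nat}" "j \<in> {1..3::nat}"
  obtain g where g: "\<And>i. i \<in> {1..3} \<Longrightarrow> \<theta> i = var i * g i" "\<And>i. i \<in> {1..3} \<Longrightarrow> homog 1 (g i)"
  proof (rule coordinate_quotients[OF \<theta>(1), of 1])
    show "homog (Suc 1) (\<theta> i)" for i using \<theta>(2)[of i] by (simp add: numeral_2_eq_2)
    show "ind {i} \<in> diamond_forms" if "i \<in> {1..3}" for i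
      using that unfolding set_1_3 by (auto simp: diamond_forms_def)
  qed (rule that)
  have pair: "\<exists>c. g k - g l = (const s * var l + var k) * const c"
    if a: "a \<in> diamond_forms" "a k = 1" "a l = s" "\<And>i. i \<noteq> k \<Longrightarrow> i \<noteq> l \<Longrightarrow> a i = 0"
      and kl: "k \<in> {1..3}" "l \<in> {1..3}" "k \<noteq> l" and s: "s \<noteq> 0" for a k l s
  proof -
    have sm: "(\<Sum>i\<in>{1..3}. const (a i) * f i) = const s * f l + f k" for f :: "nat \<Rightarrow> qpoly"
    proof -
      have "(\<Sum>i\<in>{1..3}. const (a i) * f i) = (\<Sum>i\<in>{k, l}. const (a i) * f i)"
        by (rule sum.mono_neutral_right) (use kl a in auto)
      then show ?thesis using kl a by simp
    qed
    let ?L = "const s * var l + var k"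
    have L: "lin_form 3 a = ?L" unfolding lin_form_def by (rule sm)
    have "lin_form 3 a dvd apply_der 3 \<theta> a" using \<theta>(1) a(1) by (simp add: Dmod_iff)
    then have "?L dvd const s * \<theta> l + \<theta> k" unfolding L apply_der_def sm .
    also have "const s * \<theta> l + \<theta> k = ?L * g l + var k * (g k - g l)"
      using g(1) kl by (simp add: algebra_simps)
    finally have "?L dvd var k * (g k - g l)" by (simp add: dvd_add_right_iff)
    moreover have "\<not> ?L dvd var k"
    proof
      assume "?L dvd var k"
      then obtain q where "var k = ?L * q" by (elim dvdE)
      then have "ev (\<lambda>i. if i = k then 1 else if i = l then - inverse s else 0) (var k) =
          ev (\<lambda>i. if i = k then 1 else if i = l then - inverse s else 0) (?L * q)" by simp
      then show False using kl s by (simp add: ev.hom_mult ev.hom_add)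
    qed
    ultimately have "?L dvd g k - g l"
      using lin_form_prime[of k 3 a "var k" "g k - g l"] kl a L by auto
    then obtain q where q: "g k - g l = ?L * q" by (elim dvdE)
    have L0: "lin_form 3 a \<noteq> 0" using kl(1) a(2) by (intro lin_form_nonzero[of k]) auto
    have "homog (Suc 0) (g k - g l)" using kl g(2) by (auto intro!: homog_diff)
    then have "homog 0 q" using homog_quotient[OF _ q[folded L] homog_lin_form L0] by blast
    then show ?thesis using q homog_0_const by blast
  qed
  obtain c12 where c12: "g 1 - g 2 = (const 1 * var 2 + var 1) * const c12"
    using pair[of "ind {1, 2}" 1 2 1] by (auto simp: diamond_forms_def ind_def)
  obtain c32 where c32: "g 3 - g 2 = (const (-1) * var 2 + var 3) * const c32"
    using pair[of "\<lambda>i. ind {3} i - ind {2} i" 3 2 "-1"] by (auto simp: diamond_forms_def ind_def)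
  obtain c31 where c31: "g 3 - g 1 = (const (-1) * var 1 + var 3) * const c31"
    using pair[of "\<lambda>i. ind {3} i - ind {1} i" 3 1 "-1"] by (auto simp: diamond_forms_def ind_def)
  \<comment> \<open>The relation g 1 - g 2 = (g 3 - g 2) - (g 3 - g 1); unit vectors then read off
    its coefficients.\<close>
  have eq: "(const 1 * var 2 + var 1) * const c12 = (const (-1) * var 2 + var 3) * const c32 - (const (-1) * var 1 + var 3) * const c31"
    unfolding c12[symmetric] c32[symmetric] c31[symmetric] by simp
  have e: "(v 2 + v 1) * c12 = (v 3 - v 2) * c32 - (v 3 - v 1) * c31" for v :: "nat \<Rightarrow> rat"
    using arg_cong[OF eq, of "ev v"] by (simp add: ev.hom_mult ev.hom_add ev.hom_minus)
  have "c12 = 0" "c32 = 0" "c31 = 0"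
    using e[of "ind {1}"] e[of "ind {2}"] e[of "ind {3}"] by (auto simp: ind_def)
  then have "g 1 = g 2" "g 3 = g 2" using c12 c32 by auto
  then have "g i = g j" using ij unfolding set_1_3 by auto
  then show "var i * \<theta> j = var j * \<theta> i" using g(1) ij by (simp add: mult_ac)
qed simp

subsection \<open>The resonance arrangement of rank four\<close>

lemma homog_psub:
  assumes h: "\<And>i. homog 1 (h i)" and p: "homog d p" shows "homog d (psub h p)"
proof -
  have "homog d (psub h (hc d q))" for d q
  proof (induction q arbitrary: d rule: qpoly_induct)
    case (mult p q)
    show ?case unfolding hc_mult psub.hom_sum psub.hom_mult
    proof (rule homog_sum)
      fix i assume "i \<in> {..d}"
      then show "homog d (psub h (hc i p) * psub h (hc (d - i) q))"
        using homog_mult[OF mult(1)[of i] mult(2)[of "d - i"]] by simp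
    qed
  qed (use h in \<open>auto simp: hc_const hc_var hc_add psub.hom_add psub.hom_zero homog_const intro: homog_add\<close>)
  moreover have "hc d p = p" using p by (simp add: homog_hc_iff)
  ultimately show ?thesis by metis
qed

text \<open>Division with remainder by a variable. Repeating it gives explicit coefficients for the
  linear and quadratic forms that follow.\<close>

lemma split_variable:
  assumes "homog (Suc d) p" "p \<in> polys_over (insert i V)"
  shows "\<exists>q r. p = var i * q + r \<and> homog d q \<and> q \<in> polys_over (insert i V) \<and>
    homog (Suc d) r \<and> r \<in> polys_over V"
proof -
  let ?h = "\<lambda>l. if l \<in> V - {i} then var l else 0"
  have "var i dvd psub (\<lambda>l. if l = i \<or> l \<in> V then var l else 0) p - psub ?h p"
    by (rule psub_cong_dvd) auto
  moreover have "psub (\<lambda>l. if l = i \<or> l \<in> V then var l else 0) p = p"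
    by (rule psub_id_on[OF assms(2)]) auto
  ultimately have dvd: "var i dvd p - psub ?h p" by simp
  have rP: "psub ?h p \<in> polys_over V"
    by (rule psub_polys_over[of _ UNIV]) (auto intro: polys_over_var)
  then have "p - psub ?h p \<in> polys_over (insert i V)"
    using assms(2) by (intro polys_over_diff) (auto simp: polys_over_def)
  then obtain q where q: "q \<in> polys_over (insert i V)" "p - psub ?h p = var i * q"
    using dvd_in_polys[OF _ _ dvd, of "insert i V"] polys_over_var by blast
  have hr: "homog (Suc d) (psub ?h p)"
    by (rule homog_psub[OF _ assms(1)]) (use homog_var in auto)
  have "homog d q"
    by (rule homog_quotient[OF homog_diff[OF assms(1) hr] q(2) homog_var]) simp
  then show ?thesis using q hr rP by (intro exI[of _ q] exI[of _ "psub ?h p"]) (auto simp: algebra_simps)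
qed

lemma homog_Suc_no_vars: "homog (Suc d) p \<Longrightarrow> p \<in> polys_over {} \<Longrightarrow> p = 0"
proof -
  assume a: "homog (Suc d) p" "p \<in> polys_over {}"
  have "psub (\<lambda>_. 0) p = const (ev (\<lambda>_. 0) p)"
    by (induction p rule: qpoly_induct)
      (simp_all add: psub.hom_add psub.hom_mult ev.hom_add ev.hom_mult const_add const_mult)
  then have "p = const (ev (\<lambda>_. 0) p)" using psub_id_on[OF a(2)] by auto
  then have "homog 0 p" using homog_const by metis
  then show "p = 0" using homog_unique[OF a(1)] by auto
qed

lemma linear_form_eval:
  assumes "homog 1 p" "p \<in> polys_over {1, 2, 3}"
  obtains a b c where "\<And>v. ev v p = a * v 1 + b * v 2 + c * v 3"
proof -
  have "\<exists>a b c. \<forall>v. ev v p = a * v 1 + b * v 2 + c * v 3"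
  proof -
    obtain q1 r1 where 1: "p = var 1 * q1 + r1" "homog 0 q1" "homog 1 r1" "r1 \<in> polys_over {2, 3}"
      using split_variable[of 0 p 1 "{2, 3}"] assms by auto
    obtain q2 r2 where 2: "r1 = var 2 * q2 + r2" "homog 0 q2" "homog 1 r2" "r2 \<in> polys_over {3}"
      using split_variable[of 0 r1 2 "{3}"] 1 by auto
    obtain q3 r3 where 3: "r2 = var 3 * q3 + r3" "homog 0 q3" "homog 1 r3" "r3 \<in> polys_over {}"
      using split_variable[of 0 r2 3 "{}"] 2 by auto
    have "r3 = 0" using homog_Suc_no_vars[of 0 r3] 3 by simp
    obtain a b c where "q1 = const a" "q2 = const b" "q3 = const c"
      using homog_0_const 1 2 3 by metis
    then have "ev v p = a * v 1 + b * v 2 + c * v 3" for v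
      using 1 2 3 \<open>r3 = 0\<close> by (simp add: ev.hom_add ev.hom_mult)
    then show ?thesis by blast
  qed
  then show ?thesis using that by blast
qed

lemma quadratic_form_eval:
  assumes "homog 2 p" "p \<in> polys_over {1, 2, 3}"
  obtains a1 a2 a3 a4 a5 a6 where "\<And>v. ev v p = a1 * (v 1 * v 1) + a2 * (v 2 * v 2) + a3 * (v 3 * v 3)
    + a4 * (v 1 * v 2) + a5 * (v 1 * v 3) + a6 * (v 2 * v 3)"
proof -
  have "\<exists>a1 a2 a3 a4 a5 a6. \<forall>v. ev v p = a1 * (v 1 * v 1) + a2 * (v 2 * v 2) + a3 * (v 3 * v 3)
    + a4 * (v 1 * v 2) + a5 * (v 1 * v 3) + a6 * (v 2 * v 3)"
  proof -
    have sub: "q \<in> polys_over {1, 2, 3}" if "q \<in> polys_over V" "V \<subseteq> {1, 2, 3}" for q V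
      using that by (auto simp: polys_over_def)
    obtain q1 r1 where 1: "p = var 1 * q1 + r1" "homog 1 q1" "q1 \<in> polys_over {1, 2, 3}" "homog 2 r1" "r1 \<in> polys_over {2, 3}"
      using split_variable[of 1 p 1 "{2, 3}"] assms by (auto simp: numeral_2_eq_2)
    obtain q2 r2 where 2: "r1 = var 2 * q2 + r2" "homog 1 q2" "q2 \<in> polys_over {2, 3}" "homog 2 r2" "r2 \<in> polys_over {3}"
      using split_variable[of 1 r1 2 "{3}"] 1 by (auto simp: numeral_2_eq_2)
    obtain q3 r3 where 3: "r2 = var 3 * q3 + r3" "homog 1 q3" "q3 \<in> polys_over {3}" "homog 2 r3" "r3 \<in> polys_over {}"
      using split_variable[of 1 r2 3 "{}"] 2 by (auto simp: numeral_2_eq_2)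
    have "r3 = 0" using homog_Suc_no_vars[of 1 r3] 3 by (simp add: numeral_2_eq_2)
    obtain a b c where q1: "\<And>v. ev v q1 = a * v 1 + b * v 2 + c * v 3"
      using linear_form_eval[OF 1(2,3)] by metis
    obtain a' b' c' where q2: "\<And>v. ev v q2 = a' * v 1 + b' * v 2 + c' * v 3"
      using linear_form_eval[OF 2(2) sub[OF 2(3)]] by auto
    obtain a'' b'' c'' where q3: "\<And>v. ev v q3 = a'' * v 1 + b'' * v 2 + c'' * v 3"
      using linear_form_eval[OF 3(2) sub[OF 3(3)]] by auto
    have "ev v p = a * (v 1 * v 1) + b' * (v 2 * v 2) + c'' * (v 3 * v 3)
      + (b + a') * (v 1 * v 2) + (c + a'') * (v 1 * v 3) + (c' + b'') * (v 2 * v 3)" for v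
      using 1(1) 2(1) 3(1) \<open>r3 = 0\<close> by (simp add: ev.hom_add ev.hom_mult q1 q2 q3 algebra_simps)
    then show ?thesis by blast
  qed
  then show ?thesis using that by blast
qed

text \<open>With s the sum of the two variables, the combination equals
  \<open>var i * var i * (a + b)\<close> plus s times \<open>(var j - var i) * b\<close>. To first
  order s divides \<open>a + b\<close>; the quotient \<open>e\<close> then carries the second order
  condition on s = 0.\<close>

lemma double_pair:
  assumes ij: "i \<in> {1..3}" "j \<in> {1..3}" "i \<noteq> j" and a: "homog 2 a" "a \<in> polys_over {1..3}" and b: "homog 2 b" "b \<in> polys_over {1..3}"
    and dvd: "vs {i, j} * vs {i, j} dvd var i * var i * a + var j * var j * b"
  obtains e where "homog 1 e" "e \<in> polys_over {1..3}" "a + b = vs {i, j} * e"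
    "\<And>v. v i + v j = 0 \<Longrightarrow> v i * v i * ev v e + (v j - v i) * ev v b = 0"
proof -
  let ?s = "vs {i, j}"
  have s: "?s = var i + var j" using ij(3) by (simp add: vs_def)
  have sub: "{i, j} \<subseteq> {1..3}" using ij by simp
  have s0: "?s \<noteq> 0" by (rule vs_nonzero) auto
  have nd: "\<not> ?s dvd var i * var i"
  proof
    assume "?s dvd var i * var i"
    then have "?s dvd var i" using vs_prime[OF sub] by blast
    then have "?s dvd vs {i}" by (simp add: vs_def)
    then show False using vs_not_dvd[of "{i, j}" "{i}"] ij(3) by auto
  qed
  obtain q where q: "var i * var i * a + var j * var j * b = ?s * ?s * q" using dvd by (elim dvdE)
  have eq: "var i * var i * (a + b) + ?s * ((var j - var i) * b) = ?s * ?s * q"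
  proof -
    have "var i * var i * (a + b) + ?s * ((var j - var i) * b) = var i * var i * a + var j * var j * b"
      unfolding s by (simp add: algebra_simps)
    then show ?thesis using q by simp
  qed
  have "?s dvd ?s * ?s * q - ?s * ((var j - var i) * b)" by (simp add: mult.assoc dvd_diff)
  also have "?s * ?s * q - ?s * ((var j - var i) * b) = var i * var i * (a + b)"
    unfolding eq[symmetric] by simp
  finally have "?s dvd a + b" using vs_prime[OF sub, of "var i * var i"] nd by blast
  then obtain e where e: "e \<in> polys_over {1..3}" "a + b = ?s * e"
    using dvd_in_polys[OF vs_polys_over[OF sub] polys_over_add[OF a(2) b(2)]] by blast
  have "homog 1 e"
    by (rule homog_quotient[OF _ e(2) homog_vs s0]) (use a b in \<open>auto intro: homog_add simp: numeral_2_eq_2\<close>)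
  moreover have "?s * (var i * var i * e + (var j - var i) * b) = ?s * (?s * q)"
    using eq unfolding e(2) by (simp add: algebra_simps)
  then have "var i * var i * e + (var j - var i) * b = ?s * q" using s0 by simp
  then have "ev v (var i * var i * e + (var j - var i) * b) = ev v (?s * q)" for v by simp
  then have "v i * v i * ev v e + (v j - v i) * ev v b = (v i + v j) * ev v q" for v
    by (simp add: ev.hom_add ev.hom_mult ev.hom_minus s)
  ultimately show ?thesis using that[of e] e by auto
qed

text \<open>This is the double arrangement that the restriction of the rank four resonance arrangement to
  \<open>x\<^sub>4 = 0\<close> carries: \<open>x\<^sub>I\<close> and \<open>x\<^sub>I + x\<^sub>4\<close> restrict to the same form. The pairs alone leave the
  solutions \<open>a\<^sub>1 = \<lambda> (x\<^sup>2 + xy + xz + 3yz)\<close> and its permutations, and the full sum forces \<open>\<lambda> = 0\<close>.\<close>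

lemma double_resonance:
  assumes f: "\<And>i. i \<in> {1..3} \<Longrightarrow> homog 4 (f i)" "\<And>i. i \<in> {1..3} \<Longrightarrow> f i \<in> polys_over {1..3}"
    and dvd: "\<And>I. I \<noteq> {} \<Longrightarrow> I \<subseteq> {1..3} \<Longrightarrow> vs I * vs I dvd (\<Sum>i\<in>I. f i)"
    and i: "i \<in> {1..3}"
  shows "f i = 0"
proof -
  have quot: "\<exists>q. q \<in> polys_over {1..3} \<and> homog 2 q \<and> (\<Sum>i\<in>I. f i) = vs I * vs I * q"
    if I: "I \<noteq> {}" "I \<subseteq> {1..3}" for I
  proof -
    have fin: "finite I" using I(2) finite_subset by blast
    have P: "vs I * vs I \<in> polys_over {1..3}" "(\<Sum>i\<in>I. f i) \<in> polys_over {1..3}"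
      using I f(2) by (auto intro!: polys_over_mult vs_polys_over polys_over_sum)
    obtain q where q: "q \<in> polys_over {1..3}" "(\<Sum>i\<in>I. f i) = vs I * vs I * q"
      using dvd_in_polys[OF P dvd[OF I]] by blast
    have h4: "homog 4 (\<Sum>i\<in>I. f i)" using f(1) I(2) by (intro homog_sum) auto
    have h2: "homog 2 (vs I * vs I)" using homog_mult[OF homog_vs homog_vs, of I I] by (simp add: numeral_2_eq_2)
    have "homog 2 q"
      using homog_cancel[OF h2, of 2 q] h4 q(2) vs_nonzero[OF fin I(1)] by simp
    with q show ?thesis by blast
  qed
  have "\<forall>i\<in>{1..3}. \<exists>q. q \<in> polys_over {1..3} \<and> homog 2 q \<and> f i = var i * var i * q"
    using quot[of "{_}"] by (auto simp: vs_def)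
  from bchoice[OF this] obtain a where a: "\<forall>i\<in>{1..3}. a i \<in> polys_over {1..3} \<and> homog 2 (a i) \<and> f i = var i * var i * a i" ..
  have pr: "vs {i, j} * vs {i, j} dvd var i * var i * a i + var j * var j * a j"
    if "i \<in> {1..3}" "j \<in> {1..3}" "i \<noteq> j" for i j
    using dvd[of "{i, j}"] that a by auto
  have m: "1 \<in> {1..3::nat}" "2 \<in> {1..3::nat}" "3 \<in> {1..3::nat}" by auto
  obtain e12 where e12: "homog 1 e12" "e12 \<in> polys_over {1..3}" "a 1 + a 2 = vs {1, 2} * e12"
    "\<And>v. v 1 + v 2 = 0 \<Longrightarrow> v 1 * v 1 * ev v e12 + (v 2 - v 1) * ev v (a 2) = 0"
    using double_pair[of 1 2 "a 1" "a 2"] pr[of 1 2] a m by (metis numeral_eq_one_iff semiring_norm(85))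
  obtain e13 where e13: "homog 1 e13" "e13 \<in> polys_over {1..3}" "a 1 + a 3 = vs {1, 3} * e13"
    "\<And>v. v 1 + v 3 = 0 \<Longrightarrow> v 1 * v 1 * ev v e13 + (v 3 - v 1) * ev v (a 3) = 0"
    using double_pair[of 1 3 "a 1" "a 3"] pr[of 1 3] a m by (metis numeral_eq_one_iff semiring_norm(86))
  obtain e23 where e23: "homog 1 e23" "e23 \<in> polys_over {1..3}" "a 2 + a 3 = vs {2, 3} * e23"
    "\<And>v. v 2 + v 3 = 0 \<Longrightarrow> v 2 * v 2 * ev v e23 + (v 3 - v 2) * ev v (a 3) = 0"
    using double_pair[of 2 3 "a 2" "a 3"] pr[of 2 3] a m by (metis numeral_eq_iff semiring_norm(88))
  obtain q where q: "q \<in> polys_over {1..3}" "homog 2 q" "(\<Sum>i\<in>{1, 2, 3}. f i) = vs {1, 2, 3} * vs {1, 2, 3} * q"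
    using quot[of "{1, 2, 3}"] by auto
  have qs: "var 1 * var 1 * a 1 + var 2 * var 2 * a 2 + var 3 * var 3 * a 3 = vs {1, 2, 3} * vs {1, 2, 3} * q"
    using q(3) a m by (simp add: add.assoc)
  obtain a1 a2 a3 a4 a5 a6 where A: "\<And>v. ev v (a 1) = a1 * (v 1 * v 1) + a2 * (v 2 * v 2) + a3 * (v 3 * v 3)
    + a4 * (v 1 * v 2) + a5 * (v 1 * v 3) + a6 * (v 2 * v 3)"
    using quadratic_form_eval[of "a 1"] a m unfolding set_1_3 by blast
  obtain b1 b2 b3 b4 b5 b6 where B: "\<And>v. ev v (a 2) = b1 * (v 1 * v 1) + b2 * (v 2 * v 2) + b3 * (v 3 * v 3)
    + b4 * (v 1 * v 2) + b5 * (v 1 * v 3) + b6 * (v 2 * v 3)"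
    using quadratic_form_eval[of "a 2"] a m unfolding set_1_3 by blast
  obtain c1 c2 c3 c4 c5 c6 where C: "\<And>v. ev v (a 3) = c1 * (v 1 * v 1) + c2 * (v 2 * v 2) + c3 * (v 3 * v 3)
    + c4 * (v 1 * v 2) + c5 * (v 1 * v 3) + c6 * (v 2 * v 3)"
    using quadratic_form_eval[of "a 3"] a m unfolding set_1_3 by blast
  obtain q1 q2 q3 q4 q5 q6 where Q: "\<And>v. ev v q = q1 * (v 1 * v 1) + q2 * (v 2 * v 2) + q3 * (v 3 * v 3)
    + q4 * (v 1 * v 2) + q5 * (v 1 * v 3) + q6 * (v 2 * v 3)"
    using quadratic_form_eval[of q] q(1,2) unfolding set_1_3 by blast
  obtain d1 d2 d3 where D: "\<And>v. ev v e12 = d1 * v 1 + d2 * v 2 + d3 * v 3"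
    using linear_form_eval[of e12] e12(1,2) unfolding set_1_3 by blast
  obtain g1 g2 g3 where G: "\<And>v. ev v e13 = g1 * v 1 + g2 * v 2 + g3 * v 3"
    using linear_form_eval[of e13] e13(1,2) unfolding set_1_3 by blast
  obtain h1 h2 h3 where H: "\<And>v. ev v e23 = h1 * v 1 + h2 * v 2 + h3 * v 3"
    using linear_form_eval[of e23] e23(1,2) unfolding set_1_3 by blast
  have E12: "ev v (a 1) + ev v (a 2) = (v 1 + v 2) * ev v e12" for v
    using arg_cong[OF e12(3), of "ev v"] by (simp add: ev.hom_add ev.hom_mult)
  have E13: "ev v (a 1) + ev v (a 3) = (v 1 + v 3) * ev v e13" for v
    using arg_cong[OF e13(3), of "ev v"] by (simp add: ev.hom_add ev.hom_mult)
  have E23: "ev v (a 2) + ev v (a 3) = (v 2 + v 3) * ev v e23" for v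
    using arg_cong[OF e23(3), of "ev v"] by (simp add: ev.hom_add ev.hom_mult)
  have E123: "v 1 * v 1 * ev v (a 1) + v 2 * v 2 * ev v (a 2) + v 3 * v 3 * ev v (a 3)
      = (v 1 + v 2 + v 3) * (v 1 + v 2 + v 3) * ev v q" for v
    using arg_cong[OF qs, of "ev v"] by (simp add: ev.hom_add ev.hom_mult add.assoc)
  let ?p = "\<lambda>(x::rat) (y::rat) (z::rat) (i::nat). if i = 1 then x else if i = 2 then y else z"
  have F12: "(a1 * (x * x) + a2 * (y * y) + a3 * (z * z) + a4 * (x * y) + a5 * (x * z) + a6 * (y * z))
      + (b1 * (x * x) + b2 * (y * y) + b3 * (z * z) + b4 * (x * y) + b5 * (x * z) + b6 * (y * z)) = (x + y) * (d1 * x + d2 * y + d3 * z)" for x y z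
    using E12[of "?p x y z"] unfolding A B D by simp
  have L12: "x * x * (d1 * x + d2 * (-x) + d3 * z) + (- x - x) * (b1 * (x * x) + b2 * ((-x) * (-x)) + b3 * (z * z) + b4 * (x * (-x)) + b5 * (x * z) + b6 * ((-x) * z)) = 0" for x y z
    using e12(4)[of "?p x (-x) z"] unfolding A B D by simp
  \<comment> \<open>Unit points and sums of two of them determine a quadratic form in three
    variables. With x = 1, \<open>L12\<close> is quadratic in z, so three values of z exhaust
    it.\<close>
  note p12 = F12[of "1" "0" "0", simplified] F12[of "0" "1" "0", simplified] F12[of "0" "0" "1", simplified] F12[of "1" "1" "0", simplified] F12[of "1" "0" "1", simplified] F12[of "0" "1" "1", simplified]
    L12[where x = 1 and z = "0", simplified] L12[where x = 1 and z = "1", simplified] L12[where x = 1 and z = "-1", simplified]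
  have F13: "(a1 * (x * x) + a2 * (y * y) + a3 * (z * z) + a4 * (x * y) + a5 * (x * z) + a6 * (y * z))
      + (c1 * (x * x) + c2 * (y * y) + c3 * (z * z) + c4 * (x * y) + c5 * (x * z) + c6 * (y * z)) = (x + z) * (g1 * x + g2 * y + g3 * z)" for x y z
    using E13[of "?p x y z"] unfolding A C G by simp
  have L13: "x * x * (g1 * x + g2 * y + g3 * (-x)) + (- x - x) * (c1 * (x * x) + c2 * (y * y) + c3 * ((-x) * (-x)) + c4 * (x * y) + c5 * (x * (-x)) + c6 * (y * (-x))) = 0" for x y z
    using e13(4)[of "?p x y (-x)"] unfolding A C G by simp
  note p13 = F13[of "1" "0" "0", simplified] F13[of "0" "1" "0", simplified] F13[of "0" "0" "1", simplified] F13[of "1" "1" "0", simplified] F13[of "1" "0" "1", simplified] F13[of "0" "1" "1", simplified]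
    L13[where x = 1 and y = "0", simplified] L13[where x = 1 and y = "1", simplified] L13[where x = 1 and y = "-1", simplified]
  have F23: "(b1 * (x * x) + b2 * (y * y) + b3 * (z * z) + b4 * (x * y) + b5 * (x * z) + b6 * (y * z))
      + (c1 * (x * x) + c2 * (y * y) + c3 * (z * z) + c4 * (x * y) + c5 * (x * z) + c6 * (y * z)) = (y + z) * (h1 * x + h2 * y + h3 * z)" for x y z
    using E23[of "?p x y z"] unfolding B C H by simp
  have L23: "y * y * (h1 * x + h2 * y + h3 * (-y)) + (- y - y) * (c1 * (x * x) + c2 * (y * y) + c3 * ((-y) * (-y)) + c4 * (x * y) + c5 * (x * (-y)) + c6 * (y * (-y))) = 0" for x y z
    using e23(4)[of "?p x y (-y)"] unfolding B C H by simp
  note p23 = F23[of "1" "0" "0", simplified] F23[of "0" "1" "0", simplified] F23[of "0" "0" "1", simplified] F23[of "1" "1" "0", simplified] F23[of "1" "0" "1", simplified] F23[of "0" "1" "1", simplified]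
    L23[where y = 1 and x = "0", simplified] L23[where y = 1 and x = "1", simplified] L23[where y = 1 and x = "-1", simplified]
  have z3: "b3 = 0" "a3 = 0" using p12 by linarith+
  have z2: "c2 = 0" "a2 = 0" using p13 by linarith+
  have z1: "c1 = 0" "b1 = 0" using p23 by linarith+
  note z = z1 z2 z3
  have r12: "d3 = a5 + b5" "d3 = a6 + b6" "a4 + b4 = a1 + b2" "a1 - b2 = 2 * b2 - 2 * b4" "d3 = 2 * b5 - 2 * b6"
    using p12 unfolding z by linarith+
  have r13: "g2 = a4 + c4" "g2 = a6 + c6" "a5 + c5 = a1 + c3" "a1 - c3 = 2 * c3 - 2 * c5" "g2 = 2 * c4 - 2 * c6"
    using p13 unfolding z by linarith+
  have r23: "h1 = b4 + c4" "h1 = b5 + c5" "b6 + c6 = b2 + c3" "b2 - c3 = 2 * c3 - 2 * c6" "h1 = 2 * c4 - 2 * c5"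
    using p23 unfolding z by linarith+
  have ex: "a4 = a1" "a5 = a1" "a6 = 3 * a1" "b2 = a1" "b4 = a1" "b5 = 3 * a1" "b6 = a1"
    "c3 = a1" "c4 = 3 * a1" "c5 = a1" "c6 = a1"
    using r12 r13 r23 by linarith+
  \<comment> \<open>The first six points express \<open>q\<close> through \<open>a1\<close>, with
    coefficient \<open>a1\<close> at the squares and \<open>- a1\<close> at the mixed terms. At (1,
    1, 1) the left side is then 18 times \<open>a1\<close> and the right side is 0.\<close>
  have "a1 = 0"
    using E123[of "?p (1) (0) (0)"] E123[of "?p (0) (1) (0)"] E123[of "?p (0) (0) (1)"] E123[of "?p (1) (1) (0)"] E123[of "?p (1) (0) (1)"] E123[of "?p (0) (1) (1)"] E123[of "?p (1) (1) (1)"]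
    unfolding A B C Q z ex by simp
  then have "ev v (a 1) = 0" "ev v (a 2) = 0" "ev v (a 3) = 0" for v
    unfolding A B C z ex by simp_all
  then have "ev v (a i) = 0" for v using i unfolding set_1_3 by auto
  then have "a i = 0" using exists_nonzero_value by blast
  then show ?thesis using a i by simp
qed

definition resonance :: "nat \<Rightarrow> (nat \<Rightarrow> rat) set" where
  "resonance n = {ind I | I. I \<noteq> {} \<and> I \<subseteq> {1..n}}"

lemma Dmod_resonance:
  "\<theta> \<in> Dmod n (resonance n) \<longleftrightarrow> \<theta> \<in> derivations n \<and> (\<forall>I. I \<noteq> {} \<longrightarrow> I \<subseteq> {1..n} \<longrightarrow> vs I dvd (\<Sum>i\<in>I. \<theta> i))"
proof -
  have "(\<forall>a\<in>resonance n. lin_form n a dvd apply_der n \<theta> a) \<longleftrightarrow>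
    (\<forall>I. I \<noteq> {} \<longrightarrow> I \<subseteq> {1..n} \<longrightarrow> lin_form n (ind I) dvd apply_der n \<theta> (ind I))"
    unfolding resonance_def by blast
  then show ?thesis unfolding Dmod_iff by (simp add: lin_form_ind apply_der_ind)
qed

lemma Dmod_resonanceD:
  "\<theta> \<in> Dmod n (resonance n) \<Longrightarrow> I \<noteq> {} \<Longrightarrow> I \<subseteq> {1..n} \<Longrightarrow> vs I dvd (\<Sum>i\<in>I. \<theta> i)"
  unfolding Dmod_resonance by blast

text \<open>As \<open>\<eta> 4 = 0\<close>, a set \<open>I\<close> inside \<open>{1..3}\<close> and
  \<open>insert 4 I\<close> give the same sum, divisible by two forms with the same restriction to
  the hyperplane of variable 4. There the square divides, so \<open>double_resonance\<close> makes
  the restriction vanish. Dividing by \<open>var 4\<close> gives a logarithmic derivation of smaller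
  degree.\<close>

lemma resonance_zero:
  assumes "k \<le> 4" "\<eta> \<in> Dmod 4 (resonance 4)" "\<eta> 4 = 0" "\<And>i. homog k (\<eta> i)" "i \<in> {1..3}"
  shows "\<eta> i = 0"
  using assms
proof (induction k arbitrary: \<eta> i)
  case (0 \<eta> i)
  obtain c where c: "\<eta> i = const c" using homog_0_const 0 by blast
  have "vs {i} dvd (\<Sum>i\<in>{i}. \<eta> i)" using 0(5) by (intro Dmod_resonanceD[OF 0(2)]) auto
  then obtain q where "const c = var i * q" unfolding c[symmetric] by (auto simp: vs_def elim: dvdE)
  then have "ev (\<lambda>_. 0) (const c) = 0" by (simp only: ev.hom_mult ev_var mult_zero_left)
  then show ?case by (simp add: c)
next
  case (Suc k)
  let ?h = "\<lambda>l. if l \<in> {1..3} then var l else 0"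
  \<comment> \<open>The power of \<open>var 1\<close> lifts the degree to exactly 4, as
    \<open>double_resonance\<close> requires.\<close>
  define f where "f l = var 1 ^ (4 - Suc k) * psub ?h (\<eta> l)" for l
  have der: "\<eta> \<in> derivations 4" and dvd: "\<And>I. I \<noteq> {} \<Longrightarrow> I \<subseteq> {1..4} \<Longrightarrow> vs I dvd (\<Sum>i\<in>I. \<eta> i)"
    using Suc.prems(2) unfolding Dmod_resonance by blast+
  have psub_vs: "psub ?h (vs I) = vs (I \<inter> {1..3})" if "finite I" for I
    unfolding vs_def psub.hom_sum psub_var using that by (simp add: sum.inter_restrict)
  have f0: "f l = 0" if l: "l \<in> {1..3}" for l
  proof (rule double_resonance[OF _ _ _ l])
    fix l :: nat
    have "homog (4 - Suc k) (var 1 ^ (4 - Suc k))"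
      using homog_prod[of "{..<4 - Suc k}" "\<lambda>_. 1" "\<lambda>_. var 1"] homog_var by simp
    moreover have "homog (Suc k) (psub ?h (\<eta> l))"
      by (rule homog_psub[OF _ Suc.prems(4)]) (use homog_var in auto)
    ultimately show "homog 4 (f l)" unfolding f_def using homog_mult Suc.prems(1) by fastforce
    show "f l \<in> polys_over {1..3}" unfolding f_def
      by (intro polys_over_mult polys_over_power polys_over_var psub_polys_over[of _ UNIV])
        (auto intro: polys_over_var)
  next
    fix I :: "nat set" assume I: "I \<noteq> {}" "I \<subseteq> {1..3}"
    have fin: "finite I" using I(2) finite_subset by blast
    have n4: "4 \<notin> I" using I(2) by auto
    have I4: "I \<subseteq> {1..4}" "insert 4 I \<subseteq> {1..4}" using I(2) by auto
    let ?S = "\<Sum>i\<in>I. \<eta> i"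
    have "vs I dvd ?S" using dvd[OF I(1) I4(1)] .
    then obtain q where q: "?S = vs I * q" by (elim dvdE)
    \<comment> \<open>The two forms are distinct primes, so the second one divides the cofactor of
      the first.\<close>
    have "vs (insert 4 I) dvd ?S" using dvd[OF _ I4(2)] fin n4 Suc.prems(3) by simp
    then have "vs (insert 4 I) dvd q"
      using vs_prime[OF I4(2)] vs_not_dvd[of "insert 4 I" I] fin I(1) n4 unfolding q by auto
    then obtain q' where q': "q = vs (insert 4 I) * q'" by (elim dvdE)
    have "I \<inter> {1..3} = I" "insert 4 I \<inter> {1..3} = I" using I(2) by auto
    then have "psub ?h (vs I) = vs I" "psub ?h (vs (insert 4 I)) = vs I"
      using psub_vs[OF fin] psub_vs[of "insert 4 I"] fin by (simp_all only: finite_insert)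
    then have S: "psub ?h ?S = vs I * vs I * psub ?h q'"
      unfolding q q' psub.hom_mult by (simp only: mult.assoc)
    have "(\<Sum>i\<in>I. f i) = var 1 ^ (4 - Suc k) * psub ?h ?S"
      unfolding f_def psub.hom_sum sum_distrib_left ..
    then have "(\<Sum>i\<in>I. f i) = vs I * vs I * (var 1 ^ (4 - Suc k) * psub ?h q')"
      unfolding S by (simp only: mult_ac)
    then show "vs I * vs I dvd (\<Sum>i\<in>I. f i)" by (simp only: dvd_triv_left)
  qed
  have dv4: "\<exists>q. q \<in> polys_over {1..4} \<and> \<eta> l = var 4 * q" if l: "l \<in> {1..3}" for l
  proof -
    have P: "\<eta> l \<in> polys_over {1..4}" using der l unfolding derivations_def polys_in_over by auto
    have "psub ?h (\<eta> l) = 0" using f0[OF l] unfolding f_def by simp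
    moreover have "var 4 dvd psub (\<lambda>l. if l \<in> {1..4} then var l else 0) (\<eta> l) - psub ?h (\<eta> l)"
    proof (rule psub_cong_dvd)
      fix l :: nat
      show "var 4 dvd (if l \<in> {1..4} then var l else 0) - (if l \<in> {1..3} then var l else 0)"
        by (cases "l = 4") auto
    qed
    moreover have "psub (\<lambda>l. if l \<in> {1..4} then var l else 0) (\<eta> l) = \<eta> l"
      by (rule psub_id_on[OF P]) auto
    ultimately have d: "var 4 dvd \<eta> l" by simp
    have "var 4 \<in> polys_over {1..4}" by (rule polys_over_var) simp
    then show ?thesis using dvd_in_polys[OF _ P d] by blast
  qed
  then have "\<forall>l\<in>{1..3}. \<exists>q. q \<in> polys_over {1..4} \<and> \<eta> l = var 4 * q" by blast
  from bchoice[OF this] obtain q where q: "\<forall>l\<in>{1..3}. q l \<in> polys_over {1..4} \<and> \<eta> l = var 4 * q l" ..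
  define \<eta>' where "\<eta>' l = (if l \<in> {1..3} then q l else 0)" for l
  have e: "\<eta> l = var 4 * \<eta>' l" for l
  proof -
    consider "l \<in> {1..3}" | "l = 4" | "l \<notin> {1..4}" by fastforce
    then show ?thesis using q Suc.prems(3) der unfolding \<eta>'_def derivations_def by cases auto
  qed
  have h': "homog k (\<eta>' l)" for l
    by (rule homog_quotient[OF Suc.prems(4) e homog_var]) simp
  have "\<eta>' \<in> Dmod 4 (resonance 4)" unfolding Dmod_resonance
  proof (intro conjI allI impI)
    show "\<eta>' \<in> derivations 4" unfolding derivations_def polys_in_over \<eta>'_def using q by auto
    fix I :: "nat set" assume I: "I \<noteq> {}" "I \<subseteq> {1..4}"
    have fin: "finite I" using I(2) finite_subset by blast
    have "vs I dvd var 4 * (\<Sum>i\<in>I. \<eta>' i)"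
      using dvd[OF I] unfolding e sum_distrib_left[symmetric] .
    then have "vs I dvd vs {4} \<or> vs I dvd (\<Sum>i\<in>I. \<eta>' i)"
      using vs_prime[OF I(2,1)] by (auto simp: vs_def)
    then show "vs I dvd (\<Sum>i\<in>I. \<eta>' i)"
      using vs_not_dvd[of I "{4}"] fin I(1) by (auto simp: \<eta>'_def)
  qed
  moreover have "\<eta>' 4 = 0" by (simp add: \<eta>'_def)
  ultimately have "\<eta>' i = 0" using Suc.IH[of \<eta>' i] Suc.prems(1,5) h' by simp
  then show ?case using e[of i] by simp
qed

text \<open>Subtracting the multiple of the Euler derivation with the same last entry reduces to
  derivations whose last entry is zero.\<close>

lemma rigid_resonance: "rigid 4 (resonance 4) 4"
proof (rule rigid_exactI)
  fix \<theta> i j assume \<theta>: "\<theta> \<in> Dmod 4 (resonance 4)" "\<And>i. homog 4 (\<theta> i)" and ij: "i \<in> {1..4::nat}" "j \<in> {1..4::nat}"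
  have m4: "(4::nat) \<in> {1..4}" by simp
  have P: "\<theta> l \<in> polys_over {1..4}" if "l \<in> {1..4}" for l
    using \<theta>(1) that unfolding Dmod_iff derivations_def polys_in_over by auto
  have "vs {4} dvd (\<Sum>i\<in>{4}. \<theta> i)" by (rule Dmod_resonanceD[OF \<theta>(1)]) auto
  then have "var 4 dvd \<theta> 4" by (simp add: vs_def)
  then obtain g where g: "g \<in> polys_over {1..4}" "\<theta> 4 = var 4 * g"
    using dvd_in_polys[OF polys_over_var[OF m4] P[OF m4]] by blast
  have hg: "homog 3 g"
    by (rule homog_quotient[OF _ g(2) homog_var]) (use \<theta>(2)[of 4] in \<open>simp_all add: eval_nat_numeral\<close>)
  define \<eta> where "\<eta> l = (if l \<in> {1..4} then \<theta> l - g * var l else 0)" for l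
  have h\<eta>: "homog 4 (\<eta> l)" for l
    using homog_diff[OF \<theta>(2) homog_mult[OF hg homog_var, simplified]] by (auto simp: \<eta>_def)
  have "\<eta> \<in> Dmod 4 (resonance 4)" unfolding Dmod_resonance
  proof (intro conjI allI impI)
    show "\<eta> \<in> derivations 4" unfolding derivations_def polys_in_over \<eta>_def
      using P g(1) by (auto intro!: polys_over_diff polys_over_mult polys_over_var)
    fix I :: "nat set" assume I: "I \<noteq> {}" "I \<subseteq> {1..4}"
    have "(\<Sum>i\<in>I. \<eta> i) = (\<Sum>i\<in>I. \<theta> i - g * var i)"
      using I(2) unfolding \<eta>_def by (intro sum.cong) auto
    also have "\<dots> = (\<Sum>i\<in>I. \<theta> i) - g * vs I"
      by (simp add: sum_subtractf vs_def sum_distrib_left)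
    finally show "vs I dvd (\<Sum>i\<in>I. \<eta> i)"
      using Dmod_resonanceD[OF \<theta>(1) I] by (simp add: dvd_diff)
  qed
  moreover have "\<eta> 4 = 0" using g(2) by (simp add: \<eta>_def mult.commute)
  ultimately have "\<eta> l = 0" if "l \<in> {1..3}" for l
    using resonance_zero[of 4 \<eta> l] h\<eta> that by simp
  with \<open>\<eta> 4 = 0\<close> have "\<theta> l = g * var l" if "l \<in> {1..4}" for l
  proof -
    have "l \<in> {1..3} \<or> l = 4" using that by auto
    then have "\<eta> l = 0" using \<open>\<eta> 4 = 0\<close> \<open>\<And>l. l \<in> {1..3} \<Longrightarrow> \<eta> l = 0\<close> by blast
    then show ?thesis using that by (simp add: \<eta>_def)
  qed
  then show "var i * \<theta> j = var j * \<theta> i" using ij by (simp add: mult_ac)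
qed simp

section \<open>Induced minors\<close>

text \<open>Cuts behave well under contraction, unions and injective images, so later arguments use
  them in place of walks.\<close>

lemma induced_connected_cut:
  "induced_connected E I \<longleftrightarrow> I \<noteq> {} \<and>
    (\<forall>S. S \<subseteq> I \<longrightarrow> S \<noteq> {} \<longrightarrow> S \<noteq> I \<longrightarrow> (\<exists>s\<in>S. \<exists>t\<in>I - S. {s, t} \<in> E))"
proof (intro iffI conjI allI impI)
  fix S assume c: "induced_connected E I" and S: "S \<subseteq> I" "S \<noteq> {}" "S \<noteq> I"
  let ?R = "{(a, b). a \<in> I \<and> b \<in> I \<and> {a, b} \<in> E}"
  show "\<exists>s\<in>S. \<exists>t\<in>I - S. {s, t} \<in> E"
  proof (rule ccontr)
    assume no: "\<not> (\<exists>s\<in>S. \<exists>t\<in>I - S. {s, t} \<in> E)"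
    obtain u v where uv: "u \<in> S" "v \<in> I" "v \<notin> S" using S by blast
    have "(u, v) \<in> ?R\<^sup>*" using c uv S unfolding induced_connected_def by blast
    then have "v \<in> S" by (induction rule: rtrancl_induct) (use uv no in auto)
    with uv show False by simp
  qed
next
  assume c: "I \<noteq> {} \<and> (\<forall>S. S \<subseteq> I \<longrightarrow> S \<noteq> {} \<longrightarrow> S \<noteq> I \<longrightarrow> (\<exists>s\<in>S. \<exists>t\<in>I - S. {s, t} \<in> E))"
  let ?R = "{(a, b). a \<in> I \<and> b \<in> I \<and> {a, b} \<in> E}"
  have "(u, v) \<in> ?R\<^sup>*" if uv: "u \<in> I" "v \<in> I" for u v
  proof -
    let ?S = "{w \<in> I. (u, w) \<in> ?R\<^sup>*}"
    have "\<not> (\<exists>s\<in>?S. \<exists>t\<in>I - ?S. {s, t} \<in> E)"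
      by (auto intro: rtrancl_into_rtrancl)
    moreover have "u \<in> ?S" using uv by auto
    ultimately have "?S = I" using c[THEN conjunct2, rule_format, of ?S] by blast
    then show ?thesis using uv by auto
  qed
  then show "induced_connected E I" using c unfolding induced_connected_def by blast
qed (auto simp: induced_connected_def)

lemma finite_conn_subgraph_arr: "finite (conn_subgraph_arr n E)"
proof -
  have "conn_subgraph_arr n E \<subseteq> ind ` Pow {1..n}" unfolding conn_subgraph_arr_def ind_def by auto
  then show ?thesis by (rule finite_subset) simp
qed

lemma conn_subgraph_arr_ind:
  "conn_subgraph_arr n E = {ind I | I. I \<noteq> {} \<and> I \<subseteq> {1..n} \<and> induced_connected E I}"
  unfolding conn_subgraph_arr_def ind_def ..

lemma arr_conn_subgraph: "arr n (conn_subgraph_arr n E)"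
  unfolding arr_def
proof (intro conjI ballI impI finite_conn_subgraph_arr)
  fix a assume "a \<in> conn_subgraph_arr n E"
  then obtain I where "a = ind I" "I \<noteq> {}" "I \<subseteq> {1..n}" unfolding conn_subgraph_arr_ind by blast
  then show "\<exists>p\<in>{1..n}. a p \<noteq> 0" by (auto simp: ind_def)
next
  fix a b assume ab: "a \<in> conn_subgraph_arr n E" "b \<in> conn_subgraph_arr n E" "a \<noteq> b"
  then obtain I J where IJ: "a = ind I" "I \<noteq> {}" "I \<subseteq> {1..n}" "b = ind J" "J \<noteq> {}" "J \<subseteq> {1..n}"
    unfolding conn_subgraph_arr_ind by blast
  then have "finite I" "finite J" using finite_subset by blast+
  then show "\<not> lin_form n a dvd lin_form n b"
    using IJ ab(3) vs_not_dvd[of I J] by (auto simp: lin_form_ind)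
qed

definition touch :: "nat set set \<Rightarrow> nat set \<Rightarrow> nat set \<Rightarrow> bool" where
  "touch E A B \<longleftrightarrow> (\<exists>u\<in>A. \<exists>w\<in>B. {u, w} \<in> E)"

lemma touch_commute: "touch E A B \<longleftrightarrow> touch E B A"
  unfolding touch_def by (metis insert_commute)

text \<open>\<open>Vs\<close> lists the branch sets of an induced minor whose graph has edge list \<open>es\<close>
  (pairs written with the smaller index first).\<close>

definition minor_model :: "nat set \<Rightarrow> nat set set \<Rightarrow> (nat \<times> nat) list \<Rightarrow> nat set list \<Rightarrow> bool" where
  "minor_model W E es Vs \<longleftrightarrow> (\<forall>A\<in>set Vs. A \<subseteq> W \<and> induced_connected E A) \<and>
    (\<forall>k<length Vs. \<forall>h<k. Vs ! h \<inter> Vs ! k = {} \<and> (touch E (Vs ! h) (Vs ! k) \<longleftrightarrow> (h, k) \<in> set es))"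

definition adjl :: "(nat \<times> nat) list \<Rightarrow> nat \<Rightarrow> nat \<Rightarrow> bool" where
  "adjl es h k \<longleftrightarrow> (h, k) \<in> set es \<or> (k, h) \<in> set es"

definition hcon :: "(nat \<times> nat) list \<Rightarrow> nat set \<Rightarrow> bool" where
  "hcon es K \<longleftrightarrow> K \<noteq> {} \<and> (\<forall>S. S \<subseteq> K \<longrightarrow> S \<noteq> {} \<longrightarrow> S \<noteq> K \<longrightarrow> (\<exists>s\<in>S. \<exists>t\<in>K - S. adjl es s t))"

lemma minor_model_touch:
  assumes "minor_model W E es Vs" "\<forall>(h, k)\<in>set es. h < k" "h < length Vs" "k < length Vs" "h \<noteq> k"
  shows "Vs ! h \<inter> Vs ! k = {}" "touch E (Vs ! h) (Vs ! k) \<longleftrightarrow> adjl es h k"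
proof -
  have "Vs ! h \<inter> Vs ! k = {} \<and> (touch E (Vs ! h) (Vs ! k) \<longleftrightarrow> adjl es h k)"
  proof (cases "h < k")
    case True
    then have "(k, h) \<notin> set es" using assms(2) by fastforce
    then show ?thesis using assms(1,4) True unfolding minor_model_def adjl_def by blast
  next
    case False
    then have "k < h" using assms(5) by simp
    moreover have "(h, k) \<notin> set es" using assms(2) False by fastforce
    ultimately show ?thesis
      using assms(1,3) touch_commute unfolding minor_model_def adjl_def by blast
  qed
  then show "Vs ! h \<inter> Vs ! k = {}" "touch E (Vs ! h) (Vs ! k) \<longleftrightarrow> adjl es h k" by auto
qed

text \<open>A cut of the union that splits a branch set is crossed by an edge inside it. A cut
  splitting no branch set is a union of branch sets and corresponds to a cut of the index set
  \<open>K\<close>.\<close>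

lemma minor_model_connected:
  assumes M: "minor_model W E es Vs" and es: "\<forall>(h, k)\<in>set es. h < k" and K: "K \<subseteq> {..<length Vs}"
  shows "induced_connected E (\<Union>h\<in>K. Vs ! h) \<longleftrightarrow> hcon es K"
proof
  let ?U = "\<Union>h\<in>K. Vs ! h"
  have con: "induced_connected E (Vs ! h)" if "h \<in> K" for h
    using M K that unfolding minor_model_def by (auto simp: set_conv_nth)
  then have ne: "Vs ! h \<noteq> {}" if "h \<in> K" for h using that unfolding induced_connected_def by blast
  have disj: "Vs ! h \<inter> Vs ! k = {}" and tch: "touch E (Vs ! h) (Vs ! k) \<longleftrightarrow> adjl es h k"
    if "h \<in> K" "k \<in> K" "h \<noteq> k" for h k
    using minor_model_touch[OF M es, of h k] K that by auto
  {
    assume H: "hcon es K"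
    show "induced_connected E ?U" unfolding induced_connected_cut
    proof (intro conjI allI impI)
      show "?U \<noteq> {}" using H ne unfolding hcon_def by fastforce
      fix S assume S: "S \<subseteq> ?U" "S \<noteq> {}" "S \<noteq> ?U"
      show "\<exists>s\<in>S. \<exists>t\<in>?U - S. {s, t} \<in> E"
      proof (cases "\<exists>h\<in>K. S \<inter> Vs ! h \<noteq> {} \<and> \<not> Vs ! h \<subseteq> S")
        case True
        then obtain h where h: "h \<in> K" "S \<inter> Vs ! h \<noteq> {}" "S \<inter> Vs ! h \<noteq> Vs ! h" by blast
        then have "\<exists>s\<in>S \<inter> Vs ! h. \<exists>t\<in>Vs ! h - S \<inter> Vs ! h. {s, t} \<in> E"
          using con[OF h(1)] unfolding induced_connected_cut by blast
        then show ?thesis using h(1) by blast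
      next
        case False
        let ?K' = "{h \<in> K. Vs ! h \<subseteq> S}"
        have SU: "S = (\<Union>h\<in>?K'. Vs ! h)"
        proof (intro equalityI subsetI)
          fix x assume x: "x \<in> S"
          then obtain h where h: "h \<in> K" "x \<in> Vs ! h" using S(1) by blast
          then have "Vs ! h \<subseteq> S" using False x by blast
          with h show "x \<in> (\<Union>h\<in>?K'. Vs ! h)" by blast
        qed blast
        have "?K' \<noteq> {}"
        proof
          assume "?K' = {}"
          with SU have "S = {}" by simp
          with S(2) show False by simp
        qed
        moreover have "?K' \<noteq> K"
        proof
          assume "?K' = K"
          with SU have "S = ?U" by simp
          with S(3) show False by simp
        qed
        moreover have "?K' \<subseteq> K" by blast
        ultimately obtain s t where st: "s \<in> ?K'" "t \<in> K - ?K'" "adjl es s t"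
          using H[unfolded hcon_def, THEN conjunct2, rule_format, of ?K'] by blast
        then have "s \<noteq> t" by auto
        then obtain u w where uw: "u \<in> Vs ! s" "w \<in> Vs ! t" "{u, w} \<in> E"
          using tch[of s t] st unfolding touch_def by auto
        moreover have "w \<notin> S" using False st(2) uw(2) by blast
        ultimately show ?thesis using st by blast
      qed
    qed
  }
  {
    assume C: "induced_connected E ?U"
    show "hcon es K" unfolding hcon_def
    proof (intro conjI allI impI)
      show "K \<noteq> {}" using C unfolding induced_connected_def by auto
      fix S assume S: "S \<subseteq> K" "S \<noteq> {}" "S \<noteq> K"
      let ?S = "\<Union>h\<in>S. Vs ! h"
      obtain k where k: "k \<in> K" "k \<notin> S" using S by blast
      have kS: "Vs ! k \<inter> ?S = {}"
      proof -
        have "Vs ! k \<inter> Vs ! h = {}" if "h \<in> S" for h using disj[of k h] k S(1) that by blast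
        then show ?thesis by blast
      qed
      have "?S \<noteq> ?U"
      proof
        assume "?S = ?U"
        moreover have "Vs ! k \<subseteq> ?U" using k(1) by blast
        ultimately have "Vs ! k \<subseteq> ?S" by simp
        with kS ne[OF k(1)] show False by blast
      qed
      moreover have "?S \<noteq> {}"
      proof -
        obtain s where "s \<in> S" using S(2) by blast
        then show ?thesis using ne[of s] S(1) by blast
      qed
      moreover have "?S \<subseteq> ?U" using S(1) by blast
      ultimately obtain u w where uw: "u \<in> ?S" "w \<in> ?U - ?S" "{u, w} \<in> E"
        using C[unfolded induced_connected_cut, THEN conjunct2, rule_format, of ?S] by blast
      from uw(1) obtain s where s: "s \<in> S" "u \<in> Vs ! s" by blast
      from uw(2) obtain t where t: "t \<in> K" "w \<in> Vs ! t" by blast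
      with uw(2) have "t \<notin> S" by blast
      note st = s t this
      then have "touch E (Vs ! s) (Vs ! t)" using uw unfolding touch_def by blast
      moreover have "s \<in> K" "s \<noteq> t" using st S(1) by auto
      ultimately have "adjl es s t" using tch[of s t] st(3) by simp
      then show "\<exists>s\<in>S. \<exists>t\<in>K - S. adjl es s t" using st by blast
    qed
  }
qed

subsection \<open>Certificates\<close>

text \<open>Filtering \<open>K\<close> preserves the order of the list, so equality of vertex sets
  can be tested as equality of lists.\<close>

definition grow :: "(nat \<times> nat) list \<Rightarrow> nat list \<Rightarrow> nat list \<Rightarrow> nat list" where
  "grow es K S = filter (\<lambda>h. h \<in> set S \<or> (\<exists>s\<in>set S. adjl es s h)) K"

definition reach :: "(nat \<times> nat) list \<Rightarrow> nat list \<Rightarrow> nat list" where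
  "reach es K = (grow es K ^^ length K) [hd K]"

lemma reach_subset:
  assumes "T \<subseteq> set K" "hd K \<in> T" "\<And>s t. s \<in> T \<Longrightarrow> t \<in> set K - T \<Longrightarrow> \<not> adjl es s t"
  shows "set (reach es K) \<subseteq> T"
proof -
  have "set ((grow es K ^^ i) [hd K]) \<subseteq> T" for i
  proof (induction i)
    case (Suc i)
    then show ?case using assms unfolding funpow.simps o_def grow_def by fastforce
  qed (use assms in auto)
  then show ?thesis by (simp add: reach_def)
qed

text \<open>An uncrossed cut traps the search on the side containing \<open>hd K\<close>, so the
  search could not have filled \<open>K\<close>.\<close>

lemma reach_hcon:
  assumes "K \<noteq> []" "reach es K = K" shows "hcon es (set K)"
  unfolding hcon_def
proof (intro conjI allI impI)
  fix S assume S: "S \<subseteq> set K" "S \<noteq> {}" "S \<noteq> set K"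
  have sym: "adjl es s t \<longleftrightarrow> adjl es t s" for s t by (auto simp: adjl_def)
  show "\<exists>s\<in>S. \<exists>t\<in>set K - S. adjl es s t"
  proof (rule ccontr)
    assume no: "\<not> (\<exists>s\<in>S. \<exists>t\<in>set K - S. adjl es s t)"
    show False
    proof (cases "hd K \<in> S")
      case True
      then have "set K \<subseteq> S" using reach_subset[of S K es] S no assms(2) by auto
      with S show False by blast
    next
      case False
      then have "hd K \<in> set K - S" using assms(1) by simp
      then have "set K \<subseteq> set K - S"
        using reach_subset[of "set K - S" K es] no sym assms(2) by auto
      with S show False by blast
    qed
  qed
qed (use assms in simp)

text \<open>A proper nonempty part stable under \<open>grow\<close> is a cut without crossing
  edges.\<close>

lemma closed_not_hcon:
  assumes "R = reach es K" "grow es K R = R" "R \<noteq> K" "R \<noteq> []" shows "\<not> hcon es (set K)"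
proof
  assume H: "hcon es (set K)"
  have sub: "set R \<subseteq> set K" using assms(2) unfolding grow_def by (metis filter_is_subset)
  have "set R \<noteq> set K"
  proof
    assume "set R = set K"
    then have "grow es K R = K" unfolding grow_def by simp
    with assms show False by simp
  qed
  then obtain s t where st: "s \<in> set R" "t \<in> set K - set R" "adjl es s t"
    using H sub assms(4) unfolding hcon_def by (metis set_empty)
  then have "t \<in> set (grow es K R)" unfolding grow_def by auto
  with st assms(2) show False by simp
qed

definition comb :: "int list list \<Rightarrow> int list \<Rightarrow> nat \<Rightarrow> int" where
  "comb C \<beta> h = sum_list (map (\<lambda>j. \<beta> ! j * C ! j ! h) [0..<length C])"

text \<open>Rows of \<open>C\<close> are linear forms on the vertices of a minor and \<open>D\<close> is a right inverse of \<open>C\<close>. The check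
  is that the connected vertex sets whose indicator lies in the row space of \<open>C\<close> are exactly the combinations
  of rows given by \<open>B\<close>, so that \<open>B\<close> is the localization in the coordinates \<open>C\<close>.\<close>

definition certificate :: "nat \<Rightarrow> (nat \<times> nat) list \<Rightarrow> int list list \<Rightarrow> int list list \<Rightarrow> int list list \<Rightarrow> bool" where
  "certificate m es C D B \<longleftrightarrow>
    list_all (\<lambda>(h, k). h < k) es \<and>
    list_all (\<lambda>j. list_all (\<lambda>l. sum_list (map (\<lambda>h. C ! j ! h * D ! h ! l) [0..<m]) = (if j = l then 1 else 0))
      [0..<length C]) [0..<length C] \<and>
    list_all (\<lambda>\<beta>. let K = filter (\<lambda>h. comb C \<beta> h = 1) [0..<m] in
      K \<noteq> [] \<and> reach es K = K \<and> list_all (\<lambda>h. comb C \<beta> h = 0 \<or> comb C \<beta> h = 1) [0..<m]) B \<and>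
    list_all (\<lambda>bs. let K = filter (\<lambda>h. bs ! h) [0..<m] in K = [] \<or>
      (let \<beta> = map (\<lambda>j. sum_list (map (\<lambda>h. D ! h ! j) K)) [0..<length C] in
        list_ex (\<lambda>h. comb C \<beta> h \<noteq> (if bs ! h then 1 else 0)) [0..<m] \<or> \<beta> \<in> set B \<or>
        (let R = reach es K in R \<noteq> [] \<and> R \<noteq> K \<and> grow es K R = R)))
      (List.n_lists m [False, True])"

text \<open>Lists count from 0 and coordinates from 1. The value 0 elsewhere makes vectors
  comparable as functions.\<close>

definition bvec :: "int list \<Rightarrow> nat \<Rightarrow> rat" where
  "bvec \<beta> j = (if 1 \<le> j \<and> j \<le> length \<beta> then of_int (\<beta> ! (j - 1)) else 0)"

lemma n_lists_map: "map f [0..<m] \<in> set (List.n_lists m [False, True])"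
proof -
  have "set (map f [0..<m]) \<subseteq> {False, True}" by auto
  then show ?thesis unfolding set_n_lists by auto
qed

text \<open>Rows of \<open>C\<close> become forms constant on branch sets and zero outside them;
  columns of \<open>D\<close> become vectors supported on one representative per branch set. A
  connected set whose indicator lies in the flat is then a union of branch sets, determined by the
  representatives it contains, and the finite check runs over all choices of them.\<close>

theorem certificate_not_free:
  assumes M: "minor_model {1..n} E es Vs" and m: "length Vs = m"
    and cert: "certificate m es C D B" and len: "\<forall>\<beta>\<in>set B. length \<beta> = length C"
    and r: "2 \<le> length C" and rigid: "rigid (length C) (bvec ` set B) d"
    and card: "length B \<le> (length C - 1) * (d + 1)"
  shows "\<not> free_arrangement n (conn_subgraph_arr n E)"
proof
  assume free: "free_arrangement n (conn_subgraph_arr n E)"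
  define r where "r = length C"
  have es: "\<forall>(h, k)\<in>set es. h < k" using cert by (auto simp: certificate_def list_all_iff)
  have con: "induced_connected E (Vs ! h)" and VW: "Vs ! h \<subseteq> {1..n}" if "h < m" for h
    using M m that unfolding minor_model_def by (auto simp: set_conv_nth)
  then have ne: "Vs ! h \<noteq> {}" if "h < m" for h using that unfolding induced_connected_def by blast
  define rp where "rp h = (SOME u. u \<in> Vs ! h)" for h
  have rp: "rp h \<in> Vs ! h" if "h < m" for h unfolding rp_def using ne[OF that] some_in_eq by blast
  have disj: "Vs ! h \<inter> Vs ! k = {}" if "h < m" "k < m" "h \<noteq> k" for h k
    using minor_model_touch(1)[OF M es] that m by auto
  define \<psi> where "\<psi> j i = (\<Sum>h<m. of_int (C ! (j - 1) ! h) * ind (Vs ! h) i)" for j i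
  define \<sigma> where "\<sigma> l i = (\<Sum>h<m. of_int (D ! h ! (l - 1)) * (if i = rp h then 1 else 0 :: rat))" for l i
  have ind_rp: "ind (Vs ! h) (rp k) = (if h = k then 1 else 0)" if "h < m" "k < m" for h k
    using rp[OF that(2)] disj[OF that] by (auto simp: ind_def)
  have \<psi>_at: "\<psi> j i = of_int (C ! (j - 1) ! h)" if "h < m" "i \<in> Vs ! h" for j i h
  proof -
    have "\<psi> j i = (\<Sum>k<m. if k = h then of_int (C ! (j - 1) ! h) else 0)"
      unfolding \<psi>_def by (rule sum.cong) (use that disj[of h] in \<open>auto simp: ind_def\<close>)
    then show ?thesis using that by simp
  qed
  have \<psi>_out: "\<psi> j i = 0" if "\<And>h. h < m \<Longrightarrow> i \<notin> Vs ! h" for j i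
    unfolding \<psi>_def using that by (intro sum.neutral) (auto simp: ind_def)
  have dot_\<sigma>: "dot n a (\<sigma> l) = (\<Sum>h<m. of_int (D ! h ! (l - 1)) * a (rp h))" for a l
  proof -
    have "dot n a (\<sigma> l) = (\<Sum>h<m. \<Sum>i\<in>{1..n}. of_int (D ! h ! (l - 1)) * (if i = rp h then a i else 0))"
      unfolding dot_def \<sigma>_def sum_distrib_left by (subst sum.swap) (intro sum.cong refl, auto)
    also have "\<dots> = (\<Sum>h<m. of_int (D ! h ! (l - 1)) * a (rp h))"
    proof (rule sum.cong[OF refl])
      fix h assume "h \<in> {..<m}"
      then have "rp h \<in> {1..n}" using rp VW by blast
      then show "(\<Sum>i\<in>{1..n}. of_int (D ! h ! (l - 1)) * (if i = rp h then a i else 0))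
          = of_int (D ! h ! (l - 1)) * a (rp h)" by (simp add: sum_distrib_left[symmetric])
    qed
    finally show ?thesis .
  qed
  have sl: "sum_list (map f [0..<k]) = (\<Sum>h<k. f h)" for f :: "nat \<Rightarrow> int" and k
    by (simp add: interv_sum_list_conv_sum_set_nat lessThan_atLeast0)
  have dual: "dot n (\<psi> j) (\<sigma> l) = (if j = l then 1 else 0)" if jl: "j \<in> {1..r}" "l \<in> {1..r}" for j l
  proof -
    have "dot n (\<psi> j) (\<sigma> l) = (\<Sum>h<m. of_int (C ! (j - 1) ! h * D ! h ! (l - 1)))"
      unfolding dot_\<sigma> by (rule sum.cong) (auto simp: \<psi>_at[OF _ rp])
    also have "\<dots> = of_int (\<Sum>h<m. C ! (j - 1) ! h * D ! h ! (l - 1))" by simp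
    also have "(\<Sum>h<m. C ! (j - 1) ! h * D ! h ! (l - 1)) = (if j - 1 = l - 1 then 1 else 0)"
    proof -
      have "j - 1 < length C" "l - 1 < length C" using jl by (auto simp: r_def)
      then show ?thesis using cert unfolding certificate_def list_all_iff sl by auto
    qed
    finally show ?thesis using jl by auto
  qed
  have comb: "comb C \<beta> h = (\<Sum>j<r. \<beta> ! j * C ! j ! h)" for \<beta> h
    unfolding comb_def sl r_def ..
  have pb: "(\<Sum>j\<in>{1..r}. bvec \<beta> j * \<psi> j i) = of_int (comb C \<beta> h)"
    if "length \<beta> = r" "h < m" "i \<in> Vs ! h" for \<beta> i h
    unfolding One_nat_def sum_1_n comb using that by (auto simp: \<psi>_at[OF that(2,3)] bvec_def intro!: sum.cong)
  have pb0: "(\<Sum>j\<in>{1..r}. b j * \<psi> j i) = 0" if "\<And>h. h < m \<Longrightarrow> i \<notin> Vs ! h" for b i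
    using \<psi>_out[OF that] by (intro sum.neutral) auto
  have unionI: "ind (\<Union>h\<in>K. Vs ! h) i = (\<Sum>j\<in>{1..r}. bvec \<beta> j * \<psi> j i)"
    if K: "K \<subseteq> {..<m}" and \<beta>: "length \<beta> = r" "\<And>h. h < m \<Longrightarrow> comb C \<beta> h = (if h \<in> K then 1 else 0)" for K \<beta> i
  proof (cases "\<exists>h<m. i \<in> Vs ! h")
    case True
    then obtain h where h: "h < m" "i \<in> Vs ! h" by blast
    then have "i \<in> (\<Union>h\<in>K. Vs ! h) \<longleftrightarrow> h \<in> K" using disj K by blast
    then show ?thesis unfolding pb[OF \<beta>(1) h] \<beta>(2)[OF h(1)] by (simp add: ind_def)
  next
    case False
    then have "i \<notin> (\<Union>h\<in>K. Vs ! h)" using K by blast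
    then show ?thesis using pb0[of i "bvec \<beta>"] False by (simp add: ind_def)
  qed
  show False
  proof (rule obstruction[OF arr_conn_subgraph free, of r \<psi> \<sigma> "bvec ` set B" d])
    show "2 \<le> r" using r by (simp add: r_def)
    show "dot n (\<psi> j) (\<sigma> l) = (if j = l then 1 else 0)" if "j \<in> {1..r}" "l \<in> {1..r}" for j l
      using dual[OF that] .
    show "finite (bvec ` set B)" by simp
    show "rigid r (bvec ` set B) d" using rigid by (simp add: r_def)
    have "card (bvec ` set B) \<le> length B"
      using card_image_le[of "set B" bvec] card_length[of B] by simp
    then show "card (bvec ` set B) \<le> (r - 1) * (d + 1)" using card by (simp add: r_def)
  next
    fix b assume "b \<in> bvec ` set B"
    then obtain \<beta> where \<beta>: "\<beta> \<in> set B" "b = bvec \<beta>" by blast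
    then have l: "length \<beta> = r" using len by (simp add: r_def)
    define K where "K = filter (\<lambda>h. comb C \<beta> h = 1) [0..<m]"
    have K: "K \<noteq> []" "reach es K = K" "\<And>h. h < m \<Longrightarrow> comb C \<beta> h = 0 \<or> comb C \<beta> h = 1"
      using cert \<beta>(1) unfolding certificate_def list_all_iff K_def Let_def by auto
    have Km: "set K \<subseteq> {..<m}" by (auto simp: K_def)
    have "hcon es (set K)" by (rule reach_hcon[OF K(1,2)])
    then have c: "induced_connected E (\<Union>h\<in>set K. Vs ! h)"
      using minor_model_connected[OF M es] Km m by simp
    moreover have "(\<Union>h\<in>set K. Vs ! h) \<subseteq> {1..n}" using VW Km by blast
    ultimately have "ind (\<Union>h\<in>set K. Vs ! h) \<in> conn_subgraph_arr n E"
      unfolding conn_subgraph_arr_ind induced_connected_def by blast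
    moreover have "comb C \<beta> h = (if h \<in> set K then 1 else 0)" if "h < m" for h
      using K(3)[OF that] that by (auto simp: K_def)
    then have "ind (\<Union>h\<in>set K. Vs ! h) i = (\<Sum>j\<in>{1..r}. b j * \<psi> j i)" for i
      using unionI[OF Km l] \<beta>(2) by blast
    ultimately show "\<exists>a\<in>conn_subgraph_arr n E. \<forall>i\<in>{1..n}. a i = (\<Sum>j\<in>{1..r}. b j * \<psi> j i)" by blast
  next
    fix a assume a: "a \<in> conn_subgraph_arr n E" and fl: "\<forall>i\<in>{1..n}. a i = (\<Sum>j\<in>{1..r}. dot n a (\<sigma> j) * \<psi> j i)"
    obtain I where I: "a = ind I" "I \<noteq> {}" "I \<subseteq> {1..n}" "induced_connected E I"
      using a unfolding conn_subgraph_arr_ind by blast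
    define bs where "bs = map (\<lambda>h. rp h \<in> I) [0..<m]"
    define K where "K = filter (\<lambda>h. bs ! h) [0..<m]"
    define \<beta> where "\<beta> = map (\<lambda>j. sum_list (map (\<lambda>h. D ! h ! j) K)) [0..<length C]"
    have Ks: "set K = {h. h < m \<and> rp h \<in> I}" by (auto simp: K_def bs_def)
    then have Km: "set K \<subseteq> {..<m}" by auto
    have l: "length \<beta> = r" by (simp add: \<beta>_def r_def)
    have "bvec \<beta> j = dot n a (\<sigma> j)" if j: "j \<in> {1..r}" for j
    proof -
      have "distinct K" by (simp add: K_def)
      moreover have "j - 1 < length C" using j by (auto simp: r_def)
      ultimately have "\<beta> ! (j - 1) = (\<Sum>h\<in>set K. D ! h ! (j - 1))"
        by (simp add: \<beta>_def sum_list_distinct_conv_sum_set)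
      also have "\<dots> = (\<Sum>h<m. D ! h ! (j - 1) * (if rp h \<in> I then 1 else 0))"
        unfolding Ks by (rule sum.mono_neutral_cong_left) auto
      finally have "\<beta> ! (j - 1) = (\<Sum>h<m. D ! h ! (j - 1) * (if rp h \<in> I then 1 else 0))" .
      then have "bvec \<beta> j = of_int (\<Sum>h<m. D ! h ! (j - 1) * (if rp h \<in> I then 1 else 0))"
        using j l by (simp add: bvec_def)
      also have "\<dots> = (\<Sum>h<m. of_int (D ! h ! (j - 1)) * ind I (rp h))"
        unfolding of_int_sum by (intro sum.cong refl) (simp add: ind_def)
      finally show ?thesis unfolding dot_\<sigma> I(1) .
    qed
    then have fl': "ind I i = (\<Sum>j\<in>{1..r}. bvec \<beta> j * \<psi> j i)" if "i \<in> {1..n}" for i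
      using fl that I(1) by auto
    have cb: "comb C \<beta> h = (if h \<in> set K then 1 else 0)" if h: "h < m" for h
    proof -
      have "rp h \<in> {1..n}" using rp[OF h] VW[OF h] by blast
      then have "ind I (rp h) = of_int (comb C \<beta> h)" using fl' pb[OF l h rp[OF h]] by simp
      then have "of_int (comb C \<beta> h) = (of_int (if h \<in> set K then 1 else 0) :: rat)"
        using h by (simp add: Ks ind_def split: if_splits)
      then show ?thesis by linarith
    qed
    have eq: "ind (\<Union>h\<in>set K. Vs ! h) i = (\<Sum>j\<in>{1..r}. bvec \<beta> j * \<psi> j i)" for i
      by (rule unionI[OF Km l cb])
    \<comment> \<open>Both indicators are the same combination of the rows, so membership of a
      representative decides the whole branch set.\<close>
    have IU: "I = (\<Union>h\<in>set K. Vs ! h)"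
    proof (rule Set.set_eqI)
      fix i
      show "i \<in> I \<longleftrightarrow> i \<in> (\<Union>h\<in>set K. Vs ! h)"
      proof (cases "i \<in> {1..n}")
        case True
        then have "ind I i = ind (\<Union>h\<in>set K. Vs ! h) i" using fl' eq by simp
        then show ?thesis by (auto simp: ind_def split: if_splits)
      next
        case False
        then show ?thesis using I(3) VW Km by blast
      qed
    qed
    have hc: "hcon es (set K)" using I(4) minor_model_connected[OF M es] Km m unfolding IU by simp
    then have Kne: "K \<noteq> []" by (auto simp: hcon_def)
    have "bs \<in> set (List.n_lists m [False, True])" unfolding bs_def by (rule n_lists_map)
    then have "list_ex (\<lambda>h. comb C \<beta> h \<noteq> (if bs ! h then 1 else 0)) [0..<m] \<or> \<beta> \<in> set B \<or>
        (let R = reach es K in R \<noteq> [] \<and> R \<noteq> K \<and> grow es K R = R)"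
      using cert Kne unfolding certificate_def list_all_iff Let_def K_def \<beta>_def by blast
    moreover have "\<not> list_ex (\<lambda>h. comb C \<beta> h \<noteq> (if bs ! h then 1 else 0)) [0..<m]"
      using cb unfolding list_ex_iff by (auto simp: K_def)
    moreover have "\<not> (let R = reach es K in R \<noteq> [] \<and> R \<noteq> K \<and> grow es K R = R)"
      using closed_not_hcon[OF refl, of es K] hc unfolding Let_def by blast
    ultimately have "\<beta> \<in> set B" by simp
    then show "\<exists>b\<in>bvec ` set B. \<forall>i\<in>{1..n}. a i = (\<Sum>j\<in>{1..r}. b j * \<psi> j i)"
      using fl' I(1) by blast
  qed
qed

subsection \<open>The forbidden induced minors\<close>

lemma rigid_mono: "A \<subseteq> B \<Longrightarrow> rigid r A d \<Longrightarrow> rigid r B d"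
  unfolding rigid_def Dmod_iff by (meson subsetD)

lemma rigid_unit_vectors:
  assumes "2 \<le> r" "\<And>j. j < r \<Longrightarrow> bvec (map (\<lambda>i. if i = j then 1 else 0) [0..<r]) \<in> B"
    and "\<gamma> \<in> B" "\<And>j. j \<in> {1..r} \<Longrightarrow> \<gamma> j \<noteq> 0"
  shows "rigid r B 1"
proof (rule rigid_circuit[OF assms(1) _ _ assms(3)])
  show "\<gamma> j \<noteq> 0" if "j \<in> {1..r}" for j using assms(4) that .
  show "ind {j} \<in> B" if j: "j \<in> {1..r}" for j
  proof -
    have "bvec (map (\<lambda>i. if i = j - 1 then 1 else 0) [0..<r]) = ind {j}"
      using j by (auto simp: bvec_def ind_def fun_eq_iff)
    then show ?thesis using assms(2)[of "j - 1"] j by auto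
  qed
qed

definition complete4_edges :: "(nat \<times> nat) list" where
  "complete4_edges = [(0, 1), (0, 2), (0, 3), (1, 2), (1, 3), (2, 3)]"

definition diamond_edges :: "(nat \<times> nat) list" where
  "diamond_edges = [(0, 1), (0, 2), (1, 2), (1, 3), (2, 3)]"

definition square_pendant_edges :: "(nat \<times> nat) list" where
  "square_pendant_edges = [(0, 1), (0, 3), (0, 4), (1, 2), (2, 3)]"

definition star4_edges :: "(nat \<times> nat) list" where
  "star4_edges = [(0, 1), (0, 2), (0, 3), (0, 4)]"

definition cricket_edges :: "(nat \<times> nat) list" where
  "cricket_edges = [(0, 1), (0, 2), (0, 3), (0, 4), (1, 2)]"

definition butterfly_edges :: "(nat \<times> nat) list" where
  "butterfly_edges = [(0, 1), (0, 2), (0, 3), (0, 4), (1, 2), (3, 4)]"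

definition net_edges :: "(nat \<times> nat) list" where
  "net_edges = [(0, 1), (0, 2), (0, 3), (1, 2), (1, 4), (2, 5)]"

definition spider_edges :: "(nat \<times> nat) list" where
  "spider_edges = [(0, 1), (0, 3), (0, 5), (1, 2), (3, 4), (5, 6)]"

text \<open>The flat comes from the relation {0,1} + {0,2,3,4} = {0,3} + {0,1,2,4} between
  indicators of connected sets. By the certificate no other connected set lies in their span, so the
  localization consists of four planes in general position in rank 3.\<close>

lemma square_pendant_not_free:
  assumes "minor_model {1..n} E square_pendant_edges [V0, V1, V2, V3, V4]"
  shows "\<not> free_arrangement n (conn_subgraph_arr n E)"
proof (rule certificate_not_free[OF assms refl, where d = 1 and
    C = "[[1, 1, 0, 0, 0], [1, 0, 0, 1, 0], [1, 1, 1, 0, 1]]" and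
    D = "[[0, 1, 0], [1, -1, 0], [-1, 0, 1], [0, 0, 0], [0, 0, 0]]" and
    B = "[[1, 0, 0], [0, 1, 0], [0, 0, 1], [-1, 1, 1]]"])
  show "certificate (length [V0, V1, V2, V3, V4]) square_pendant_edges [[1, 1, 0, 0, 0], [1, 0, 0, 1, 0], [1, 1, 1, 0, 1]]
    [[0, 1, 0], [1, -1, 0], [-1, 0, 1], [0, 0, 0], [0, 0, 0]] [[1, 0, 0], [0, 1, 0], [0, 0, 1], [-1, 1, 1]]"
    unfolding square_pendant_edges_def list.size One_nat_def[symmetric] add_0 by code_simp
  show "rigid (length [[1, 1, 0, 0, 0], [1, 0, 0, 1, 0], [1, 1, 1, 0, 1]]) (bvec ` set [[1, 0, 0], [0, 1, 0], [0, 0, 1], [-1, 1, 1]]) 1"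
  proof (rule rigid_unit_vectors[where \<gamma> = "bvec [-1, 1, 1]"])
    fix j assume "j < length [[1, 1, 0, 0, 0], [1, 0, 0, 1, 0], [1, 1, 1, 0, 1]]"
    then have "j \<in> {0, 1, 2}" by auto
    then show "bvec (map (\<lambda>i. if i = j then 1 else 0) [0..<length [[1, 1, 0, 0, 0], [1, 0, 0, 1, 0], [1, 1, 1, 0, 1]]]) \<in> bvec ` set [[1, 0, 0], [0, 1, 0], [0, 0, 1], [-1, 1, 1]]"
      by (auto simp: upt_rec)
  next
    fix j assume "j \<in> {1..length [[1, 1, 0, 0, 0], [1, 0, 0, 1, 0], [1, 1, 1, 0, 1]]}"
    then have "j \<in> {1, 2, 3}" by auto
    then show "bvec [-1, 1, 1] j \<noteq> 0" by (auto simp: bvec_def)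
  qed auto
qed auto

text \<open>Relation between connected sets: {0} + {0,1,2,3,4} = {0,1,2} + {0,3,4}.\<close>

lemma star4_not_free:
  assumes "minor_model {1..n} E star4_edges [V0, V1, V2, V3, V4]"
  shows "\<not> free_arrangement n (conn_subgraph_arr n E)"
proof (rule certificate_not_free[OF assms refl, where d = 1 and
    C = "[[1, 0, 0, 0, 0], [1, 1, 1, 0, 0], [1, 0, 0, 1, 1]]" and
    D = "[[1, 0, 0], [-1, 1, 0], [0, 0, 0], [-1, 0, 1], [0, 0, 0]]" and
    B = "[[1, 0, 0], [0, 1, 0], [0, 0, 1], [-1, 1, 1]]"])
  show "certificate (length [V0, V1, V2, V3, V4]) star4_edges [[1, 0, 0, 0, 0], [1, 1, 1, 0, 0], [1, 0, 0, 1, 1]]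
    [[1, 0, 0], [-1, 1, 0], [0, 0, 0], [-1, 0, 1], [0, 0, 0]] [[1, 0, 0], [0, 1, 0], [0, 0, 1], [-1, 1, 1]]"
    unfolding star4_edges_def list.size One_nat_def[symmetric] add_0 by code_simp
  show "rigid (length [[1, 0, 0, 0, 0], [1, 1, 1, 0, 0], [1, 0, 0, 1, 1]]) (bvec ` set [[1, 0, 0], [0, 1, 0], [0, 0, 1], [-1, 1, 1]]) 1"
  proof (rule rigid_unit_vectors[where \<gamma> = "bvec [-1, 1, 1]"])
    fix j assume "j < length [[1, 0, 0, 0, 0], [1, 1, 1, 0, 0], [1, 0, 0, 1, 1]]"
    then have "j \<in> {0, 1, 2}" by auto
    then show "bvec (map (\<lambda>i. if i = j then 1 else 0) [0..<length [[1, 0, 0, 0, 0], [1, 1, 1, 0, 0], [1, 0, 0, 1, 1]]]) \<in> bvec ` set [[1, 0, 0], [0, 1, 0], [0, 0, 1], [-1, 1, 1]]"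
      by (auto simp: upt_rec)
  next
    fix j assume "j \<in> {1..length [[1, 0, 0, 0, 0], [1, 1, 1, 0, 0], [1, 0, 0, 1, 1]]}"
    then have "j \<in> {1, 2, 3}" by auto
    then show "bvec [-1, 1, 1] j \<noteq> 0" by (auto simp: bvec_def)
  qed auto
qed auto

text \<open>Relation between connected sets: {0} + {0,1,2,3,4} = {0,1,3} + {0,2,4}. The pairing
  separates the adjacent vertices 1 and 2, as {1,2} would otherwise be a further connected set in
  the flat.\<close>

lemma cricket_not_free:
  assumes "minor_model {1..n} E cricket_edges [V0, V1, V2, V3, V4]"
  shows "\<not> free_arrangement n (conn_subgraph_arr n E)"
proof (rule certificate_not_free[OF assms refl, where d = 1 and
    C = "[[1, 0, 0, 0, 0], [1, 1, 0, 1, 0], [1, 0, 1, 0, 1]]" and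
    D = "[[1, 0, 0], [-1, 1, 0], [-1, 0, 1], [0, 0, 0], [0, 0, 0]]" and
    B = "[[1, 0, 0], [0, 1, 0], [0, 0, 1], [-1, 1, 1]]"])
  show "certificate (length [V0, V1, V2, V3, V4]) cricket_edges [[1, 0, 0, 0, 0], [1, 1, 0, 1, 0], [1, 0, 1, 0, 1]]
    [[1, 0, 0], [-1, 1, 0], [-1, 0, 1], [0, 0, 0], [0, 0, 0]] [[1, 0, 0], [0, 1, 0], [0, 0, 1], [-1, 1, 1]]"
    unfolding cricket_edges_def list.size One_nat_def[symmetric] add_0 by code_simp
  show "rigid (length [[1, 0, 0, 0, 0], [1, 1, 0, 1, 0], [1, 0, 1, 0, 1]]) (bvec ` set [[1, 0, 0], [0, 1, 0], [0, 0, 1], [-1, 1, 1]]) 1"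
  proof (rule rigid_unit_vectors[where \<gamma> = "bvec [-1, 1, 1]"])
    fix j assume "j < length [[1, 0, 0, 0, 0], [1, 1, 0, 1, 0], [1, 0, 1, 0, 1]]"
    then have "j \<in> {0, 1, 2}" by auto
    then show "bvec (map (\<lambda>i. if i = j then 1 else 0) [0..<length [[1, 0, 0, 0, 0], [1, 1, 0, 1, 0], [1, 0, 1, 0, 1]]]) \<in> bvec ` set [[1, 0, 0], [0, 1, 0], [0, 0, 1], [-1, 1, 1]]"
      by (auto simp: upt_rec)
  next
    fix j assume "j \<in> {1..length [[1, 0, 0, 0, 0], [1, 1, 0, 1, 0], [1, 0, 1, 0, 1]]}"
    then have "j \<in> {1, 2, 3}" by auto
    then show "bvec [-1, 1, 1] j \<noteq> 0" by (auto simp: bvec_def)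
  qed auto
qed auto

text \<open>Same relation as for the cricket; the pairing separates both of the edges 12 and
  34.\<close>

lemma butterfly_not_free:
  assumes "minor_model {1..n} E butterfly_edges [V0, V1, V2, V3, V4]"
  shows "\<not> free_arrangement n (conn_subgraph_arr n E)"
proof (rule certificate_not_free[OF assms refl, where d = 1 and
    C = "[[1, 0, 0, 0, 0], [1, 1, 0, 1, 0], [1, 0, 1, 0, 1]]" and
    D = "[[1, 0, 0], [-1, 1, 0], [-1, 0, 1], [0, 0, 0], [0, 0, 0]]" and
    B = "[[1, 0, 0], [0, 1, 0], [0, 0, 1], [-1, 1, 1]]"])
  show "certificate (length [V0, V1, V2, V3, V4]) butterfly_edges [[1, 0, 0, 0, 0], [1, 1, 0, 1, 0], [1, 0, 1, 0, 1]]
    [[1, 0, 0], [-1, 1, 0], [-1, 0, 1], [0, 0, 0], [0, 0, 0]] [[1, 0, 0], [0, 1, 0], [0, 0, 1], [-1, 1, 1]]"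
    unfolding butterfly_edges_def list.size One_nat_def[symmetric] add_0 by code_simp
  show "rigid (length [[1, 0, 0, 0, 0], [1, 1, 0, 1, 0], [1, 0, 1, 0, 1]]) (bvec ` set [[1, 0, 0], [0, 1, 0], [0, 0, 1], [-1, 1, 1]]) 1"
  proof (rule rigid_unit_vectors[where \<gamma> = "bvec [-1, 1, 1]"])
    fix j assume "j < length [[1, 0, 0, 0, 0], [1, 1, 0, 1, 0], [1, 0, 1, 0, 1]]"
    then have "j \<in> {0, 1, 2}" by auto
    then show "bvec (map (\<lambda>i. if i = j then 1 else 0) [0..<length [[1, 0, 0, 0, 0], [1, 1, 0, 1, 0], [1, 0, 1, 0, 1]]]) \<in> bvec ` set [[1, 0, 0], [0, 1, 0], [0, 0, 1], [-1, 1, 1]]"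
      by (auto simp: upt_rec)
  next
    fix j assume "j \<in> {1..length [[1, 0, 0, 0, 0], [1, 1, 0, 1, 0], [1, 0, 1, 0, 1]]}"
    then have "j \<in> {1, 2, 3}" by auto
    then show "bvec [-1, 1, 1] j \<noteq> 0" by (auto simp: bvec_def)
  qed auto
qed auto

text \<open>Relation between connected sets, in rank 4: {0,1} + {0,2,3} + {1,2,4,5} = {0,1,2,4} +
  {0,1,2,3,5}.\<close>

lemma net_not_free:
  assumes "minor_model {1..n} E net_edges [V0, V1, V2, V3, V4, V5]"
  shows "\<not> free_arrangement n (conn_subgraph_arr n E)"
proof (rule certificate_not_free[OF assms refl, where d = 1 and
    C = "[[1, 1, 0, 0, 0, 0], [1, 0, 1, 1, 0, 0], [1, 1, 1, 0, 1, 0], [1, 1, 1, 1, 0, 1]]" and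
    D = "[[1, 1, 0, -1], [0, -1, 0, 1], [-1, 0, 1, 0], [0, 0, -1, 1], [0, 0, 0, 0], [0, 0, 0, 0]]" and
    B = "[[1, 0, 0, 0], [0, 1, 0, 0], [0, 0, 1, 0], [0, 0, 0, 1], [-1, -1, 1, 1]]"])
  show "certificate (length [V0, V1, V2, V3, V4, V5]) net_edges [[1, 1, 0, 0, 0, 0], [1, 0, 1, 1, 0, 0], [1, 1, 1, 0, 1, 0], [1, 1, 1, 1, 0, 1]]
    [[1, 1, 0, -1], [0, -1, 0, 1], [-1, 0, 1, 0], [0, 0, -1, 1], [0, 0, 0, 0], [0, 0, 0, 0]] [[1, 0, 0, 0], [0, 1, 0, 0], [0, 0, 1, 0], [0, 0, 0, 1], [-1, -1, 1, 1]]"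
    unfolding net_edges_def list.size One_nat_def[symmetric] add_0 by code_simp
  show "rigid (length [[1, 1, 0, 0, 0, 0], [1, 0, 1, 1, 0, 0], [1, 1, 1, 0, 1, 0], [1, 1, 1, 1, 0, 1]]) (bvec ` set [[1, 0, 0, 0], [0, 1, 0, 0], [0, 0, 1, 0], [0, 0, 0, 1], [-1, -1, 1, 1]]) 1"
  proof (rule rigid_unit_vectors[where \<gamma> = "bvec [-1, -1, 1, 1]"])
    fix j assume "j < length [[1, 1, 0, 0, 0, 0], [1, 0, 1, 1, 0, 0], [1, 1, 1, 0, 1, 0], [1, 1, 1, 1, 0, 1]]"
    then have "j \<in> {0, 1, 2, 3}" by auto
    then show "bvec (map (\<lambda>i. if i = j then 1 else 0) [0..<length [[1, 1, 0, 0, 0, 0], [1, 0, 1, 1, 0, 0], [1, 1, 1, 0, 1, 0], [1, 1, 1, 1, 0, 1]]]) \<in> bvec ` set [[1, 0, 0, 0], [0, 1, 0, 0], [0, 0, 1, 0], [0, 0, 0, 1], [-1, -1, 1, 1]]"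
      by (auto simp: upt_rec)
  next
    fix j assume "j \<in> {1..length [[1, 1, 0, 0, 0, 0], [1, 0, 1, 1, 0, 0], [1, 1, 1, 0, 1, 0], [1, 1, 1, 1, 0, 1]]}"
    then have "j \<in> {1, 2, 3, 4}" by auto
    then show "bvec [-1, -1, 1, 1] j \<noteq> 0" by (auto simp: bvec_def)
  qed auto
qed auto

text \<open>Relation between connected sets, in rank 5: {0,1,3} + {0,1,2,5} + {0,3,4,5,6} = {0} +
  {0,1,3,4,5} + {0,1,2,3,5,6}.\<close>

lemma spider_not_free:
  assumes "minor_model {1..n} E spider_edges [V0, V1, V2, V3, V4, V5, V6]"
  shows "\<not> free_arrangement n (conn_subgraph_arr n E)"
proof (rule certificate_not_free[OF assms refl, where d = 1 and
    C = "[[1, 0, 0, 0, 0, 0, 0], [1, 1, 0, 1, 0, 0, 0], [1, 1, 1, 0, 0, 1, 0], [1, 1, 0, 1, 1, 1, 0], [1, 1, 1, 1, 0, 1, 1]]" and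
    D = "[[1, 0, 0, 0, 0], [-1, 1, 1, 0, -1], [0, -1, 0, 0, 1], [0, 0, -1, 0, 1], [0, -1, 0, 1, 0], [0, 0, 0, 0, 0], [0, 0, 0, 0, 0]]" and
    B = "[[1, 0, 0, 0, 0], [0, 1, 0, 0, 0], [0, 0, 1, 0, 0], [0, 0, 0, 1, 0], [0, 0, 0, 0, 1], [1, -1, -1, 1, 1]]"])
  show "certificate (length [V0, V1, V2, V3, V4, V5, V6]) spider_edges [[1, 0, 0, 0, 0, 0, 0], [1, 1, 0, 1, 0, 0, 0], [1, 1, 1, 0, 0, 1, 0], [1, 1, 0, 1, 1, 1, 0], [1, 1, 1, 1, 0, 1, 1]]
    [[1, 0, 0, 0, 0], [-1, 1, 1, 0, -1], [0, -1, 0, 0, 1], [0, 0, -1, 0, 1], [0, -1, 0, 1, 0], [0, 0, 0, 0, 0], [0, 0, 0, 0, 0]] [[1, 0, 0, 0, 0], [0, 1, 0, 0, 0], [0, 0, 1, 0, 0], [0, 0, 0, 1, 0], [0, 0, 0, 0, 1], [1, -1, -1, 1, 1]]"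
    unfolding spider_edges_def list.size One_nat_def[symmetric] add_0 by code_simp
  show "rigid (length [[1, 0, 0, 0, 0, 0, 0], [1, 1, 0, 1, 0, 0, 0], [1, 1, 1, 0, 0, 1, 0], [1, 1, 0, 1, 1, 1, 0], [1, 1, 1, 1, 0, 1, 1]]) (bvec ` set [[1, 0, 0, 0, 0], [0, 1, 0, 0, 0], [0, 0, 1, 0, 0], [0, 0, 0, 1, 0], [0, 0, 0, 0, 1], [1, -1, -1, 1, 1]]) 1"
  proof (rule rigid_unit_vectors[where \<gamma> = "bvec [1, -1, -1, 1, 1]"])
    fix j assume "j < length [[1, 0, 0, 0, 0, 0, 0], [1, 1, 0, 1, 0, 0, 0], [1, 1, 1, 0, 0, 1, 0], [1, 1, 0, 1, 1, 1, 0], [1, 1, 1, 1, 0, 1, 1]]"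
    then have "j \<in> {0, 1, 2, 3, 4}" by auto
    then show "bvec (map (\<lambda>i. if i = j then 1 else 0) [0..<length [[1, 0, 0, 0, 0, 0, 0], [1, 1, 0, 1, 0, 0, 0], [1, 1, 1, 0, 0, 1, 0], [1, 1, 0, 1, 1, 1, 0], [1, 1, 1, 1, 0, 1, 1]]]) \<in> bvec ` set [[1, 0, 0, 0, 0], [0, 1, 0, 0, 0], [0, 0, 1, 0, 0], [0, 0, 0, 1, 0], [0, 0, 0, 0, 1], [1, -1, -1, 1, 1]]"
      by (auto simp: upt_rec)
  next
    fix j assume "j \<in> {1..length [[1, 0, 0, 0, 0, 0, 0], [1, 1, 0, 1, 0, 0, 0], [1, 1, 1, 0, 0, 1, 0], [1, 1, 0, 1, 1, 1, 0], [1, 1, 1, 1, 0, 1, 1]]}"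
    then have "j \<in> {1, 2, 3, 4, 5}" by auto
    then show "bvec [1, -1, -1, 1, 1] j \<noteq> 0" by (auto simp: bvec_def)
  qed auto
qed auto

text \<open>The flat is spanned by the two vertices of degree three and the full vertex set. Its six
  forms meet the bound 2 * 3 with equality, so rigidity up to degree 2 is just enough.\<close>

lemma diamond_not_free:
  assumes "minor_model {1..n} E diamond_edges [V0, V1, V2, V3]"
  shows "\<not> free_arrangement n (conn_subgraph_arr n E)"
proof (rule certificate_not_free[OF assms refl, where d = 2 and
    C = "[[0, 1, 0, 0], [0, 0, 1, 0], [1, 1, 1, 1]]" and
    D = "[[-1, -1, 1], [1, 0, 0], [0, 1, 0], [0, 0, 0]]" and
    B = "[[1, 0, 0], [0, 1, 0], [0, 0, 1], [1, 1, 0], [-1, 0, 1], [0, -1, 1]]"])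
  show "certificate (length [V0, V1, V2, V3]) diamond_edges [[0, 1, 0, 0], [0, 0, 1, 0], [1, 1, 1, 1]]
    [[-1, -1, 1], [1, 0, 0], [0, 1, 0], [0, 0, 0]] [[1, 0, 0], [0, 1, 0], [0, 0, 1], [1, 1, 0], [-1, 0, 1], [0, -1, 1]]"
    unfolding diamond_edges_def list.size One_nat_def[symmetric] add_0 by code_simp
  have "bvec ` set [[1, 0, 0], [0, 1, 0], [0, 0, 1], [1, 1, 0], [-1, 0, 1], [0, -1, 1]] = diamond_forms"
    unfolding diamond_forms_def list.set image_insert image_empty
    by (intro arg_cong2[of _ _ _ _ insert] refl)
      (auto simp: bvec_def ind_def fun_eq_iff numeral_2_eq_2 numeral_3_eq_3 le_Suc_eq)
  then show "rigid (length [[0, 1, 0, 0], [0, 0, 1, 0], [1, 1, 1, 1]]) (bvec ` set [[1, 0, 0], [0, 1, 0], [0, 0, 1], [1, 1, 0], [-1, 0, 1], [0, -1, 1]]) 2"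
    using rigid_diamond by (simp add: numeral_3_eq_3)
qed auto

text \<open>All vertex sets are connected and the flat is the whole space. The 15 forms meet the
  bound 3 * 5 with equality, so rigidity up to degree 4 is just enough.\<close>

lemma complete4_not_free:
  assumes "minor_model {1..n} E complete4_edges [V0, V1, V2, V3]"
  shows "\<not> free_arrangement n (conn_subgraph_arr n E)"
proof (rule certificate_not_free[OF assms refl, where d = 4 and
    C = "[[1, 0, 0, 0], [0, 1, 0, 0], [0, 0, 1, 0], [0, 0, 0, 1]]" and
    D = "[[1, 0, 0, 0], [0, 1, 0, 0], [0, 0, 1, 0], [0, 0, 0, 1]]" and
    B = "[[0, 0, 0, 1], [0, 0, 1, 0], [0, 0, 1, 1], [0, 1, 0, 0], [0, 1, 0, 1], [0, 1, 1, 0], [0, 1, 1, 1], [1, 0, 0, 0], [1, 0, 0, 1], [1, 0, 1, 0], [1, 0, 1, 1], [1, 1, 0, 0], [1, 1, 0, 1], [1, 1, 1, 0], [1, 1, 1, 1]]"])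
  show "certificate (length [V0, V1, V2, V3]) complete4_edges [[1, 0, 0, 0], [0, 1, 0, 0], [0, 0, 1, 0], [0, 0, 0, 1]]
    [[1, 0, 0, 0], [0, 1, 0, 0], [0, 0, 1, 0], [0, 0, 0, 1]] [[0, 0, 0, 1], [0, 0, 1, 0], [0, 0, 1, 1], [0, 1, 0, 0], [0, 1, 0, 1], [0, 1, 1, 0], [0, 1, 1, 1], [1, 0, 0, 0], [1, 0, 0, 1], [1, 0, 1, 0], [1, 0, 1, 1], [1, 1, 0, 0], [1, 1, 0, 1], [1, 1, 1, 0], [1, 1, 1, 1]]"
    unfolding complete4_edges_def list.size One_nat_def[symmetric] add_0 by code_simp
  have "resonance 4 \<subseteq> bvec ` set [[0, 0, 0, 1], [0, 0, 1, 0], [0, 0, 1, 1], [0, 1, 0, 0], [0, 1, 0, 1], [0, 1, 1, 0], [0, 1, 1, 1], [1, 0, 0, 0], [1, 0, 0, 1], [1, 0, 1, 0], [1, 0, 1, 1], [1, 1, 0, 0], [1, 1, 0, 1], [1, 1, 1, 0], [1, 1, 1, 1]]"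
  proof
    fix a assume "a \<in> resonance 4"
    then obtain I where I: "a = ind I" "I \<noteq> {}" "I \<subseteq> {1..4}" unfolding resonance_def by blast
    let ?l = "[if 1 \<in> I then 1 else 0, if 2 \<in> I then 1 else 0, if 3 \<in> I then 1 else 0, if 4 \<in> I then 1 else 0]"
    have "bvec ?l j = ind I j" for j
    proof -
      consider "j \<in> {1, 2, 3, 4}" | "j \<notin> {1..4}" using set_1_4 by blast
      then show ?thesis
      proof cases
        case 1
        then show ?thesis by (auto simp: bvec_def ind_def)
      next
        case 2
        then show ?thesis using I(3) by (auto simp: bvec_def ind_def)
      qed
    qed
    then have "a = bvec ?l" using I(1) by auto
    moreover have "1 \<in> I \<or> 2 \<in> I \<or> 3 \<in> I \<or> 4 \<in> I" using I(2,3) unfolding set_1_4 by blast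
    then have "?l \<in> set [[0, 0, 0, 1], [0, 0, 1, 0], [0, 0, 1, 1], [0, 1, 0, 0], [0, 1, 0, 1], [0, 1, 1, 0], [0, 1, 1, 1], [1, 0, 0, 0], [1, 0, 0, 1], [1, 0, 1, 0], [1, 0, 1, 1], [1, 1, 0, 0], [1, 1, 0, 1], [1, 1, 1, 0], [1, 1, 1, 1]]" by auto
    ultimately show "a \<in> bvec ` set [[0, 0, 0, 1], [0, 0, 1, 0], [0, 0, 1, 1], [0, 1, 0, 0], [0, 1, 0, 1], [0, 1, 1, 0], [0, 1, 1, 1], [1, 0, 0, 0], [1, 0, 0, 1], [1, 0, 1, 0], [1, 0, 1, 1], [1, 1, 0, 0], [1, 1, 0, 1], [1, 1, 1, 0], [1, 1, 1, 1]]" by blast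
  qed
  from rigid_mono[OF this rigid_resonance]
  show "rigid (length [[1, 0, 0, 0], [0, 1, 0, 0], [0, 0, 1, 0], [0, 0, 0, 1]]) (bvec ` set [[0, 0, 0, 1], [0, 0, 1, 0], [0, 0, 1, 1], [0, 1, 0, 0], [0, 1, 0, 1], [0, 1, 1, 0], [0, 1, 1, 1], [1, 0, 0, 0], [1, 0, 0, 1], [1, 0, 1, 0], [1, 0, 1, 1], [1, 1, 0, 0], [1, 1, 0, 1], [1, 1, 1, 0], [1, 1, 1, 1]]) 4"
    by (simp add: eval_nat_numeral)
qed auto

section \<open>Graphs without the forbidden induced minors\<close>

lemma touch_Un_left [simp]: "touch E (A \<union> B) C \<longleftrightarrow> touch E A C \<or> touch E B C"
  and touch_Un_right [simp]: "touch E A (B \<union> C) \<longleftrightarrow> touch E A B \<or> touch E A C"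
  and touch_empty [simp]: "\<not> touch E {} C" "\<not> touch E C {}"
  and touch_single: "touch E {u} {w} \<longleftrightarrow> {u, w} \<in> E"
  by (auto simp: touch_def)

lemma connected_Un:
  assumes A: "induced_connected E A" and B: "induced_connected E B" and t: "touch E A B"
  shows "induced_connected E (A \<union> B)"
  unfolding induced_connected_cut
proof (intro conjI allI impI)
  show "A \<union> B \<noteq> {}" using A by (auto simp: induced_connected_def)
  fix S assume S: "S \<subseteq> A \<union> B" "S \<noteq> {}" "S \<noteq> A \<union> B"
  have cutA: "\<exists>s\<in>S \<inter> A. \<exists>t\<in>A - S. {s, t} \<in> E" if "S \<inter> A \<noteq> {}" "\<not> A \<subseteq> S"
    using A[unfolded induced_connected_cut, THEN conjunct2, rule_format, of "S \<inter> A"] that by blast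
  have cutB: "\<exists>s\<in>S \<inter> B. \<exists>t\<in>B - S. {s, t} \<in> E" if "S \<inter> B \<noteq> {}" "\<not> B \<subseteq> S"
    using B[unfolded induced_connected_cut, THEN conjunct2, rule_format, of "S \<inter> B"] that by blast
  obtain a b where ab: "a \<in> A" "b \<in> B" "{a, b} \<in> E" using t by (auto simp: touch_def)
  then have ba: "{b, a} \<in> E" by (simp add: insert_commute)
  show "\<exists>s\<in>S. \<exists>t\<in>A \<union> B - S. {s, t} \<in> E"
  proof (cases "(S \<inter> A \<noteq> {} \<and> \<not> A \<subseteq> S) \<or> (S \<inter> B \<noteq> {} \<and> \<not> B \<subseteq> S)")
    case True
    then show ?thesis using cutA cutB by blast
  next
    case False
    then have "(a \<in> S \<and> b \<notin> S) \<or> (b \<in> S \<and> a \<notin> S)" using S ab by blast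
    then show ?thesis using ab ba by blast
  qed
qed

lemma connected_single [simp]: "induced_connected E {x}"
  by (simp add: induced_connected_def)

lemma connected_nonempty: "induced_connected E A \<Longrightarrow> A \<noteq> {}"
  by (simp add: induced_connected_def)

text \<open>An induced path as a vertex list: the equivalence with \<open>y = hd xs\<close> both
  demands the edges of the path and excludes chords.\<close>

fun pathl :: "nat set set \<Rightarrow> nat list \<Rightarrow> bool" where
  "pathl E [] \<longleftrightarrow> True"
| "pathl E (x # xs) \<longleftrightarrow> x \<notin> set xs \<and> pathl E xs \<and> (\<forall>y\<in>set xs. {x, y} \<in> E \<longleftrightarrow> y = hd xs)"

lemma pathl_append:
  "pathl E (A @ B) \<longleftrightarrow> pathl E A \<and> pathl E B \<and> set A \<inter> set B = {} \<and>
    (\<forall>x\<in>set A. \<forall>y\<in>set B. {x, y} \<in> E \<longleftrightarrow> x = last A \<and> y = hd B)"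
proof (induction A)
  case (Cons a A)
  show ?case
  proof (cases "A = []")
    case False
    have l: "a \<notin> set A \<Longrightarrow> a \<noteq> last A" using False by auto
    have h: "set A \<inter> set B = {} \<Longrightarrow> y \<in> set B \<Longrightarrow> y \<noteq> hd A" for y using False hd_in_set by blast
    have "pathl E ((a # A) @ B) \<longleftrightarrow> a \<notin> set A \<and> a \<notin> set B \<and> pathl E (A @ B) \<and>
        (\<forall>y\<in>set A. {a, y} \<in> E \<longleftrightarrow> y = hd A) \<and> (\<forall>y\<in>set B. {a, y} \<in> E \<longleftrightarrow> y = hd A)"
      using False by (auto simp: ball_Un)
    also have "\<dots> \<longleftrightarrow> a \<notin> set A \<and> a \<notin> set B \<and> pathl E (A @ B) \<and>
        (\<forall>y\<in>set A. {a, y} \<in> E \<longleftrightarrow> y = hd A) \<and> (\<forall>y\<in>set B. {a, y} \<in> E \<longleftrightarrow> a = last A \<and> y = hd B)"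
      using l h Cons.IH by (intro conj_cong refl ball_cong) auto
    also have "\<dots> \<longleftrightarrow> pathl E (a # A) \<and> pathl E B \<and> set (a # A) \<inter> set B = {} \<and>
        (\<forall>x\<in>set (a # A). \<forall>y\<in>set B. {x, y} \<in> E \<longleftrightarrow> x = last (a # A) \<and> y = hd B)"
      using Cons.IH False by (simp add: conj_ac)
    finally show ?thesis .
  qed (use Cons in auto)
qed simp

lemma pathl_rev: "pathl E (rev xs) \<longleftrightarrow> pathl E xs"
proof (induction xs)
  case (Cons x xs)
  have "(\<forall>y\<in>set xs. {y, x} \<in> E \<longleftrightarrow> y = last (rev xs)) \<longleftrightarrow> (\<forall>y\<in>set xs. {x, y} \<in> E \<longleftrightarrow> y = hd xs)"
    by (cases xs) (auto simp: insert_commute last_rev)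
  then show ?case using Cons by (auto simp: pathl_append)
qed simp

lemma pathl_connected: "pathl E xs \<Longrightarrow> xs \<noteq> [] \<Longrightarrow> induced_connected E (set xs)"
proof (induction xs)
  case (Cons x xs)
  show ?case
  proof (cases "xs = []")
    case False
    then have "touch E {x} (set xs)" using Cons.prems(1) by (auto simp: touch_def)
    then have "induced_connected E ({x} \<union> set xs)"
      using Cons False by (intro connected_Un) auto
    then show ?thesis by simp
  qed simp
qed simp

lemma pathl_distinct: "pathl E xs \<Longrightarrow> distinct xs"
  by (induction xs) auto

lemma pathl_mid:
  assumes "pathl E (A @ x # B)"
  shows "touch E (set A) {x} \<longleftrightarrow> A \<noteq> []" "touch E {x} (set B) \<longleftrightarrow> B \<noteq> []" "\<not> touch E (set A) (set B)"
    "x \<notin> set A" "x \<notin> set B" "set A \<inter> set B = {}"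
    "induced_connected E (set A \<union> {x})" "induced_connected E ({x} \<union> set B)"
    "A \<noteq> [] \<Longrightarrow> induced_connected E (set A)" "B \<noteq> [] \<Longrightarrow> induced_connected E (set B)"
proof -
  note p = assms[unfolded pathl_append]
  show t1: "touch E (set A) {x} \<longleftrightarrow> A \<noteq> []" using p by (auto simp: touch_def)
  show t2: "touch E {x} (set B) \<longleftrightarrow> B \<noteq> []" using p by (auto simp: touch_def)
  show "\<not> touch E (set A) (set B)" using p by (auto simp: touch_def)
  show "x \<notin> set A" "x \<notin> set B" "set A \<inter> set B = {}" using p by auto
  show A: "induced_connected E (set A)" if "A \<noteq> []" using p that pathl_connected by blast
  show B: "induced_connected E (set B)" if "B \<noteq> []" using p that pathl_connected[of E B] by simp
  show "induced_connected E (set A \<union> {x})"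
    using connected_Un[OF A connected_single] t1 by (cases "A = []") auto
  show "induced_connected E ({x} \<union> set B)"
    using connected_Un[OF connected_single B] t2 by (cases "B = []") auto
qed

inductive forbidden :: "nat set \<Rightarrow> nat set set \<Rightarrow> bool" for W E where
  "minor_model W E complete4_edges [V0, V1, V2, V3] \<Longrightarrow> forbidden W E"
| "minor_model W E diamond_edges [V0, V1, V2, V3] \<Longrightarrow> forbidden W E"
| "minor_model W E square_pendant_edges [V0, V1, V2, V3, V4] \<Longrightarrow> forbidden W E"
| "minor_model W E star4_edges [V0, V1, V2, V3, V4] \<Longrightarrow> forbidden W E"
| "minor_model W E cricket_edges [V0, V1, V2, V3, V4] \<Longrightarrow> forbidden W E"
| "minor_model W E butterfly_edges [V0, V1, V2, V3, V4] \<Longrightarrow> forbidden W E"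
| "minor_model W E net_edges [V0, V1, V2, V3, V4, V5] \<Longrightarrow> forbidden W E"
| "minor_model W E spider_edges [V0, V1, V2, V3, V4, V5, V6] \<Longrightarrow> forbidden W E"

lemma forbidden_not_free:
  assumes "forbidden {1..n} E" shows "\<not> free_arrangement n (conn_subgraph_arr n E)"
  using assms
  by cases (rule complete4_not_free diamond_not_free square_pendant_not_free star4_not_free cricket_not_free
      butterfly_not_free net_not_free spider_not_free; assumption)+

lemmas model_simps = minor_model_def All_less_Suc touch_commute Int_Un_distrib Int_Un_distrib2

text \<open>Branch sets such as \<open>{x} \<union> set B\<close> have to remain unions for the
  \<open>touch\<close> rules to split them.\<close>

declare Un_insert_left [simp del] Un_insert_right [simp del]

lemma touch_set_iff: "touch E {v} (set A) \<longleftrightarrow> (\<exists>u\<in>set A. {v, u} \<in> E)"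
  by (auto simp: touch_def)

text \<open>Let \<open>x\<close> and \<open>y\<close> be the first two neighbours of
  \<open>v\<close> on the path. A third one gives a diamond, by contracting the stretch from
  \<open>x\<close> up to \<open>y\<close> and everything after \<open>y\<close>. Two neighbours that
  are not consecutive close a cycle, and any path vertex outside it gives a square with a pendant
  edge.\<close>

lemma path_neighbours:
  assumes p: "pathl E xs" and v: "v \<notin> set xs" and W: "insert v (set xs) \<subseteq> W" and nf: "\<not> forbidden W E"
    and t: "touch E {v} (set xs)"
  obtains A x B where "xs = A @ x # B" "\<And>u. u \<in> set xs \<Longrightarrow> {v, u} \<in> E \<longleftrightarrow> u = x"
  | A x y B where "xs = A @ x # y # B" "\<And>u. u \<in> set xs \<Longrightarrow> {v, u} \<in> E \<longleftrightarrow> u = x \<or> u = y"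
  | x B y where "xs = x # B @ [y]" "B \<noteq> []" "\<And>u. u \<in> set xs \<Longrightarrow> {v, u} \<in> E \<longleftrightarrow> u = x \<or> u = y"
proof -
  let ?N = "\<lambda>u. {v, u} \<in> E"
  have "\<exists>u\<in>set xs. ?N u" using t by (simp add: touch_set_iff)
  then obtain A x C where C: "xs = A @ x # C" "?N x" "\<forall>u\<in>set A. \<not> ?N u"
    using split_list_first_prop[of xs ?N] by blast
  show ?thesis
  proof (cases "\<exists>u\<in>set C. ?N u")
    case False
    then have "?N u \<longleftrightarrow> u = x" if "u \<in> set xs" for u using C that by auto
    then show ?thesis using that(1) C(1) by blast
  next
    case True
    then obtain B y D where D: "C = B @ y # D" "?N y" "\<forall>u\<in>set B. \<not> ?N u"
      using split_list_first_prop[of C ?N] by blast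
    have xs: "xs = A @ x # B @ y # D" using C(1) D(1) by simp
    have pC: "pathl E (x # B @ y # D)" using p unfolding xs pathl_append by simp
    have pA: "pathl E ((A @ x # B) @ y # D)" using p unfolding xs by simp
    note m1 = pathl_mid[OF p[unfolded xs]] and m2 = pathl_mid[of E "x # B" y D, simplified append_Cons, OF pC]
      and m3 = pathl_mid[OF pA]
    have m4: "touch E {x} (set B) \<longleftrightarrow> B \<noteq> []" "x \<notin> set B" "B \<noteq> [] \<Longrightarrow> induced_connected E (set B)"
      using pathl_mid[of E "[]" x B] pC by (simp_all add: pathl_append pathl.simps(2)[of E x "B @ y # D"]) (auto simp: pathl_append)
    have m5: "touch E (set B) {y} \<longleftrightarrow> B \<noteq> []" "\<not> touch E (set B) (set D)"
      using pathl_mid[of E B y D] pC by simp_all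
    have xy: "touch E {x} {y} \<longleftrightarrow> B = []" 
      using pC pathl_distinct[OF pC] hd_in_set[of B] by (auto simp: touch_def hd_append)
    have xD: "\<not> touch E {x} (set D)" using m2(3) by (auto simp: touch_def)
    have vx: "touch E {v} {x}" "touch E {v} {y}" using C D by (auto simp: touch_single)
    have vA: "\<not> touch E {v} (set A)" "\<not> touch E {v} (set B)" using C D by (auto simp: touch_def)
    have nv: "v \<noteq> x" "v \<noteq> y" "v \<notin> set A" "v \<notin> set B" "v \<notin> set D" using v unfolding xs by auto
    have d: "x \<noteq> y" "y \<notin> set B" "y \<notin> set D" "x \<notin> set D" "set B \<inter> set D = {}" "y \<notin> set A" "x \<notin> set A"
      "set A \<inter> set B = {}" "set A \<inter> set D = {}"
      using pathl_distinct[OF p] unfolding xs by auto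
    have w: "v \<in> W" "x \<in> W" "y \<in> W" "set A \<subseteq> W" "set B \<subseteq> W" "set D \<subseteq> W" using W unfolding xs by auto
    have tA: "touch E (set A) {x} \<longleftrightarrow> A \<noteq> []" "\<not> touch E (set A) (set B)" "\<not> touch E (set A) {y}" "\<not> touch E (set A) (set D)"
      using m1(1,3) by (auto simp: touch_def)
    show ?thesis
    proof (cases "\<exists>u\<in>set D. ?N u")
      case True
      then have "touch E {v} (set D)" "D \<noteq> []" by (auto simp: touch_def)
      then have "minor_model W E diamond_edges [{x} \<union> set B, {y}, {v}, set D]"
        using vx vA nv d w xy xD m4 m5 m2(2,10) connected_Un[OF connected_single m4(3), of x]
        by (cases "B = []") (auto simp: model_simps diamond_edges_def)
      then show ?thesis using nf forbidden.intros by blast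
    next
      case False
      then have N: "?N u \<longleftrightarrow> u = x \<or> u = y" if "u \<in> set xs" for u using C D that by auto
      then have vD: "\<not> touch E {v} (set D)" using d unfolding xs by (auto simp: touch_def)
      show ?thesis
      proof (cases "B = []")
        case True
        then show ?thesis using that(2)[of A x y D] N xs by simp
      next
        case B: False
        show ?thesis
        proof (cases "A = [] \<and> D = []")
          case True
          then show ?thesis using that(3)[of x B y] N xs B by simp
        next
          case False
          have "minor_model W E square_pendant_edges [{x}, set B, {y}, {v}, set A]" if "A \<noteq> []"
            using that B vx vA nv d w xy m4 m5 tA m1(9)
            by (auto simp: model_simps square_pendant_edges_def)
          moreover have "minor_model W E square_pendant_edges [{y}, set B, {x}, {v}, set D]" if "D \<noteq> []"
            using that B vx vA vD nv d w xy xD m4 m5 m2(2,10)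
            by (auto simp: model_simps square_pendant_edges_def)
          ultimately show ?thesis using nf forbidden.intros False by blast
        qed
      qed
    qed
  qed
qed

lemma head_touch:
  assumes "distinct (A @ x # B)" "\<And>u. u \<in> set (A @ x # B) \<Longrightarrow> touch E {u} Q \<longleftrightarrow> u = hd (A @ x # B)"
  shows "touch E (set A) Q \<longleftrightarrow> A \<noteq> []" "touch E {x} Q \<longleftrightarrow> A = []" "\<not> touch E (set B) Q"
proof -
  have t: "touch E S Q \<longleftrightarrow> (\<exists>u\<in>S. touch E {u} Q)" for S by (auto simp: touch_def)
  have hdA: "A \<noteq> [] \<Longrightarrow> hd A \<in> set A" by simp
  show "touch E (set A) Q \<longleftrightarrow> A \<noteq> []" unfolding t[of "set A"] using assms hdA by (cases "A = []") auto
  show "touch E {x} Q \<longleftrightarrow> A = []" using assms(1) assms(2)[of x] hdA by (cases "A = []") auto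
  show "\<not> touch E (set B) Q" unfolding t[of "set B"] using assms hdA by (cases "A = []") (simp, force)
qed

text \<open>Common core for legs at a triangle and legs at a centre: \<open>Q\<close> and
  \<open>R\<close> are the two other legs, which touch each other in the first situation and not in
  the second. Contact with \<open>h\<close> before its end gives a star or a cricket, two
  consecutive neighbours a cricket or a butterfly, and both ends of \<open>h\<close> a square with a
  pendant edge.\<close>

lemma hanging:
  assumes h: "pathl E h" and v: "v \<notin> set h" and W: "{v} \<union> set h \<union> Q \<union> R \<subseteq> W" and nf: "\<not> forbidden W E"
    and t: "touch E {v} (set h)"
    and c: "induced_connected E Q" "induced_connected E R"
    and d: "Q \<inter> R = {}" "set h \<inter> Q = {}" "set h \<inter> R = {}" "v \<notin> Q" "v \<notin> R"
    and nt: "\<not> touch E {v} Q" "\<not> touch E {v} R"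
    and tQ: "\<And>u. u \<in> set h \<Longrightarrow> touch E {u} Q \<longleftrightarrow> u = hd h"
    and tR: "\<And>u. u \<in> set h \<Longrightarrow> touch E {u} R \<longleftrightarrow> u = hd h"
  shows "h \<noteq> [] \<and> (\<forall>u\<in>set h. {v, u} \<in> E \<longleftrightarrow> u = last h)"
proof -
  have Wh: "insert v (set h) \<subseteq> W" using W by auto
  have wQ: "Q \<subseteq> W" "R \<subseteq> W" "v \<in> W" using W by auto
  note dh = pathl_distinct[OF h]
  show ?thesis
  proof (rule path_neighbours[OF h v Wh nf t])
    fix A x B assume e: "h = A @ x # B" and N: "\<And>u. u \<in> set h \<Longrightarrow> {v, u} \<in> E \<longleftrightarrow> u = x"
    note m = pathl_mid[OF h[unfolded e]]
    note q = head_touch[of A x B E Q, OF dh[unfolded e] tQ[unfolded e]]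
      and r = head_touch[of A x B E R, OF dh[unfolded e] tR[unfolded e]]
    have vt: "touch E {v} {x}" "\<not> touch E {v} (set A)" "\<not> touch E {v} (set B)"
      using N m(4,5) unfolding e by (auto simp: touch_def)
    have D: "set A \<inter> Q = {}" "set B \<inter> Q = {}" "x \<notin> Q" "set A \<inter> R = {}" "set B \<inter> R = {}" "x \<notin> R"
      "v \<notin> set A" "v \<notin> set B" "v \<noteq> x"
      using d v unfolding e by auto
    have w: "set A \<subseteq> W" "x \<in> W" "set B \<subseteq> W" using Wh unfolding e by auto
    have "minor_model W E cricket_edges [set A \<union> {x}, Q, R, {v}, set B]" if "B \<noteq> []" "touch E Q R"
      using that c d(1,4,5) nt wQ m q r vt D w by (auto simp: model_simps cricket_edges_def)
    moreover have "minor_model W E star4_edges [set A \<union> {x}, set B, {v}, Q, R]" if "B \<noteq> []" "\<not> touch E Q R"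
      using that c d(1,4,5) nt wQ m q r vt D w by (auto simp: model_simps star4_edges_def)
    ultimately have "forbidden W E" if "B \<noteq> []"
      using that forbidden.intros(4,5) by (cases "touch E Q R") blast+
    then have "B = []" using nf by blast
    then show ?thesis using N e by simp
  next
    fix A x y B assume e: "h = A @ x # y # B" and N: "\<And>u. u \<in> set h \<Longrightarrow> {v, u} \<in> E \<longleftrightarrow> u = x \<or> u = y"
    note m = pathl_mid[OF h[unfolded e]]
    note q = head_touch[of A x "y # B" E Q, OF dh[unfolded e] tQ[unfolded e]]
      and r = head_touch[of A x "y # B" E R, OF dh[unfolded e] tR[unfolded e]]
    have y: "\<not> touch E {y} Q" "\<not> touch E {y} R" "touch E {x} {y}" "\<not> touch E (set A) {y}"
      using q(3) r(3) m(3) h unfolding e pathl_append by (auto simp: touch_def)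
    have vt: "touch E {v} {x}" "touch E {v} {y}" "\<not> touch E {v} (set A)"
      using N m(4,6) unfolding e by (auto simp: touch_def)
    have D: "set A \<inter> Q = {}" "x \<notin> Q" "set A \<inter> R = {}" "x \<notin> R" "y \<notin> Q" "y \<notin> R"
      "v \<notin> set A" "v \<noteq> x" "v \<noteq> y" "x \<noteq> y" "y \<notin> set A"
      using d v dh unfolding e by auto
    have w: "set A \<subseteq> W" "x \<in> W" "y \<in> W" using Wh unfolding e by auto
    have "minor_model W E butterfly_edges [set A \<union> {x}, {y}, {v}, Q, R]" if "touch E Q R"
      using that c d(1,4,5) nt wQ m(1,4,7,9) q(1,2) r(1,2) y vt D w by (auto simp: model_simps butterfly_edges_def)
    moreover have "minor_model W E cricket_edges [set A \<union> {x}, {y}, {v}, Q, R]" if "\<not> touch E Q R"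
      using that c d(1,4,5) nt wQ m(1,4,7,9) q(1,2) r(1,2) y vt D w by (auto simp: model_simps cricket_edges_def)
    ultimately show ?thesis using nf forbidden.intros(5,6) by blast
  next
    fix x B y assume e: "h = x # B @ [y]" and B: "B \<noteq> []"
      and N: "\<And>u. u \<in> set h \<Longrightarrow> {v, u} \<in> E \<longleftrightarrow> u = x \<or> u = y"
    have e': "h = [] @ x # (B @ [y])" using e by simp
    note q = head_touch[of "[]" x "B @ [y]" E Q, OF dh[unfolded e'] tQ[unfolded e']]
    have hy: "pathl E (B @ y # [])" using h unfolding e by simp
    note m = pathl_mid[OF hy]
    have D: "set B \<inter> Q = {}" "x \<notin> Q" "y \<notin> Q" "v \<notin> set B" "v \<noteq> x" "v \<noteq> y" "x \<noteq> y" "x \<notin> set B"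
      using d v dh unfolding e by auto
    have tt: "touch E {x} (set B)" "\<not> touch E {x} {y}" "\<not> touch E (set B) Q" "\<not> touch E {y} Q"
      using q(3) h hd_in_set[OF B] m(4) B unfolding e by (auto simp: touch_def)
    have vt: "touch E {v} {x}" "touch E {v} {y}" "\<not> touch E {v} (set B)"
      using N D m(4) unfolding e by (auto simp: touch_def)
    have w: "set B \<subseteq> W" "x \<in> W" "y \<in> W" using Wh unfolding e by auto
    have "minor_model W E square_pendant_edges [{x}, set B, {y}, {v}, Q]"
      using B c d(4) nt wQ m q(2) tt vt D w by (auto simp: model_simps square_pendant_edges_def)
    then show ?thesis using nf forbidden.intros by blast
  qed
qed

text \<open>The cycle is cut open at \<open>w\<close>. It has at least four vertices; the triangle
  is counted among the paths with a triangle.\<close>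

definition cyclel :: "nat set set \<Rightarrow> nat \<Rightarrow> nat list \<Rightarrow> bool" where
  "cyclel E w xs \<longleftrightarrow> pathl E xs \<and> 3 \<le> length xs \<and> w \<notin> set xs \<and>
    (\<forall>u\<in>set xs. {w, u} \<in> E \<longleftrightarrow> u = hd xs \<or> u = last xs)"

lemma cycle_arcs:
  assumes c: "cyclel E w (P @ Q)" and ne: "P \<noteq> []" "Q \<noteq> []"
  shows "induced_connected E (set P)" "induced_connected E (set Q)" "touch E (set P) (set Q)"
    "touch E {w} (set P)" "touch E {w} (set Q)" "set P \<inter> set Q = {}" "w \<notin> set P" "w \<notin> set Q"
proof -
  have p: "pathl E (P @ Q)" using c by (simp add: cyclel_def)
  note a = p[unfolded pathl_append]
  show "induced_connected E (set P)" "induced_connected E (set Q)" using a ne pathl_connected by blast+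
  have l: "last P \<in> set P" "hd Q \<in> set Q" "hd P \<in> set P" "last Q \<in> set Q" using ne by auto
  show "touch E (set P) (set Q)" using a l unfolding touch_def by blast
  show "touch E {w} (set P)" "touch E {w} (set Q)" using c l ne by (auto simp: cyclel_def touch_def)
  show "set P \<inter> set Q = {}" "w \<notin> set P" "w \<notin> set Q" using a c by (auto simp: cyclel_def)
qed

text \<open>Cycles do not grow. A new vertex with two neighbours on the cycle sees two arcs and
  yields K4 or a diamond; with a single neighbour it is the pendant vertex of a contracted
  square.\<close>

lemma cycle_extension_forbidden:
  assumes c: "cyclel E w xs" and v: "v \<notin> insert w (set xs)" and W: "insert v (insert w (set xs)) \<subseteq> W"
    and t: "touch E {v} ({w} \<union> set xs)"
  shows "forbidden W E"
proof (rule ccontr)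
  assume nf: "\<not> forbidden W E"
  have p: "pathl E xs" and l3: "3 \<le> length xs" and w: "w \<notin> set xs"
    and wN: "\<And>u. u \<in> set xs \<Longrightarrow> {w, u} \<in> E \<longleftrightarrow> u = hd xs \<or> u = last xs"
    using c by (auto simp: cyclel_def)
  have vw: "v \<noteq> w" "v \<notin> set xs" "v \<in> W" "w \<in> W" "set xs \<subseteq> W" using v W by auto
  \<comment> \<open>Two consecutive arcs and \<open>w\<close> contract to a triangle, of which
    \<open>v\<close> sees three or two vertices.\<close>
  have arcs: False if "xs = P @ Q" "P \<noteq> []" "Q \<noteq> []" "touch E {v} (set P)" "touch E {v} (set Q)" for P Q
  proof -
    note a = cycle_arcs[OF c[unfolded that(1)] that(2,3)]
    have "set P \<subseteq> W" "set Q \<subseteq> W" "v \<notin> set P" "v \<notin> set Q" using vw unfolding that(1) by auto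
    note f = a that(4,5) vw this
    have "minor_model W E complete4_edges [set P, set Q, {w}, {v}]" if "touch E {v} {w}"
      using f that by (auto simp: model_simps complete4_edges_def)
    moreover have "minor_model W E diamond_edges [{v}, set P, set Q, {w}]" if "\<not> touch E {v} {w}"
      using f that by (auto simp: model_simps diamond_edges_def)
    ultimately show False using nf forbidden.intros by blast
  qed
  \<comment> \<open>The cycle is contracted to a square with corner \<open>x\<close>. For
    \<open>x\<close> inside the path the other corners are both sides and \<open>w\<close>; at an
    end, \<open>x\<close> is adjacent to \<open>w\<close> and the remaining path is split into its
    vertex next to \<open>x\<close> and the rest.\<close>
  have pendant: False
    if nbr: "\<And>u. u \<in> set xs \<Longrightarrow> {v, u} \<in> E \<longleftrightarrow> u = x" and e: "xs = A @ x # B" and nw: "\<not> touch E {v} {w}" for A x B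
  proof -
    note m = pathl_mid[OF p[unfolded e]]
    have dx: "distinct (A @ x # B)" using pathl_distinct[OF p] e by simp
    have vt: "touch E {v} {x}" "\<not> touch E {v} (set A)" "\<not> touch E {v} (set B)"
      using nbr m(4,5) unfolding e by (auto simp: touch_def)
    have f: "v \<noteq> x" "v \<notin> set A" "v \<notin> set B" "w \<noteq> x" "w \<notin> set A" "w \<notin> set B" "set A \<subseteq> W" "set B \<subseteq> W" "x \<in> W"
      using vw w unfolding e by auto
    consider "A \<noteq> []" "B \<noteq> []" | "A = []" "B \<noteq> []" | "A \<noteq> []" "B = []" using l3 e by (cases A; cases B) auto
    then show False
    proof cases
      case 1
      have "hd A \<in> set A" "last B \<in> set B" using 1 by auto
      then have "touch E {w} (set A)" "touch E {w} (set B)" "\<not> touch E {w} {x}"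
        using wN 1 m(4,5) unfolding e touch_def by auto
      then have "minor_model W E square_pendant_edges [{x}, set B, {w}, set A, {v}]"
        using 1 m vt f vw nw by (auto simp: model_simps square_pendant_edges_def)
      then show False using nf forbidden.intros by blast
    next
      case 2
      then obtain b C where b: "B = b # C" by (cases B) auto
      then have C: "C \<noteq> []" using l3 e 2 by auto
      have q: "pathl E ([x] @ b # C)" using p e b 2 by simp
      note m2 = pathl_mid[OF q]
      have lC: "last C \<in> set C" using C by simp
      have bC: "b \<noteq> x" "b \<noteq> last C" using m2(4,5) lC by auto
      have "{w, x} \<in> E" "{w, last C} \<in> E" "{w, b} \<notin> E"
        using wN[of x] wN[of "last C"] wN[of b] 2 b C bC unfolding e by simp_all
      then have tw: "touch E {w} {x}" "touch E {w} (set C)" "\<not> touch E {w} {b}"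
        using lC by (auto simp: touch_def)
      have tv: "\<not> touch E {v} {b}" "\<not> touch E {v} (set C)" using vt(3) b by (auto simp: touch_def)
      have "b \<in> W" "set C \<subseteq> W" "v \<noteq> b" "v \<notin> set C" "w \<noteq> b" "w \<notin> set C" using f b by auto
      then have "minor_model W E square_pendant_edges [{x}, {b}, set C, {w}, {v}]"
        using C m2[simplified] tw tv vt(1) f(1,4,9) vw(1,3,4) nw by (auto simp: model_simps square_pendant_edges_def)
      then show False using nf forbidden.intros by blast
    next
      case 3
      then obtain b C where b: "A = C @ [b]" by (cases A rule: rev_cases) auto
      then have C: "C \<noteq> []" using l3 e 3 by auto
      have q: "pathl E (C @ b # [x])" using p e b 3 by simp
      note m2 = pathl_mid[OF q]
      have lC: "hd C \<in> set C" using C by simp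
      have bC: "b \<noteq> x" "b \<noteq> hd C" using m2(4,5) lC by auto
      have "{w, x} \<in> E" "{w, hd C} \<in> E" "{w, b} \<notin> E"
        using wN[of x] wN[of "hd C"] wN[of b] 3 b C bC unfolding e by simp_all
      then have tw: "touch E {w} {x}" "touch E {w} (set C)" "\<not> touch E {w} {b}"
        using lC by (auto simp: touch_def)
      have tv: "\<not> touch E {v} {b}" "\<not> touch E {v} (set C)" using vt(2) b by (auto simp: touch_def)
      have "b \<in> W" "set C \<subseteq> W" "v \<noteq> b" "v \<notin> set C" "w \<noteq> b" "w \<notin> set C" using f b by auto
      then have "minor_model W E square_pendant_edges [{x}, {b}, set C, {w}, {v}]"
        using C m2[simplified] tw tv vt(1) f(1,4,9) vw(1,3,4) nw by (auto simp: model_simps square_pendant_edges_def)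
      then show False using nf forbidden.intros by blast
    qed
  qed
  show False
  proof (cases "touch E {v} (set xs)")
    case False
    obtain x B' where x: "xs = x # B'" using l3 by (cases xs) auto
    obtain B y where y: "B' = B @ [y]" using l3 x by (cases B' rule: rev_cases) auto
    have B: "B \<noteq> []" using l3 x y by auto
    have q: "pathl E ([] @ x # (B @ [y]))" "pathl E (B @ y # [])" using p x y by auto
    note m1 = pathl_mid[OF q(1)] and m2 = pathl_mid[OF q(2)]
    have tt: "touch E {x} (set B)" "\<not> touch E {x} {y}" "touch E {w} {x}" "touch E {w} {y}" "\<not> touch E {w} (set B)"
      using wN m1(5) m2(4) p hd_in_set[OF B] B unfolding x y by (auto simp: touch_def)
    have "touch E {v} {w}" using t False by simp
    moreover have "\<not> touch E {v} {x}" "\<not> touch E {v} (set B)" "\<not> touch E {v} {y}"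
      using False unfolding x y by (auto simp: touch_def)
    moreover have "x \<noteq> y" "x \<notin> set B" using m1(5) by auto
    moreover have "set B \<subseteq> W" "x \<in> W" "y \<in> W" "v \<noteq> x" "v \<noteq> y" "v \<notin> set B" "w \<noteq> x" "w \<noteq> y" "w \<notin> set B"
      using vw w unfolding x y by auto
    ultimately have "minor_model W E square_pendant_edges [{w}, {x}, set B, {y}, {v}]"
      using B m2 tt vw by (auto simp: model_simps square_pendant_edges_def)
    then show False using nf forbidden.intros by blast
  next
    case True
    have Wx: "insert v (set xs) \<subseteq> W" using W by auto
    show False
    proof (rule path_neighbours[OF p vw(2) Wx nf True])
      fix A x B assume e: "xs = A @ x # B" and N: "\<And>u. u \<in> set xs \<Longrightarrow> {v, u} \<in> E \<longleftrightarrow> u = x"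
      note m = pathl_mid[OF p[unfolded e]]
      show False
      proof (cases "touch E {v} {w}")
        case False
        then show False using pendant[OF N e] by blast
      next
        case vtw: True
        have vt: "touch E {v} {x}" "\<not> touch E {v} (set A)" "\<not> touch E {v} (set B)"
          using N m(4,5) unfolding e by (auto simp: touch_def)
        have f: "v \<noteq> x" "v \<notin> set A" "v \<notin> set B" "w \<noteq> x" "w \<notin> set A" "w \<notin> set B" "set A \<subseteq> W" "set B \<subseteq> W" "x \<in> W"
          using vw w unfolding e by auto
        show False
        proof (cases "A = []")
          case True
          then have B: "B \<noteq> []" using l3 e by auto
          have "last B \<in> set B" using B by simp
          then have "touch E {w} {x}" "touch E {w} (set B)" using wN True B unfolding e by (auto simp: touch_def)
          then have "minor_model W E diamond_edges [{v}, {w}, {x}, set B]"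
            using B m vt vtw f vw by (auto simp: model_simps diamond_edges_def)
          then show False using nf forbidden.intros by blast
        next
          case A: False
          note a = cycle_arcs[of E w A "x # B", OF c[unfolded e] A, simplified]
          have "touch E {v} (set (x # B))" using vt(1) by (auto simp: touch_def)
          then have "minor_model W E diamond_edges [{v}, {w}, set (x # B), set A]"
            using A m a vt(2) vtw f vw by (auto simp: model_simps diamond_edges_def)
          then show False using nf forbidden.intros by blast
        qed
      qed
    next
      fix A x y B assume e: "xs = A @ x # y # B" and N: "\<And>u. u \<in> set xs \<Longrightarrow> {v, u} \<in> E \<longleftrightarrow> u = x \<or> u = y"
      show False by (rule arcs[of "A @ [x]" "y # B"]) (use e N in \<open>auto simp: touch_def\<close>)
    next
      fix x B y assume e: "xs = x # B @ [y]" and N: "\<And>u. u \<in> set xs \<Longrightarrow> {v, u} \<in> E \<longleftrightarrow> u = x \<or> u = y"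
      show False by (rule arcs[of "x # B" "[y]"]) (use e N in \<open>auto simp: touch_def\<close>)
    qed
  qed
qed

section \<open>Three legs at a triangle or at a centre\<close>

definition cross :: "nat set set \<Rightarrow> nat list \<Rightarrow> nat list \<Rightarrow> bool" where
  "cross E a b \<longleftrightarrow> set a \<inter> set b = {} \<and> (\<forall>x\<in>set a. \<forall>y\<in>set b. {x, y} \<in> E \<longleftrightarrow> x = hd a \<and> y = hd b)"

text \<open>All three legs may be long. The symmetric form allows a new vertex to be attached to any
  of them, before the net excludes three long legs.\<close>

definition triangle_legs :: "nat set set \<Rightarrow> nat list \<Rightarrow> nat list \<Rightarrow> nat list \<Rightarrow> bool" where
  "triangle_legs E p q r \<longleftrightarrow> pathl E p \<and> pathl E q \<and> pathl E r \<and> p \<noteq> [] \<and> q \<noteq> [] \<and> r \<noteq> [] \<and>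
    cross E p q \<and> cross E p r \<and> cross E q r"

definition spider_legs :: "nat set set \<Rightarrow> nat \<Rightarrow> nat list \<Rightarrow> nat list \<Rightarrow> nat list \<Rightarrow> bool" where
  "spider_legs E c p q r \<longleftrightarrow> pathl E (c # p) \<and> pathl E (c # q) \<and> pathl E (c # r) \<and> p \<noteq> [] \<and> q \<noteq> [] \<and> r \<noteq> [] \<and>
    set p \<inter> set q = {} \<and> set p \<inter> set r = {} \<and> set q \<inter> set r = {} \<and>
    \<not> touch E (set p) (set q) \<and> \<not> touch E (set p) (set r) \<and> \<not> touch E (set q) (set r)"

lemma cross_commute: "cross E a b \<longleftrightarrow> cross E b a"
proof -
  have "cross E b a" if "cross E a b" for a b
    unfolding cross_def
  proof (intro conjI ballI)
    show "set b \<inter> set a = {}" using that by (auto simp: cross_def)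
    fix x y assume "x \<in> set b" "y \<in> set a"
    then have "{y, x} \<in> E \<longleftrightarrow> y = hd a \<and> x = hd b" using that by (simp add: cross_def)
    then show "{x, y} \<in> E \<longleftrightarrow> x = hd b \<and> y = hd a" by (auto simp: insert_commute)
  qed
  then show ?thesis by blast
qed

lemma triangle_legs_swap:
  "triangle_legs E p q r \<Longrightarrow> triangle_legs E q p r" "triangle_legs E p q r \<Longrightarrow> triangle_legs E p r q"
  unfolding triangle_legs_def using cross_commute by blast+

lemma spider_legs_swap:
  "spider_legs E c p q r \<Longrightarrow> spider_legs E c q p r" "spider_legs E c p q r \<Longrightarrow> spider_legs E c p r q"
  unfolding spider_legs_def by (simp_all add: touch_commute Int_commute)

lemma cross_touch:
  assumes "cross E a b" "a \<noteq> []" "b \<noteq> []"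
  shows "touch E (set a) (set b)" "\<And>u. u \<in> set a \<Longrightarrow> touch E {u} (set b) \<longleftrightarrow> u = hd a" "set a \<inter> set b = {}"
proof -
  have "hd a \<in> set a" "hd b \<in> set b" using assms by auto
  then show "touch E (set a) (set b)" "\<And>u. u \<in> set a \<Longrightarrow> touch E {u} (set b) \<longleftrightarrow> u = hd a" "set a \<inter> set b = {}"
    using assms(1) unfolding cross_def touch_def by auto
qed

lemma triangle_extend_leg:
  assumes T: "triangle_legs E p q r" and v: "v \<notin> set p \<union> set q \<union> set r"
    and W: "{v} \<union> set p \<union> set q \<union> set r \<subseteq> W" and nf: "\<not> forbidden W E"
    and t: "touch E {v} (set p)" "\<not> touch E {v} (set q)" "\<not> touch E {v} (set r)"
  shows "triangle_legs E (p @ [v]) q r"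
proof -
  have T': "pathl E p" "pathl E q" "pathl E r" "p \<noteq> []" "q \<noteq> []" "r \<noteq> []" "cross E p q" "cross E p r" "cross E q r"
    using T by (auto simp: triangle_legs_def)
  have N: "p \<noteq> [] \<and> (\<forall>u\<in>set p. {v, u} \<in> E \<longleftrightarrow> u = last p)"
    by (rule hanging[of E p v "set q" "set r" W])
      (use T' v W nf t cross_touch[OF T'(7) T'(4,5)] cross_touch[OF T'(8) T'(4,6)] cross_touch[OF T'(9) T'(5,6)]
        pathl_connected in auto)
  have "pathl E (p @ [v])" using T'(1) v N unfolding pathl_append by (auto simp: insert_commute)
  moreover have "cross E (p @ [v]) b" if "cross E p b" "\<not> touch E {v} (set b)" "v \<notin> set b" for b
  proof -
    have "hd p \<noteq> v" using hd_in_set[OF T'(4)] v by auto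
    then show ?thesis using that T'(4) unfolding cross_def touch_def by auto
  qed
  ultimately show ?thesis using T' t v unfolding triangle_legs_def by auto
qed

text \<open>A vertex touching two legs gives K4 or a diamond once the legs are contracted. Hence it
  touches one leg only, where \<open>hanging\<close> places it at the end.\<close>

lemma triangle_extend:
  assumes T: "triangle_legs E p q r" and v: "v \<notin> set p \<union> set q \<union> set r"
    and W: "{v} \<union> set p \<union> set q \<union> set r \<subseteq> W" and nf: "\<not> forbidden W E"
    and t: "touch E {v} (set p \<union> set q \<union> set r)"
  shows "triangle_legs E (p @ [v]) q r \<or> triangle_legs E p (q @ [v]) r \<or> triangle_legs E p q (r @ [v])"
proof -
  have two: False if T: "triangle_legs E p q r" and v: "v \<notin> set p \<union> set q \<union> set r"
    and W: "{v} \<union> set p \<union> set q \<union> set r \<subseteq> W" and t: "touch E {v} (set p)" "touch E {v} (set q)" for p q r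
  proof -
    have T': "pathl E p" "pathl E q" "pathl E r" "p \<noteq> []" "q \<noteq> []" "r \<noteq> []" "cross E p q" "cross E p r" "cross E q r"
      using T by (auto simp: triangle_legs_def)
    note f = cross_touch(1,3)[OF T'(7) T'(4,5)] cross_touch(1,3)[OF T'(8) T'(4,6)] cross_touch(1,3)[OF T'(9) T'(5,6)]
      pathl_connected[OF T'(1,4)] pathl_connected[OF T'(2,5)] pathl_connected[OF T'(3,6)]
    have w: "v \<in> W" "set p \<subseteq> W" "set q \<subseteq> W" "set r \<subseteq> W" "v \<notin> set p" "v \<notin> set q" "v \<notin> set r" using v W by auto
    have "minor_model W E complete4_edges [set p, set q, set r, {v}]" if "touch E {v} (set r)"
      using f w t that by (auto simp: model_simps complete4_edges_def)
    moreover have "minor_model W E diamond_edges [{v}, set p, set q, set r]" if "\<not> touch E {v} (set r)"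
      using f w t that by (auto simp: model_simps diamond_edges_def)
    ultimately show False using nf forbidden.intros(1,2) by blast
  qed
  have n: "\<not> (touch E {v} (set p) \<and> touch E {v} (set q))" "\<not> (touch E {v} (set p) \<and> touch E {v} (set r))"
    "\<not> (touch E {v} (set q) \<and> touch E {v} (set r))"
  proof -
    have T2: "triangle_legs E p r q" and T3: "triangle_legs E q r p" using T triangle_legs_swap by blast+
    have W2: "v \<notin> set p \<union> set r \<union> set q" "{v} \<union> set p \<union> set r \<union> set q \<subseteq> W" using v W by blast+
    have W3: "v \<notin> set q \<union> set r \<union> set p" "{v} \<union> set q \<union> set r \<union> set p \<subseteq> W" using v W by blast+
    show "\<not> (touch E {v} (set p) \<and> touch E {v} (set q))" "\<not> (touch E {v} (set p) \<and> touch E {v} (set r))"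
      "\<not> (touch E {v} (set q) \<and> touch E {v} (set r))"
      using two[OF T v W] two[OF T2 W2] two[OF T3 W3] by blast+
  qed
  have "touch E {v} (set p) \<or> touch E {v} (set q) \<or> touch E {v} (set r)" using t by simp
  then consider "touch E {v} (set p)" "\<not> touch E {v} (set q)" "\<not> touch E {v} (set r)"
    | "touch E {v} (set q)" "\<not> touch E {v} (set p)" "\<not> touch E {v} (set r)"
    | "touch E {v} (set r)" "\<not> touch E {v} (set p)" "\<not> touch E {v} (set q)" using n by blast
  then show ?thesis
  proof cases
    case 1
    then show ?thesis using triangle_extend_leg[OF T v W nf] by blast
  next
    case 2
    have "triangle_legs E (q @ [v]) p r"
      by (rule triangle_extend_leg[OF triangle_legs_swap(1)[OF T] _ _ nf]) (use v W 2 in auto)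
    then show ?thesis using triangle_legs_swap by blast
  next
    case 3
    have "triangle_legs E r p q" using T triangle_legs_swap by blast
    then have "triangle_legs E (r @ [v]) p q"
      by (rule triangle_extend_leg[OF _ _ _ nf]) (use v W 3 in auto)
    then show ?thesis using triangle_legs_swap by blast
  qed
qed

lemma spider_leg:
  assumes "pathl E (c # p)" "p \<noteq> []"
  shows "touch E {c} (set p)" "c \<notin> set p" "induced_connected E (set p)" "pathl E p"
  using assms pathl_connected[of E p] hd_in_set[of p] by (auto simp: touch_def)

lemma spider_extend_leg:
  assumes S: "spider_legs E c p q r" and v: "v \<notin> {c} \<union> set p \<union> set q \<union> set r"
    and W: "{v} \<union> {c} \<union> set p \<union> set q \<union> set r \<subseteq> W" and nf: "\<not> forbidden W E"
    and t: "touch E {v} ({c} \<union> set p)" "\<not> touch E {v} (set q)" "\<not> touch E {v} (set r)"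
  shows "spider_legs E c (p @ [v]) q r"
proof -
  have S': "pathl E (c # p)" "pathl E (c # q)" "pathl E (c # r)" "p \<noteq> []" "q \<noteq> []" "r \<noteq> []"
    "set p \<inter> set q = {}" "set p \<inter> set r = {}" "set q \<inter> set r = {}"
    "\<not> touch E (set p) (set q)" "\<not> touch E (set p) (set r)" "\<not> touch E (set q) (set r)"
    using S by (auto simp: spider_legs_def)
  have hQ: "touch E {u} (set b) \<longleftrightarrow> u = hd (c # p)"
    if "u \<in> set (c # p)" "\<not> touch E (set p) (set b)" "pathl E (c # b)" "b \<noteq> []" for u b
  proof (cases "u = c")
    case True
    then show ?thesis using spider_leg(1)[OF that(3,4)] by simp
  next
    case False
    then have "u \<in> set p" using that(1) by simp
    then show ?thesis using that(2) False by (auto simp: touch_def)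
  qed
  have N: "c # p \<noteq> [] \<and> (\<forall>u\<in>set (c # p). {v, u} \<in> E \<longleftrightarrow> u = last (c # p))"
  proof (rule hanging[of E "c # p" v "set q" "set r" W])
    show "touch E {u} (set q) \<longleftrightarrow> u = hd (c # p)" if "u \<in> set (c # p)" for u
      by (rule hQ[OF that S'(10,2,5)])
    show "touch E {u} (set r) \<longleftrightarrow> u = hd (c # p)" if "u \<in> set (c # p)" for u
      by (rule hQ[OF that S'(11,3,6)])
    show "touch E {v} (set (c # p))" using t(1) by (auto simp: touch_def)
  qed (use S' v W nf t(2,3) spider_leg[OF S'(2,5)] spider_leg[OF S'(3,6)] in auto)
  have "pathl E (c # p @ [v])"
  proof -
    have "pathl E ((c # p) @ [v])" using S'(1) v N unfolding pathl_append by (auto simp: insert_commute)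
    then show ?thesis by simp
  qed
  then show ?thesis using S' t v unfolding spider_legs_def by (auto simp: touch_commute)
qed

text \<open>A vertex touching two legs closes a cycle through the centre: with a further contact to
  the third leg or to \<open>c\<close> this is a diamond, otherwise a square with the third leg as
  pendant. Hence it touches at most one leg and possibly the centre.\<close>

lemma spider_extend:
  assumes S: "spider_legs E c p q r" and v: "v \<notin> {c} \<union> set p \<union> set q \<union> set r"
    and W: "{v} \<union> {c} \<union> set p \<union> set q \<union> set r \<subseteq> W" and nf: "\<not> forbidden W E"
    and t: "touch E {v} ({c} \<union> set p \<union> set q \<union> set r)"
  shows "spider_legs E c (p @ [v]) q r \<or> spider_legs E c p (q @ [v]) r \<or> spider_legs E c p q (r @ [v])"
proof -
  have two: False if S: "spider_legs E c p q r" and v: "v \<notin> {c} \<union> set p \<union> set q \<union> set r"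
    and W: "{v} \<union> {c} \<union> set p \<union> set q \<union> set r \<subseteq> W" and t: "touch E {v} (set p)" "touch E {v} (set q)" for p q r
  proof -
    have S': "pathl E (c # p)" "pathl E (c # q)" "pathl E (c # r)" "p \<noteq> []" "q \<noteq> []" "r \<noteq> []"
      "set p \<inter> set q = {}" "set p \<inter> set r = {}" "set q \<inter> set r = {}"
      "\<not> touch E (set p) (set q)" "\<not> touch E (set p) (set r)" "\<not> touch E (set q) (set r)"
      using S by (auto simp: spider_legs_def)
    note f = S'(7-12) spider_leg(1-3)[OF S'(1,4)] spider_leg(1-3)[OF S'(2,5)] spider_leg(1-3)[OF S'(3,6)]
    have w: "v \<in> W" "c \<in> W" "set p \<subseteq> W" "set q \<subseteq> W" "set r \<subseteq> W" "v \<notin> set p" "v \<notin> set q" "v \<notin> set r" "v \<noteq> c"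
      using v W by auto
    have cp: "induced_connected E ({v} \<union> set p)" by (rule connected_Un[OF connected_single f(9) t(1)])
    have "minor_model W E diamond_edges [set q, {v} \<union> set p, {c}, set r]" if "touch E {v} (set r)"
      using f w t that cp by (auto simp: model_simps diamond_edges_def)
    moreover have "minor_model W E diamond_edges [set p, {c}, {v}, set q]" if "touch E {v} {c}"
      using f w t that by (auto simp: model_simps diamond_edges_def)
    moreover have "minor_model W E square_pendant_edges [{c}, set p, {v}, set q, set r]"
      if "\<not> touch E {v} (set r)" "\<not> touch E {v} {c}"
      using f w t that by (auto simp: model_simps square_pendant_edges_def)
    ultimately show False using nf forbidden.intros(2,3) by blast
  qed
  have n: "\<not> (touch E {v} (set p) \<and> touch E {v} (set q))" "\<not> (touch E {v} (set p) \<and> touch E {v} (set r))"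
    "\<not> (touch E {v} (set q) \<and> touch E {v} (set r))"
  proof -
    have S2: "spider_legs E c p r q" and S3: "spider_legs E c q r p" using S spider_legs_swap by blast+
    have W2: "v \<notin> {c} \<union> set p \<union> set r \<union> set q" "{v} \<union> {c} \<union> set p \<union> set r \<union> set q \<subseteq> W" using v W by blast+
    have W3: "v \<notin> {c} \<union> set q \<union> set r \<union> set p" "{v} \<union> {c} \<union> set q \<union> set r \<union> set p \<subseteq> W" using v W by blast+
    show "\<not> (touch E {v} (set p) \<and> touch E {v} (set q))" "\<not> (touch E {v} (set p) \<and> touch E {v} (set r))"
      "\<not> (touch E {v} (set q) \<and> touch E {v} (set r))"
      using two[OF S v W] two[OF S2 W2] two[OF S3 W3] by blast+
  qed
  consider "touch E {v} ({c} \<union> set p)" "\<not> touch E {v} (set q)" "\<not> touch E {v} (set r)"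
    | "touch E {v} ({c} \<union> set q)" "\<not> touch E {v} (set p)" "\<not> touch E {v} (set r)"
    | "touch E {v} ({c} \<union> set r)" "\<not> touch E {v} (set p)" "\<not> touch E {v} (set q)"
    using n t by (cases "touch E {v} (set p)"; cases "touch E {v} (set q)"; cases "touch E {v} (set r)") auto
  then show ?thesis
  proof cases
    case 1
    then show ?thesis using spider_extend_leg[OF S v W nf] by blast
  next
    case 2
    have "spider_legs E c (q @ [v]) p r"
      by (rule spider_extend_leg[OF spider_legs_swap(1)[OF S] _ _ nf]) (use v W 2 in auto)
    then show ?thesis using spider_legs_swap by blast
  next
    case 3
    have "spider_legs E c r p q" using S spider_legs_swap by blast
    then have "spider_legs E c (r @ [v]) p q"
      by (rule spider_extend_leg[OF _ _ _ nf]) (use v W 3 in auto)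
    then show ?thesis using spider_legs_swap by blast
  qed
qed

text \<open>The third leg is the single vertex \<open>z\<close>, which is what distinguishes almost
  paths and paths with a triangle among the spiders and nets.\<close>

inductive family :: "nat set set \<Rightarrow> nat set \<Rightarrow> bool" for E where
  family_path: "pathl E xs \<Longrightarrow> xs \<noteq> [] \<Longrightarrow> family E (set xs)"
| family_cycle: "cyclel E w xs \<Longrightarrow> family E ({w} \<union> set xs)"
| family_almost: "spider_legs E c p q [z] \<Longrightarrow> family E ({c} \<union> set p \<union> set q \<union> {z})"
| family_triangle: "triangle_legs E p q [z] \<Longrightarrow> family E (set p \<union> set q \<union> {z})"

section \<open>Growing a member of the families by one vertex\<close>

lemma family_eq: "family E A \<Longrightarrow> A = B \<Longrightarrow> family E B"
  by simp

text \<open>Contracting the tails of the two long legs leaves three legs of length exactly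
  two.\<close>

lemma long_spider_forbidden:
  assumes S: "spider_legs E c p q [z, v]" and len: "2 \<le> length p" "2 \<le> length q"
    and W: "{c} \<union> set p \<union> set q \<union> {z, v} \<subseteq> W"
  shows "forbidden W E"
proof -
  have list2: "\<exists>a A. l = a # A \<and> A \<noteq> []" if "2 \<le> length l" for l :: "nat list"
    using that by (cases l; cases "tl l") auto
  obtain a A where a: "p = a # A" "A \<noteq> []" using list2[OF len(1)] by blast
  obtain b B where b: "q = b # B" "B \<noteq> []" using list2[OF len(2)] by blast
  have p: "pathl E ([c] @ a # A)" "pathl E ([c] @ b # B)" "pathl E ([c] @ z # [v])"
    using S a b by (auto simp: spider_legs_def)
  note m = pathl_mid[OF p(1), simplified] pathl_mid[OF p(2), simplified] pathl_mid[OF p(3), simplified]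
  have n: "\<not> touch E {a} {b}" "\<not> touch E {a} (set B)" "\<not> touch E (set A) {b}" "\<not> touch E (set A) (set B)"
    "\<not> touch E {a} {z}" "\<not> touch E {a} {v}" "\<not> touch E (set A) {z}" "\<not> touch E (set A) {v}"
    "\<not> touch E {b} {z}" "\<not> touch E {b} {v}" "\<not> touch E (set B) {z}" "\<not> touch E (set B) {v}"
    using S unfolding spider_legs_def a b by (auto simp: touch_def)
  have d: "a \<noteq> b" "a \<notin> set B" "b \<notin> set A" "set A \<inter> set B = {}" "a \<noteq> z" "a \<noteq> v" "z \<notin> set A" "v \<notin> set A"
    "b \<noteq> z" "b \<noteq> v" "z \<notin> set B" "v \<notin> set B" "z \<noteq> v" "c \<noteq> z" "c \<noteq> v" "c \<noteq> a" "c \<notin> set A" "c \<noteq> b" "c \<notin> set B"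
    "a \<notin> set A" "b \<notin> set B"
    using S unfolding spider_legs_def a b by auto
  have w: "c \<in> W" "a \<in> W" "b \<in> W" "z \<in> W" "v \<in> W" "set A \<subseteq> W" "set B \<subseteq> W" using W unfolding a b by auto
  have "minor_model W E spider_edges [{c}, {a}, set A, {b}, set B, {z}, {v}]"
    using m n d w a(2) b(2) by (auto simp: model_simps spider_edges_def)
  then show ?thesis by (rule forbidden.intros)
qed

lemma long_net_forbidden:
  assumes T: "triangle_legs E p q [z, v]" and len: "2 \<le> length p" "2 \<le> length q"
    and W: "set p \<union> set q \<union> {z, v} \<subseteq> W"
  shows "forbidden W E"
proof -
  have list2: "\<exists>a A. l = a # A \<and> A \<noteq> []" if "2 \<le> length l" for l :: "nat list"
    using that by (cases l; cases "tl l") auto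
  obtain a A where a: "p = a # A" "A \<noteq> []" using list2[OF len(1)] by blast
  obtain b B where b: "q = b # B" "B \<noteq> []" using list2[OF len(2)] by blast
  have p: "pathl E ([] @ a # A)" "pathl E ([] @ b # B)" "pathl E ([] @ z # [v])"
    using T a b by (auto simp: triangle_legs_def)
  note m = pathl_mid[OF p(1), simplified] pathl_mid[OF p(2), simplified] pathl_mid[OF p(3), simplified]
  have d: "a \<noteq> b" "a \<notin> set B" "b \<notin> set A" "set A \<inter> set B = {}" "a \<noteq> z" "a \<noteq> v" "z \<notin> set A" "v \<notin> set A"
    "b \<noteq> z" "b \<noteq> v" "z \<notin> set B" "v \<notin> set B" "z \<noteq> v" "a \<notin> set A" "b \<notin> set B"
    using T unfolding triangle_legs_def cross_def a b by auto
  have n: "touch E {a} {b}" "\<not> touch E {a} (set B)" "\<not> touch E (set A) {b}" "\<not> touch E (set A) (set B)"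
    "touch E {a} {z}" "\<not> touch E {a} {v}" "\<not> touch E (set A) {z}" "\<not> touch E (set A) {v}"
    "touch E {b} {z}" "\<not> touch E {b} {v}" "\<not> touch E (set B) {z}" "\<not> touch E (set B) {v}"
    using T d unfolding triangle_legs_def cross_def a b by (auto simp: touch_def)
  have w: "a \<in> W" "b \<in> W" "z \<in> W" "v \<in> W" "set A \<subseteq> W" "set B \<subseteq> W" using W unfolding a b by auto
  have "minor_model W E net_edges [{a}, {b}, {z}, set A, set B, {v}]"
    using m n d w a(2) b(2) by (auto simp: model_simps net_edges_def)
  then show ?thesis by (rule forbidden.intros)
qed

text \<open>A path turns into any of the families, according to \<open>path_neighbours\<close>; a
  cycle admits no extension; almost paths and paths with a triangle grow along a leg, which must not
  make all three legs long.\<close>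

lemma family_extend:
  assumes U: "family E U" and v: "v \<notin> U" and W: "{v} \<union> U \<subseteq> W" and nf: "\<not> forbidden W E" and t: "touch E {v} U"
  shows "family E ({v} \<union> U)"
  using U
proof cases
  case (family_path xs)
  have v': "v \<notin> set xs" and W': "insert v (set xs) \<subseteq> W" and t': "touch E {v} (set xs)"
    using v W t family_path(1) by auto
  show ?thesis
  proof (rule path_neighbours[OF family_path(2) v' W' nf t'])
    fix A x B assume e: "xs = A @ x # B" and N: "\<And>u. u \<in> set xs \<Longrightarrow> {v, u} \<in> E \<longleftrightarrow> u = x"
    note p = family_path(2)[unfolded e]
    consider "A = []" | "B = []" | "A \<noteq> []" "B \<noteq> []" by blast
    then show ?thesis
    proof cases
      case 1
      then have "pathl E (v # xs)" using family_path(2) v' N e by auto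
      from this show ?thesis by (rule family_eq[OF family.family_path]) (use family_path(1) in auto)
    next
      case 2
      have "pathl E (xs @ [v])"
        using family_path(2) v' N 2 e unfolding pathl_append by (auto simp: insert_commute)
      from this show ?thesis by (rule family_eq[OF family.family_path]) (use family_path(1) in auto)
    next
      case 3
      have pr: "pathl E (A @ [x])" "pathl E (x # B)" using p[unfolded pathl_append] by (auto simp: pathl_append)
      have "pathl E (x # rev A)" using pr(1) pathl_rev[of E "A @ [x]"] by simp
      moreover have "pathl E (x # [v])" using v' N[of x] e by (auto simp: insert_commute)
      moreover have "\<not> touch E (set (rev A)) (set B)" using pathl_mid(3)[OF p] by simp
      moreover have "\<not> touch E (set (rev A)) (set [v])" "\<not> touch E (set B) (set [v])"
        using N pathl_mid(4,5)[OF p] unfolding e touch_def by (auto simp: insert_commute)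
      ultimately have "spider_legs E x (rev A) B [v]"
        using 3 pr(2) v' pathl_mid(6)[OF p] unfolding spider_legs_def e by auto
      from this show ?thesis by (rule family_eq[OF family_almost]) (use family_path(1) e in auto)
    qed
  next
    fix A x y B assume e: "xs = A @ x # y # B" and N: "\<And>u. u \<in> set xs \<Longrightarrow> {v, u} \<in> E \<longleftrightarrow> u = x \<or> u = y"
    have p: "pathl E ((A @ [x]) @ y # B)" using family_path(2) e by simp
    note a = p[unfolded pathl_append]
    have pr: "pathl E (A @ [x])" "pathl E (y # B)" using a by (auto simp: pathl_append)
    have "pathl E (rev (A @ [x]))" using pr(1) by (simp only: pathl_rev)
    moreover have "cross E (rev (A @ [x])) (y # B)" using a unfolding cross_def by auto
    moreover have "{u, v} \<in> E \<longleftrightarrow> u = x \<or> u = y" if "u \<in> set xs" for u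
      using N[OF that] by (simp add: insert_commute)
    then have "cross E (rev (A @ [x])) [v]" "cross E (y # B) [v]"
      using v' pathl_distinct[OF p] unfolding cross_def e by auto
    ultimately have "triangle_legs E (rev (A @ [x])) (y # B) [v]"
      using pr unfolding triangle_legs_def by auto
    from this show ?thesis by (rule family_eq[OF family_triangle]) (use family_path(1) e in auto)
  next
    fix x B y assume e: "xs = x # B @ [y]" and B: "B \<noteq> []" and N: "\<And>u. u \<in> set xs \<Longrightarrow> {v, u} \<in> E \<longleftrightarrow> u = x \<or> u = y"
    have "3 \<le> length xs" using e B by (cases B) auto
    then have "cyclel E v xs" using family_path(2) v' N e unfolding cyclel_def by auto
    then show ?thesis using family_cycle family_path(1) by simp
  qed
next
  case (family_cycle w xs)
  then show ?thesis using cycle_extension_forbidden[of E w xs v W] v W nf t by auto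
next
  case (family_almost c p q z)
  have "spider_legs E c (p @ [v]) q [z] \<or> spider_legs E c p (q @ [v]) [z] \<or> spider_legs E c p q ([z] @ [v])"
    by (rule spider_extend[OF family_almost(2) _ _ nf]) (use v W t family_almost(1) in auto)
  then consider "spider_legs E c (p @ [v]) q [z]" | "spider_legs E c p (q @ [v]) [z]" | "spider_legs E c p q [z, v]"
    by auto
  then show ?thesis
  proof cases
    case 1
    from this show ?thesis by (rule family_eq[OF family.family_almost]) (use family_almost(1) in auto)
  next
    case 2
    from this show ?thesis by (rule family_eq[OF family.family_almost]) (use family_almost(1) in auto)
  next
    case 3
    have ne: "p \<noteq> []" "q \<noteq> []" using 3 by (auto simp: spider_legs_def)
    have "\<not> (2 \<le> length p \<and> 2 \<le> length q)"
      using long_spider_forbidden[OF 3, of W] W nf family_almost(1) by auto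
    \<comment> \<open>The leg of length one takes over the role of \<open>z\<close>, and the leg
      that was just extended becomes part of the long path.\<close>
    then consider "length p = 1" | "length q = 1" using ne by (cases p; cases q) (auto simp: not_le)
    then show ?thesis
    proof cases
      case 1
      then obtain a where a: "p = [a]" by (auto simp: length_Suc_conv)
      have "spider_legs E c q [z, v] [a]" using 3 spider_legs_swap a by blast
      from this show ?thesis by (rule family_eq[OF family.family_almost]) (use family_almost(1) a in auto)
    next
      case 2
      then obtain a where a: "q = [a]" by (auto simp: length_Suc_conv)
      have "spider_legs E c p [z, v] [a]" using 3 spider_legs_swap a by blast
      from this show ?thesis by (rule family_eq[OF family.family_almost]) (use family_almost(1) a in auto)
    qed
  qed
next
  case (family_triangle p q z)
  have "triangle_legs E (p @ [v]) q [z] \<or> triangle_legs E p (q @ [v]) [z] \<or> triangle_legs E p q ([z] @ [v])"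
    by (rule triangle_extend[OF family_triangle(2) _ _ nf]) (use v W t family_triangle(1) in auto)
  then consider "triangle_legs E (p @ [v]) q [z]" | "triangle_legs E p (q @ [v]) [z]" | "triangle_legs E p q [z, v]"
    by auto
  then show ?thesis
  proof cases
    case 1
    from this show ?thesis by (rule family_eq[OF family.family_triangle]) (use family_triangle(1) in auto)
  next
    case 2
    from this show ?thesis by (rule family_eq[OF family.family_triangle]) (use family_triangle(1) in auto)
  next
    case 3
    have ne: "p \<noteq> []" "q \<noteq> []" using 3 by (auto simp: triangle_legs_def)
    have "\<not> (2 \<le> length p \<and> 2 \<le> length q)"
      using long_net_forbidden[OF 3, of W] W nf family_triangle(1) by auto
    then consider "length p = 1" | "length q = 1" using ne by (cases p; cases q) (auto simp: not_le)
    then show ?thesis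
    proof cases
      case 1
      then obtain a where a: "p = [a]" by (auto simp: length_Suc_conv)
      have "triangle_legs E q [z, v] [a]" using 3 triangle_legs_swap a by blast
      from this show ?thesis by (rule family_eq[OF family.family_triangle]) (use family_triangle(1) a in auto)
    next
      case 2
      then obtain a where a: "q = [a]" by (auto simp: length_Suc_conv)
      have "triangle_legs E p [z, v] [a]" using 3 triangle_legs_swap a by blast
      from this show ?thesis by (rule family_eq[OF family.family_triangle]) (use family_triangle(1) a in auto)
    qed
  qed
qed

text \<open>Take a vertex set of maximal size belonging to the families. If it were proper,
  connectedness would supply an adjacent vertex and \<open>family_extend\<close> a larger
  set.\<close>

theorem connected_family:
  assumes W: "finite W" "induced_connected E W" and nf: "\<not> forbidden W E"
  shows "family E W"
proof -
  let ?P = "\<lambda>U. U \<subseteq> W \<and> family E U"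
  obtain x where x: "x \<in> W" using W(2) connected_nonempty by blast
  have "?P {x}" using family_path[of E "[x]"] x by simp
  then obtain U where U: "?P U" and max: "\<And>U'. ?P U' \<Longrightarrow> card U' \<le> card U"
    using ex_has_greatest_nat[of ?P "{x}" card "Suc (card W)"] card_mono[OF W(1)] by (auto simp: less_Suc_eq_le)
  show ?thesis
  proof (cases "U = W")
    case False
    have "U \<noteq> {}" using U by (auto elim!: family.cases simp: spider_legs_def triangle_legs_def cyclel_def)
    then obtain s t where st: "s \<in> U" "t \<in> W - U" "{s, t} \<in> E"
      using W(2)[unfolded induced_connected_cut, THEN conjunct2, rule_format, of U] U False by blast
    have "touch E {t} U" using st unfolding touch_def by (metis insert_commute singletonI)
    then have "family E ({t} \<union> U)"
      by (intro family_extend[OF _ _ _ nf]) (use U st in auto)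
    then have "card ({t} \<union> U) \<le> card U" using max[of "{t} \<union> U"] U st by auto
    moreover have "finite U" using U W(1) finite_subset by blast
    ultimately show ?thesis using st by (simp add: Un_insert_left)
  qed (use U in blast)
qed

section \<open>Indefinite sums\<close>

text \<open>Homogenized Bernoulli polynomials: \<open>bern c z k Y\<close> has \<open>z\<close>-difference \<open>z Y ^ k\<close>;
  \<open>c\<close> embeds the rationals into the ring.\<close>

fun bern :: "(rat \<Rightarrow> 'a::comm_ring_1) \<Rightarrow> 'a \<Rightarrow> nat \<Rightarrow> 'a \<Rightarrow> 'a" where
  "bern c z k Y = c (1 / of_nat (Suc k)) *
    (Y ^ Suc k - (\<Sum>j<k. of_nat (Suc k choose j) * z ^ (k - j) * bern c z j Y))"

declare bern.simps [simp del]

lemma bern_hom: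
  assumes "comm_ring_hom h" "\<And>q. h (c q) = c' q"
  shows "h (bern c z k Y) = bern c' (h z) k (h Y)"
proof (induction k rule: less_induct)
  case (less k)
  interpret h: comm_ring_hom h by (rule assms(1))
  show ?case
    by (subst (1 2) bern.simps) (auto simp: h.hom_mult h.hom_minus h.hom_power h.hom_sum assms(2) less h.hom_of_nat
        simp del: power_Suc intro!: sum.cong)
qed

lemma bern_diff:
  assumes "coeff_hom c"
  shows "bern c z k (Y + z) - bern c z k Y = z * Y ^ k"
proof (induction k rule: less_induct)
  case (less k)
  interpret c: coeff_hom c by (rule assms)
  let ?b = "\<lambda>j. of_nat (Suc k choose j) * z ^ (k - j)"
  have bin: "(Y + z) ^ Suc k - Y ^ Suc k = (\<Sum>j\<le>k. of_nat (Suc k choose j) * Y ^ j * z ^ (Suc k - j))"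
    by (subst binomial_ring) (simp del: power_Suc)
  have "bern c z k (Y + z) - bern c z k Y = c (1 / of_nat (Suc k)) *
      ((Y + z) ^ Suc k - Y ^ Suc k - (\<Sum>j<k. ?b j * (bern c z j (Y + z) - bern c z j Y)))"
    by (subst (1 2) bern.simps) (simp add: right_diff_distrib sum_subtractf del: power_Suc)
  also have "(\<Sum>j<k. ?b j * (bern c z j (Y + z) - bern c z j Y)) = (\<Sum>j<k. of_nat (Suc k choose j) * Y ^ j * z ^ (Suc k - j))"
    by (intro sum.cong refl) (simp add: less Suc_diff_le less_imp_le mult_ac)
  \<comment> \<open>The terms with j < k cancel against the recursion and only the binomial term j =
    k remains.\<close>
  also have "(Y + z) ^ Suc k - Y ^ Suc k - \<dots> = of_nat (Suc k) * Y ^ k * z"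
    unfolding bin by (simp add: lessThan_Suc_atMost[symmetric])
  also have "c (1 / of_nat (Suc k)) * (of_nat (Suc k) * Y ^ k * z) = c (1 / of_nat (Suc k)) * of_nat (Suc k) * (z * Y ^ k)"
    by (simp add: mult_ac)
  also have "c (1 / of_nat (Suc k)) * of_nat (Suc k) = 1"
  proof -
    have ofn: "c (of_nat m) = of_nat m" for m by (induction m) (auto simp: c.c_0 c.c_1 c.c_add)
    have "c (1 / of_nat (Suc k)) * c (of_nat (Suc k)) = c 1" by (simp add: c.c_mult[symmetric] del: of_nat_Suc)
    then show ?thesis by (simp only: ofn c.c_1)
  qed
  finally show ?case by simp
qed

lemma bern_dvd: "(Y - Y') dvd bern c z k Y - bern c z k Y'" for Y Y' :: "'a::idom"
proof (induction k rule: less_induct)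
  case (less k)
  have p: "(Y - Y') dvd Y ^ Suc k - Y' ^ Suc k" by (metis dvd_triv_left power_diff_sumr2)
  let ?b = "\<lambda>j. of_nat (Suc k choose j) * z ^ (k - j)"
  have "bern c z k Y - bern c z k Y' = c (1 / of_nat (Suc k)) *
      (Y ^ Suc k - Y' ^ Suc k - (\<Sum>j<k. ?b j * (bern c z j Y - bern c z j Y')))"
    by (subst (1 2) bern.simps) (simp add: right_diff_distrib sum_subtractf del: power_Suc)
  moreover have "(Y - Y') dvd (\<Sum>j<k. ?b j * (bern c z j Y - bern c z j Y'))"
    using less by (intro dvd_sum dvd_mult) auto
  ultimately show ?case using p by (simp add: dvd_diff dvd_mult)
qed

lemma bern_tdeg:
  assumes "tdeg z \<le> 1" "tdeg Y \<le> 1" shows "tdeg (bern const z k Y) \<le> Suc k"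
proof (induction k rule: less_induct)
  case (less k)
  have "tdeg (Y ^ Suc k) \<le> Suc k" using tdeg_power_le[OF assms(2), of "Suc k"] by simp
  moreover have "tdeg (of_nat (Suc k choose j) * z ^ (k - j) * bern const z j Y) \<le> Suc k" if "j < k" for j
  proof -
    have on: "of_nat m = const (of_nat m)" for m by (induction m) (auto simp: const_add)
    have "tdeg (z ^ (k - j) * bern const z j Y) \<le> (k - j) + Suc j"
      using tdeg_mult_le[of "z ^ (k - j)" "bern const z j Y"] tdeg_power_le[OF assms(1), of "k - j"] less[OF that] by simp
    then show ?thesis unfolding on mult.assoc using that by (intro tdeg_const_mult_le) auto
  qed
  ultimately show ?case
    by (subst bern.simps) (auto intro!: tdeg_const_mult_le tdeg_diff_le tdeg_sum_le simp del: power_Suc)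
qed

lemma bern_polys_over:
  assumes "z \<in> polys_over V" "Y \<in> polys_over V" shows "bern const z k Y \<in> polys_over V"
proof (induction k rule: less_induct)
  case (less k)
  have on: "of_nat m = const (of_nat m)" for m by (induction m) (auto simp: const_add)
  show ?case
    by (subst bern.simps, unfold on)
      (use less assms in \<open>auto intro!: polys_over_mult polys_over_diff polys_over_sum polys_over_power simp del: power_Suc\<close>)
qed

text \<open>Indefinite sum of \<open>g\<close> with step \<open>z\<close>. The factor
  \<open>z\<close> in its difference equation keeps it polynomial in \<open>z\<close>; at z = 0 it
  is the integral.\<close>

definition usum :: "qpoly \<Rightarrow> qpoly poly \<Rightarrow> qpoly \<Rightarrow> qpoly" where
  "usum z g Y = (\<Sum>k\<le>degree g. coeff g k * bern const z k Y)"

lemma usum_diff: "usum z g (Y + z) - usum z g Y = z * poly g Y"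
proof -
  have "usum z g (Y + z) - usum z g Y = (\<Sum>k\<le>degree g. coeff g k * (bern const z k (Y + z) - bern const z k Y))"
    by (simp add: usum_def right_diff_distrib sum_subtractf)
  then show ?thesis
    by (simp add: bern_diff[OF psub_h.coeff_hom_axioms] poly_altdef sum_distrib_left mult_ac)
qed

lemma usum_dvd: "(Y - Y') dvd usum z g Y - usum z g Y'"
proof -
  have "usum z g Y - usum z g Y' = (\<Sum>k\<le>degree g. coeff g k * (bern const z k Y - bern const z k Y'))"
    by (simp add: usum_def right_diff_distrib sum_subtractf)
  then show ?thesis by (auto intro!: dvd_sum dvd_mult bern_dvd)
qed

lemma usum_polys_over:
  "z \<in> polys_over V \<Longrightarrow> Y \<in> polys_over V \<Longrightarrow> (\<And>k. coeff g k \<in> polys_over V) \<Longrightarrow> usum z g Y \<in> polys_over V"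
  unfolding usum_def by (intro polys_over_sum polys_over_mult bern_polys_over)

text \<open>Total degree when the variable of \<open>g\<close> counts as degree one. Zero
  coefficients are exempted because \<open>tdeg 0 = 0\<close>.\<close>

definition wd :: "nat \<Rightarrow> qpoly poly \<Rightarrow> bool" where
  "wd d g \<longleftrightarrow> (\<forall>k. coeff g k = 0 \<or> tdeg (coeff g k) + k \<le> d)"

lemma usum_tdeg:
  assumes "tdeg z \<le> 1" "tdeg Y \<le> 1" "wd d g" shows "tdeg (usum z g Y) \<le> Suc d"
  unfolding usum_def
proof (rule tdeg_sum_le)
  fix k
  show "tdeg (coeff g k * bern const z k Y) \<le> Suc d"
  proof (cases "coeff g k = 0")
    case False
    then have "tdeg (coeff g k) + k \<le> d" using assms(3) by (auto simp: wd_def)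
    then show ?thesis
      using tdeg_mult_le[of "coeff g k" "bern const z k Y"] bern_tdeg[OF assms(1,2), of k] by linarith
  qed simp
qed

lemma wd_degree: "wd d g \<Longrightarrow> degree g \<le> d"
  by (rule degree_le) (auto simp: wd_def)

lemma wd_mult: assumes "wd d g" "wd e h" shows "wd (d + e) (g * h)"
  unfolding wd_def
proof
  fix k
  show "coeff (g * h) k = 0 \<or> tdeg (coeff (g * h) k) + k \<le> d + e"
  proof (cases "k \<le> d + e")
    case False
    then have "degree (g * h) < k"
      using degree_mult_le[of g h] wd_degree[OF assms(1)] wd_degree[OF assms(2)] by linarith
    then show ?thesis by (simp add: coeff_eq_0)
  next
    case True
    have "tdeg (coeff g i * coeff h (k - i)) \<le> d + e - k" if "i \<le> k" for i
    proof (cases "coeff g i = 0 \<or> coeff h (k - i) = 0")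
      case False
      then have "tdeg (coeff g i) + i \<le> d" "tdeg (coeff h (k - i)) + (k - i) \<le> e"
        using assms by (auto simp: wd_def)
      then show ?thesis using tdeg_mult_le[of "coeff g i" "coeff h (k - i)"] that by linarith
    qed auto
    then have "tdeg (coeff (g * h) k) \<le> d + e - k" unfolding coeff_mult by (intro tdeg_sum_le) auto
    then show ?thesis using True by linarith
  qed
qed

lemma wd_linear: "tdeg a \<le> 1 \<Longrightarrow> wd 1 [:a, 1:]"
  by (auto simp: wd_def coeff_pCons split: nat.split)

lemma wd_1: "wd 0 1"
  by (auto simp: wd_def one_pCons coeff_pCons split: nat.split)

lemma wd_monom: "wd j (monom 1 j)"
  by (auto simp: wd_def)

lemma wd_const: "tdeg a \<le> 1 \<Longrightarrow> wd 1 [:a:]"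
  by (auto simp: wd_def coeff_pCons split: nat.split)

lemma wd_prod_linear: "finite S \<Longrightarrow> (\<And>s. s \<in> S \<Longrightarrow> tdeg (a s) \<le> 1) \<Longrightarrow> wd (card S) (\<Prod>s\<in>S. [:a s, 1:])"
proof (induction S rule: finite_induct)
  case (insert x S)
  then show ?case using wd_mult[OF wd_linear, of "a x" "card S" "\<Prod>s\<in>S. [:a s, 1:]"] by auto
qed (simp add: wd_1)

definition coeffs_over :: "nat set \<Rightarrow> qpoly poly \<Rightarrow> bool" where
  "coeffs_over V g \<longleftrightarrow> (\<forall>k. coeff g k \<in> polys_over V)"

lemma coeffs_over_mult: "coeffs_over V g \<Longrightarrow> coeffs_over V h \<Longrightarrow> coeffs_over V (g * h)"
  unfolding coeffs_over_def coeff_mult by (auto intro!: polys_over_sum polys_over_mult)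

lemma coeffs_over_pCons: "a \<in> polys_over V \<Longrightarrow> coeffs_over V g \<Longrightarrow> coeffs_over V (pCons a g)"
  unfolding coeffs_over_def by (auto simp: coeff_pCons split: nat.split)

lemma coeffs_over_basic [simp]: "coeffs_over V 0" "coeffs_over V 1" "coeffs_over V (monom 1 j)"
  unfolding coeffs_over_def by (auto simp: one_pCons coeff_pCons split: nat.split)

lemma coeffs_over_prod: "(\<And>s. s \<in> S \<Longrightarrow> coeffs_over V (f s)) \<Longrightarrow> coeffs_over V (prod f S)"
  by (induction S rule: infinite_finite_induct) (auto intro: coeffs_over_mult)

text \<open>At a point with z = 1 an indefinite sum depends on \<open>Y\<close> only through its
  value there, via one rational polynomial with unit step. Independence of derivations thus becomes
  a question about univariate rational polynomials.\<close>

lemma rational_usum: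
  assumes "ev P z = 1" "wd d g"
  shows "\<exists>H. degree H \<le> Suc d \<and> (\<forall>Y. ev P (usum z g Y) = poly H (ev P Y)) \<and>
    (\<forall>t. poly H (t + 1) - poly H t = ev P (poly g (const t)))"
proof -
  interpret ch: coeff_hom "\<lambda>q::rat. [:q:]" by unfold_locales (auto simp: one_pCons)
  define H where "H = (\<Sum>k\<le>degree g. smult (ev P (coeff g k)) (bern (\<lambda>q. [:q:]) 1 k [:0, 1:]))"
  have db: "degree (bern (\<lambda>q. [:q:]) 1 k [:0, 1:]) \<le> Suc k" for k
  proof (induction k rule: less_induct)
    case (less k)
    have "degree ([:0, 1:] ^ Suc k :: rat poly) \<le> Suc k"
      using degree_power_le[of "[:0, 1:] :: rat poly" "Suc k"] by simp
    moreover have "degree (of_nat (Suc k choose j) * 1 ^ (k - j) * bern (\<lambda>q. [:q:]) 1 j [:0, 1:] :: rat poly) \<le> Suc k"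
      if "j < k" for j
    proof -
      have "degree (of_nat (Suc k choose j) * bern (\<lambda>q. [:q:]) 1 j [:0, 1:] :: rat poly) \<le> degree (bern (\<lambda>q. [:q:]) 1 j [:0, 1:] :: rat poly)"
        using degree_mult_le[of "of_nat (Suc k choose j) :: rat poly"] by (metis add.left_neutral degree_of_nat)
      then show ?thesis using less[OF that] that by simp
    qed
    ultimately have "degree ([:0, 1:] ^ Suc k - (\<Sum>j<k. of_nat (Suc k choose j) * 1 ^ (k - j) * bern (\<lambda>q. [:q:]) 1 j [:0, 1:]) :: rat poly) \<le> Suc k"
      by (intro degree_diff_le degree_sum_le) auto
    then show ?case by (subst bern.simps) (simp del: power_Suc)
  qed
  have pb: "poly (bern (\<lambda>q. [:q:]) 1 k [:0, 1:]) t = bern (\<lambda>q. q) 1 k t" for k and t :: rat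
  proof -
    have "comm_ring_hom (\<lambda>p. poly p t)" by unfold_locales auto
    from bern_hom[OF this, of "\<lambda>q. [:q:]" "\<lambda>q. q" 1 k "[:0, 1:]"] show ?thesis by simp
  qed
  have ev: "ev P (usum z g Y) = poly H (ev P Y)" for Y
  proof -
    have "ev P (bern const z k Y) = bern (\<lambda>q. q) 1 k (ev P Y)" for k
      using bern_hom[OF ev.comm_ring_hom_axioms[of P], of const "\<lambda>q. q" z k Y] assms(1) by simp
    then show ?thesis by (simp add: usum_def H_def ev.hom_sum ev.hom_mult poly_sum pb)
  qed
  have "degree H \<le> Suc d" unfolding H_def
  proof (rule degree_sum_le)
    fix k assume "k \<in> {..degree g}"
    then have "Suc k \<le> Suc d" using wd_degree[OF assms(2)] by simp
    then show "degree (smult (ev P (coeff g k)) (bern (\<lambda>q. [:q:]) 1 k [:0, 1:])) \<le> Suc d"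
      using db[of k] degree_smult_le order_trans by metis
  qed simp
  moreover have "poly H (t + 1) - poly H t = ev P (poly g (const t))" for t
  proof -
    have "ev P (usum z g (const t + z) - usum z g (const t)) = ev P (z * poly g (const t))" by (simp add: usum_diff)
    then show ?thesis using assms(1) by (simp add: ev.hom_minus ev.hom_mult ev ev.hom_add)
  qed
  ultimately show ?thesis using ev by blast
qed

lemma tdeg_der_det:
  assumes "\<And>k i. k < n \<Longrightarrow> tdeg (\<Theta> k i) \<le> d k"
  shows "tdeg (der_det n \<Theta>) \<le> (\<Sum>k<n. d k)"
  unfolding der_det_def fdet_leibniz
proof (rule tdeg_sum_le)
  fix p
  have "tdeg (\<Prod>i = 0..<n. \<Theta> i (Suc (p i))) \<le> (\<Sum>k = 0..<n. d k)"
    using assms by (intro tdeg_prod_le) auto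
  then show "tdeg (signof p * (\<Prod>i = 0..<n. \<Theta> i (Suc (p i)))) \<le> (\<Sum>k<n. d k)"
    by (cases "sign p = 1") (auto simp: sign_def lessThan_atLeast0 split: if_splits)
qed

section \<open>Free deformations of the braid arrangement\<close>

text \<open>In the coordinates \<open>y\<^sub>i\<close> and \<open>z\<close> the arrangement consists of \<open>z\<close>, of all \<open>y\<^sub>j - y\<^sub>i\<close>, and of
  \<open>y\<^sub>j - y\<^sub>i + z\<close> for \<open>(i, j) \<in> T\<close>. The basis consists of the Euler derivation and of derivations
  \<open>y\<^sub>i \<mapsto> F(y\<^sub>i)\<close>, \<open>z \<mapsto> 0\<close>, where \<open>F(Y + z) - F(Y) = z G(Y)\<close>.\<close>

theorem deformation_free:
  fixes g :: "nat \<Rightarrow> nat" and G :: "nat \<Rightarrow> qpoly poly" and y :: "nat \<Rightarrow> qpoly" and z :: qpoly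
  assumes n: "n = m + 1" and bij: "bij_betw g {1..m+1} {1..n}"
    and y: "\<And>i. y i = (\<Sum>k\<in>{1..i}. var (g k))"
    and z: "z = (if cyc then - (y m + var (g (m + 1))) else var (g (m + 1)))"
    and types: "\<And>J. J \<noteq> {} \<Longrightarrow> J \<subseteq> {1..m+1} \<Longrightarrow> induced_connected E (g ` J) \<Longrightarrow>
      (\<exists>i j. i < j \<and> j \<le> m \<and> J = {Suc i..j}) \<or>
      (\<exists>i j. (i, j) \<in> T \<and> i < j \<and> j \<le> m \<and> J = (if cyc then {1..m+1} - {Suc i..j} else {Suc i..j} \<union> {m+1})) \<or>
      J = (if cyc then {1..m+1} else {m+1})"
    and div: "\<And>p i j. p < m \<Longrightarrow> (i, j) \<in> T \<Longrightarrow> i < j \<Longrightarrow> j \<le> m \<Longrightarrow> y j - y i + z dvd poly (G p) (y j)"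
    and over: "\<And>p. p < m \<Longrightarrow> coeffs_over {1..n} (G p)"
    and wd: "\<And>p. p < m \<Longrightarrow> wd (dg p) (G p)" "\<And>p. p < m \<Longrightarrow> dg p \<le> m"
    and indep: "\<And>P c H p. (\<And>i. i \<le> m \<Longrightarrow> ev P (y i) = 2 * of_nat i) \<Longrightarrow> ev P z = 1 \<Longrightarrow> degree H \<le> Suc m \<Longrightarrow>
      (\<And>t. poly H (t + 1) - poly H t = (\<Sum>p<m. c p * ev P (poly (G p) (const t)))) \<Longrightarrow>
      (\<And>k. k \<le> m \<Longrightarrow> poly H (2 * of_nat k) = poly H 0) \<Longrightarrow> p < m \<Longrightarrow> c p = (0::rat)"
    and count: "1 + (\<Sum>p<m. Suc (dg p)) \<le> card (conn_subgraph_arr n E)"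
  shows "free_arrangement n (conn_subgraph_arr n E)"
proof -
  let ?N = "{1..m+1}"
  define gi where "gi = the_inv_into ?N g"
  have inj: "inj_on g ?N" and img: "g ` ?N = {1..n}" using bij by (auto simp: bij_betw_def)
  have gi: "gi (g k) = k" if "k \<in> ?N" for k unfolding gi_def by (rule the_inv_into_f_f[OF inj that])
  have gin: "g k \<in> {1..n}" if "k \<in> ?N" for k using img that by blast
  let ?F = "\<lambda>p. usum z (G p)"
  \<comment> \<open>Entries of the derivation, so that sums over intervals telescope. It sends
    \<open>y i\<close> to \<open>?F p (y i) - ?F p (y 0)\<close>, because \<open>y 0 = 0\<close> has
    to go to 0, and \<open>z\<close> to 0; for a cycle the last variable is - z -
    \<open>y m\<close>, which explains the third case.\<close>
  define cp where "cp p k = (if k \<le> m then ?F p (y k) - ?F p (y (k - 1)) else if cyc then ?F p (y 0) - ?F p (y m) else 0)" for p k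
  define \<theta> where "\<theta> p v = (if v \<in> {1..n} then cp p (gi v) else 0)" for p v
  define \<Theta> where "\<Theta> k = (if k = 0 then (\<lambda>v. if v \<in> {1..n} then var v else 0) else \<theta> (k - 1))" for k
  have yP: "y i \<in> polys_over {1..n}" "tdeg (y i) \<le> 1" if "i \<le> m" for i
    unfolding y using gin that by (auto intro!: polys_over_sum polys_over_var tdeg_sum_le tdeg_var[simplified])
  have m1: "m + 1 \<in> ?N" by simp
  have zP: "z \<in> polys_over {1..n}" "tdeg z \<le> 1"
  proof -
    have "var (g (m + 1)) \<in> polys_over {1..n}" by (rule polys_over_var[OF gin[OF m1]])
    then show "z \<in> polys_over {1..n}"
      using yP[of m] unfolding z by (auto intro!: polys_over_uminus polys_over_add polys_over_diff)
    show "tdeg z \<le> 1" unfolding z using yP[of m] tdeg_var[of "g (m + 1)"] by (auto intro!: tdeg_add_le tdeg_diff_le simp del: One_nat_def)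
  qed
  have FP: "?F p (y i) \<in> polys_over {1..n}" "tdeg (?F p (y i)) \<le> Suc (dg p)" if "p < m" "i \<le> m" for p i
    using usum_polys_over[OF zP(1) yP(1)[OF that(2)]] over[OF that(1)] usum_tdeg[OF zP(2) yP(2)[OF that(2)] wd(1)[OF that(1)]]
    by (auto simp: coeffs_over_def)
  have cpP: "cp p k \<in> polys_over {1..n}" "tdeg (cp p k) \<le> Suc (dg p)" if "p < m" for p k
    unfolding cp_def using FP[OF that] by (auto intro!: polys_over_diff tdeg_diff_le)
  have \<theta>P: "\<theta> p \<in> derivations n" "tdeg (\<theta> p v) \<le> Suc (dg p)" if "p < m" for p v
    using cpP[OF that] unfolding \<theta>_def derivations_def polys_in_over by auto
  have sum\<theta>: "(\<Sum>v\<in>g ` J. \<theta> p v) = (\<Sum>k\<in>J. cp p k)" if "J \<subseteq> ?N" for p J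
  proof -
    have "inj_on g J" using inj that by (rule inj_on_subset)
    then have "(\<Sum>v\<in>g ` J. \<theta> p v) = (\<Sum>k\<in>J. \<theta> p (g k))" by (simp add: sum.reindex)
    also have "\<dots> = (\<Sum>k\<in>J. cp p k)"
    proof (rule sum.cong[OF refl])
      fix k assume "k \<in> J"
      then have "k \<in> ?N" using that by blast
      then show "\<theta> p (g k) = cp p k" using gin gi by (simp only: \<theta>_def if_True)
    qed
    finally show ?thesis .
  qed
  have vsJ: "vs (g ` J) = (\<Sum>k\<in>J. var (g k))" if "J \<subseteq> ?N" for J
    unfolding vs_def using inj_on_subset[OF inj that] by (simp add: sum.reindex)
  have int\<theta>: "(\<Sum>k\<in>{Suc i..j}. cp p k) = ?F p (y j) - ?F p (y i)" if "i \<le> j" "j \<le> m" for p i j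
  proof -
    have "(\<Sum>k\<in>{Suc i..j}. cp p k) = (\<Sum>k\<in>{Suc i..j}. ?F p (y k) - ?F p (y (k - 1)))"
      by (rule sum.cong) (use that in \<open>auto simp: cp_def\<close>)
    then show ?thesis using sum_telescope''[OF that(1), of "\<lambda>k. ?F p (y k)"] by simp
  qed
  have intv: "(\<Sum>k\<in>{Suc i..j}. var (g k)) = y j - y i" if "i \<le> j" for i j
  proof -
    have "(\<Sum>k\<in>{Suc i..j}. var (g k)) = (\<Sum>k\<in>{Suc i..j}. y k - y (k - 1))"
    proof (rule sum.cong[OF refl])
      fix k assume "k \<in> {Suc i..j}"
      then obtain k' where "k = Suc k'" by (cases k) auto
      then show "var (g k) = y k - y (k - 1)" unfolding y by simp
    qed
    then show ?thesis using sum_telescope''[OF that, of y] by simp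
  qed
  have D\<theta>: "\<theta> p \<in> Dmod n (conn_subgraph_arr n E)" if p: "p < m" for p
  proof -
    have "lin_form n a dvd apply_der n (\<theta> p) a" if a: "a \<in> conn_subgraph_arr n E" for a
    proof -
      obtain I where I: "a = ind I" "I \<noteq> {}" "I \<subseteq> {1..n}" "induced_connected E I"
        using a unfolding conn_subgraph_arr_ind by blast
      define J where "J = {k \<in> ?N. g k \<in> I}"
      have JN: "J \<subseteq> ?N" by (auto simp: J_def)
      have gJ: "g ` J = I"
      proof (intro equalityI subsetI)
        fix x assume x: "x \<in> I"
        then have "x \<in> g ` ?N" using I(3) img by blast
        then show "x \<in> g ` J" using x by (auto simp: J_def)
      qed (auto simp: J_def)
      then have "J \<noteq> {}" using I(2) by auto
      have sp: "{1..m+1} = insert (m+1) {Suc 0..m}" by auto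
      have allv: "(\<Sum>k\<in>?N. var (g k)) = y m + var (g (m + 1))" unfolding y sp by (simp add: add.commute)
      have all\<theta>: "(\<Sum>k\<in>?N. cp p k) = cp p (m + 1) + (?F p (y m) - ?F p (y 0))"
        unfolding sp using int\<theta>[of 0 m p] by simp
      have "vs (g ` J) dvd (\<Sum>v\<in>g ` J. \<theta> p v)"
        unfolding sum\<theta>[OF JN] vsJ[OF JN]
        using types[OF \<open>J \<noteq> {}\<close> JN I(4)[folded gJ]]
      proof (elim disjE exE conjE)
        fix i j assume ij: "i < j" "j \<le> m" "J = {Suc i..j}"
        then have "i \<le> j" by simp
        show "(\<Sum>k\<in>J. var (g k)) dvd (\<Sum>k\<in>J. cp p k)"
          unfolding ij(3) int\<theta>[OF \<open>i \<le> j\<close> ij(2)] intv[OF \<open>i \<le> j\<close>] by (rule usum_dvd)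
      next
        fix i j assume T: "(i, j) \<in> T" "i < j" "j \<le> m"
          and J: "J = (if cyc then {1..m+1} - {Suc i..j} else {Suc i..j} \<union> {m+1})"
        have ij: "i \<le> j" using T by simp
        \<comment> \<open>Modulo the form, \<open>y i\<close> equals \<open>y j + z\<close>, where
          the indefinite sum differs from its value at \<open>y j\<close> by \<open>z\<close> times
          \<open>G p\<close> at \<open>y j\<close>; the latter is divisible by
          \<open>div\<close>.\<close>
        have "y j - y i + z dvd ?F p (y j + z) - ?F p (y i)"
          using usum_dvd[of "y j + z" "y i" z "G p"] by (simp add: algebra_simps)
        moreover have "y j - y i + z dvd z * poly (G p) (y j)" using div[OF p T] by (rule dvd_mult)
        ultimately have "y j - y i + z dvd (?F p (y j + z) - ?F p (y i)) - z * poly (G p) (y j)" by (rule dvd_diff)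
        also have "(?F p (y j + z) - ?F p (y i)) - z * poly (G p) (y j) = ?F p (y j) - ?F p (y i)"
          unfolding usum_diff[symmetric] by simp
        finally have key: "y j - y i + z dvd ?F p (y j) - ?F p (y i)" .
        show "(\<Sum>k\<in>J. var (g k)) dvd (\<Sum>k\<in>J. cp p k)"
        proof (cases cyc)
          case True
          have sub: "{Suc i..j} \<subseteq> ?N" using T by auto
          have "(\<Sum>k\<in>J. var (g k)) = - (y j - y i + z)"
            unfolding J if_P[OF True] sum_diff[OF finite_atLeastAtMost sub] allv intv[OF ij] using True by (simp add: z)
          moreover have "(\<Sum>k\<in>J. cp p k) = - (?F p (y j) - ?F p (y i))"
            unfolding J if_P[OF True] sum_diff[OF finite_atLeastAtMost sub] all\<theta> int\<theta>[OF ij T(3)] using True by (simp add: cp_def)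
          ultimately show ?thesis using key by (simp only: minus_dvd_iff dvd_minus_iff)
        next
          case False
          have dis: "{Suc i..j} \<inter> {m + 1} = {}" using T by auto
          have "(\<Sum>k\<in>J. var (g k)) = y j - y i + z"
            unfolding J if_not_P[OF False] using intv[OF ij] False dis by (subst sum.union_disjoint) (auto simp: z)
          moreover have "(\<Sum>k\<in>J. cp p k) = ?F p (y j) - ?F p (y i)"
            unfolding J if_not_P[OF False] using int\<theta>[OF ij T(3)] False dis by (subst sum.union_disjoint) (auto simp: cp_def)
          ultimately show ?thesis using key by simp
        qed
      next
        assume J: "J = (if cyc then {1..m+1} else {m+1})"
        have "(\<Sum>k\<in>J. cp p k) = 0"
        proof (cases cyc)
          case True
          then show ?thesis unfolding J if_P[OF True] all\<theta> by (simp add: cp_def)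
        next
          case False
          then show ?thesis unfolding J if_not_P[OF False] by (simp add: cp_def)
        qed
        then show "(\<Sum>k\<in>J. var (g k)) dvd (\<Sum>k\<in>J. cp p k)" by simp
      qed
      then show ?thesis using I(1,3) gJ by (simp add: lin_form_ind apply_der_ind)
    qed
    then show ?thesis using \<theta>P(1)[OF p] by (simp add: Dmod_iff)
  qed
  have DE: "\<Theta> 0 \<in> Dmod n (conn_subgraph_arr n E)"
  proof -
    have "apply_der n (\<Theta> 0) a = lin_form n a" for a
      unfolding apply_der_def lin_form_def \<Theta>_def by (rule sum.cong) auto
    then show ?thesis
      unfolding Dmod_iff derivations_def polys_in_over by (auto simp: \<Theta>_def intro: polys_over_var)
  qed
  have D: "\<Theta> k \<in> Dmod n (conn_subgraph_arr n E)" if "k < n" for k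
    using DE D\<theta>[of "k - 1"] that n by (cases "k = 0") (auto simp: \<Theta>_def)
  show ?thesis
  proof (rule saito_free[OF arr_conn_subgraph D])
    have "tdeg (\<Theta> k v) \<le> (if k = 0 then 1 else Suc (dg (k - 1)))" if "k < n" for k v
      using \<theta>P(2)[of "k - 1" v] tdeg_var[of v] that n by (cases "k = 0") (auto simp: \<Theta>_def)
    then have "tdeg (der_det n \<Theta>) \<le> (\<Sum>k<n. if k = 0 then 1 else Suc (dg (k - 1)))"
      by (rule tdeg_der_det)
    also have "\<dots> = 1 + (\<Sum>p<m. Suc (dg p))"
      unfolding n Suc_eq_plus1[symmetric] by (subst sum.lessThan_Suc_shift) simp
    finally show "tdeg (der_det n \<Theta>) \<le> card (conn_subgraph_arr n E)" using count by simp
  next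
    \<comment> \<open>All path variables are 2, so that \<open>y i\<close> becomes 2i. For a cycle
      the last value is chosen to make \<open>z\<close>, the negative of the total, equal to
      1.\<close>
    define P where "P v = (if v = g (m + 1) then (if cyc then - 1 - 2 * of_nat m else 1) else (2::rat))" for v
    have Pg: "P (g k) = 2" if "k \<in> {1..m}" for k
    proof -
      have "g k \<noteq> g (m + 1)" using inj_onD[OF inj, of k "m + 1"] that by auto
      then show ?thesis by (simp add: P_def)
    qed
    have Py: "ev P (y i) = 2 * of_nat i" if "i \<le> m" for i
    proof -
      have "ev P (y i) = (\<Sum>k\<in>{1..i}. 2)" unfolding y ev.hom_sum ev_var by (rule sum.cong) (use Pg that in auto)
      then show ?thesis by simp
    qed
    have Pz: "ev P z = 1" unfolding z using Py[of m] by (simp add: ev.hom_uminus ev.hom_add ev.hom_minus P_def)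
    have "\<forall>p\<in>{..<m}. \<exists>H. degree H \<le> Suc (dg p) \<and> (\<forall>Y. ev P (?F p Y) = poly H (ev P Y)) \<and>
        (\<forall>t. poly H (t + 1) - poly H t = ev P (poly (G p) (const t)))"
      using rational_usum[OF Pz wd(1)] by blast
    from bchoice[OF this] obtain H where H: "\<forall>p\<in>{..<m}. degree (H p) \<le> Suc (dg p) \<and>
        (\<forall>Y. ev P (?F p Y) = poly (H p) (ev P Y)) \<and>
        (\<forall>t. poly (H p) (t + 1) - poly (H p) t = ev P (poly (G p) (const t)))" ..
    show "der_det n \<Theta> \<noteq> 0"
    proof
      assume "der_det n \<Theta> = 0"
      moreover have "ev P (der_det n \<Theta>) = fdet n (\<lambda>k j. ev P (\<Theta> k (Suc j)))"
        unfolding der_det_def by (rule fdet_hom) unfold_locales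
      ultimately have "fdet n (\<lambda>k j. ev P (\<Theta> k (Suc j))) = 0" by (simp add: ev.hom_zero)
      then obtain c where c: "\<exists>i<n. c i \<noteq> 0" "\<forall>j<n. (\<Sum>k<n. c k * ev P (\<Theta> k (Suc j))) = 0"
        unfolding fdet_0_left by blast
      have rel: "c 0 * P (g k) + (\<Sum>p<m. c (Suc p) * ev P (cp p k)) = 0" if k: "k \<in> ?N" for k
      proof -
        obtain j where j: "g k = Suc j" "j < n" using gin[OF k] by (cases "g k") auto
        have "(\<Sum>k'<n. c k' * ev P (\<Theta> k' (g k))) = 0" using c(2) j by simp
        also have "(\<Sum>k'<n. c k' * ev P (\<Theta> k' (g k))) = c 0 * ev P (\<Theta> 0 (g k)) + (\<Sum>p<m. c (Suc p) * ev P (\<Theta> (Suc p) (g k)))"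
          unfolding n Suc_eq_plus1[symmetric] by (rule sum.lessThan_Suc_shift)
        also have "ev P (\<Theta> 0 (g k)) = P (g k)" using gin[OF k] by (auto simp: \<Theta>_def)
        also have "(\<Sum>p<m. c (Suc p) * ev P (\<Theta> (Suc p) (g k))) = (\<Sum>p<m. c (Suc p) * ev P (cp p k))"
          using gin[OF k] gi[OF k] by (auto simp: \<Theta>_def \<theta>_def intro!: sum.cong)
        finally show ?thesis .
      qed
      define K where "K = (\<Sum>p<m. smult (c (Suc p)) (H p))"
      have PK: "(\<Sum>p<m. c (Suc p) * ev P (?F p (y i))) = poly K (2 * of_nat i)" if "i \<le> m" for i
        using H Py[OF that] by (simp add: K_def poly_sum)
      have step: "c 0 * 2 + (poly K (2 * of_nat k) - poly K (2 * of_nat (k - 1))) = 0" if k: "k \<in> {1..m}" for k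
      proof -
        have "(\<Sum>p<m. c (Suc p) * ev P (cp p k)) = (\<Sum>p<m. c (Suc p) * ev P (?F p (y k))) - (\<Sum>p<m. c (Suc p) * ev P (?F p (y (k - 1))))"
          using k by (simp add: cp_def ev.hom_minus right_diff_distrib sum_subtractf)
        also have "\<dots> = poly K (2 * of_nat k) - poly K (2 * of_nat (k - 1))"
          using PK[of k] PK[of "k - 1"] k by auto
        finally show ?thesis using rel[of k] Pg[OF k] k by auto
      qed
      \<comment> \<open>A dependency with Euler coefficient \<open>c 0\<close> makes the combined
        indefinite sum \<open>K\<close> linear along the points 2k.\<close>
      have lin: "poly K (2 * of_nat k) = poly K 0 - 2 * c 0 * of_nat k" if "k \<le> m" for k
        using that
      proof (induction k)
        case (Suc k)
        then show ?case using step[of "Suc k"] by (simp add: algebra_simps)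
      qed simp
      \<comment> \<open>The last coordinate decides: for a cycle the contributions of 2m cancel and
        - \<open>c 0\<close> remains, otherwise only the Euler derivation is nonzero there.\<close>
      have c0: "c 0 = 0"
      proof (cases cyc)
        case True
        have "(\<Sum>p<m. c (Suc p) * ev P (cp p (m + 1))) = (\<Sum>p<m. c (Suc p) * ev P (?F p (y 0))) - (\<Sum>p<m. c (Suc p) * ev P (?F p (y m)))"
          using True by (simp add: cp_def ev.hom_minus right_diff_distrib sum_subtractf)
        also have "\<dots> = poly K 0 - poly K (2 * of_nat m)" using PK[of 0] PK[of m] by simp
        finally show ?thesis using rel[OF m1] lin[of m] True by (simp add: P_def algebra_simps)
      next
        case False
        then show ?thesis using rel[OF m1] by (simp add: P_def cp_def ev.hom_zero)
      qed
      have "c (Suc p) = 0" if p: "p < m" for p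
      proof (rule indep[OF Py Pz _ _ _ p, of K "\<lambda>p. c (Suc p)"])
        show "degree K \<le> Suc m" unfolding K_def
        proof (rule degree_sum_le)
          fix p assume p: "p \<in> {..<m}"
          then have "degree (H p) \<le> Suc (dg p)" using H by blast
          then have "degree (H p) \<le> Suc m" using wd(2)[of p] p by simp
          then show "degree (smult (c (Suc p)) (H p)) \<le> Suc m" using degree_smult_le order_trans by blast
        qed simp
        fix t :: rat
        show "poly K (t + 1) - poly K t = (\<Sum>p<m. c (Suc p) * ev P (poly (G p) (const t)))"
          using H by (simp add: K_def poly_sum sum_subtractf[symmetric] right_diff_distrib[symmetric])
      next
        fix k :: nat assume "k \<le> m"
        then show "poly K (2 * of_nat k) = poly K 0" using lin c0 by simp
      qed
      then have "c i = 0" if "i < n" for i using c0 that n by (cases i) auto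
      with c(1) show False by blast
    qed
  qed
qed

subsection \<open>Independence at a rational point\<close>

lemma poly_many_roots_zero:
  fixes p :: "rat poly"
  assumes "finite S" "degree p < card S" "\<And>x. x \<in> S \<Longrightarrow> poly p x = 0"
  shows "p = 0"
proof (rule ccontr)
  assume "p \<noteq> 0"
  then have "card S \<le> card {x. poly p x = 0}"
    using assms(3) by (intro card_mono poly_roots_finite) auto
  also have "\<dots> \<le> degree p" using \<open>p \<noteq> 0\<close> by (rule card_poly_roots_bound)
  finally show False using assms(2) by simp
qed

lemma coeff_prod_linear:
  fixes a :: "'b \<Rightarrow> rat"
  assumes "finite S"
  shows "coeff (\<Prod>s\<in>S. [:a s, 1:]) (card S) = 1" "degree (\<Prod>s\<in>S. [:a s, 1:]) = card S"
    "S \<noteq> {} \<Longrightarrow> coeff (\<Prod>s\<in>S. [:a s, 1:]) (card S - 1) = (\<Sum>s\<in>S. a s)"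
proof -
  have "coeff (\<Prod>s\<in>S. [:a s, 1:]) (card S) = 1 \<and> degree (\<Prod>s\<in>S. [:a s, 1:]) = card S \<and>
    (S \<noteq> {} \<longrightarrow> coeff (\<Prod>s\<in>S. [:a s, 1:]) (card S - 1) = (\<Sum>s\<in>S. a s))"
    using assms
  proof (induction S rule: finite_induct)
    case (insert x S)
    let ?q = "\<Prod>s\<in>S. [:a s, 1:]"
    have q: "coeff ?q (card S) = 1" "degree ?q = card S" "S \<noteq> {} \<Longrightarrow> coeff ?q (card S - 1) = (\<Sum>s\<in>S. a s)"
      using insert.IH by auto
    have e: "(\<Prod>s\<in>insert x S. [:a s, 1:]) = smult (a x) ?q + pCons 0 ?q"
      using insert.hyps by simp
    have c: "coeff (\<Prod>s\<in>insert x S. [:a s, 1:]) (Suc i) = a x * coeff ?q (Suc i) + coeff ?q i" for i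
      unfolding e by simp
    have c1: "coeff (\<Prod>s\<in>insert x S. [:a s, 1:]) (Suc (card S)) = 1"
      unfolding c using q by (simp add: coeff_eq_0)
    have "degree (\<Prod>s\<in>insert x S. [:a s, 1:]) = Suc (card S)"
    proof (rule antisym)
      show "degree (\<Prod>s\<in>insert x S. [:a s, 1:]) \<le> Suc (card S)"
      proof (rule degree_le, intro allI impI)
        fix i assume "Suc (card S) < i"
        then obtain j where "i = Suc j" "card S < j" by (cases i) auto
        then show "coeff (\<Prod>s\<in>insert x S. [:a s, 1:]) i = 0" using c[of j] q(2) by (simp add: coeff_eq_0)
      qed
      show "Suc (card S) \<le> degree (\<Prod>s\<in>insert x S. [:a s, 1:])" using c1 by (intro le_degree) auto
    qed
    moreover have "coeff (\<Prod>s\<in>insert x S. [:a s, 1:]) (card S) = (\<Sum>s\<in>insert x S. a s)"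
    proof (cases "S = {}")
      case False
      then obtain k where k: "card S = Suc k" using insert.hyps(1) by (metis card_0_eq not0_implies_Suc)
      then show ?thesis using c[of k] q(1) q(3)[OF False] insert.hyps by simp
    qed simp
    ultimately show ?case using c1 insert.hyps by simp
  qed simp
  then show "coeff (\<Prod>s\<in>S. [:a s, 1:]) (card S) = 1" "degree (\<Prod>s\<in>S. [:a s, 1:]) = card S"
    "S \<noteq> {} \<Longrightarrow> coeff (\<Prod>s\<in>S. [:a s, 1:]) (card S - 1) = (\<Sum>s\<in>S. a s)" by auto
qed

lemma poly_prod_linear: "poly (\<Prod>s\<in>S. [:a s, 1:]) t = (\<Prod>s\<in>S. t + a s)" for t :: "'a::comm_ring_1"
  by (simp add: poly_prod add.commute)

text \<open>Up to a constant, \<open>H\<close> is a multiple of the polynomial with roots 0, 2, ...,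
  2m, because its degree exceeds the number of these points by nothing.\<close>

lemma equal_values_difference:
  fixes H :: "rat poly"
  assumes "degree H \<le> Suc m" "\<And>k. k \<le> m \<Longrightarrow> poly H (2 * of_nat k) = poly H 0"
  shows "\<exists>C. \<forall>t. poly H (t + 1) - poly H t = C * ((\<Prod>s\<le>m. t + 1 - 2 * of_nat s) - (\<Prod>s\<le>m. t - 2 * of_nat s))"
proof -
  let ?P = "\<Prod>s\<le>m. [:- (2 * of_nat s), 1:] :: rat poly"
  define C where "C = coeff H (Suc m)"
  have P: "coeff ?P (Suc m) = 1" "degree ?P = Suc m"
    using coeff_prod_linear(1,2)[of "{..m}" "\<lambda>s. - (2 * of_nat s)"] by auto
  have "H - [:poly H 0:] - smult C ?P = 0"
  proof (rule poly_many_roots_zero)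
    let ?S = "(\<lambda>k. 2 * of_nat k :: rat) ` {..m}"
    have "degree (H - [:poly H 0:] - smult C ?P) \<le> m"
    proof (rule degree_le, intro allI impI)
      fix i assume i: "m < i"
      show "coeff (H - [:poly H 0:] - smult C ?P) i = 0"
      proof (cases "i = Suc m")
        case True
        then show ?thesis using P by (simp add: C_def coeff_pCons)
      next
        case False
        then have "Suc m < i" using i by simp
        then show ?thesis using assms(1) P(2) i by (cases i) (auto simp: coeff_eq_0)
      qed
    qed
    moreover have "card ?S = Suc m" by (subst card_image) (auto intro: inj_onI)
    ultimately show "degree (H - [:poly H 0:] - smult C ?P) < card ?S" by simp
    fix x assume "x \<in> ?S"
    then obtain k where k: "k \<le> m" "x = 2 * of_nat k" by auto
    have "(\<Prod>s\<le>m. x - 2 * of_nat s) = 0" using k by (intro prod_zero) auto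
    then show "poly (H - [:poly H 0:] - smult C ?P) x = 0" using assms(2)[OF k(1)] k(2) by (simp add: poly_prod)
  qed simp
  then have HP: "H = [:poly H 0:] + smult C ?P" by (simp add: algebra_simps)
  have val: "poly H t = poly H 0 + C * (\<Prod>s\<le>m. t - 2 * of_nat s)" for t
    using arg_cong[OF HP, of "\<lambda>q. poly q t"] by (simp add: poly_prod)
  have "poly H (t + 1) - poly H t = C * ((\<Prod>s\<le>m. t + 1 - 2 * of_nat s) - (\<Prod>s\<le>m. t - 2 * of_nat s))" for t
    using val[of "t + 1"] val[of t] by (simp add: right_diff_distrib)
  then show ?thesis by blast
qed

text \<open>Parity: shifted factors never vanish at the even points, which is the reason for the
  step 2.\<close>

lemma odd_nonzero: "(2 * of_nat r + 1 - 2 * of_nat s :: rat) \<noteq> 0"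
proof
  assume "(2 * of_nat r + 1 - 2 * of_nat s :: rat) = 0"
  then have "(of_nat (2 * r + 1) :: rat) = of_nat (2 * s)" by simp
  then have "2 * r + 1 = 2 * s" by (simp only: of_nat_eq_iff)
  then show False by presburger
qed

text \<open>The right side is h(t) times the factors t - 2s for s >= k, plus h'(t) times the factors
  t + 1 - 2s for s < e. At the even points t = 2r with r >= k the first part vanishes, which fixes
  h' at more points than its degree allows unless \<open>C = 0\<close>.\<close>

lemma family_independence:
  fixes c :: "nat \<Rightarrow> rat"
  assumes km: "k \<le> m" and e: "e = k \<or> e = Suc k \<and> k < m"
    and eq: "\<And>t. C * ((\<Prod>s\<le>m. t + 1 - 2 * of_nat s) - (\<Prod>s\<le>m. t - 2 * of_nat s)) =
      (\<Sum>p<m. c p * (if p < k then t ^ p * (\<Prod>s\<in>{k..m}. t - 2 * of_nat s)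
        else t ^ (p - k) * (\<Prod>s<e. t + 1 - 2 * of_nat s)))"
    and p: "p < m"
  shows "c p = 0"
proof -
  define b where "b = m - k"
  have m: "m = k + b" using km by (simp add: b_def)
  define h where "h = (\<Sum>j<k. monom (c j) j)"
  define h' where "h' = (\<Sum>j<b. monom (c (k + j)) j)"
  have eq': "C * ((\<Prod>s\<le>m. t + 1 - 2 * of_nat s) - (\<Prod>s\<le>m. t - 2 * of_nat s)) =
      poly h t * (\<Prod>s\<in>{k..m}. t - 2 * of_nat s) + poly h' t * (\<Prod>s<e. t + 1 - 2 * of_nat s)" for t
  proof -
    have "(\<Sum>p<k + b. f p) = (\<Sum>p<k. f p) + (\<Sum>j<b. f (k + j))" for f :: "nat \<Rightarrow> rat"
      by (induction b) (auto simp: add_ac)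
    then show ?thesis unfolding eq unfolding m
      by (simp add: h_def h'_def poly_sum poly_monom sum_distrib_right mult_ac)
  qed
  have ch': "coeff h' i = (if i < b then c (k + i) else 0)" for i
    by (simp add: h'_def coeff_sum)
  have ch: "coeff h i = (if i < k then c i else 0)" for i
    by (simp add: h_def coeff_sum)
  define M where "M = (\<Prod>s\<in>{e..m}. [:1 - 2 * of_nat s, 1:] :: rat poly)"
  define P where "P = (\<Prod>s\<in>{k..m}. [:- (2 * of_nat s), 1:] :: rat poly)"
  have fin: "finite {e..m}" "finite {k..m}" by auto
  note cM = coeff_prod_linear[OF fin(1), of "\<lambda>s. 1 - 2 * of_nat s", folded M_def]
    and cP = coeff_prod_linear[OF fin(2), of "\<lambda>s. - (2 * of_nat s)", folded P_def]
  have val: "poly h' (2 * of_nat r) = C * poly M (2 * of_nat r)" if r: "r \<in> {k..m}" for r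
  proof -
    let ?t = "2 * of_nat r :: rat"
    have z1: "(\<Prod>s\<le>m. ?t - 2 * of_nat s) = 0" by (rule prod_zero[of _ ]) (use r in auto)
    have z2: "(\<Prod>s\<in>{k..m}. ?t - 2 * of_nat s) = 0" by (rule prod_zero) (use r in auto)
    have "{..m} = {..<e} \<union> {e..m}" using e km by auto
    then have sp: "(\<Prod>s\<le>m. ?t + 1 - 2 * of_nat s) = (\<Prod>s<e. ?t + 1 - 2 * of_nat s) * (\<Prod>s\<in>{e..m}. ?t + 1 - 2 * of_nat s)"
      by (simp only:) (rule prod.union_disjoint, auto)
    have nz: "(\<Prod>s<e. ?t + 1 - 2 * of_nat s) \<noteq> 0" using odd_nonzero by auto
    have "C * (\<Prod>s\<in>{e..m}. ?t + 1 - 2 * of_nat s) = poly h' ?t"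
      using eq'[of ?t] unfolding z1 z2 sp using nz by (simp add: mult_ac)
    moreover have "poly M ?t = (\<Prod>s\<in>{e..m}. ?t + 1 - 2 * of_nat s)"
      unfolding M_def poly_prod_linear by (rule prod.cong) auto
    ultimately show ?thesis by simp
  qed
  \<comment> \<open>For e = k the polynomial \<open>M\<close> has degree b + 1, and adding
    \<open>P\<close>, which vanishes at the same points, cancels the leading term. Then the b + 1
    even points suffice.\<close>
  define Q where "Q = h' - smult C M + (if e = k then smult C P else 0)"
  have "Q = 0"
  proof (rule poly_many_roots_zero)
    let ?S = "(\<lambda>k. 2 * of_nat k :: rat) ` {k..m}"
    have "degree Q \<le> b"
    proof (rule degree_le, intro allI impI)
      fix i assume i: "b < i"
      consider "e = Suc k" | "e = k" "i = Suc b" | "e = k" "Suc b < i" using e i by linarith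
      then show "coeff Q i = 0"
      proof cases
        case 1
        then have "degree M < i" using cM(2) i m by simp
        then show ?thesis using i 1 by (simp add: Q_def ch' coeff_eq_0)
      next
        case 2
        then have "card {e..m} = i" "card {k..m} = i" using m by auto
        then show ?thesis using i 2 cM(1) cP(1) by (simp add: Q_def ch')
      next
        case 3
        then have "degree M < i" "degree P < i" using cM(2) cP(2) m by auto
        then show ?thesis using i by (simp add: Q_def ch' coeff_eq_0)
      qed
    qed
    moreover have "card ?S = Suc b" using m by (subst card_image) (auto intro: inj_onI)
    ultimately show "degree Q < card ?S" by simp
    fix x assume "x \<in> ?S"
    then obtain r where r: "r \<in> {k..m}" "x = 2 * of_nat r" by auto
    have "(\<Prod>s\<in>{k..m}. x - 2 * of_nat s) = 0" by (rule prod_zero) (use r in auto)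
    then have "poly P x = 0" by (simp add: P_def poly_prod)
    then show "poly Q x = 0" using val[OF r(1)] r(2) by (simp add: Q_def)
  qed simp
  \<comment> \<open>\<open>h'\<close> has degree below b, so the coefficient of \<open>Q\<close> at
    b comes from \<open>C\<close> alone: it is - C in one case, and - C (b + 1) from the subleading
    coefficients in the other.\<close>
  have "C = 0"
  proof (cases "e = k")
    case False
    then have "e = Suc k" "k < m" using e by auto
    then have "card {e..m} = b" using m by auto
    then have "coeff Q b = - C" using cM(1) False by (simp add: Q_def ch')
    then show ?thesis using \<open>Q = 0\<close> by simp
  next
    case True
    have cb: "card {k..m} - 1 = b" "{k..m} \<noteq> {}" using m by auto
    define s2 where "s2 = (\<Sum>s\<in>{k..m}. 2 * of_nat s :: rat)"
    have "coeff M b = (\<Sum>s\<in>{k..m}. 1 - 2 * of_nat s)" "coeff P b = (\<Sum>s\<in>{k..m}. - (2 * of_nat s))"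
      using cM(3) cP(3) cb True by auto
    then have MP: "coeff M b = of_nat (Suc b) - s2" "coeff P b = - s2"
      using m unfolding sum_subtractf sum_negf s2_def by auto
    have "coeff Q b = - C * coeff M b + C * coeff P b" using True by (simp add: Q_def ch')
    also have "\<dots> = - C * of_nat (Suc b)" unfolding MP by (simp add: algebra_simps)
    finally have "coeff Q b = - C * of_nat (Suc b)" .
    then have "C * of_nat (Suc b) = 0" using \<open>Q = 0\<close> by simp
    then show ?thesis by (simp del: of_nat_Suc)
  qed
  then have "h' = 0" using \<open>Q = 0\<close> by (simp add: Q_def split: if_splits)
  have "poly (h * P) t = 0" for t
    using eq'[of t] \<open>C = 0\<close> \<open>h' = 0\<close> by (simp add: P_def poly_prod)
  then have "h * P = 0" using poly_all_0_iff_0 by blast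
  moreover have "P \<noteq> 0" using cP(1) by auto
  ultimately have "h = 0" by simp
  show "c p = 0"
  proof (cases "p < k")
    case True
    then show ?thesis using ch[of p] \<open>h = 0\<close> by simp
  next
    case False
    then have "p - k < b" "k + (p - k) = p" using p m by auto
    then show ?thesis using ch'[of "p - k"] \<open>h' = 0\<close> by simp
  qed
qed

text \<open>The factor - 3 is the value of \<open>y p - y (Suc p) - z\<close> at the chosen point.
  With it each basis function is a difference of consecutive \<open>X p\<close>, while the left side
  is \<open>C\<close> times the sum of all of them; the \<open>X p\<close> are independent.\<close>

lemma cycle_independence:
  fixes c :: "nat \<Rightarrow> rat"
  assumes eq: "\<And>t. C * ((\<Prod>s\<le>m. t + 1 - 2 * of_nat s) - (\<Prod>s\<le>m. t - 2 * of_nat s)) =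
      (\<Sum>p<m. c p * ((- 3) * (\<Prod>s<p. t + 1 - 2 * of_nat s) * (\<Prod>s\<in>{Suc (Suc p)..m}. t - 2 * of_nat s)))"
    and p: "p < m"
  shows "c p = 0"
proof -
  \<comment> \<open>Products with shifted factors below p, plain factors above p and no factor at p:
    the terms of the telescoping from the plain product to the shifted one.\<close>
  define X where "X p t = (\<Prod>s<p. t + 1 - 2 * of_nat s) * (\<Prod>s\<in>{Suc p..m}. t - 2 * of_nat s)" for p and t :: rat
  have gX: "(- 3) * (\<Prod>s<p. t + 1 - 2 * of_nat s) * (\<Prod>s\<in>{Suc (Suc p)..m}. t - 2 * of_nat s) = X p t - X (Suc p) t"
    if "p < m" for p and t :: rat
  proof -
    have "{Suc p..m} = insert (Suc p) {Suc (Suc p)..m}" using that by auto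
    then show ?thesis unfolding X_def by (simp add: algebra_simps)
  qed
  have tel: "(\<Prod>s\<le>m. t + 1 - 2 * of_nat s) - (\<Prod>s\<le>m. t - 2 * of_nat s) = (\<Sum>p\<le>m. X p t)" for t :: rat
  proof -
    define Y where "Y p = (\<Prod>s<p. t + 1 - 2 * of_nat s) * (\<Prod>s\<in>{p..m}. t - 2 * of_nat s)" for p
    have "Y (Suc p) - Y p = X p t" if "p \<le> m" for p
    proof -
      have "{p..m} = insert p {Suc p..m}" using that by auto
      then show ?thesis unfolding X_def Y_def by (simp add: algebra_simps)
    qed
    then have "(\<Sum>p\<le>m. X p t) = (\<Sum>p\<le>m. Y (Suc p) - Y p)" by (intro sum.cong) auto
    also have "\<dots> = Y (Suc m) - Y 0" unfolding lessThan_Suc_atMost[symmetric] by (rule sum_lessThan_telescope)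
    also have "\<dots> = (\<Prod>s\<le>m. t + 1 - 2 * of_nat s) - (\<Prod>s\<le>m. t - 2 * of_nat s)"
      by (simp add: Y_def lessThan_Suc_atMost atLeast0AtMost)
    finally show ?thesis ..
  qed
  define a where "a p = (if p < m then c p else 0) - (if p = 0 then 0 else c (p - 1)) - C" for p
  have rel: "(\<Sum>p\<le>m. a p * X p t) = 0" for t
  proof -
    have "C * (\<Sum>p\<le>m. X p t) = (\<Sum>p<m. c p * (X p t - X (Suc p) t))"
      unfolding tel[symmetric] eq by (rule sum.cong) (use gX in auto)
    moreover have "(\<Sum>p\<le>m. (if p < m then c p else 0) * X p t) = (\<Sum>p<m. c p * X p t)"
      by (rule sum.mono_neutral_cong_right) auto
    moreover have "(\<Sum>p\<le>m. (if p = 0 then 0 else c (p - 1)) * X p t) = (\<Sum>p<m. c p * X (Suc p) t)"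
      unfolding lessThan_Suc_atMost[symmetric] by (subst sum.lessThan_Suc_shift) simp
    ultimately show ?thesis
      by (simp add: a_def left_diff_distrib right_diff_distrib sum_subtractf sum_distrib_left)
  qed
  \<comment> \<open>Triangularity, from the top down: at t = 2q all \<open>X p\<close> with p < q
    vanish, those with p > q already have coefficient zero, and \<open>X q\<close> is nonzero by
    parity.\<close>
  have a0: "a (m - j) = 0" if "j \<le> m" for j
    using that
  proof (induction j rule: less_induct)
    case (less j)
    let ?q = "m - j" and ?t = "2 * of_nat (m - j) :: rat"
    have "a p * X p ?t = (if p = ?q then a ?q * X ?q ?t else 0)" if "p \<le> m" for p
    proof -
      consider "p = ?q" | "p < ?q" | "?q < p" by linarith
      then show ?thesis
      proof cases
        case 2
        then have "(\<Prod>s\<in>{Suc p..m}. ?t - 2 * of_nat s) = 0"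
          by (intro prod_zero) (auto intro!: bexI[of _ ?q])
        then show ?thesis using 2 by (simp add: X_def)
      next
        case 3
        then have "a (m - (m - p)) = 0" using less.IH[of "m - p"] less.prems that by auto
        then show ?thesis using 3 that by simp
      qed simp
    qed
    then have "(\<Sum>p\<le>m. a p * X p ?t) = (\<Sum>p\<le>m. if p = ?q then a ?q * X ?q ?t else 0)" by (intro sum.cong) auto
    then have "a ?q * X ?q ?t = 0" using rel[of ?t] by simp
    moreover have "X ?q ?t \<noteq> 0" using odd_nonzero[of ?q] by (auto simp: X_def simp del: of_nat_diff)
    ultimately show ?case by simp
  qed
  have az: "a q = 0" if "q \<le> m" for q using a0[of "m - q"] that by simp
  have cl: "c q = of_nat (Suc q) * C" if "q < m" for q
    using that
  proof (induction q)
    case 0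
    then show ?case using az[of 0] by (simp add: a_def)
  next
    case (Suc q)
    then show ?case using az[of "Suc q"] by (simp add: a_def algebra_simps)
  qed
  \<comment> \<open>The last relation, c (m - 1) + C = 0, meets the recursion c (m - 1) = m
    C.\<close>
  have "of_nat (Suc m) * C = 0" using az[of m] cl[of "m - 1"] p by (simp add: a_def algebra_simps)
  then have "C = 0" by (simp del: of_nat_Suc)
  then show ?thesis using cl[OF p] by simp
qed

subsection \<open>Connected vertex sets of the four families\<close>

lemma connected_image:
  assumes inj: "inj_on g J" and adj: "\<And>x y. x \<in> J \<Longrightarrow> y \<in> J \<Longrightarrow> {g x, g y} \<in> E \<longleftrightarrow> {x, y} \<in> F"
  shows "induced_connected E (g ` J) \<longleftrightarrow> induced_connected F J"
proof
  assume c: "induced_connected E (g ` J)"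
  show "induced_connected F J" unfolding induced_connected_cut
  proof (intro conjI allI impI)
    show "J \<noteq> {}" using connected_nonempty[OF c] by auto
    fix S assume S: "S \<subseteq> J" "S \<noteq> {}" "S \<noteq> J"
    have "g ` S \<noteq> g ` J" using S inj_on_image_eq_iff[OF inj S(1) order_refl] by simp
    then obtain s t where st: "s \<in> g ` S" "t \<in> g ` J - g ` S" "{s, t} \<in> E"
      using c[unfolded induced_connected_cut, THEN conjunct2, rule_format, of "g ` S"] S by auto
    then obtain a b where "a \<in> S" "b \<in> J - S" "s = g a" "t = g b" by auto
    then show "\<exists>s\<in>S. \<exists>t\<in>J - S. {s, t} \<in> F" using adj[of a b] st(3) S(1) by auto
  qed
next
  assume c: "induced_connected F J"
  show "induced_connected E (g ` J)" unfolding induced_connected_cut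
  proof (intro conjI allI impI)
    show "g ` J \<noteq> {}" using connected_nonempty[OF c] by auto
    fix S assume S: "S \<subseteq> g ` J" "S \<noteq> {}" "S \<noteq> g ` J"
    define S' where "S' = {x \<in> J. g x \<in> S}"
    have gS: "g ` S' = S" using S(1) by (auto simp: S'_def)
    then have "S' \<noteq> {}" "S' \<noteq> J" using S by auto
    moreover have "S' \<subseteq> J" by (auto simp: S'_def)
    ultimately obtain a b where ab: "a \<in> S'" "b \<in> J - S'" "{a, b} \<in> F"
      using c[unfolded induced_connected_cut, THEN conjunct2, rule_format, of S'] by auto
    then have "g a \<in> S" "g b \<in> g ` J - S" "{g a, g b} \<in> E" using adj[of a b] by (auto simp: S'_def)
    then show "\<exists>s\<in>S. \<exists>t\<in>g ` J - S. {s, t} \<in> E" by blast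
  qed
qed

lemma convex_nat_set:
  fixes S :: "nat set"
  assumes "finite S" "S \<noteq> {}" "\<And>a b c. a \<in> S \<Longrightarrow> c \<in> S \<Longrightarrow> a < b \<Longrightarrow> b < c \<Longrightarrow> b \<in> S"
  shows "S = {Min S..Max S}"
proof (intro equalityI subsetI)
  fix x assume "x \<in> {Min S..Max S}"
  then show "x \<in> S" using assms(3)[of "Min S" "Max S" x] Min_in[OF assms(1,2)] Max_in[OF assms(1,2)]
    by (cases "x = Min S"; cases "x = Max S") auto
qed (use assms(1,2) in auto)

lemma convex_interval:
  assumes "S \<subseteq> {1..m}" "S \<noteq> {}" "\<And>a b c. a \<in> S \<Longrightarrow> c \<in> S \<Longrightarrow> a < b \<Longrightarrow> b < c \<Longrightarrow> b \<in> S"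
  obtains i j where "i < j" "j \<le> m" "S = {Suc i..j}"
proof -
  have fin: "finite S" using assms(1) finite_subset by blast
  have S: "S = {Min S..Max S}" using convex_nat_set[OF fin assms(2,3)] .
  have "Min S \<in> S" "Max S \<in> S" "Min S \<le> Max S" using fin assms(2) by auto
  then have "1 \<le> Min S" "Max S \<le> m" "Min S \<le> Max S" using assms(1) by auto
  then show ?thesis using that[of "Min S - 1" "Max S"] S by auto
qed

lemma connected_cutD:
  "induced_connected F J \<Longrightarrow> S \<subseteq> J \<Longrightarrow> S \<noteq> {} \<Longrightarrow> S \<noteq> J \<Longrightarrow> \<exists>s\<in>S. \<exists>t\<in>J - S. {s, t} \<in> F"
  unfolding induced_connected_cut by blast

text \<open>One description for three families: \<open>m + 1\<close> is joined to the path vertices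
  from \<open>k\<close> to \<open>e\<close>. This is an almost path for e = k, a path with a
  triangle for e = k + 1, and a path for k = e = m.\<close>

definition family_adj :: "nat \<Rightarrow> nat \<Rightarrow> nat \<Rightarrow> nat set set \<Rightarrow> bool" where
  "family_adj m k e F \<longleftrightarrow> (\<forall>i j. 1 \<le> i \<longrightarrow> i < j \<longrightarrow> j \<le> m + 1 \<longrightarrow>
    ({i, j} \<in> F \<longleftrightarrow> j \<le> m \<and> j = Suc i \<or> j = m + 1 \<and> k \<le> i \<and> i \<le> e))"

definition cycle_adj :: "nat \<Rightarrow> nat set set \<Rightarrow> bool" where
  "cycle_adj m F \<longleftrightarrow> (\<forall>i j. 1 \<le> i \<longrightarrow> i < j \<longrightarrow> j \<le> m + 1 \<longrightarrow>
    ({i, j} \<in> F \<longleftrightarrow> j = Suc i \<or> i = 1 \<and> j = m + 1))"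

text \<open>Because \<open>e \<le> Suc k\<close>, a gap in the path leaves one side without a
  neighbour of \<open>m + 1\<close>, and this side would be cut off. So the path part is an
  interval, and when it is nonempty and \<open>m + 1\<close> is present, it has to contain a
  neighbour of \<open>m + 1\<close>.\<close>

lemma family_types:
  assumes F: "family_adj m k e F" and ke: "k \<le> e" "e \<le> Suc k"
    and J: "J \<subseteq> {1..m+1}" "induced_connected F J"
  shows "(\<exists>i j. i < j \<and> j \<le> m \<and> J = {Suc i..j}) \<or>
    (\<exists>i j. (i < e \<and> k \<le> j) \<and> i < j \<and> j \<le> m \<and> J = {Suc i..j} \<union> {m+1}) \<or> J = {m+1}"
proof -
  have adj: "{i, j} \<in> F \<longleftrightarrow> j \<le> m \<and> j = Suc i \<or> j = m + 1 \<and> k \<le> i \<and> i \<le> e" if "1 \<le> i" "i < j" "j \<le> m + 1" for i j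
    using F that unfolding family_adj_def by blast
  let ?S = "J \<inter> {1..m}"
  have conv: "b \<in> ?S" if abc: "a \<in> ?S" "c \<in> ?S" "a < b" "b < c" for a b c
  proof (rule ccontr)
    assume "b \<notin> ?S"
    then have bJ: "b \<notin> J" using abc by auto
    have cut: False if A: "A = {x \<in> J. x < b \<and> x \<le> m} \<or> A = {x \<in> J. b < x \<and> x \<le> m}" and nK: "\<And>x. x \<in> A \<Longrightarrow> \<not> (k \<le> x \<and> x \<le> e)" for A
    proof -
      have ac: "a \<in> J" "c \<in> J" "a \<le> m" "c \<le> m" "\<not> b < a" "\<not> c < b" using abc by auto
      have "A \<subseteq> J" using A by blast
      moreover have "a \<in> A \<and> c \<notin> A \<or> c \<in> A \<and> a \<notin> A"
        using A
      proof
        assume "A = {x \<in> J. x < b \<and> x \<le> m}"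
        then show ?thesis using ac abc(3) by simp
      next
        assume "A = {x \<in> J. b < x \<and> x \<le> m}"
        then show ?thesis using ac abc(4) by simp
      qed
      then have "A \<noteq> {}" "A \<noteq> J" using ac by blast+
      ultimately obtain s t where st: "s \<in> A" "t \<in> J - A" "{s, t} \<in> F" using connected_cutD[OF J(2)] by blast
      have "s \<noteq> t" using st by auto
      have sJ: "s \<in> J" "s \<le> m" "t \<in> J" using st A by blast+
      then have r: "1 \<le> s" "s \<le> m" "1 \<le> t" "t \<le> m + 1" "t \<noteq> b" using J(1) bJ by auto
      have side: "s < b \<and> (t < b \<longrightarrow> m < t) \<or> b < s \<and> (b < t \<longrightarrow> m < t)"
        using A
      proof
        assume "A = {x \<in> J. x < b \<and> x \<le> m}"
        then show ?thesis using st by auto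
      next
        assume "A = {x \<in> J. b < x \<and> x \<le> m}"
        then show ?thesis using st by auto
      qed
      have "{t, s} \<in> F" using st(3) by (simp add: insert_commute)
      then consider "t = Suc s" "t \<le> m" | "s = Suc t" "s \<le> m" | "t = m + 1" "k \<le> s" "s \<le> e"
        using adj[of s t] adj[of t s] st(3) r \<open>s \<noteq> t\<close> by (cases "s < t") auto
      then show False
      proof cases
        case 3
        then show False using nK[OF st(1)] by blast
      qed (use side r in linarith)+
    qed
    show False
    \<comment> \<open>For e <= b no vertex right of b sees \<open>m + 1\<close>. Otherwise b <= k,
      and no vertex left of b does.\<close>
    proof (cases "e \<le> b")
      case True
      then show False using cut[of "{x \<in> J. b < x \<and> x \<le> m}"] by auto
    next
      case False
      then show False using cut[of "{x \<in> J. x < b \<and> x \<le> m}"] ke by auto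
    qed
  qed
  have N: "{1..m+1} = {1..m} \<union> {m+1}" by auto
  have JS: "J = ?S \<or> J = ?S \<union> {m+1}" using J(1) unfolding N by blast
  show ?thesis
  proof (cases "?S = {}")
    case True
    have "J = {m+1}"
      using JS
    proof
      assume "J = ?S"
      with True connected_nonempty[OF J(2)] show ?thesis by blast
    next
      assume a: "J = ?S \<union> {m+1}"
      have "?S \<union> {m+1} = {m+1}" using True by blast
      with a show ?thesis by blast
    qed
    then show ?thesis by blast
  next
    case False
    obtain i j where ij: "i < j" "j \<le> m" "?S = {Suc i..j}"
    proof (rule convex_interval[of ?S m])
      show "?S \<subseteq> {1..m}" by blast
      show "?S \<noteq> {}" by (rule False)
      show "b \<in> ?S" if "a \<in> ?S" "c \<in> ?S" "a < b" "b < c" for a b c by (rule conv[OF that])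
    qed (rule that)
    show ?thesis
    proof (cases "m + 1 \<in> J")
      case False
      then have "J = ?S" using JS by blast
      then have "J = {Suc i..j}" unfolding ij(3) .
      then show ?thesis using ij(1,2) by blast
    next
      case True
      then have JU: "J = ?S \<union> {m+1}" using JS by blast
      have "m + 1 \<notin> ?S" by simp
      then have "?S \<noteq> J" using True by metis
      then obtain s t where st: "s \<in> ?S" "t \<in> J - ?S" "{s, t} \<in> F"
        using connected_cutD[OF J(2), of ?S] False by blast
      then have "t = m + 1" using JU by blast
      then have "k \<le> s" "s \<le> e" using adj[of s t] st by auto
      moreover have "Suc i \<le> s" "s \<le> j" using st(1) unfolding ij(3) by auto
      ultimately have "i < e" "k \<le> j" by auto
      moreover have "J = {Suc i..j} \<union> {m+1}" using JU unfolding ij(3) .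
      ultimately show ?thesis using ij(1,2) by blast
    qed
  qed
qed

lemma interval_connected:
  assumes "\<And>x. a \<le> x \<Longrightarrow> x < b \<Longrightarrow> {x, Suc x} \<in> F" "a \<le> b"
  shows "induced_connected F {a..b}"
  using assms(2,1)
proof (induction b rule: dec_induct)
  case (step b)
  have "induced_connected F ({a..b} \<union> {Suc b})"
  proof (rule connected_Un)
    show "touch F {a..b} {Suc b}" using step.prems[of b] step.hyps by (auto simp: touch_def)
  qed (use step in auto)
  moreover have "{a..b} \<union> {Suc b} = {a..Suc b}" using step.hyps by auto
  ultimately show ?case by simp
qed simp

lemma family_connected:
  assumes F: "family_adj m k e F" and ke: "k \<le> e" and ij: "i < j" "j \<le> m"
  shows "induced_connected F {Suc i..j}" "i < e \<Longrightarrow> k \<le> j \<Longrightarrow> induced_connected F ({Suc i..j} \<union> {m+1})"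
proof -
  show I: "induced_connected F {Suc i..j}"
    by (rule interval_connected) (use F ij in \<open>auto simp: family_adj_def\<close>)
  assume a: "i < e" "k \<le> j"
  let ?s = "max k (Suc i)"
  have "{?s, m + 1} \<in> F" using F a ij ke unfolding family_adj_def by auto
  moreover have "?s \<in> {Suc i..j}" using a ij by auto
  ultimately have "touch F {Suc i..j} {m + 1}" unfolding touch_def by blast
  then show "induced_connected F ({Suc i..j} \<union> {m+1})" by (intro connected_Un I connected_single)
qed

text \<open>Two missing vertices with a present one on each of the two arcs between them separate
  the set. Hence the set, or its complement when \<open>m + 1\<close> belongs to it, is an interval
  avoiding \<open>m + 1\<close>.\<close>

lemma cycle_types:
  assumes F: "cycle_adj m F"
    and J: "J \<subseteq> {1..m+1}" "induced_connected F J"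
  shows "(\<exists>i j. i < j \<and> j \<le> m \<and> J = {Suc i..j}) \<or>
    (\<exists>i j. i < j \<and> j \<le> m \<and> J = {1..m+1} - {Suc i..j}) \<or> J = {1..m+1}"
proof -
  have adj: "{i, j} \<in> F \<longleftrightarrow> j = Suc i \<or> i = 1 \<and> j = m + 1" if "1 \<le> i" "i < j" "j \<le> m + 1" for i j
    using F that unfolding cycle_adj_def by blast
  have cut: False if abc: "a < b" "b < c" "c \<le> m + 1" "1 \<le> a" "a \<notin> J" "c \<notin> J" "b \<in> J" "d \<in> J" "d < a \<or> c < d" for a b c d
  proof -
    let ?A = "J \<inter> {a<..<c}"
    have "b \<in> ?A" "d \<notin> ?A" using abc by auto
    then have "?A \<noteq> {}" "?A \<noteq> J" using abc(8) by (blast, metis)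
    then obtain s t where st: "s \<in> ?A" "t \<in> J - ?A" "{s, t} \<in> F" using connected_cutD[OF J(2), of ?A] by blast
    have tac: "t \<noteq> a" "t \<noteq> c" "t \<in> {1..m+1}" using st(2) abc(5,6) J(1) by blast+
    have s: "a < s" "s < c" using st(1) by simp_all
    have t: "t < a \<or> c < t"
    proof (rule ccontr)
      assume "\<not> (t < a \<or> c < t)"
      then have "t \<in> {a<..<c}" using tac by simp
      then show False using st(2) by blast
    qed
    have t': "1 \<le> t" "t \<le> m + 1" using tac(3) by simp_all
    have "{t, s} \<in> F" using st(3) by (simp only: insert_commute)
    show False
    proof (cases "s < t")
      case True
      then have "t = Suc s \<or> s = 1 \<and> t = m + 1" using adj[of s t] st(3) s t' abc(4) by simp
      then show False using True t s abc(4) by linarith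
    next
      case False
      then have "s = Suc t \<or> t = 1 \<and> s = m + 1" using adj[of t s] \<open>{t, s} \<in> F\<close> s t' t abc(3) by simp
      then show False using False t s abc(3) by linarith
    qed
  qed
  show ?thesis
  proof (cases "m + 1 \<in> J")
    case False
    have N: "{1..m+1} = {1..m} \<union> {m+1}" by auto
    have Jm: "J \<subseteq> {1..m}" using J(1) False unfolding N by blast
    have "b \<in> J" if "a \<in> J" "c \<in> J" "a < b" "b < c" for a b c
    proof (rule ccontr)
      assume "b \<notin> J"
      moreover have "1 \<le> a" "c \<le> m" using that(1,2) Jm by auto
      ultimately show False using cut[of b c "m + 1" a] that False by simp
    qed
    then obtain i j where "i < j" "j \<le> m" "J = {Suc i..j}"
      by (rule convex_interval[OF Jm connected_nonempty[OF J(2)]])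
    then show ?thesis by blast
  next
    case True
    let ?C = "{1..m+1} - J"
    show ?thesis
    proof (cases "?C = {}")
      case True
      then have "J = {1..m+1}" using J(1) by blast
      then show ?thesis by blast
    next
      case False
      have Cm: "?C \<subseteq> {1..m}"
      proof
        fix x assume x: "x \<in> ?C"
        then have "x \<noteq> m + 1" using True by blast
        then show "x \<in> {1..m}" using x by simp
      qed
      have "b \<in> ?C" if "a \<in> ?C" "c \<in> ?C" "a < b" "b < c" for a b c
      proof (rule ccontr)
        assume "b \<notin> ?C"
        moreover have "b \<in> {1..m+1}" using that by simp
        ultimately have "b \<in> J" by blast
        moreover have "c \<le> m" using that(2) Cm by fastforce
        moreover have "1 \<le> a" "a \<notin> J" "c \<notin> J" using that(1,2) by simp_all
        ultimately show False using cut[of a b c "m + 1"] that(3,4) True by simp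
      qed
      then obtain i j where ij: "i < j" "j \<le> m" "?C = {Suc i..j}"
        by (rule convex_interval[OF Cm False])
      have "J = {1..m+1} - ?C" using J(1) by blast
      then have "J = {1..m+1} - {Suc i..j}" unfolding ij(3) .
      then show ?thesis using ij(1,2) by blast
    qed
  qed
qed

lemma cycle_connected:
  assumes F: "cycle_adj m F" and ij: "i < j" "j \<le> m"
  shows "induced_connected F {Suc i..j}" "induced_connected F ({1..m+1} - {Suc i..j})" "induced_connected F {1..m+1}"
proof -
  have st: "{x, Suc x} \<in> F" if "1 \<le> x" "x \<le> m" for x using F that unfolding cycle_adj_def by auto
  show "induced_connected F {Suc i..j}" by (rule interval_connected) (use st ij in auto)
  show "induced_connected F {1..m+1}" by (rule interval_connected) (use st in auto)
  have R: "induced_connected F {Suc j..m+1}" by (rule interval_connected) (use st ij in auto)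
  show "induced_connected F ({1..m+1} - {Suc i..j})"
  proof (cases "i = 0")
    case True
    then have "{1..m+1} - {Suc i..j} = {Suc j..m+1}" by auto
    then show ?thesis using R by simp
  next
    case False
    have L: "induced_connected F {1..i}" by (rule interval_connected) (use st ij False in auto)
    have "{1, m + 1} \<in> F" using F ij unfolding cycle_adj_def by auto
    then have "touch F {1..i} {Suc j..m+1}" using False ij by (force simp: touch_def)
    then have "induced_connected F ({1..i} \<union> {Suc j..m+1})" by (rule connected_Un[OF L R])
    moreover have "{1..m+1} - {Suc i..j} = {1..i} \<union> {Suc j..m+1}" using ij by auto
    ultimately show ?thesis by simp
  qed
qed

section \<open>Counting connected vertex sets\<close>

lemma count_lower:
  assumes g: "inj_on g {1..m+1}" "g ` {1..m+1} \<subseteq> {1..n}"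
    and J: "\<And>J. J \<in> \<J> \<Longrightarrow> J \<subseteq> {1..m+1} \<and> induced_connected E (g ` J)"
  shows "card \<J> \<le> card (conn_subgraph_arr n E)"
proof (rule card_inj_on_le[of "\<lambda>J. ind (g ` J)"])
  show "inj_on (\<lambda>J. ind (g ` J)) \<J>"
  proof (rule inj_onI)
    fix A B assume AB: "A \<in> \<J>" "B \<in> \<J>" "ind (g ` A) = ind (g ` B)"
    have "x \<in> g ` A \<longleftrightarrow> x \<in> g ` B" for x using fun_cong[OF AB(3), of x] by (auto simp: ind_def split: if_splits)
    then have "g ` A = g ` B" by blast
    then show "A = B" using inj_on_image_eq_iff[OF g(1)] J AB by blast
  qed
  show "(\<lambda>J. ind (g ` J)) ` \<J> \<subseteq> conn_subgraph_arr n E"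
  proof
    fix a assume "a \<in> (\<lambda>J. ind (g ` J)) ` \<J>"
    then obtain A where A: "A \<in> \<J>" "a = ind (g ` A)" by blast
    then have "induced_connected E (g ` A)" "g ` A \<subseteq> {1..n}" using J g(2) by blast+
    then show "a \<in> conn_subgraph_arr n E"
      unfolding conn_subgraph_arr_ind using A(2) connected_nonempty by blast
  qed
qed (rule finite_conn_subgraph_arr)

definition pairs :: "nat \<Rightarrow> (nat \<times> nat) set" where
  "pairs m = {(i, j). i < j \<and> j \<le> m}"

lemma pairs_Suc: "pairs (Suc m) = pairs m \<union> {..m} \<times> {Suc m}"
  by (auto simp: pairs_def le_Suc_eq)

lemma finite_pairs [simp]: "finite (pairs m)"
  by (rule finite_subset[of _ "{..m} \<times> {..m}"]) (auto simp: pairs_def)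

lemma card_pairs: "2 * card (pairs m) = m * (m + 1)"
proof (induction m)
  case 0
  have "pairs 0 = {}" by (auto simp: pairs_def)
  then show ?case by simp
next
  case (Suc m)
  have "card (pairs (Suc m)) = card (pairs m) + card ({..m} \<times> {Suc m})"
    unfolding pairs_Suc by (rule card_Un_disjoint[OF finite_pairs]) (auto simp: pairs_def)
  then show ?case using Suc by simp
qed

lemma card_interval_image:
  assumes "S \<subseteq> pairs m" "inj_on f (Pow {1..m})"
  shows "card ((\<lambda>(i, j). f {Suc i..j}) ` S) = card S"
proof (rule card_image, rule inj_onI)
  fix p q assume pq: "p \<in> S" "q \<in> S" "(case p of (i, j) \<Rightarrow> f {Suc i..j}) = (case q of (i, j) \<Rightarrow> f {Suc i..j})"
  obtain i j i' j' where e: "p = (i, j)" "q = (i', j')" by (cases p, cases q)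
  then have r: "i < j" "j \<le> m" "i' < j'" "j' \<le> m" using pq(1,2) assms(1) by (auto simp: pairs_def)
  have "{Suc i..j} = {Suc i'..j'}" using inj_onD[OF assms(2), of "{Suc i..j}" "{Suc i'..j'}"] pq(3) r e by auto
  then have "Suc i = Suc i'" "j = j'" using r by (auto simp: Icc_eq_Icc)
  then show "p = q" using e by simp
qed

text \<open>A lower bound is what the degree condition of Saito's criterion asks for.
  \<open>f\<close> abstracts how an interval yields a set through \<open>m + 1\<close>: by adding
  this vertex, or by taking the complement.\<close>

lemma count_connected_sets:
  assumes g: "inj_on g {1..m+1}" "g ` {1..m+1} \<subseteq> {1..n}"
    and S: "S \<subseteq> pairs m" and f: "inj_on f (Pow {1..m})"
    and fA: "\<And>A. A \<subseteq> {1..m} \<Longrightarrow> m + 1 \<in> f A \<and> f A \<subseteq> {1..m+1}"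
    and c: "\<And>i j. i < j \<Longrightarrow> j \<le> m \<Longrightarrow> induced_connected E (g ` {Suc i..j})"
      "\<And>i j. (i, j) \<in> S \<Longrightarrow> induced_connected E (g ` f {Suc i..j})" "induced_connected E (g ` f {})"
  shows "card (pairs m) + card S + 1 \<le> card (conn_subgraph_arr n E)"
proof -
  define \<A> where "\<A> = (\<lambda>(i, j). {Suc i..j}) ` pairs m"
  define \<B> where "\<B> = (\<lambda>(i, j). f {Suc i..j}) ` S"
  have fin: "finite S" by (rule finite_subset[OF S finite_pairs])
  have iv: "{Suc i..j} \<subseteq> {1..m}" "{Suc i..j} \<noteq> {}" if "(i, j) \<in> pairs m" for i j
    using that by (auto simp: pairs_def)
  have A: "J \<subseteq> {1..m} \<and> induced_connected E (g ` J)" if J: "J \<in> \<A>" for J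
  proof -
    obtain i j where ij: "(i, j) \<in> pairs m" "J = {Suc i..j}" using J by (auto simp: \<A>_def \<B>_def)
    then have "i < j" "j \<le> m" by (simp_all add: pairs_def)
    then show ?thesis using c(1) iv(1)[OF ij(1)] ij(2) by metis
  qed
  have B: "m + 1 \<in> J \<and> J \<noteq> f {} \<and> J \<subseteq> {1..m+1} \<and> induced_connected E (g ` J)" if J: "J \<in> \<B>" for J
  proof -
    obtain i j where ij: "(i, j) \<in> S" "J = f {Suc i..j}" using J by (auto simp: \<A>_def \<B>_def)
    then have p: "(i, j) \<in> pairs m" using S by blast
    then have "f {Suc i..j} \<noteq> f {}" using inj_onD[OF f, of "{Suc i..j}" "{}"] iv[OF p] by blast
    then show ?thesis using fA[OF iv(1)[OF p]] c(2)[OF ij(1)] ij(2) by blast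
  qed
  have F: "m + 1 \<in> f {}" "f {} \<subseteq> {1..m+1}" using fA[of "{}"] by simp_all
  have nA: "m + 1 \<notin> J" if "J \<in> \<A>" for J
  proof -
    have "J \<subseteq> {1..m}" using A[OF that] by blast
    then show ?thesis by fastforce
  qed
  have "card (\<A> \<union> \<B> \<union> {f {}}) = card \<A> + card \<B> + card {f {}}"
  proof (subst card_Un_disjoint)
    have "f {} \<notin> \<A>" using nA[of "f {}"] F(1) by blast
    moreover have "f {} \<notin> \<B>" using B[of "f {}"] by blast
    ultimately show "(\<A> \<union> \<B>) \<inter> {f {}} = {}" by blast
    have "\<A> \<inter> \<B> = {}" using nA B by blast
    then have "card (\<A> \<union> \<B>) = card \<A> + card \<B>" by (intro card_Un_disjoint) (auto simp: fin \<A>_def \<B>_def)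
    then show "card (\<A> \<union> \<B>) + card {f {}} = card \<A> + card \<B> + card {f {}}" by simp
  qed (auto simp: fin \<A>_def \<B>_def)
  also have "\<dots> = card (pairs m) + card S + 1"
    using card_interval_image[of "pairs m" m "\<lambda>A. A"] card_interval_image[OF S f] by (simp add: \<A>_def \<B>_def)
  finally have "card (\<A> \<union> \<B> \<union> {f {}}) = card (pairs m) + card S + 1" .
  moreover have "card (\<A> \<union> \<B> \<union> {f {}}) \<le> card (conn_subgraph_arr n E)"
  proof (rule count_lower[OF g])
    fix J assume "J \<in> \<A> \<union> \<B> \<union> {f {}}"
    then consider "J \<in> \<A>" | "J \<in> \<B>" | "J = f {}" by blast
    then show "J \<subseteq> {1..m+1} \<and> induced_connected E (g ` J)"
    proof cases
      case 1
      have "{1..m} \<subseteq> {1..m+1}" by auto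
      then show ?thesis using A[OF 1] by blast
    next
      case 2
      then show ?thesis using B by blast
    next
      case 3
      then show ?thesis using F(2) c(3) by blast
    qed
  qed
  ultimately show ?thesis by simp
qed

section \<open>Freeness of the members of the families\<close>

lemma sum_lessThan_add: "(\<Sum>p<k + b. f p) = (\<Sum>p<k. f p) + (\<Sum>q<b. f (k + q))" for f :: "nat \<Rightarrow> nat"
  by (induction b) auto

lemma sum_shifted: "2 * (\<Sum>p<k. p + c) + k = k * k + 2 * k * (c :: nat)"
  by (induction k) (auto simp: algebra_simps)

lemma family_free:
  assumes n: "n = m + 1" and km: "k \<le> m" and e: "e = k \<or> e = Suc k \<and> k < m"
    and bij: "bij_betw g {1..m+1} {1..n}" and F: "family_adj m k e F"
    and adj: "\<And>x y. x \<in> {1..m+1} \<Longrightarrow> y \<in> {1..m+1} \<Longrightarrow> {g x, g y} \<in> E \<longleftrightarrow> {x, y} \<in> F"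
  shows "free_arrangement n (conn_subgraph_arr n E)"
proof -
  define y where "y i = (\<Sum>k\<in>{1..i}. var (g k))" for i
  define z where "z = var (g (m + 1))"
  \<comment> \<open>Two ways to be divisible by \<open>y j - y i + z\<close> at \<open>y j\<close>
    for all i < e and j >= k: vanish at every such \<open>y j\<close>, or contain the factor for
    every such i. Powers of the variable give k polynomials of the first kind and m - k of the
    second.\<close>
  define G where "G p = (if p < k then monom 1 p * (\<Prod>s\<in>{k..m}. [:- y s, 1:])
    else monom 1 (p - k) * (\<Prod>s<e. [:z - y s, 1:]))" for p
  define dg where "dg p = (if p < k then p + card {k..m} else p - k + card {..<e})" for p
  let ?T = "{(i, j). i < e \<and> k \<le> j}"
  have inj: "inj_on g {1..m+1}" and img: "g ` {1..m+1} = {1..n}" using bij by (auto simp: bij_betw_def)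
  have ke: "k \<le> e" "e \<le> Suc k" "e \<le> m" using e km by auto
  have conn: "induced_connected E (g ` J) \<longleftrightarrow> induced_connected F J" if "J \<subseteq> {1..m+1}" for J
    by (rule connected_image) (use inj_on_subset[OF inj that] adj that in blast)+
  have gv: "var (g i) \<in> polys_over {1..n}" if "1 \<le> i" "i \<le> m + 1" for i
    using img that by (intro polys_over_var) auto
  have yP: "y i \<in> polys_over {1..n}" "tdeg (y i) \<le> 1" if "i \<le> m" for i
    unfolding y_def using gv that by (auto intro!: polys_over_sum tdeg_sum_le tdeg_var[simplified])
  have zP: "z \<in> polys_over {1..n}" "tdeg z \<le> 1" using gv[of "m + 1"] tdeg_var unfolding z_def by auto
  show ?thesis
  proof (rule deformation_free[where cyc = False and T = ?T and G = G and dg = dg and y = y and z = z, OF n bij])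
    fix J assume J: "J \<subseteq> {1..m+1}" "induced_connected E (g ` J)"
    show "(\<exists>i j. i < j \<and> j \<le> m \<and> J = {Suc i..j}) \<or>
      (\<exists>i j. (i, j) \<in> ?T \<and> i < j \<and> j \<le> m \<and> J = (if False then {1..m+1} - {Suc i..j} else {Suc i..j} \<union> {m+1})) \<or>
      J = (if False then {1..m+1} else {m+1})"
      using family_types[OF F ke(1,2) J(1) J(2)[unfolded conn[OF J(1)]]] unfolding mem_Collect_eq prod.case if_False .
  next
    fix p i j assume a: "p < m" "(i, j) \<in> ?T" "i < j" "j \<le> m"
    show "y j - y i + z dvd poly (G p) (y j)"
    proof (cases "p < k")
      case True
      have "(\<Prod>s\<in>{k..m}. poly [:- y s, 1:] (y j)) = 0" using a by (intro prod_zero) (auto intro!: bexI[of _ j])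
      then show ?thesis unfolding G_def poly_mult poly_prod using True by (simp add: poly_prod del: poly_pCons prod_zero_iff)
    next
      case False
      have "poly [:z - y i, 1:] (y j) dvd (\<Prod>s<e. poly [:z - y s, 1:] (y j))" using a by (intro dvd_prodI) auto
      moreover have "poly [:z - y i, 1:] (y j) = y j - y i + z" by simp
      ultimately have "y j - y i + z dvd (\<Prod>s<e. poly [:z - y s, 1:] (y j))" by metis
      then show ?thesis unfolding G_def poly_mult poly_prod using False by (simp add: poly_prod del: poly_pCons)
    qed
  next
    fix p assume p: "p < m"
    show "coeffs_over {1..n} (G p)"
      unfolding G_def using yP(1) zP(1) ke
      by (auto simp: one_pCons[symmetric] intro!: coeffs_over_mult coeffs_over_prod coeffs_over_pCons polys_over_diff polys_over_uminus)
    show "wd (dg p) (G p)"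
    proof (cases "p < k")
      case True
      have "wd (p + card {k..m}) (monom 1 p * (\<Prod>s\<in>{k..m}. [:- y s, 1:]))"
        by (intro wd_mult wd_monom wd_prod_linear) (use yP(2) in auto)
      then show ?thesis using True by (simp add: G_def dg_def)
    next
      case False
      have "wd (p - k + card {..<e}) (monom 1 (p - k) * (\<Prod>s<e. [:z - y s, 1:]))"
        by (intro wd_mult wd_monom wd_prod_linear tdeg_diff_le) (use yP(2) zP(2) ke in auto)
      then show ?thesis using False by (simp add: G_def dg_def)
    qed
    show "dg p \<le> m" using p e km by (auto simp: dg_def)
  next
    fix P c H p
    assume a: "\<And>i. i \<le> m \<Longrightarrow> ev P (y i) = 2 * of_nat i" "ev P z = 1" "degree H \<le> Suc m"
      "\<And>t. poly H (t + 1) - poly H t = (\<Sum>p<m. c p * ev P (poly (G p) (const t)))"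
      "\<And>k. k \<le> m \<Longrightarrow> poly H (2 * of_nat k) = poly H 0" "p < m"
    obtain C where C: "\<And>t. poly H (t + 1) - poly H t = C * ((\<Prod>s\<le>m. t + 1 - 2 * of_nat s) - (\<Prod>s\<le>m. t - 2 * of_nat s))"
      using equal_values_difference[OF a(3,5)] by blast
    have "ev P (poly (G p) (const t)) = (if p < k then t ^ p * (\<Prod>s\<in>{k..m}. t - 2 * of_nat s)
        else t ^ (p - k) * (\<Prod>s<e. t + 1 - 2 * of_nat s))" for p t
      using a(1,2) ke unfolding G_def
      by (auto simp: poly_prod poly_monom ev.hom_mult ev.hom_prod ev.hom_power ev.hom_add ev.hom_minus ev.hom_uminus intro!: prod.cong)
    then show "c p = 0" using family_independence[OF km e _ a(6), of C c] C a(4) by simp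
  next
    let ?S = "{(i, j) \<in> pairs m. i < e \<and> k \<le> j}"
    have "card (pairs m) + card ?S + 1 \<le> card (conn_subgraph_arr n E)"
    proof (rule count_connected_sets[OF inj _ _, where f = "\<lambda>A. A \<union> {m+1}"])
      show "inj_on (\<lambda>A. A \<union> {m + 1}) (Pow {1..m})"
      proof (rule inj_onI)
        fix A B assume "A \<in> Pow {1..m}" "B \<in> Pow {1..m}" "A \<union> {m + 1} = B \<union> {m + 1}"
        moreover have "m + 1 \<notin> {1..m}" by simp
        ultimately show "A = B" by blast
      qed
      fix i j assume ij: "i < j" "j \<le> m"
      have "{Suc i..j} \<subseteq> {1..m+1}" using ij by auto
      then show "induced_connected E (g ` {Suc i..j})" using family_connected(1)[OF F ke(1) ij] conn by blast
    next
      fix i j assume ij: "(i, j) \<in> ?S"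
      then have r: "i < j" "j \<le> m" "i < e" "k \<le> j" by (simp_all add: pairs_def)
      have "{Suc i..j} \<union> {m+1} \<subseteq> {1..m+1}" using r by auto
      then show "induced_connected E (g ` ({Suc i..j} \<union> {m+1}))" using family_connected(2)[OF F ke(1) r] conn by blast
    next
      show "induced_connected E (g ` ({} \<union> {m+1}))" by simp
    qed (use img in auto)
    \<comment> \<open>Both counts are doubled so that triangular numbers appear without division.
      For e = k + 1 the pair (k, k) has to be taken out of the product of index sets.\<close>
    moreover have "2 * (1 + (\<Sum>p<m. Suc (dg p))) = 2 * (card (pairs m) + card ?S + 1)"
    proof -
      obtain b where b: "m = k + b" using km le_Suc_ex by blast
      have "(\<Sum>p<m. Suc (dg p)) = (\<Sum>p<k. p + (b + 2)) + (\<Sum>q<b. q + Suc e)"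
        unfolding b sum_lessThan_add by (simp add: dg_def b)
      then have s: "2 * (\<Sum>p<m. Suc (dg p)) + m = k * k + 2 * k * (b + 2) + (b * b + 2 * b * Suc e)"
        using sum_shifted[where k = k and c = "b + 2"] sum_shifted[where k = b and c = "Suc e"] b by linarith
      show ?thesis
        using e
      proof
        assume ek: "e = k"
        then have "?S = {..<k} \<times> {k..m}" by (auto simp: pairs_def)
        then have "card ?S = k * Suc b" using b by simp
        then show ?thesis using s card_pairs[of m] ek b by (simp add: algebra_simps)
      next
        assume ek: "e = Suc k \<and> k < m"
        then have S: "{..k} \<times> {k..m} = insert (k, k) ?S" by (auto simp: pairs_def)
        have "finite ?S" by (rule finite_subset[OF _ finite_pairs[of m]]) auto
        moreover have "(k, k) \<notin> ?S" by (simp add: pairs_def)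
        ultimately have "card ({..k} \<times> {k..m}) = Suc (card ?S)" unfolding S by (rule card_insert_disjoint)
        then have "Suc (card ?S) = Suc k * Suc b" using b by simp
        then show ?thesis using s card_pairs[of m] ek b by (simp add: algebra_simps)
      qed
    qed
    then have "1 + (\<Sum>p<m. Suc (dg p)) = card (pairs m) + card ?S + 1"
      by (rule mult_left_cancel[THEN iffD1, rotated]) simp
    ultimately show "1 + (\<Sum>p<m. Suc (dg p)) \<le> card (conn_subgraph_arr n E)" by (simp only:)
  qed (simp_all add: y_def z_def)
qed

lemma cycle_free:
  assumes n: "n = m + 1" and m: "2 \<le> m"
    and bij: "bij_betw g {1..m+1} {1..n}" and F: "cycle_adj m F"
    and adj: "\<And>x y. x \<in> {1..m+1} \<Longrightarrow> y \<in> {1..m+1} \<Longrightarrow> {g x, g y} \<in> E \<longleftrightarrow> {x, y} \<in> F"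
  shows "free_arrangement n (conn_subgraph_arr n E)"
proof -
  define y where "y i = (\<Sum>k\<in>{1..i}. var (g k))" for i
  define z where "z = - (y m + var (g (m + 1)))"
  \<comment> \<open>All pairs i < j occur. The last product handles j >= p + 2 by vanishing, the
    middle one i < p, and the only pair left, i = p with j = p + 1, is handled by the constant
    factor. Every \<open>G p\<close> has degree m.\<close>
  define G where "G p = [:y p - y (Suc p) - z:] * (\<Prod>s<p. [:z - y s, 1:]) * (\<Prod>s\<in>{Suc (Suc p)..m}. [:- y s, 1:])" for p
  have inj: "inj_on g {1..m+1}" and img: "g ` {1..m+1} = {1..n}" using bij by (auto simp: bij_betw_def)
  have conn: "induced_connected E (g ` J) \<longleftrightarrow> induced_connected F J" if "J \<subseteq> {1..m+1}" for J
    by (rule connected_image) (use inj_on_subset[OF inj that] adj that in blast)+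
  have gv: "var (g i) \<in> polys_over {1..n}" if "1 \<le> i" "i \<le> m + 1" for i
    using img that by (intro polys_over_var) auto
  have yP: "y i \<in> polys_over {1..n}" "tdeg (y i) \<le> 1" if "i \<le> m" for i
    unfolding y_def using gv that by (auto intro!: polys_over_sum tdeg_sum_le tdeg_var[simplified])
  have zP: "z \<in> polys_over {1..n}" "tdeg z \<le> 1"
    using gv[of "m + 1"] tdeg_var[of "g (m + 1)"] yP[of m] unfolding z_def
    by (auto intro!: polys_over_uminus polys_over_add polys_over_diff tdeg_add_le tdeg_diff_le simp del: One_nat_def)
  show ?thesis
  proof (rule deformation_free[where cyc = True and T = UNIV and G = G and dg = "\<lambda>p. m" and y = y and z = z, OF n bij])
    fix J assume J: "J \<subseteq> {1..m+1}" "induced_connected E (g ` J)"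
    show "(\<exists>i j. i < j \<and> j \<le> m \<and> J = {Suc i..j}) \<or>
      (\<exists>i j. (i, j) \<in> UNIV \<and> i < j \<and> j \<le> m \<and> J = (if True then {1..m+1} - {Suc i..j} else {Suc i..j} \<union> {m+1})) \<or>
      J = (if True then {1..m+1} else {m+1})"
      using cycle_types[OF F J(1) J(2)[unfolded conn[OF J(1)]]] by (simp only: UNIV_I simp_thms if_True)
  next
    fix p i j assume a: "p < m" "i < j" "j \<le> m"
    consider "Suc (Suc p) \<le> j" | "i < p" | "i = p" "j = Suc p" using a by linarith
    then show "y j - y i + z dvd poly (G p) (y j)"
    proof cases
      case 1
      have "(\<Prod>s\<in>{Suc (Suc p)..m}. poly [:- y s, 1:] (y j)) = 0" using a 1 by (intro prod_zero) (auto intro!: bexI[of _ j])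
      then show ?thesis unfolding G_def poly_mult poly_prod by (simp del: poly_pCons prod_zero_iff)
    next
      case 2
      have "poly [:z - y i, 1:] (y j) dvd (\<Prod>s<p. poly [:z - y s, 1:] (y j))" using 2 by (intro dvd_prodI) auto
      moreover have "poly [:z - y i, 1:] (y j) = y j - y i + z" by simp
      ultimately have "y j - y i + z dvd (\<Prod>s<p. poly [:z - y s, 1:] (y j))" by metis
      then show ?thesis unfolding G_def poly_mult poly_prod by (intro dvd_mult2 dvd_mult)
    next
      case 3
      have "poly [:y p - y (Suc p) - z:] (y j) = (y j - y i + z) * (- 1)" using 3 by simp
      then have "y j - y i + z dvd poly [:y p - y (Suc p) - z:] (y j)" by (metis dvd_triv_left)
      then show ?thesis unfolding G_def poly_mult by (intro dvd_mult2)
    qed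
  next
    fix p assume p: "p < m"
    show "coeffs_over {1..n} (G p)"
      unfolding G_def using yP(1) zP(1) p
      by (auto simp: one_pCons[symmetric] simp del: mult_pCons_left intro!: coeffs_over_mult coeffs_over_prod coeffs_over_pCons polys_over_diff polys_over_uminus)
    have "wd (1 + card {..<p} + card {Suc (Suc p)..m}) (G p)"
      unfolding G_def using yP(2) zP(2) p
      by (intro wd_mult wd_const wd_prod_linear) (auto intro!: tdeg_diff_le simp del: One_nat_def)
    moreover have "1 + card {..<p} + card {Suc (Suc p)..m} = m" using p by simp
    ultimately show "wd m (G p)" by metis
  next
    fix P c H p
    assume a: "\<And>i. i \<le> m \<Longrightarrow> ev P (y i) = 2 * of_nat i" "ev P z = 1" "degree H \<le> Suc m"
      "\<And>t. poly H (t + 1) - poly H t = (\<Sum>p<m. c p * ev P (poly (G p) (const t)))"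
      "\<And>k. k \<le> m \<Longrightarrow> poly H (2 * of_nat k) = poly H 0" "p < m"
    obtain C where C: "\<And>t. poly H (t + 1) - poly H t = C * ((\<Prod>s\<le>m. t + 1 - 2 * of_nat s) - (\<Prod>s\<le>m. t - 2 * of_nat s))"
      using equal_values_difference[OF a(3,5)] by blast
    have "ev P (poly (G p) (const t)) = (- 3) * (\<Prod>s<p. t + 1 - 2 * of_nat s) * (\<Prod>s\<in>{Suc (Suc p)..m}. t - 2 * of_nat s)"
      if "p < m" for p t
    proof -
      have "ev P (poly [:y p - y (Suc p) - z:] (const t)) = - 3"
        using a(1)[of p] a(1)[of "Suc p"] a(2) that by (simp add: ev.hom_minus)
      moreover have "ev P (poly (\<Prod>s<p. [:z - y s, 1:]) (const t)) = (\<Prod>s<p. t + 1 - 2 * of_nat s)"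
        using a(1,2) that unfolding poly_prod ev.hom_prod
        by (intro prod.cong) (auto simp: ev.hom_minus ev.hom_add)
      moreover have "ev P (poly (\<Prod>s\<in>{Suc (Suc p)..m}. [:- y s, 1:]) (const t)) = (\<Prod>s\<in>{Suc (Suc p)..m}. t - 2 * of_nat s)"
        using a(1) unfolding poly_prod ev.hom_prod
        by (intro prod.cong) (auto simp: ev.hom_uminus ev.hom_add ev.hom_minus)
      ultimately show ?thesis unfolding G_def poly_mult ev.hom_mult by simp
    qed
    then have "(\<Sum>p<m. c p * ev P (poly (G p) (const t))) = (\<Sum>p<m. c p * ((- 3) * (\<Prod>s<p. t + 1 - 2 * of_nat s) * (\<Prod>s\<in>{Suc (Suc p)..m}. t - 2 * of_nat s)))" for t
      by (intro sum.cong) auto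
    then show "c p = 0" using cycle_independence[OF _ a(6), of C c] C a(4) by simp
  next
    have "card (pairs m) + card (pairs m) + 1 \<le> card (conn_subgraph_arr n E)"
    proof (rule count_connected_sets[OF inj _ order_refl, where f = "\<lambda>A. {1..m+1} - A"])
      have N: "{1..m} \<subseteq> {1..m+1}" by auto
      show "inj_on (\<lambda>A. {1..m+1} - A) (Pow {1..m})"
      proof (rule inj_onI)
        fix A B assume "A \<in> Pow {1..m}" "B \<in> Pow {1..m}" "{1..m+1} - A = {1..m+1} - B"
        then show "A = B" using N by blast
      qed
      fix i j assume ij: "i < j" "j \<le> m"
      have "{Suc i..j} \<subseteq> {1..m+1}" using ij by auto
      then show "induced_connected E (g ` {Suc i..j})" using cycle_connected(1)[OF F ij] conn by blast
    next
      fix i j assume "(i, j) \<in> pairs m"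
      then have ij: "i < j" "j \<le> m" by (simp_all add: pairs_def)
      show "induced_connected E (g ` ({1..m+1} - {Suc i..j}))" using cycle_connected(2)[OF F ij] conn by blast
    next
      show "induced_connected E (g ` ({1..m+1} - {}))" using cycle_connected(3)[OF F, of 0 1] conn m by simp
    qed (use img in auto)
    then show "1 + (\<Sum>p<m. Suc m) \<le> card (conn_subgraph_arr n E)" using card_pairs[of m] by simp
  qed (simp_all add: y_def z_def)
qed

subsection \<open>The classification\<close>

lemma path_edges_iff: "i < j \<Longrightarrow> {i, j} \<in> path_edges m \<longleftrightarrow> 1 \<le> i \<and> j = Suc i \<and> j \<le> m"
  by (auto simp: path_edges_def doubleton_eq_iff)

lemma graph_iso_inverse:
  assumes "graph_iso n E N F"
  obtains g where "n = N" "bij_betw g {1..N} {1..n}"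
    "\<And>x y. x \<in> {1..N} \<Longrightarrow> y \<in> {1..N} \<Longrightarrow> {g x, g y} \<in> E \<longleftrightarrow> {x, y} \<in> F"
proof -
  obtain f where f: "bij_betw f {1..n} {1..N}" "\<And>u v. u \<in> {1..n} \<Longrightarrow> v \<in> {1..n} \<Longrightarrow> {u, v} \<in> E \<longleftrightarrow> {f u, f v} \<in> F"
    using assms unfolding graph_iso_def by blast
  let ?g = "the_inv_into {1..n} f"
  have g: "bij_betw ?g {1..N} {1..n}" by (rule bij_betw_the_inv_into[OF f(1)])
  have fg: "f (?g x) = x" "?g x \<in> {1..n}" if "x \<in> {1..N}" for x
    using f_the_inv_into_f_bij_betw[OF f(1)] that bij_betwE[OF g] by blast+
  have "{?g x, ?g y} \<in> E \<longleftrightarrow> {x, y} \<in> F" if "x \<in> {1..N}" "y \<in> {1..N}" for x y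
    using f(2)[OF fg(2)[OF that(1)] fg(2)[OF that(2)]] fg(1)[OF that(1)] fg(1)[OF that(2)] by metis
  moreover have "n = N" using bij_betw_same_card[OF f(1)] by simp
  ultimately show ?thesis using that g by blast
qed

lemma iso_family_free:
  assumes "graph_iso n E (m + 1) F" "family_adj m k e F" "k \<le> m" "e = k \<or> e = Suc k \<and> k < m"
  shows "free_arrangement n (conn_subgraph_arr n E)"
  by (rule graph_iso_inverse[OF assms(1)], rule family_free[OF _ assms(3,4) _ assms(2)])

lemma iso_cycle_free:
  assumes "graph_iso n E (m + 1) F" "cycle_adj m F" "2 \<le> m"
  shows "free_arrangement n (conn_subgraph_arr n E)"
  by (rule graph_iso_inverse[OF assms(1)], rule cycle_free[OF _ assms(3) _ assms(2)])

text \<open>The last vertex of the path plays the additional vertex, attached to vertex m; for m = 0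
  this is the graph with one vertex.\<close>

lemma path_family_adj: "family_adj m m m (path_edges (m + 1))"
  unfolding family_adj_def using path_edges_iff[of _ _ "m + 1"] by auto

lemma almost_path_family_adj: "k \<le> m \<Longrightarrow> family_adj m k k (almost_path_edges m k)"
  unfolding family_adj_def almost_path_edges_def using path_edges_iff[of _ _ m] by (auto simp: doubleton_eq_iff)

lemma path_triangle_family_adj: "k < m \<Longrightarrow> family_adj m k (Suc k) (path_triangle_edges m k)"
  unfolding family_adj_def path_triangle_edges_def using path_edges_iff[of _ _ m] by (auto simp: doubleton_eq_iff)

lemma cycle_cycle_adj: "cycle_adj m (cycle_edges (m + 1))"
  unfolding cycle_adj_def cycle_edges_def using path_edges_iff[of _ _ "m + 1"] by (auto simp: doubleton_eq_iff)

lemma pathl_nth: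
  "pathl E xs \<Longrightarrow> i < j \<Longrightarrow> j < length xs \<Longrightarrow> {xs ! i, xs ! j} \<in> E \<longleftrightarrow> j = Suc i"
proof (induction xs arbitrary: i j)
  case (Cons x xs)
  obtain j' where j: "j = Suc j'" "j' < length xs" using Cons.prems by (cases j) auto
  show ?case
  proof (cases i)
    case 0
    have "xs \<noteq> []" using j by auto
    then have "xs ! j' = hd xs \<longleftrightarrow> j' = 0"
      using nth_eq_iff_index_eq[OF pathl_distinct, of E xs j' 0] Cons.prems(1) j by (simp add: hd_conv_nth)
    then show ?thesis using Cons.prems(1) 0 j by simp
  next
    case (Suc i')
    then show ?thesis using Cons.IH[of i' j'] Cons.prems j by simp
  qed
qed simp

lemma graph_iso_list:
  assumes zs: "distinct zs" "set zs = {1..n}"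
    and e: "\<And>i j. i < j \<Longrightarrow> j < length zs \<Longrightarrow> {zs ! i, zs ! j} \<in> E \<longleftrightarrow> {Suc i, Suc j} \<in> F"
    and ns: "\<And>x. {x} \<notin> E" "\<And>x. {x} \<notin> F"
  shows "graph_iso n E (length zs) F"
proof -
  let ?N = "{..<length zs}"
  define f where "f u = Suc (the_inv_into ?N ((!) zs) u)" for u
  have b: "bij_betw ((!) zs) ?N {1..n}" by (rule bij_betw_nth) (use zs in auto)
  have "bij_betw (the_inv_into ?N ((!) zs)) {1..n} ?N" by (rule bij_betw_the_inv_into[OF b])
  moreover have "bij_betw Suc ?N {1..length zs}"
    by (rule bij_betwI[where g = "\<lambda>i. i - 1"]) auto
  ultimately have "bij_betw (Suc \<circ> the_inv_into ?N ((!) zs)) {1..n} {1..length zs}" by (rule bij_betw_trans)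
  then have f: "bij_betw f {1..n} {1..length zs}" unfolding comp_def f_def[symmetric] .
  have e': "{zs ! i, zs ! j} \<in> E \<longleftrightarrow> {Suc i, Suc j} \<in> F" if "i < length zs" "j < length zs" for i j
  proof -
    consider "i < j" | "i = j" | "j < i" by linarith
    then show ?thesis
    proof cases
      case 3
      then show ?thesis using e[of j i] that(1) by (simp add: insert_commute)
    qed (use e[of i j] that ns in simp_all)
  qed
  have "{u, v} \<in> E \<longleftrightarrow> {f u, f v} \<in> F" if uv: "u \<in> {1..n}" "v \<in> {1..n}" for u v
  proof -
    obtain i j where ij: "i < length zs" "u = zs ! i" "j < length zs" "v = zs ! j"
      using uv unfolding zs(2)[symmetric] in_set_conv_nth by blast
    have inj: "inj_on ((!) zs) ?N" using b by (simp add: bij_betw_def)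
    have "f u = Suc i" "f v = Suc j" using the_inv_into_f_f[OF inj] ij by (simp_all add: f_def)
    then show ?thesis using e'[OF ij(1,3)] ij(2,4) by simp
  qed
  then show ?thesis using f unfolding graph_iso_def by blast
qed

lemma path_plus_vertex_iso:
  assumes xs: "pathl E xs" "z \<notin> set xs" "set xs \<union> {z} = {1..n}"
    and z: "\<And>i. i < length xs \<Longrightarrow> {xs ! i, z} \<in> E \<longleftrightarrow> {Suc i, Suc (length xs)} \<in> F"
    and F: "\<And>i j. i < j \<Longrightarrow> j < length xs \<Longrightarrow> {Suc i, Suc j} \<in> F \<longleftrightarrow> j = Suc i"
    and ns: "\<And>x. {x} \<notin> E" "\<And>x. {x} \<notin> F"
  shows "graph_iso n E (length xs + 1) F"
proof -
  have "graph_iso n E (length (xs @ [z])) F"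
  proof (rule graph_iso_list[OF _ _ _ ns])
    show "distinct (xs @ [z])" using pathl_distinct[OF xs(1)] xs(2) by simp
    show "set (xs @ [z]) = {1..n}" using xs(3) by simp
    fix i j assume ij: "i < j" "j < length (xs @ [z])"
    show "{(xs @ [z]) ! i, (xs @ [z]) ! j} \<in> E \<longleftrightarrow> {Suc i, Suc j} \<in> F"
    proof (cases "j < length xs")
      case True
      then show ?thesis using ij pathl_nth[OF xs(1) ij(1)] F by (simp add: nth_append)
    next
      case False
      then have "j = length xs" using ij by simp
      then show ?thesis using z[of i] ij(1) by (simp add: nth_append)
    qed
  qed
  then show ?thesis by simp
qed

lemma nth_eq_hd: "distinct xs \<Longrightarrow> i < length xs \<Longrightarrow> xs ! i = hd xs \<longleftrightarrow> i = 0"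
  by (cases xs) (auto simp: nth_eq_iff_index_eq[where j = 0, symmetric] nth_Cons')

lemma nth_eq_last: "distinct xs \<Longrightarrow> i < length xs \<Longrightarrow> xs ! i = last xs \<longleftrightarrow> i = length xs - 1"
proof -
  assume a: "distinct xs" "i < length xs"
  then have "xs \<noteq> []" by auto
  then show ?thesis using a nth_eq_iff_index_eq[of xs i "length xs - 1"] by (simp add: last_conv_nth)
qed

lemma family_iso:
  assumes "family E U" "U = {1..n}" and ns: "\<And>x. {x} \<notin> E"
  shows "(\<exists>m\<ge>1. graph_iso n E m (path_edges m)) \<or>
     (\<exists>m\<ge>3. graph_iso n E m (cycle_edges m)) \<or>
     (\<exists>m k. 1 < k \<and> k < m \<and> graph_iso n E (m + 1) (almost_path_edges m k)) \<or>
     (\<exists>m k. 1 \<le> k \<and> k < m \<and> graph_iso n E (m + 1) (path_triangle_edges m k))"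
  using assms(1,2)
proof cases
  case (family_path xs)
  have "graph_iso n E (length xs) (path_edges (length xs))"
  proof (rule graph_iso_list[OF _ _ _ ns])
    show "distinct xs" by (rule pathl_distinct) (rule family_path)
    show "set xs = {1..n}" using family_path assms(2) by simp
    show "{xs ! i, xs ! j} \<in> E \<longleftrightarrow> {Suc i, Suc j} \<in> path_edges (length xs)" if "i < j" "j < length xs" for i j
      using pathl_nth[of E xs i j] path_edges_iff[of "Suc i" "Suc j"] family_path that by simp
  qed (auto simp: path_edges_def)
  moreover have "1 \<le> length xs" using family_path by (cases xs) auto
  ultimately show ?thesis by blast
next
  case (family_cycle w xs)
  have c: "pathl E xs" "3 \<le> length xs" "w \<notin> set xs"
    "\<And>u. u \<in> set xs \<Longrightarrow> {w, u} \<in> E \<longleftrightarrow> u = hd xs \<or> u = last xs"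
    using family_cycle by (auto simp: cyclel_def)
  have "graph_iso n E (length xs + 1) (cycle_edges (length xs + 1))"
  proof (rule path_plus_vertex_iso[OF c(1,3) _ _ _ ns])
    show "set xs \<union> {w} = {1..n}" using family_cycle assms(2) by blast
    show "{xs ! i, w} \<in> E \<longleftrightarrow> {Suc i, Suc (length xs)} \<in> cycle_edges (length xs + 1)" if "i < length xs" for i
      using c(4)[of "xs ! i"] that nth_eq_hd[OF pathl_distinct[OF c(1)] that] nth_eq_last[OF pathl_distinct[OF c(1)] that]
        path_edges_iff[of "Suc i" "Suc (length xs)" "length xs + 1"]
      by (auto simp: cycle_edges_def doubleton_eq_iff insert_commute)
    show "{Suc i, Suc j} \<in> cycle_edges (length xs + 1) \<longleftrightarrow> j = Suc i" if "i < j" "j < length xs" for i j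
      using that path_edges_iff[of "Suc i" "Suc j" "length xs + 1"] by (auto simp: cycle_edges_def doubleton_eq_iff)
    show "{x} \<notin> cycle_edges (length xs + 1)" for x using c(2) by (auto simp: cycle_edges_def path_edges_def)
  qed
  then show ?thesis using c(2) by (metis le_add1 le_trans)
next
  case (family_almost c p q z)
  have s: "pathl E (c # p)" "pathl E (c # q)" "pathl E (c # [z])" "p \<noteq> []" "q \<noteq> []"
    "set p \<inter> set q = {}" "z \<notin> set p" "z \<notin> set q" "\<not> touch E (set p) (set q)" "\<not> touch E (set p) {z}" "\<not> touch E (set q) {z}"
    using family_almost by (auto simp: spider_legs_def)
  \<comment> \<open>Two legs joined at the centre form the long path. The centre has list index
    \<open>length p\<close>, which is vertex \<open>length p + 1\<close>.\<close>
  let ?xs = "rev p @ c # q"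
  have x: "pathl E ?xs"
    unfolding pathl_append pathl_rev
  proof (intro conjI ballI)
    show "set (rev p) \<inter> set (c # q) = {}" using s by auto
    fix u v assume uv: "u \<in> set (rev p)" "v \<in> set (c # q)"
    show "{u, v} \<in> E \<longleftrightarrow> u = last (rev p) \<and> v = hd (c # q)"
    proof (cases "v = c")
      case True
      have "{u, c} = {c, u}" by blast
      then show ?thesis using s(1) uv True by (simp add: last_rev)
    next
      case False
      then have "v \<in> set q" using uv by simp
      then show ?thesis using s(9) uv False by (auto simp: touch_def)
    qed
  qed (use s in simp_all)
  have zc: "z \<noteq> c" "{c, z} \<in> E" using s(3) by auto
  let ?k = "length p + 1" and ?m = "length ?xs"
  have "graph_iso n E (?m + 1) (almost_path_edges ?m ?k)"
  proof (rule path_plus_vertex_iso[OF x _ _ _ _ ns])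
    show "z \<notin> set ?xs" using s zc by auto
    show "set ?xs \<union> {z} = {1..n}" using family_almost assms(2) by auto
    fix i assume i: "i < ?m"
    have "{u, z} \<in> E \<longleftrightarrow> u = c" if "u \<in> set ?xs" for u
      using that zc s(10,11) s(1,2) by (auto simp: touch_def)
    moreover have "?xs ! i = c \<longleftrightarrow> i = length p"
      using nth_eq_iff_index_eq[OF pathl_distinct[OF x] i, of "length p"] by (simp add: nth_append)
    ultimately have "{?xs ! i, z} \<in> E \<longleftrightarrow> i = length p" using nth_mem[OF i] by blast
    then show "{?xs ! i, z} \<in> E \<longleftrightarrow> {Suc i, Suc ?m} \<in> almost_path_edges ?m ?k"
      using path_edges_iff[of "Suc i" "Suc ?m" ?m] i by (simp add: almost_path_edges_def doubleton_eq_iff)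
  next
    show "{Suc i, Suc j} \<in> almost_path_edges ?m ?k \<longleftrightarrow> j = Suc i" if "i < j" "j < ?m" for i j
      using that path_edges_iff[of "Suc i" "Suc j" ?m] by (auto simp: almost_path_edges_def doubleton_eq_iff)
    show "{x} \<notin> almost_path_edges ?m ?k" for x by (auto simp: almost_path_edges_def path_edges_def)
  qed
  moreover have "1 < ?k" "?k < ?m" using s(4,5) by auto
  ultimately show ?thesis by blast
next
  case (family_triangle p q z)
  have s: "pathl E p" "pathl E q" "p \<noteq> []" "q \<noteq> []" "cross E p q" "cross E p [z]" "cross E q [z]"
    using family_triangle by (auto simp: triangle_legs_def)
  let ?xs = "rev p @ q"
  have x: "pathl E ?xs"
    unfolding pathl_append pathl_rev using s by (simp add: cross_def last_rev)
  \<comment> \<open>The triangle sits on the joint of the two legs: \<open>hd p\<close> is vertex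
    \<open>length p\<close>, counted from 1, and \<open>hd q\<close> is the next one.\<close>
  let ?k = "length p" and ?m = "length ?xs"
  have k: "1 \<le> ?k" "?k < ?m" using s(3,4) by (simp_all add: Suc_le_eq)
  have "graph_iso n E (?m + 1) (path_triangle_edges ?m ?k)"
  proof (rule path_plus_vertex_iso[OF x _ _ _ _ ns])
    show "z \<notin> set ?xs" using s by (auto simp: cross_def)
    show "set ?xs \<union> {z} = {1..n}" using family_triangle assms(2) by auto
    fix i assume i: "i < ?m"
    have h: "hd p \<in> set p" "hd q \<in> set q" using s(3,4) by simp_all
    then have "hd p \<notin> set q" "hd q \<notin> set p" using s(5) unfolding cross_def by blast+
    then have "{u, z} \<in> E \<longleftrightarrow> u = hd p \<or> u = hd q" if "u \<in> set ?xs" for u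
      using that s(6,7) by (auto simp: cross_def)
    moreover have "?xs ! (length p - 1) = hd p" using s(3) by (simp add: nth_append rev_nth hd_conv_nth)
    then have "?xs ! i = hd p \<longleftrightarrow> i = length p - 1"
      using nth_eq_iff_index_eq[OF pathl_distinct[OF x] i, of "length p - 1"] k by simp
    moreover have "?xs ! i = hd q \<longleftrightarrow> i = length p"
      using nth_eq_iff_index_eq[OF pathl_distinct[OF x] i, of "length p"] s(4) by (simp add: nth_append hd_conv_nth)
    ultimately have "{?xs ! i, z} \<in> E \<longleftrightarrow> Suc i = length p \<or> i = length p" using nth_mem[OF i] k(1) by auto
    then show "{?xs ! i, z} \<in> E \<longleftrightarrow> {Suc i, Suc ?m} \<in> path_triangle_edges ?m ?k"
      using path_edges_iff[of "Suc i" "Suc ?m" ?m] i by (simp add: path_triangle_edges_def doubleton_eq_iff)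
  next
    show "{Suc i, Suc j} \<in> path_triangle_edges ?m ?k \<longleftrightarrow> j = Suc i" if "i < j" "j < ?m" for i j
      using that path_edges_iff[of "Suc i" "Suc j" ?m] by (auto simp: path_triangle_edges_def doubleton_eq_iff)
    show "{x} \<notin> path_triangle_edges ?m ?k" for x using k by (auto simp: path_triangle_edges_def path_edges_def)
  qed
  then show ?thesis using k by blast
qed

theorem theorem1p5:
  fixes n :: nat and E :: "nat set set"
  assumes "n \<ge> 1" and "simple_graph n E" and "induced_connected E {1..n}"
  shows "free_arrangement n (conn_subgraph_arr n E) \<longleftrightarrow>
    ((\<exists>m\<ge>1. graph_iso n E m (path_edges m)) \<or>
     (\<exists>m\<ge>3. graph_iso n E m (cycle_edges m)) \<or>
     (\<exists>m k. 1 < k \<and> k < m \<and> graph_iso n E (m + 1) (almost_path_edges m k)) \<or>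
     (\<exists>m k. 1 \<le> k \<and> k < m \<and> graph_iso n E (m + 1) (path_triangle_edges m k)))"
    (is "?L \<longleftrightarrow> ?R")
proof
  assume ?L
  then have "\<not> forbidden {1..n} E" using forbidden_not_free by blast
  then have "family E {1..n}" using connected_family assms(3) by blast
  moreover have "{x} \<notin> E" for x using assms(2) unfolding simple_graph_def by force
  ultimately show ?R by (rule family_iso[OF _ refl])
next
  assume ?R
  then consider (path) m where "1 \<le> m" "graph_iso n E m (path_edges m)"
    | (cycle) m where "3 \<le> m" "graph_iso n E m (cycle_edges m)"
    | (almost) m k where "1 < k" "k < m" "graph_iso n E (m + 1) (almost_path_edges m k)"
    | (triangle) m k where "1 \<le> k" "k < m" "graph_iso n E (m + 1) (path_triangle_edges m k)"
    by blast
  then show ?L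
  proof cases
    case (path m)
    then obtain m' where "m = m' + 1" using le_Suc_ex[of 1 m] by auto
    then show ?thesis using path iso_family_free[OF _ path_family_adj] by simp
  next
    case (cycle m)
    then obtain m' where "m = m' + 1" "2 \<le> m'" using le_Suc_ex[of 3 m] by (metis Suc_eq_plus1 Suc_le_mono add_Suc numeral_2_eq_2 numeral_3_eq_3 le_add1)
    then show ?thesis using cycle iso_cycle_free[OF _ cycle_cycle_adj] by simp
  next
    case (almost m k)
    then show ?thesis by (intro iso_family_free[OF almost(3) almost_path_family_adj]) auto
  next
    case (triangle m k)
    then show ?thesis by (intro iso_family_free[OF triangle(3) path_triangle_family_adj]) auto
  qed
qed

end
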